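(* Let $N\ge 3$, $\gamma>1$, $\mu>0$, $2\mu+\lambda>0$. Let $(f,\rho,u)$ be any global classical solution of the Vlasov/compressible Navier–Stokes system (described in the context) with initial data $(f_0,\rho_0,u_0)$, satisfying (i) $\|\rho_f\|_{L^\infty(\mathbb R_+;L^{N/2}(\mathbb T^N))}<\infty$, where $\rho_f(x,t):=\int_{\mathbb R^N} f(x,v,t)\,dv$; (ii) $\rho(x,t)\in[0,\bar\rho]$ for all $(x,t)\in\mathbb T^N\times\mathbb R_+$, and $\rho_c(0)>0$; (iii) $u\in L^\infty(\mathbb T^N\times\mathbb R_+)$, and $E_0>0$ is small enough, where $E_0$ is the initial total energy. Then $$\mathcal L(f(t),\rho(t),u(t))\le C\,\mathcal L(f_0,\rho_0,u_0)\,e^{-Ct},\qquad t\ge 0,$$ where $C$ is a positive constant independent of $t$, and $\mathcal L$ is given by $$\mathcal L(f,\rho,u):=\int_{\mathbb T^N\times\mathbb R^N}|v-v_c|^2 f\,dx\,dv+\int_{\mathbb T^N}\rho|u-m_c|^2\,dx+\int_{\mathbb T^N}(\rho-\rho_c)^2\,dx+|v_c-m_c|^2 .$$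
   Context: $\mathbb T^N$ is the $N$-dimensional torus, of volume $1$. The unknowns are the one-particle distribution function $f=f(x,v,t)\ge0$ on $\mathbb T^N\times\mathbb R^N\times\mathbb R_+$, and the fluid density $\rho=\rho(x,t)$ and velocity $u=u(x,t)\in\mathbb R^N$ on $\mathbb T^N\times\mathbb R_+$. The Vlasov/compressible Navier–Stokes system is $$\partial_t f+v\cdot\nabla_x f+\nabla_v\cdot((u-v)f)=Q(f,f),$$ $$\partial_t\rho+\nabla_x\cdot(\rho u)=0,$$ $$\partial_t(\rho u)+\nabla_x\cdot(\rho u\otimes u)+\nabla_x p(\rho)+Lu=-\int_{\mathbb R^N}(u-v)f\,dv,$$ with $(f,\rho,u)|_{t=0}=(f_0,\rho_0,u_0)$, $p(\rho)=\rho^\gamma$, $Lu=-\mu\Delta_x u-(\mu+\lambda)\nabla_x\nabla_x\cdot u$. The particle interaction operator $Q$ is assumed to satisfy $\int_{\mathbb R^N}Q(f,f)\,dv=\int_{\mathbb R^N}Q(f,f)v_i\,dv=0$ for $i=1,\dots,N$ and $\int_{\mathbb T^N\times\mathbb R^N}Q(f,f)|v|^2\,dx\,dv\le0$. Averages: $$f_c(t):=\int_{\mathbb T^N\times\mathbb R^N}f\,dx\,dv,\quad \rho_c(t):=\int_{\mathbb T^N}\rho\,dx,\quad v_c(t):=\frac{\int_{\mathbb T^N\times\mathbb R^N}vf\,dx\,dv}{\int_{\mathbb T^N\times\mathbb R^N}f\,dx\,dv},\quad m_c(t):=\frac{\int_{\mathbb T^N}\rho u\,dx}{\int_{\mathbb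 T^N}\rho\,dx},$$ with $f_c>0$ so that $v_c$ is defined; $f_c$ and $\rho_c$ are constant in time along solutions. Initial total energy: $E_0:=\int_{\mathbb T^N\times\mathbb R^N}|v|^2f_0\,dx\,dv+\int_{\mathbb T^N}\rho_0|u_0|^2\,dx+\frac{2}{\gamma-1}\int_{\mathbb T^N}\rho_0^\gamma\,dx$. *)

theory Defs
  imports "HOL-Analysis.Analysis"
begin

text \<open>
  Functions on the \<open>N\<close>-dimensional torus are functions on \<open>real ^ 'n\<close> (with \<open>N = CARD('n)\<close>)
  of period \<open>1\<close> in every coordinate; integrals over the torus are Lebesgue integrals over the
  unit cube. Time is the first argument throughout, so that \<open>f t\<close>, \<open>\<rho> t\<close>, \<open>u t\<close> are the
  states of the system at time \<open>t\<close>.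
\<close>

type_synonym 'n scalar_field = "real ^ 'n \<Rightarrow> real"
type_synonym 'n vector_field = "real ^ 'n \<Rightarrow> real ^ 'n"
type_synonym 'n distribution = "real ^ 'n \<Rightarrow> real ^ 'n \<Rightarrow> real"

definition torus_periodic :: "(real ^ 'n::finite \<Rightarrow> 'b) \<Rightarrow> bool" where
  "torus_periodic g \<longleftrightarrow> (\<forall>x i. g (x + axis i 1) = g x)"

definition torus :: "(real ^ 'n::finite) set" where
  "torus = cbox 0 One"

abbreviation phase_space :: "((real ^ 'n::finite) \<times> (real ^ 'n)) set" where
  "phase_space \<equiv> torus \<times> UNIV"


subsection \<open>Differential operators\<close>

definition partial :: "'n::finite \<Rightarrow> 'n scalar_field \<Rightarrow> 'n scalar_field" where
  "partial i g x = frechet_derivative g (at x) (axis i 1)"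

definition grad :: "'n::finite scalar_field \<Rightarrow> 'n vector_field" where
  "grad g x = (\<chi> i. partial i g x)"

definition divergence :: "'n::finite vector_field \<Rightarrow> 'n scalar_field" where
  "divergence w x = (\<Sum>i\<in>UNIV. partial i (\<lambda>y. w y $ i) x)"

definition laplacian :: "'n::finite scalar_field \<Rightarrow> 'n scalar_field" where
  "laplacian g x = (\<Sum>i\<in>UNIV. partial i (partial i g) x)"

definition viscous :: "real \<Rightarrow> real \<Rightarrow> 'n::finite vector_field \<Rightarrow> 'n vector_field" where
  "viscous \<mu> lam w x =
     - \<mu> *\<^sub>R (\<chi> i. laplacian (\<lambda>y. w y $ i) x) - (\<mu> + lam) *\<^sub>R grad (divergence w) x"

text \<open>Meant for open \<open>S\<close>; in finite dimension, continuity of every directional derivative is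
  continuity of the derivative.\<close>

definition C1_on :: "'a::euclidean_space set \<Rightarrow> ('a \<Rightarrow> 'b::real_normed_vector) \<Rightarrow> bool" where
  "C1_on S g \<longleftrightarrow> g differentiable_on S \<and>
     (\<forall>h. continuous_on S (\<lambda>z. frechet_derivative g (at z) h))"


subsection \<open>The Vlasov/compressible Navier--Stokes system\<close>

text \<open>The assumptions on the particle interaction operator, for \<open>q = Q(f,f)\<close> at a fixed time.
  The integrability clauses say that the integrals exist: the Bochner integral of a
  non-integrable function is \<open>0\<close> by convention.\<close>

definition interaction_conditions :: "'n::finite distribution \<Rightarrow> bool" where
  "interaction_conditions q \<longleftrightarrow>
     (\<forall>x. integrable lborel (q x) \<and> (LINT v|lborel. q x v) = 0) \<and>
     (\<forall>x i. integrable lborel (\<lambda>v. q x v * v $ i) \<and> (LINT v|lborel. q x v * v $ i) = 0) \<and>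
     set_integrable lborel phase_space (\<lambda>(x, v). q x v * (norm v)\<^sup>2) \<and>
     (LINT (x, v):phase_space|lborel. q x v * (norm v)\<^sup>2) \<le> 0"

text \<open>Regularity of classical solutions: continuity up to \<open>t = 0\<close>, and continuity of all
  derivatives occurring in the equations for \<open>t > 0\<close>.\<close>

definition classical_regularity ::
  "(real \<Rightarrow> 'n::finite distribution) \<Rightarrow> (real \<Rightarrow> 'n scalar_field) \<Rightarrow>
   (real \<Rightarrow> 'n vector_field) \<Rightarrow> bool" where
  "classical_regularity f \<rho> u \<longleftrightarrow>
     continuous_on ({0..} \<times> UNIV) (\<lambda>(t, x, v). f t x v) \<and>
     continuous_on ({0..} \<times> UNIV) (\<lambda>(t, x). \<rho> t x) \<and>
     continuous_on ({0..} \<times> UNIV) (\<lambda>(t, x). u t x) \<and>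
     C1_on ({0<..} \<times> UNIV) (\<lambda>(t, x, v). f t x v) \<and>
     C1_on ({0<..} \<times> UNIV) (\<lambda>(t, x). \<rho> t x) \<and>
     C1_on ({0<..} \<times> UNIV) (\<lambda>(t, x). u t x) \<and>
     (\<forall>i j. \<forall>t>0. partial j (\<lambda>y. u t y $ i) differentiable_on UNIV) \<and>
     (\<forall>i j k. continuous_on ({0<..} \<times> UNIV) (\<lambda>(t, x). partial k (partial j (\<lambda>y. u t y $ i)) x))"

text \<open>Decay in velocity, needed for the density, the drag force, the energy and the moments of
  the kinetic equation to make sense: velocity moments up to order one exist at every point,
  moments up to order two exist on phase space at every time, and these, as well as those of
  \<open>Q(f,f)\<close>, are locally integrable in time.\<close>

definition finite_moments ::
  "('n::finite distribution \<Rightarrow> 'n distribution \<Rightarrow> 'n distribution) \<Rightarrow>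
   (real \<Rightarrow> 'n distribution) \<Rightarrow> bool" where
  "finite_moments Q f \<longleftrightarrow>
     (\<forall>t\<ge>0. \<forall>x. integrable lborel (\<lambda>v. (1 + norm v) * f t x v)) \<and>
     (\<forall>t\<ge>0. set_integrable lborel phase_space (\<lambda>(x, v). (1 + (norm v)\<^sup>2) * f t x v)) \<and>
     (\<forall>T>0. set_integrable lborel ({0..T} \<times> phase_space)
        (\<lambda>(t, x, v). (1 + (norm v)\<^sup>2) * f t x v)) \<and>
     (\<forall>T>0. set_integrable lborel ({0<..T} \<times> phase_space)
        (\<lambda>(t, x, v). (1 + (norm v)\<^sup>2) * Q (f t) (f t) x v))"

definition vlasov_equation ::
  "('n::finite distribution \<Rightarrow> 'n distribution \<Rightarrow> 'n distribution) \<Rightarrow>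
   (real \<Rightarrow> 'n distribution) \<Rightarrow> (real \<Rightarrow> 'n vector_field) \<Rightarrow> bool" where
  "vlasov_equation Q f u \<longleftrightarrow> (\<forall>t>0. \<forall>x v.
     deriv (\<lambda>s. f s x v) t + v \<bullet> grad (\<lambda>y. f t y v) x
       + divergence (\<lambda>w. f t x w *\<^sub>R (u t x - w)) v
     = Q (f t) (f t) x v)"

definition continuity_equation ::
  "(real \<Rightarrow> 'n::finite scalar_field) \<Rightarrow> (real \<Rightarrow> 'n vector_field) \<Rightarrow> bool" where
  "continuity_equation \<rho> u \<longleftrightarrow> (\<forall>t>0. \<forall>x.
     deriv (\<lambda>s. \<rho> s x) t + divergence (\<lambda>y. \<rho> t y *\<^sub>R u t y) x = 0)"

definition momentum_equation ::
  "real \<Rightarrow> real \<Rightarrow> real \<Rightarrow> (real \<Rightarrow> 'n::finite distribution) \<Rightarrow>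
   (real \<Rightarrow> 'n scalar_field) \<Rightarrow> (real \<Rightarrow> 'n vector_field) \<Rightarrow> bool" where
  "momentum_equation \<gamma> \<mu> lam f \<rho> u \<longleftrightarrow> (\<forall>t>0. \<forall>x.
     vector_derivative (\<lambda>s. \<rho> s x *\<^sub>R u s x) (at t)
       + (\<chi> i. divergence (\<lambda>y. (\<rho> t y * u t y $ i) *\<^sub>R u t y) x)
       + grad (\<lambda>y. \<rho> t y powr \<gamma>) x + viscous \<mu> lam (u t) x
     = - (LINT v|lborel. f t x v *\<^sub>R (u t x - v)))"

definition global_classical_solution ::
  "real \<Rightarrow> real \<Rightarrow> real \<Rightarrow>
   ('n::finite distribution \<Rightarrow> 'n distribution \<Rightarrow> 'n distribution) \<Rightarrow>
   'n distribution \<Rightarrow> 'n scalar_field \<Rightarrow> 'n vector_field \<Rightarrow>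
   (real \<Rightarrow> 'n distribution) \<Rightarrow> (real \<Rightarrow> 'n scalar_field) \<Rightarrow> (real \<Rightarrow> 'n vector_field) \<Rightarrow> bool"
where
  "global_classical_solution \<gamma> \<mu> lam Q f0 \<rho>0 u0 f \<rho> u \<longleftrightarrow>
     (\<forall>t\<ge>0. torus_periodic (f t) \<and> torus_periodic (\<rho> t) \<and> torus_periodic (u t)) \<and>
     (\<forall>t\<ge>0. \<forall>x v. 0 \<le> f t x v) \<and>
     classical_regularity f \<rho> u \<and>
     finite_moments Q f \<and>
     vlasov_equation Q f u \<and>
     continuity_equation \<rho> u \<and>
     momentum_equation \<gamma> \<mu> lam f \<rho> u \<and>
     f 0 = f0 \<and> \<rho> 0 = \<rho>0 \<and> u 0 = u0"


subsection \<open>Averages, energy and Lyapunov functional of a state\<close>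

definition particle_mass :: "'n::finite distribution \<Rightarrow> real" where
  "particle_mass g = (LINT (x, v):phase_space|lborel. g x v)"

definition fluid_mass :: "'n::finite scalar_field \<Rightarrow> real" where
  "fluid_mass r = (LINT x:torus|lborel. r x)"

definition particle_mean_velocity :: "'n::finite distribution \<Rightarrow> real ^ 'n" where
  "particle_mean_velocity g =
     (LINT (x, v):phase_space|lborel. g x v *\<^sub>R v) /\<^sub>R particle_mass g"

definition fluid_mean_velocity :: "'n::finite scalar_field \<Rightarrow> 'n vector_field \<Rightarrow> real ^ 'n" where
  "fluid_mean_velocity r w = (LINT x:torus|lborel. r x *\<^sub>R w x) /\<^sub>R fluid_mass r"

definition particle_density :: "'n::finite distribution \<Rightarrow> 'n scalar_field" where
  "particle_density g x = (LINT v|lborel. g x v)"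

definition total_energy ::
  "real \<Rightarrow> 'n::finite distribution \<Rightarrow> 'n scalar_field \<Rightarrow> 'n vector_field \<Rightarrow> real" where
  "total_energy \<gamma> g r w =
     (LINT (x, v):phase_space|lborel. (norm v)\<^sup>2 * g x v)
     + (LINT x:torus|lborel. r x * (norm (w x))\<^sup>2)
     + 2 / (\<gamma> - 1) * (LINT x:torus|lborel. r x powr \<gamma>)"

definition lyapunov ::
  "'n::finite distribution \<Rightarrow> 'n scalar_field \<Rightarrow> 'n vector_field \<Rightarrow> real" where
  "lyapunov g r w =
     (LINT (x, v):phase_space|lborel. (norm (v - particle_mean_velocity g))\<^sup>2 * g x v)
     + (LINT x:torus|lborel. r x * (norm (w x - fluid_mean_velocity r w))\<^sup>2)
     + (LINT x:torus|lborel. (r x - fluid_mass r)\<^sup>2)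
     + (norm (particle_mean_velocity g - fluid_mean_velocity r w))\<^sup>2"


subsection \<open>Norm bounds\<close>

text \<open>\<open>\<parallel>g\<parallel> \<le> M\<close> in \<open>L\<^sup>p\<close> of the torus, in \<open>L\<^sup>\<infinity>(\<real>\<^sub>+; L\<^sup>p)\<close>, and in \<open>L\<^sup>\<infinity>\<close> of
  torus \<open>\<times> \<real>\<^sub>+\<close>, respectively.\<close>

definition Lp_bounded :: "real \<Rightarrow> real \<Rightarrow> 'n::finite scalar_field \<Rightarrow> bool" where
  "Lp_bounded p M g \<longleftrightarrow>
     set_borel_measurable lborel torus g \<and>
     set_integrable lborel torus (\<lambda>x. \<bar>g x\<bar> powr p) \<and>
     (LINT x:torus|lborel. \<bar>g x\<bar> powr p) powr (1 / p) \<le> M"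

definition Linf_Lp_bounded :: "real \<Rightarrow> real \<Rightarrow> (real \<Rightarrow> 'n::finite scalar_field) \<Rightarrow> bool" where
  "Linf_Lp_bounded p M g \<longleftrightarrow> (AE t in lborel. 0 \<le> t \<longrightarrow> Lp_bounded p M (g t))"

definition Linf_bounded :: "real \<Rightarrow> (real \<Rightarrow> 'n::finite vector_field) \<Rightarrow> bool" where
  "Linf_bounded U w \<longleftrightarrow> (AE (t, x) in lborel. 0 \<le> t \<and> x \<in> torus \<longrightarrow> norm (w t x) \<le> U)"

end

theory Submission
  imports Defs
begin

text \<open>
  Let \<open>V\<close> be the conserved mean velocity of the whole system. The energy of the fluctuations
  around \<open>V\<close> (kinetic energy of particles and fluid, plus the convex excess of the pressure
  potential over its value at \<open>\<rho>\<^sub>c\<close>) is comparable to the Lyapunov functional and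
  is dissipated by the velocity gradient and by the slip \<open>\<integral>\<integral> |u - v|\<^sup>2 f\<close>. The
  dissipation controls the kinetic part, the particles being handled by a weighted Sobolev inequality
  \<open>\<integral> \<rho>\<^sub>f |w|\<^sup>2 \<le> C \<parallel>\<nabla>w\<parallel>\<^sup>2\<close>, which is where
  \<open>\<rho>\<^sub>f \<in> L\<^bsup>N/2\<^esup>\<close> enters. It does not control the density, whose fluctuations are
  bounded only in time average, by testing the momentum equation with the gradient of a solution of
  \<open>\<Delta>\<Phi> = \<rho> - \<rho>\<^sub>c\<close> (Bogovskii's argument). This potential is taken
  with respect to trigonometric polynomial kernels tending to the identity, so that only periodic
  functions with explicit derivatives occur. Altogether
  \<open>(t - s) E(t) \<le> \<integral> E \<le> K E(s)\<close> for the nonincreasing energy \<open>E\<close>, so \<open>E\<close> halves over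
  each time interval of length \<open>2 K\<close>.
\<close>

subsection \<open>Calculus on the torus\<close>

text \<open>The potential energy has no dissipation of its own, so the energy balance does not
  directly give a Gronwall inequality. The test functional repairs this only in time average, and
  its values at the ends of the time interval are bounded by the energy itself; hence the integrated
  inequality. Velocity fluctuations are naturally measured around the mean of \<open>u\<close>,
  which moves in time, while the energy lives in a fixed frame. The two are reconciled because the
  conserved velocity minimises the total kinetic energy among all constant frames. Three obstacles
  of regularity shape the rest. The equations hold only for t > 0, so balances start at s > 0 or
  ignore one endpoint. The moments of \<open>f\<close> and of the interaction term are integrable in
  time without a locally uniform bound, so kinetic balances are integrated ones. The density is
  merely C1 and may vanish: its powers are differentiated through \<open>max 0\<close>, and in the
  potential estimates all derivatives fall on the kernel, with constants that do not depend on it,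
  so that the kernel can tend to the identity.\<close>

abbreviation tint :: "(real ^ 'n::finite \<Rightarrow> real) \<Rightarrow> real" where
  "tint g \<equiv> integral torus g"

text \<open>Continuous functions on the torus, the class of nearly all integrands: periodicity makes
  the integral translation invariant, and continuity gives integrability and the exchange of
  integrals without measure theory.\<close>

definition pcont :: "(real ^ 'n::finite \<Rightarrow> real) \<Rightarrow> bool" where
  "pcont g \<longleftrightarrow> torus_periodic g \<and> continuous_on UNIV g"

text \<open>Only restrictions to coordinate lines are differentiated. This is weaker than
  differentiability but suffices for the fundamental theorem of calculus on lines, and the explicit
  derivative lets product and chain rules build up long expressions.\<close>

definition has_partial ::
  "'n::finite \<Rightarrow> (real ^ 'n \<Rightarrow> real) \<Rightarrow> (real ^ 'n \<Rightarrow> real) \<Rightarrow> bool" where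
  "has_partial i g g' \<longleftrightarrow>
     (\<forall>x. ((\<lambda>s. g (x + s *\<^sub>R axis i 1)) has_real_derivative g' x) (at 0))"

lemma One_nth [simp]: "(One :: real ^ 'n::finite) $ i = 1"
  by (simp add: cart_eq_inner_axis axis_in_Basis_iff inner_sum_left_Basis)

lemma sum_Basis_nth [simp]: "(\<Sum>b\<in>Basis. (b :: real ^ 'n::finite) $ i) = 1"
  using One_nth[of i] by simp

lemma mem_torus: "x \<in> torus \<longleftrightarrow> (\<forall>i. 0 \<le> x $ i \<and> x $ i \<le> 1)"
  by (simp add: torus_def mem_box_cart)

lemma torus_nonempty: "torus \<noteq> {}"
  using mem_torus[of 0] by auto

lemma compact_torus: "compact torus"
  by (simp add: torus_def)

lemma measurable_torus [measurable]: "torus \<in> sets borel"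
  by (simp add: torus_def)

lemma content_torus [simp]: "Henstock_Kurzweil_Integration.content (torus :: (real ^ 'n::finite) set) = 1"
proof -
  have "(cbox 0 One :: (real ^ 'n) set) \<noteq> {}"
    using torus_nonempty by (simp add: torus_def)
  then show ?thesis
    by (simp add: torus_def content_cbox')
qed

lemma tint_const [simp]: "tint (\<lambda>x. c) = c"
  using content_torus by (simp add: torus_def)

lemma continuous_on_comp_UNIV:
  "continuous_on UNIV g \<Longrightarrow> continuous_on S h \<Longrightarrow> continuous_on S (\<lambda>x. g (h x))"
  by (rule continuous_on_compose2) auto

lemma pcont_const [simp]: "pcont (\<lambda>x. c)"
  and pcont_add: "pcont g \<Longrightarrow> pcont h \<Longrightarrow> pcont (\<lambda>x. g x + h x)"
  and pcont_diff: "pcont g \<Longrightarrow> pcont h \<Longrightarrow> pcont (\<lambda>x. g x - h x)"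
  and pcont_mult: "pcont g \<Longrightarrow> pcont h \<Longrightarrow> pcont (\<lambda>x. g x * h x)"
  and pcont_minus: "pcont g \<Longrightarrow> pcont (\<lambda>x. - g x)"
  and pcont_abs: "pcont g \<Longrightarrow> pcont (\<lambda>x. \<bar>g x\<bar>)"
  and pcont_power: "pcont g \<Longrightarrow> pcont (\<lambda>x. g x ^ k)"
  by (auto simp: pcont_def torus_periodic_def intro!: continuous_intros)

lemma pcont_sum: "(\<And>i. i \<in> I \<Longrightarrow> pcont (g i)) \<Longrightarrow> pcont (\<lambda>x. \<Sum>i\<in>I. g i x)"
  by (auto simp: pcont_def torus_periodic_def intro!: continuous_intros)

lemma pcont_prod: "(\<And>i. i \<in> I \<Longrightarrow> pcont (g i)) \<Longrightarrow> pcont (\<lambda>x. \<Prod>i\<in>I. g i x)"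
  by (auto simp: pcont_def torus_periodic_def intro!: continuous_intros)

lemma pcont_compose: "continuous_on UNIV H \<Longrightarrow> pcont g \<Longrightarrow> pcont (\<lambda>x. H (g x))"
  by (auto simp: pcont_def torus_periodic_def intro!: continuous_on_comp_UNIV[of H])

lemma pcont_powr: "pcont g \<Longrightarrow> (\<And>x. 0 < g x) \<Longrightarrow> pcont (\<lambda>x. g x powr a)"
  by (auto simp: pcont_def torus_periodic_def less_imp_neq[THEN not_sym] intro!: continuous_intros)

lemma pcont_cont: "pcont g \<Longrightarrow> continuous_on S g"
  using continuous_on_subset pcont_def by blast

lemma pcont_comp_cont: "pcont g \<Longrightarrow> continuous_on S h \<Longrightarrow> continuous_on S (\<lambda>x. g (h x))"
  by (rule continuous_on_comp_UNIV[OF pcont_cont])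

section \<open>Integer translations and representatives in the unit cube\<close>

lemma torus_periodic_int:
  assumes "torus_periodic g"
  shows "g (x + of_int n *\<^sub>R axis i 1) = g x"
proof -
  have *: "g (y + of_nat m *\<^sub>R axis i 1) = g y" for y and m :: nat
  proof (induction m)
    case (Suc m)
    have "y + real (Suc m) *\<^sub>R axis i 1 = (y + real m *\<^sub>R axis i 1) + axis i 1"
      by (simp add: algebra_simps)
    with Suc show ?case using assms by (metis torus_periodic_def)
  qed simp
  show ?thesis
  proof (cases "n \<ge> 0")
    case True
    with *[of x "nat n"] show ?thesis by simp
  next
    case False
    with *[of "x + of_int n *\<^sub>R axis i 1" "nat (-n)"] show ?thesis
      by (simp add: algebra_simps)
  qed
qed

lemma torus_periodic_int_vec:
  assumes "torus_periodic g"
  shows "g (x + (\<chi> i. of_int (n i))) = g x"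
proof -
  have "g (x + (\<Sum>i\<in>S. of_int (n i) *\<^sub>R axis i 1)) = g x" if "finite S" for S
    using that
  proof (induction S)
    case (insert i S)
    then show ?case
      using torus_periodic_int[OF assms, of "x + (\<Sum>i\<in>S. of_int (n i) *\<^sub>R axis i 1)" "n i" i]
      by (simp add: algebra_simps)
  qed simp
  from this[of UNIV] show ?thesis
    using basis_expansion[of "\<chi> i. real_of_int (n i)"] by (simp add: scalar_mult_eq_scaleR)
qed

lemma torus_representative:
  assumes "torus_periodic g"
  obtains y where "y \<in> torus" "g y = g x"
proof
  let ?y = "\<chi> i. frac (x $ i)"
  show "?y \<in> torus" by (auto simp: mem_torus frac_lt_1 less_imp_le)
  have "x = ?y + (\<chi> i. of_int \<lfloor>x $ i\<rfloor>)"
    by (simp add: vec_eq_iff frac_def)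
  then show "g ?y = g x"
    using torus_periodic_int_vec[OF assms, of ?y "\<lambda>i. \<lfloor>x $ i\<rfloor>"] by simp
qed

lemma pcont_shift:
  assumes "pcont g" shows "pcont (\<lambda>x. g (x + a))"
proof -
  have "g (x + axis i 1 + a) = g (x + a)" for x i
    using assms torus_periodic_def[of g] by (metis add.commute add.left_commute pcont_def)
  then show ?thesis
    using assms by (auto simp: pcont_def torus_periodic_def
      intro!: continuous_on_comp_UNIV[of g] continuous_intros)
qed

lemma pcont_shift_minus: "pcont g \<Longrightarrow> pcont (\<lambda>x. g (x - a))"
  using pcont_shift[of g "- a"] by simp

lemma pcont_reflect:
  assumes "pcont g" shows "pcont (\<lambda>x. g (a - x))"
proof -
  have "g (a - (x + axis i 1)) = g (a - x)" for x i
    using torus_periodic_int[of g "a - x" "-1" i] assms by (simp add: pcont_def algebra_simps)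
  then show ?thesis
    using assms by (auto simp: pcont_def torus_periodic_def
      intro!: continuous_on_comp_UNIV[of g] continuous_intros)
qed

lemma pcont_integrable: "pcont g \<Longrightarrow> g integrable_on torus"
  unfolding torus_def by (intro integrable_continuous pcont_cont)

lemma pcont_bounded:
  assumes "pcont g" obtains B where "B > 0" "\<And>x. \<bar>g x\<bar> \<le> B"
proof -
  have "bounded (g ` torus)"
    using assms compact_torus by (intro compact_imp_bounded compact_continuous_image pcont_cont)
  then obtain B where B: "B > 0" "\<And>x. x \<in> torus \<Longrightarrow> \<bar>g x\<bar> \<le> B"
    by (auto simp: bounded_pos)
  have "\<bar>g x\<bar> \<le> B" for x
    using torus_representative[of g x] B(2) assms by (metis pcont_def)
  with B(1) show thesis by (rule that)
qed

lemma tint_add: "pcont g \<Longrightarrow> pcont h \<Longrightarrow> tint (\<lambda>x. g x + h x) = tint g + tint h"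
  by (intro integral_add pcont_integrable)

lemma tint_diff: "pcont g \<Longrightarrow> pcont h \<Longrightarrow> tint (\<lambda>x. g x - h x) = tint g - tint h"
  by (intro integral_diff pcont_integrable)

lemma tint_sum: "finite I \<Longrightarrow> (\<And>i. i \<in> I \<Longrightarrow> pcont (g i)) \<Longrightarrow>
    tint (\<lambda>x. \<Sum>i\<in>I. g i x) = (\<Sum>i\<in>I. tint (g i))"
  by (intro integral_sum pcont_integrable)

lemma tint_mono: "pcont g \<Longrightarrow> pcont h \<Longrightarrow> (\<And>x. g x \<le> h x) \<Longrightarrow> tint g \<le> tint h"
  by (intro integral_le pcont_integrable) auto

lemma tint_nonneg: "pcont g \<Longrightarrow> (\<And>x. 0 \<le> g x) \<Longrightarrow> 0 \<le> tint g"
  by (intro integral_nonneg pcont_integrable) auto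

lemma tint_abs: "pcont g \<Longrightarrow> \<bar>tint g\<bar> \<le> tint (\<lambda>x. \<bar>g x\<bar>)"
  using integral_norm_bound_integral[of g torus "\<lambda>x. \<bar>g x\<bar>"]
  by (simp add: pcont_integrable pcont_abs)

lemma tint_pos:
  assumes "pcont g" "\<And>x. 0 < g x"
  shows "0 < tint g"
proof -
  have "\<exists>x\<in>torus. \<forall>y\<in>torus. g x \<le> g y"
    using assms(1) compact_torus torus_nonempty
    by (intro continuous_attains_inf pcont_cont)
  then obtain x where x: "\<And>y. y \<in> torus \<Longrightarrow> g x \<le> g y" by blast
  have "tint (\<lambda>y :: real ^ 'a. g x) \<le> tint g"
    by (intro integral_le pcont_integrable pcont_const assms(1) x)
  with assms(2)[of x] show ?thesis by simp
qed

lemma tint_swap: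
  fixes F :: "real ^ 'n::finite \<Rightarrow> real ^ 'm::finite \<Rightarrow> real"
  assumes "continuous_on UNIV (\<lambda>(x, y). F x y)"
  shows "tint (\<lambda>x. tint (F x)) = tint (\<lambda>y. tint (\<lambda>x. F x y))"
  unfolding torus_def
  by (rule integral_swap_continuous) (rule continuous_on_subset[OF assms], simp)

lemma tint_swap_real:
  assumes "continuous_on UNIV (\<lambda>(x, s). F x s)"
  shows "tint (\<lambda>x. integral {a..b::real} (F x)) = integral {a..b} (\<lambda>s. tint (\<lambda>x. F x s))"
  unfolding torus_def cbox_interval[symmetric]
  by (rule integral_swap_continuous) (rule continuous_on_subset[OF assms], simp)

lemma tint_continuous_param:
  assumes "continuous_on (S \<times> UNIV) (\<lambda>(s, x). F s x)"
  shows "continuous_on S (\<lambda>s. tint (F s))"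
  unfolding torus_def
  by (rule integral_continuous_on_param) (rule continuous_on_subset[OF assms], auto)

lemma tint_derivative:
  assumes "open U" "convex U" "s \<in> U"
    and "\<And>s x. s \<in> U \<Longrightarrow> ((\<lambda>s. F s x) has_real_derivative F' s x) (at s)"
    and "\<And>s. s \<in> U \<Longrightarrow> continuous_on UNIV (F s)"
    and "continuous_on (U \<times> UNIV) (\<lambda>(s, x). F' s x)"
  shows "((\<lambda>s. tint (F s)) has_real_derivative tint (F' s)) (at s)"
proof -
  have "((\<lambda>s. integral (cbox 0 One) (F s)) has_real_derivative integral (cbox 0 One) (F' s)) (at s within U)"
  proof (rule leibniz_rule_field_derivative)
    show "F s integrable_on cbox 0 One" if "s \<in> U" for s
      using that assms(5) by (intro integrable_continuous) (meson continuous_on_subset subset_UNIV)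
    show "continuous_on (U \<times> cbox 0 One) (\<lambda>(s, x). F' s x)"
      by (rule continuous_on_subset[OF assms(6)]) auto
  qed (use assms in \<open>auto intro: has_field_derivative_at_within\<close>)
  then show ?thesis
    using at_within_open[OF assms(3,1)] by (simp add: torus_def)
qed

section \<open>Translation and reflection invariance of the integral\<close>

lemma axis_nth_if: "axis i c $ j = (if j = i then c else 0)"
  by (simp add: axis_def)

lemma mem_cbox_component:
  fixes x :: "real ^ 'n::finite"
  shows "x \<in> cbox a b \<longleftrightarrow> (a $ i \<le> x $ i \<and> x $ i \<le> b $ i) \<and> (\<forall>j. j \<noteq> i \<longrightarrow> a $ j \<le> x $ j \<and> x $ j \<le> b $ j)"
  by (auto simp: mem_box_cart)

text \<open>The shifted cube is cut along the hyperplane \<open>x $ i = 1\<close>. The part beyond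
  it, moved back by one period, is exactly what the rest lacks of the original cube.\<close>

lemma tint_shift_small:
  assumes g: "pcont g" and s: "0 \<le> s" "s \<le> 1"
  shows "tint (\<lambda>x. g (x + s *\<^sub>R axis i 1)) = tint g"
proof -
  let ?k = "axis i 1 :: real ^ 'a"
  have int: "g integrable_on cbox a b" for a b
    using g by (intro integrable_continuous pcont_cont)
  have k: "?k \<in> Basis" by (simp add: axis_in_Basis_iff)
  have per: "g (x + ?k) = g x" for x using g by (auto simp: pcont_def torus_periodic_def)
  have "tint (\<lambda>x. g (x + s *\<^sub>R ?k)) = integral (cbox (s *\<^sub>R ?k) (One + s *\<^sub>R ?k)) g"
    using integral_shift_cbox[of "s *\<^sub>R ?k" "s *\<^sub>R ?k" "One + s *\<^sub>R ?k" g] by (simp add: torus_def)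
  also have "\<dots> = integral (cbox (s *\<^sub>R ?k) One) g + integral (cbox ?k (One + s *\<^sub>R ?k)) g"
  proof -
    have "cbox (s *\<^sub>R ?k) (One + s *\<^sub>R ?k) \<inter> {x. x \<bullet> ?k \<le> 1} = cbox (s *\<^sub>R ?k) One"
      using s by (auto simp: mem_cbox_component[of _ _ _ i] inner_axis axis_nth_if)
    moreover have "cbox (s *\<^sub>R ?k) (One + s *\<^sub>R ?k) \<inter> {x. x \<bullet> ?k \<ge> 1} = cbox ?k (One + s *\<^sub>R ?k)"
      using s by (auto simp: mem_cbox_component[of _ _ _ i] inner_axis axis_nth_if)
    ultimately show ?thesis
      using integral_split[OF int k, of "s *\<^sub>R ?k" "One + s *\<^sub>R ?k" 1] by simp
  qed
  also have "integral (cbox ?k (One + s *\<^sub>R ?k)) g = integral (cbox 0 (One + s *\<^sub>R ?k - ?k)) g"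
    using integral_shift_cbox[of ?k ?k "One + s *\<^sub>R ?k" g] by (simp add: per)
  also have "integral (cbox (s *\<^sub>R ?k) One) g + \<dots> = tint g"
  proof -
    have "cbox 0 One \<inter> {x. x \<bullet> ?k \<le> s} = cbox 0 (One + s *\<^sub>R ?k - ?k)"
      using s by (auto simp: mem_cbox_component[of _ _ _ i] inner_axis axis_nth_if)
    moreover have "cbox 0 One \<inter> {x. x \<bullet> ?k \<ge> s} = cbox (s *\<^sub>R ?k) One"
      using s by (auto simp: mem_cbox_component[of _ _ _ i] inner_axis axis_nth_if)
    ultimately show ?thesis
      using integral_split[OF int k, of 0 One s] by (simp add: torus_def)
  qed
  finally show ?thesis .
qed

lemma tint_shift_axis:
  assumes g: "pcont g"
  shows "tint (\<lambda>x. g (x + s *\<^sub>R axis i 1)) = tint g"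
proof -
  have "g (x + s *\<^sub>R axis i 1) = g (x + frac s *\<^sub>R axis i 1)" for x
    using torus_periodic_int[of g "x + frac s *\<^sub>R axis i 1" "\<lfloor>s\<rfloor>" i] g
    by (simp add: pcont_def frac_def algebra_simps)
  then show ?thesis
    using tint_shift_small[OF g, of "frac s" i] by (simp add: frac_lt_1 less_imp_le)
qed

lemma tint_shift:
  assumes g: "pcont g"
  shows "tint (\<lambda>x. g (x + a)) = tint g"
proof -
  have "tint (\<lambda>x. g (x + (\<Sum>i\<in>S. (a $ i) *\<^sub>R axis i 1))) = tint g" if "finite S" for S
    using that
  proof (induction S)
    case (insert i S)
    have "tint (\<lambda>x. g (x + (\<Sum>i\<in>insert i S. (a $ i) *\<^sub>R axis i 1)))
      = tint (\<lambda>x. (\<lambda>x. g (x + (\<Sum>i\<in>S. (a $ i) *\<^sub>R axis i 1))) (x + (a $ i) *\<^sub>R axis i 1))"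
      using insert by (simp add: algebra_simps)
    also have "\<dots> = tint (\<lambda>x. g (x + (\<Sum>i\<in>S. (a $ i) *\<^sub>R axis i 1)))"
      by (rule tint_shift_axis[OF pcont_shift[OF g]])
    finally show ?case using insert by simp
  qed simp
  from this[of UNIV] show ?thesis
    using basis_expansion[of a] by (simp add: scalar_mult_eq_scaleR)
qed

lemma tint_reflect:
  assumes g: "pcont g"
  shows "tint (\<lambda>x. g (a - x)) = tint g"
proof -
  have "tint (\<lambda>x. g (a - x)) = tint (\<lambda>x. g (a - One + x))"
  proof -
    have "tint (\<lambda>x. g (a - x)) = integral (cbox (- One) 0) (\<lambda>x. g (a + x))"
      using integral_reflect[of 0 "- One" "\<lambda>x. g (a + x)"] by (simp add: torus_def)
    also have "\<dots> = tint (\<lambda>x. g (a - One + x))"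
      using integral_shift_cbox[of 0 One One "\<lambda>x. g (a - One + x)"]
      by (simp add: torus_def algebra_simps)
    finally show ?thesis .
  qed
  also have "\<dots> = tint g"
    using tint_shift[OF g, of "a - One"] by (simp add: add.commute)
  finally show ?thesis .
qed

section \<open>Partial derivatives and integration by parts\<close>

lemma has_partialD:
  assumes "has_partial i g g'"
  shows "((\<lambda>s. g (x + s *\<^sub>R axis i 1)) has_real_derivative g' (x + s *\<^sub>R axis i 1)) (at s within S)"
proof -
  have "((\<lambda>r. g (x + s *\<^sub>R axis i 1 + r *\<^sub>R axis i 1)) has_real_derivative g' (x + s *\<^sub>R axis i 1)) (at 0)"
    using assms by (simp add: has_partial_def)
  then have "((\<lambda>r. g (x + (r + s) *\<^sub>R axis i 1)) has_real_derivative g' (x + s *\<^sub>R axis i 1)) (at 0)"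
    by (simp add: algebra_simps)
  then have "((\<lambda>s. g (x + s *\<^sub>R axis i 1)) has_real_derivative g' (x + s *\<^sub>R axis i 1)) (at s)"
    using DERIV_shift[of "\<lambda>s. g (x + s *\<^sub>R axis i 1)" _ 0 s] by (simp add: add.commute)
  then show ?thesis by (rule has_field_derivative_at_within)
qed

lemma has_partial_const: "has_partial i (\<lambda>x. c) (\<lambda>x. 0)"
  and has_partial_add: "has_partial i g g' \<Longrightarrow> has_partial i h h' \<Longrightarrow>
    has_partial i (\<lambda>x. g x + h x) (\<lambda>x. g' x + h' x)"
  and has_partial_diff: "has_partial i g g' \<Longrightarrow> has_partial i h h' \<Longrightarrow>
    has_partial i (\<lambda>x. g x - h x) (\<lambda>x. g' x - h' x)"
  and has_partial_cmult: "has_partial i g g' \<Longrightarrow> has_partial i (\<lambda>x. c * g x) (\<lambda>x. c * g' x)"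
  by (auto simp: has_partial_def intro!: derivative_eq_intros)

lemma has_partial_shift: "has_partial i g g' \<Longrightarrow> has_partial i (\<lambda>x. g (x + a)) (\<lambda>x. g' (x + a))"
  by (simp add: has_partial_def add.assoc add.commute[of _ a]) (simp flip: add.assoc)

lemma has_partial_mult:
  assumes "has_partial i g g'" "has_partial i h h'"
  shows "has_partial i (\<lambda>x. g x * h x) (\<lambda>x. g' x * h x + g x * h' x)"
  unfolding has_partial_def
proof
  fix x
  show "((\<lambda>s. g (x + s *\<^sub>R axis i 1) * h (x + s *\<^sub>R axis i 1)) has_real_derivative
      g' x * h x + g x * h' x) (at 0)"
    using DERIV_mult[of "\<lambda>s. g (x + s *\<^sub>R axis i 1)" "g' x" 0 UNIV "\<lambda>s. h (x + s *\<^sub>R axis i 1)" "h' x"]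
      assms by (simp add: has_partial_def algebra_simps)
qed

lemma has_partial_sum:
  "(\<And>k. k \<in> I \<Longrightarrow> has_partial i (g k) (g' k)) \<Longrightarrow>
    has_partial i (\<lambda>x. \<Sum>k\<in>I. g k x) (\<lambda>x. \<Sum>k\<in>I. g' k x)"
  unfolding has_partial_def by (intro allI DERIV_sum) auto

lemma has_partial_chain:
  assumes "has_partial i g g'" "\<And>x. (H has_real_derivative H' (g x)) (at (g x))"
  shows "has_partial i (\<lambda>x. H (g x)) (\<lambda>x. H' (g x) * g' x)"
  unfolding has_partial_def
proof
  fix x
  show "((\<lambda>s. H (g (x + s *\<^sub>R axis i 1))) has_real_derivative H' (g x) * g' x) (at 0)"
    using DERIV_chain2[of H "H' (g x)" "\<lambda>s. g (x + s *\<^sub>R axis i 1)" 0 "g' x" UNIV] assms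
    by (simp add: has_partial_def)
qed

lemma has_partial_ftc:
  assumes "has_partial i g g'" "0 \<le> s"
  shows "((\<lambda>r. g' (x + r *\<^sub>R axis i 1)) has_integral (g (x + s *\<^sub>R axis i 1) - g x)) {0..s}"
  using fundamental_theorem_of_calculus[of 0 s "\<lambda>r. g (x + r *\<^sub>R axis i 1)"] assms(2)
    has_partialD[OF assms(1)]
  by (simp add: has_real_derivative_iff_has_vector_derivative)

text \<open>By translation invariance the integral of \<open>g'\<close> is also its average over all
  shifts along the i-th axis. After exchanging the integrals, the inner one is the increment of
  \<open>g\<close> over a full period, which vanishes.\<close>

lemma tint_partial:
  assumes "has_partial i g g'" "pcont g" "pcont g'"
  shows "tint g' = 0"
proof -
  have c: "continuous_on UNIV (\<lambda>(x, s). g' (x + s *\<^sub>R axis i 1))"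
    unfolding case_prod_beta by (intro pcont_comp_cont[OF assms(3)] continuous_intros)
  have "g (x + axis i 1) = g x" for x
    using assms(2) by (simp add: pcont_def torus_periodic_def)
  then have "integral {0..1} (\<lambda>s. g' (x + s *\<^sub>R axis i 1)) = 0" for x
    using has_partial_ftc[OF assms(1), of 1 x] by (auto dest: integral_unique)
  then have "0 = tint (\<lambda>x. integral {0..1} (\<lambda>s. g' (x + s *\<^sub>R axis i 1)))"
    by simp
  also have "\<dots> = integral {0..1} (\<lambda>s. tint (\<lambda>x. g' (x + s *\<^sub>R axis i 1)))"
    by (rule tint_swap_real[OF c])
  also have "\<dots> = tint g'"
    using tint_shift[OF assms(3)] by simp
  finally show ?thesis by simp
qed

lemma tint_by_parts:
  assumes "has_partial i g g'" "pcont g" "pcont g'" "has_partial i h h'" "pcont h" "pcont h'"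
  shows "tint (\<lambda>x. g x * h' x) = - tint (\<lambda>x. g' x * h x)"
proof -
  have "tint (\<lambda>x. g' x * h x + g x * h' x) = 0"
    by (rule tint_partial[OF has_partial_mult[OF assms(1,4)]]) (intro pcont_add pcont_mult assms)+
  then show ?thesis
    using tint_add[of "\<lambda>x. g' x * h x" "\<lambda>x. g x * h' x"] assms by (simp add: pcont_mult)
qed

text \<open>With second derivatives this would be two integrations by parts. Here only first ones
  are assumed, so one of them is replaced by a shift: \<open>q s\<close> pairs \<open>aj\<close>
  with \<open>b\<close> shifted by \<open>s\<close> along the i-th axis. Its derivative at 0 is
  computed once directly, and once after integrating by parts in direction \<open>j\<close> and
  moving the shift onto \<open>a\<close>.\<close>

lemma tint_partial_exchange:
  assumes a: "has_partial i a ai" "has_partial j a aj" "pcont a" "pcont ai" "pcont aj"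
    and b: "has_partial i b bi" "has_partial j b bj" "pcont b" "pcont bi" "pcont bj"
  shows "tint (\<lambda>x. aj x * bi x) = tint (\<lambda>x. ai x * bj x)"
proof -
  let ?k = "axis i 1 :: real ^ 'a"
  define q where "q s = tint (\<lambda>x. aj x * b (x + s *\<^sub>R ?k))" for s
  have cont2: "continuous_on UNIV (\<lambda>(s, x). h (x + s *\<^sub>R ?k))"
    "continuous_on UNIV (\<lambda>(s, x). h (x - s *\<^sub>R ?k))" if "pcont h" for h
    unfolding case_prod_beta by (intro pcont_comp_cont[OF that] continuous_intros)+
  have cont1: "continuous_on UNIV (\<lambda>(s::real, x). h x)" if "pcont h" for h
    unfolding case_prod_beta by (intro pcont_comp_cont[OF that] continuous_intros)+
  have q1: "(q has_real_derivative tint (\<lambda>x. aj x * bi (x + 0 *\<^sub>R ?k))) (at 0)"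
    unfolding q_def
  proof (rule tint_derivative[where U = UNIV])
    show "((\<lambda>s. aj x * b (x + s *\<^sub>R ?k)) has_real_derivative aj x * bi (x + s *\<^sub>R ?k)) (at s)" for s x
      using has_partialD[OF b(1), of x s UNIV] by (auto intro!: derivative_eq_intros)
    show "continuous_on UNIV (\<lambda>x. aj x * b (x + s *\<^sub>R ?k))" for s
      by (intro pcont_cont pcont_mult pcont_shift a b)
    show "continuous_on (UNIV \<times> UNIV) (\<lambda>(s, x). aj x * bi (x + s *\<^sub>R ?k))"
      using continuous_on_mult[OF cont1[OF a(5)] cont2(1)[OF b(4)]] by (simp add: case_prod_beta)
  qed auto
  have q: "q s = tint (\<lambda>x. - (bj x * a (x - s *\<^sub>R ?k)))" for s
  proof -
    have "q s = tint (\<lambda>x. b (x + s *\<^sub>R ?k) * aj x)"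
      by (simp add: q_def mult.commute)
    also have "\<dots> = - tint (\<lambda>x. bj (x + s *\<^sub>R ?k) * a x)"
      by (rule tint_by_parts[where i = j]) (intro has_partial_shift pcont_shift a b)+
    also have "\<dots> = - tint (\<lambda>x. bj x * a (x - s *\<^sub>R ?k))"
      using tint_shift[of "\<lambda>x. bj x * a (x - s *\<^sub>R ?k)" "s *\<^sub>R ?k"]
      by (simp add: pcont_mult pcont_shift_minus a b)
    finally show ?thesis by simp
  qed
  have "(q has_real_derivative tint (\<lambda>x. bj x * ai (x - 0 *\<^sub>R ?k))) (at 0)"
    unfolding q
  proof (rule tint_derivative[where U = UNIV])
    show "((\<lambda>s. - (bj x * a (x - s *\<^sub>R ?k))) has_real_derivative bj x * ai (x - s *\<^sub>R ?k)) (at s)" for s x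
    proof -
      have "((\<lambda>s. a (x + (- s) *\<^sub>R ?k)) has_real_derivative ai (x + (- s) *\<^sub>R ?k) * (-1)) (at s)"
        by (rule DERIV_chain2[OF has_partialD[OF a(1)]]) (auto intro!: derivative_eq_intros)
      then show ?thesis by (auto intro!: derivative_eq_intros)
    qed
    show "continuous_on UNIV (\<lambda>x. - (bj x * a (x - s *\<^sub>R ?k)))" for s
      by (intro pcont_cont pcont_mult pcont_minus pcont_shift_minus a b)
    show "continuous_on (UNIV \<times> UNIV) (\<lambda>(s, x). bj x * ai (x - s *\<^sub>R ?k))"
      using continuous_on_mult[OF cont1[OF b(5)] cont2(2)[OF a(4)]] by (simp add: case_prod_beta)
  qed auto
  from DERIV_unique[OF q1 this] show ?thesis by (simp add: mult.commute)
qed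

text \<open>The bridge between \<open>tint\<close>, in which the calculus is done, and the Lebesgue
  integrals of the statement to be proved.\<close>

lemma pcont_set_integrable:
  assumes "pcont g"
  shows "set_integrable lborel torus g" "(LINT x:torus|lborel. g x) = tint g"
proof -
  show *: "set_integrable lborel torus g"
    unfolding set_integrable_def
    using borel_integrable_compact[OF compact_torus pcont_cont[OF assms]]
    by (simp add: indicator_scaleR_eq_if if_distrib cong: if_cong)
  show "(LINT x:torus|lborel. g x) = tint g"
    by (rule set_borel_integral_eq_integral(2)[OF *])
qed

section \<open>Cauchy-Schwarz and Poincare inequalities\<close>

lemma tint_cauchy_schwarz:
  assumes a: "pcont a" and b: "pcont b"
  shows "(tint (\<lambda>x. a x * b x))\<^sup>2 \<le> tint (\<lambda>x. (a x)\<^sup>2) * tint (\<lambda>x. (b x)\<^sup>2)"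
proof -
  define A B P where "A = tint (\<lambda>x. (a x)\<^sup>2)" and "B = tint (\<lambda>x. (b x)\<^sup>2)"
    and "P = tint (\<lambda>x. a x * b x)"
  have nonneg: "0 \<le> A - 2 * l * P + l\<^sup>2 * B" for l
  proof -
    have "0 \<le> tint (\<lambda>x. (a x - l * b x)\<^sup>2)"
      by (intro tint_nonneg pcont_power pcont_diff pcont_mult a b pcont_const) auto
    also have "(\<lambda>x. (a x - l * b x)\<^sup>2) = (\<lambda>x. ((a x)\<^sup>2 - 2 * l * (a x * b x)) + l\<^sup>2 * (b x)\<^sup>2)"
      by (auto simp: power2_eq_square algebra_simps)
    also have "tint \<dots> = A - 2 * l * P + l\<^sup>2 * B"
      using tint_add[of "\<lambda>x. (a x)\<^sup>2 - 2 * l * (a x * b x)" "\<lambda>x. l\<^sup>2 * (b x)\<^sup>2"]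
        tint_diff[of "\<lambda>x. (a x)\<^sup>2" "\<lambda>x. 2 * l * (a x * b x)"]
      by (simp add: pcont_power pcont_diff pcont_mult a b A_def B_def P_def)
    finally show ?thesis .
  qed
  have "B \<ge> 0" unfolding B_def by (intro tint_nonneg pcont_power b) auto
  show ?thesis
  proof (cases "B = 0")
    case True
    have "P = 0"
    proof (rule ccontr)
      assume "P \<noteq> 0"
      \<comment> \<open>With \<open>B = 0\<close> the nonnegative expression is affine in
        \<open>l\<close>, and this \<open>l\<close> would give it the value -1.\<close>
      with nonneg[of "(A + 1) / (2 * P)"] True show False by (simp add: field_simps)
    qed
    then show ?thesis using True by (simp add: A_def B_def P_def)
  next
    case False
    with \<open>B \<ge> 0\<close> have "B > 0" by simp
    with nonneg[of "P / B"] have "0 \<le> A - P\<^sup>2 / B"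
      by (simp add: field_simps power2_eq_square)
    with \<open>B > 0\<close> show ?thesis by (simp add: A_def B_def P_def field_simps)
  qed
qed

text \<open>Jensen's inequality on an interval of length at most 1: expanding the integral of
  \<open>(h - c)^2\<close>, where \<open>c\<close> is the integral of \<open>h\<close> itself, costs
  \<open>2 * c^2\<close> and returns only \<open>s * c^2\<close>.\<close>

lemma integral_square_le:
  fixes h :: "real \<Rightarrow> real"
  assumes h: "continuous_on {0..1} h" and s: "0 \<le> s" "s \<le> 1"
  shows "(integral {0..s} h)\<^sup>2 \<le> integral {0..1} (\<lambda>r. (h r)\<^sup>2)"
proof -
  define c where "c = integral {0..s} h"
  have hs: "continuous_on {0..s} h" using h s continuous_on_subset[of "{0..1}" h "{0..s}"] by auto
  have i: "h integrable_on {0..s}" "(\<lambda>r. (h r)\<^sup>2) integrable_on {0..s}"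
    "(\<lambda>r. (h r)\<^sup>2) integrable_on {0..1}"
    using h hs by (auto intro!: integrable_continuous_real continuous_intros)
  have "((\<lambda>r. ((h r)\<^sup>2 - 2 * c * h r) + c\<^sup>2) has_integral
      (integral {0..s} (\<lambda>r. (h r)\<^sup>2) - 2 * c * c) + s * c\<^sup>2) {0..s}"
    using i has_integral_const_real[of "c\<^sup>2" 0 s] s(1)
    by (intro has_integral_add has_integral_diff has_integral_mult_right)
      (auto simp: c_def has_integral_integral)
  moreover have "(\<lambda>r. ((h r)\<^sup>2 - 2 * c * h r) + c\<^sup>2) = (\<lambda>r. (h r - c)\<^sup>2)"
    by (auto simp: power2_eq_square algebra_simps)
  ultimately have "0 \<le> (integral {0..s} (\<lambda>r. (h r)\<^sup>2) - 2 * c * c) + s * c\<^sup>2"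
    by (metis has_integral_nonneg zero_le_power2)
  moreover have "s * c\<^sup>2 \<le> c\<^sup>2" using s by (simp add: mult_left_le_one_le)
  ultimately have "c\<^sup>2 \<le> integral {0..s} (\<lambda>r. (h r)\<^sup>2)"
    by (simp add: power2_eq_square)
  also have "\<dots> \<le> integral {0..1} (\<lambda>r. (h r)\<^sup>2)"
    using i s by (intro integral_subset_le) auto
  finally show ?thesis by (simp add: c_def)
qed

text \<open>The increment is the integral of \<open>w'\<close> over a segment of length at most 1.
  After squaring, each point of the segment contributes the same integral over the torus.\<close>

lemma tint_increment:
  assumes w: "pcont w" "has_partial i w w'" "pcont w'" and s: "0 \<le> s" "s \<le> 1"
  shows "tint (\<lambda>x. (w (x + s *\<^sub>R axis i 1) - w x)\<^sup>2) \<le> tint (\<lambda>x. (w' x)\<^sup>2)"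
proof -
  let ?k = "axis i 1 :: real ^ 'a"
  have c: "continuous_on UNIV (\<lambda>(x, r). (w' (x + r *\<^sub>R ?k))\<^sup>2)"
    unfolding case_prod_beta by (intro continuous_on_power pcont_comp_cont[OF w(3)] continuous_intros)
  have "tint (\<lambda>x. (w (x + s *\<^sub>R ?k) - w x)\<^sup>2)
      \<le> tint (\<lambda>x. integral {0..1} (\<lambda>r. (w' (x + r *\<^sub>R ?k))\<^sup>2))"
  proof (rule integral_le)
    show "(\<lambda>x. (w (x + s *\<^sub>R ?k) - w x)\<^sup>2) integrable_on torus"
      by (intro pcont_integrable pcont_power pcont_diff pcont_shift w)
    show "(\<lambda>x. integral {0..1} (\<lambda>r. (w' (x + r *\<^sub>R ?k))\<^sup>2)) integrable_on torus"
      unfolding torus_def cbox_interval[symmetric]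
      by (intro integrable_continuous integral_continuous_on_param continuous_on_subset[OF c]) auto
    show "(w (x + s *\<^sub>R ?k) - w x)\<^sup>2 \<le> integral {0..1} (\<lambda>r. (w' (x + r *\<^sub>R ?k))\<^sup>2)" for x
      using integral_square_le[OF pcont_comp_cont[OF w(3)] s, of "\<lambda>r. x + r *\<^sub>R ?k"]
        integral_unique[OF has_partial_ftc[OF w(2) s(1), of x]]
      by (simp add: continuous_intros)
  qed
  also have "\<dots> = integral {0..1} (\<lambda>r. tint (\<lambda>x. (w' (x + r *\<^sub>R ?k))\<^sup>2))"
    by (rule tint_swap_real[OF c])
  also have "\<dots> = tint (\<lambda>x. (w' x)\<^sup>2)"
    using tint_shift[OF pcont_power[OF w(3)]] by simp
  finally show ?thesis .
qed

text \<open>The path from \<open>x\<close> to \<open>x + y\<close> goes along one axis after the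
  other; each further leg costs a factor 2 from (a + b)^2 \<le> 2 a^2 + 2 b^2, which is where the
  power of 2 comes from.\<close>

lemma tint_increment_vec:
  fixes w :: "real ^ 'n::finite \<Rightarrow> real"
  assumes w: "pcont w" "\<And>i. has_partial i w (w' i)" "\<And>i. pcont (w' i)" and y: "y \<in> torus"
  shows "tint (\<lambda>x. (w (x + y) - w x)\<^sup>2) \<le> 2 ^ CARD('n) * (\<Sum>i\<in>UNIV. tint (\<lambda>x. (w' i x)\<^sup>2))"
proof -
  let ?y = "\<lambda>S. \<Sum>i\<in>S. (y $ i) *\<^sub>R axis i (1::real)"
  have "tint (\<lambda>x. (w (x + ?y S) - w x)\<^sup>2) \<le> 2 ^ card S * (\<Sum>i\<in>S. tint (\<lambda>x. (w' i x)\<^sup>2))"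
    if "finite S" for S
    using that
  proof (induction S)
    case (insert j S)
    let ?k = "(y $ j) *\<^sub>R axis j (1::real)"
    let ?W = "\<Sum>i\<in>S. tint (\<lambda>x. (w' i x)\<^sup>2)"
    have pos: "0 \<le> tint (\<lambda>x. (w' i x)\<^sup>2)" for i
      by (intro tint_nonneg pcont_power w) auto
    have pc: "pcont (\<lambda>x. (w (x + a + b) - w (x + a))\<^sup>2)" "pcont (\<lambda>x. (w (x + a) - w x)\<^sup>2)" for a b
      using pcont_shift[OF pcont_shift[OF w(1), of b], of a]
      by (auto intro!: pcont_power pcont_diff pcont_shift w)
    have "tint (\<lambda>x. (w (x + ?y (insert j S)) - w x)\<^sup>2)
        \<le> tint (\<lambda>x. 2 * (w (x + ?y S + ?k) - w (x + ?y S))\<^sup>2 + 2 * (w (x + ?y S) - w x)\<^sup>2)"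
    proof (rule tint_mono)
      fix x
      have "(a - c)\<^sup>2 \<le> 2 * (a - b)\<^sup>2 + 2 * (b - c)\<^sup>2" for a b c :: real
        using sum_squares_bound[of "a - b" "b - c"] zero_le_power2[of "(a - b) - (b - c)"]
        by (simp add: power2_eq_square algebra_simps)
      from this[of "w (x + ?y S + ?k)" "w x" "w (x + ?y S)"]
      show "(w (x + ?y (insert j S)) - w x)\<^sup>2
          \<le> 2 * (w (x + ?y S + ?k) - w (x + ?y S))\<^sup>2 + 2 * (w (x + ?y S) - w x)\<^sup>2"
        using insert by (simp add: add.commute add.left_commute)
    qed (intro pcont_add pcont_mult pcont_const pc pcont_power pcont_diff pcont_shift w)+
    also have "\<dots> = 2 * tint (\<lambda>x. (w (x + ?y S + ?k) - w (x + ?y S))\<^sup>2)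
        + 2 * tint (\<lambda>x. (w (x + ?y S) - w x)\<^sup>2)"
      by (subst tint_add) (auto intro: pcont_mult pc)
    also have "tint (\<lambda>x. (w (x + ?y S + ?k) - w (x + ?y S))\<^sup>2) = tint (\<lambda>x. (w (x + ?k) - w x)\<^sup>2)"
      by (rule tint_shift[OF pc(2)])
    also have "\<dots> \<le> tint (\<lambda>x. (w' j x)\<^sup>2)"
      using y by (intro tint_increment w) (auto simp: mem_torus)
    also have "2 * tint (\<lambda>x. (w' j x)\<^sup>2) \<le> 2 ^ card (insert j S) * tint (\<lambda>x. (w' j x)\<^sup>2)"
      using insert pos[of j] by (intro mult_right_mono) auto
    finally show ?case
      using insert by (simp add: algebra_simps)
  qed simp
  from this[of UNIV] show ?thesis
    using basis_expansion[of y] by (simp add: scalar_mult_eq_scaleR)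
qed

lemma tint_variance:
  assumes "pcont w"
  shows "tint (\<lambda>x. (w x - tint w)\<^sup>2) = tint (\<lambda>x. (w x)\<^sup>2) - (tint w)\<^sup>2"
proof -
  have "(\<lambda>x. (w x - tint w)\<^sup>2) = (\<lambda>x. ((w x)\<^sup>2 - 2 * tint w * w x) + (tint w)\<^sup>2)"
    by (auto simp: power2_eq_square algebra_simps)
  then show ?thesis
    using assms by (simp add: tint_add tint_diff pcont_diff pcont_mult pcont_power power2_eq_square)
qed

text \<open>Integrating \<open>(w (x + y) - w x)^2\<close> over both variables gives twice the
  variance, while for fixed \<open>y\<close> in the unit cube the integral over \<open>x\<close> is
  an increment already bounded by the gradient. The spare factor 2 is given away.\<close>

lemma poincare:
  fixes w :: "real ^ 'n::finite \<Rightarrow> real"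
  assumes w: "pcont w" "\<And>i. has_partial i w (w' i)" "\<And>i. pcont (w' i)"
  shows "tint (\<lambda>x. (w x - tint w)\<^sup>2) \<le> 2 ^ CARD('n) * (\<Sum>i\<in>UNIV. tint (\<lambda>x. (w' i x)\<^sup>2))"
proof -
  let ?K = "2 ^ CARD('n) * (\<Sum>i\<in>UNIV. tint (\<lambda>x. (w' i x)\<^sup>2))"
  define c where "c = tint w"
  have cont: "continuous_on UNIV (\<lambda>(y, x). (w (x + y) - w x)\<^sup>2)"
    unfolding case_prod_beta
    by (intro continuous_on_power continuous_on_diff pcont_comp_cont[OF w(1)] continuous_intros)
  have inner: "tint (\<lambda>y. (w (x + y) - w x)\<^sup>2) = tint (\<lambda>y. (w y)\<^sup>2) - 2 * w x * c + (w x)\<^sup>2" for x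
  proof -
    have "tint (\<lambda>y. (w (x + y) - w x)\<^sup>2) = tint (\<lambda>y. (w y - w x)\<^sup>2)"
      using tint_shift[of "\<lambda>y. (w y - w x)\<^sup>2" x]
      by (simp add: pcont_power pcont_diff w add.commute)
    also have "\<dots> = tint (\<lambda>y. ((w y)\<^sup>2 - 2 * w x * w y) + (w x)\<^sup>2)"
      by (intro arg_cong[where f = tint]) (auto simp: power2_eq_square algebra_simps)
    also have "\<dots> = tint (\<lambda>y. (w y)\<^sup>2) - 2 * w x * c + (w x)\<^sup>2"
      using w(1) by (simp add: c_def tint_add tint_diff pcont_diff pcont_mult pcont_power)
    finally show ?thesis .
  qed
  have "tint (\<lambda>y. tint (\<lambda>x. (w (x + y) - w x)\<^sup>2)) \<le> tint (\<lambda>y :: real ^ 'n. ?K)"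
  proof (rule integral_le)
    show "(\<lambda>y. tint (\<lambda>x. (w (x + y) - w x)\<^sup>2)) integrable_on torus"
      unfolding torus_def
      by (intro integrable_continuous integral_continuous_on_param continuous_on_subset[OF cont]) auto
  qed (auto intro!: tint_increment_vec w pcont_integrable)
  also have "tint (\<lambda>y. tint (\<lambda>x. (w (x + y) - w x)\<^sup>2)) = tint (\<lambda>x. tint (\<lambda>y. (w (x + y) - w x)\<^sup>2))"
    by (rule tint_swap[OF cont])
  also have "\<dots> = 2 * (tint (\<lambda>x. (w x)\<^sup>2) - c\<^sup>2)"
    unfolding inner using w(1)
    by (simp add: tint_add tint_diff pcont_add pcont_diff pcont_mult pcont_power)
      (simp add: c_def power2_eq_square)
  finally have "2 * (tint (\<lambda>x. (w x)\<^sup>2) - c\<^sup>2) \<le> ?K"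
    by simp
  moreover have "0 \<le> tint (\<lambda>x. (w x - c)\<^sup>2)"
    by (intro tint_nonneg pcont_power pcont_diff w pcont_const) auto
  ultimately show ?thesis
    using tint_variance[OF w(1)] by (simp add: c_def)
qed

subsection \<open>Sobolev inequality\<close>

definition line_avg :: "'n::finite \<Rightarrow> (real ^ 'n \<Rightarrow> real) \<Rightarrow> real ^ 'n \<Rightarrow> real" where
  "line_avg i g x = integral {0..1} (\<lambda>s. g (x + s *\<^sub>R axis i 1))"

lemma continuous_on_axis_shift: "pcont g \<Longrightarrow> continuous_on S (\<lambda>(x, s). g (x + s *\<^sub>R axis i 1))"
  unfolding case_prod_beta by (rule pcont_comp_cont) (auto intro!: continuous_intros)

lemma line_integrable: "pcont g \<Longrightarrow> (\<lambda>s. g (x + s *\<^sub>R axis i 1)) integrable_on {a..b::real}"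
  by (intro integrable_continuous_real pcont_comp_cont continuous_intros)

lemma pcont_line_avg:
  assumes "pcont g" shows "pcont (line_avg i g)"
proof -
  have "g (x + axis j 1 + s *\<^sub>R axis i 1) = g (x + s *\<^sub>R axis i 1)" for x j s
    using pcont_shift[OF assms, of "s *\<^sub>R axis i 1"] by (simp add: pcont_def torus_periodic_def)
  moreover have "continuous_on UNIV (line_avg i g)"
    unfolding line_avg_def[abs_def] cbox_interval[symmetric]
    by (rule integral_continuous_on_param) (rule continuous_on_axis_shift[OF assms])
  ultimately show ?thesis
    by (simp add: pcont_def torus_periodic_def line_avg_def)
qed

lemma line_avg_mono: "pcont g \<Longrightarrow> pcont h \<Longrightarrow> (\<And>x. g x \<le> h x) \<Longrightarrow> line_avg i g x \<le> line_avg i h x"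
  unfolding line_avg_def by (intro integral_le line_integrable) auto

lemma line_avg_pos:
  assumes "pcont g" "\<And>x. 0 < g x"
  shows "0 < line_avg i g x"
proof -
  have "continuous_on {0..1} (\<lambda>s. g (x + s *\<^sub>R axis i 1))"
    by (intro pcont_comp_cont[OF assms(1)] continuous_intros)
  then obtain s where s: "\<And>r. r \<in> {0..1} \<Longrightarrow> g (x + s *\<^sub>R axis i 1) \<le> g (x + r *\<^sub>R axis i 1)"
    using continuous_attains_inf[of "{0..1::real}"] by force
  have "integral {0..1::real} (\<lambda>r. g (x + s *\<^sub>R axis i 1)) \<le> line_avg i g x"
    unfolding line_avg_def by (intro integral_le line_integrable assms s) auto
  with assms(2)[of "x + s *\<^sub>R axis i 1"] show ?thesis by simp
qed

lemma tint_line_avg: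
  assumes "pcont g" shows "tint (line_avg i g) = tint g"
  unfolding line_avg_def[abs_def]
  using tint_swap_real[OF continuous_on_axis_shift[OF assms]] tint_shift[OF assms] by simp

text \<open>Independence of the i-th coordinate, expressed without passing to functions of one
  variable less.\<close>

definition inv_along :: "'n::finite \<Rightarrow> (real ^ 'n \<Rightarrow> real) \<Rightarrow> bool" where
  "inv_along i g \<longleftrightarrow> (\<forall>x s. g (x + s *\<^sub>R axis i 1) = g x)"

lemma line_avg_inv: "inv_along i g \<Longrightarrow> line_avg i g = g"
  by (auto simp: inv_along_def line_avg_def)

lemma inv_along_line_avg_other: "inv_along j g \<Longrightarrow> inv_along j (line_avg i g)"
  by (simp add: inv_along_def line_avg_def add.assoc add.commute[of "_ *\<^sub>R axis j 1"])
    (simp flip: add.assoc)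

lemma inv_along_line_avg:
  assumes g: "pcont g" shows "inv_along i (line_avg i g)"
proof -
  let ?k = "axis i 1 :: real ^ 'a"
  have per: "g (x + of_int n *\<^sub>R ?k) = g x" for x n
    using g torus_periodic_int pcont_def by blast
  have small: "line_avg i g (x + s *\<^sub>R ?k) = line_avg i g x" if s: "0 \<le> s" "s \<le> 1" for x s
  proof -
    let ?G = "\<lambda>r. g (x + r *\<^sub>R ?k)"
    have "line_avg i g (x + s *\<^sub>R ?k) = integral {0..1} (\<lambda>r. ?G (r + s))"
      by (simp add: line_avg_def algebra_simps)
    also have "\<dots> = integral {s..1 + s} ?G"
      using integral_shift_cbox[of s s "1 + s" ?G] by simp
    also have "\<dots> = integral {s..1} ?G + integral {1..1 + s} ?G"
      using s by (intro Henstock_Kurzweil_Integration.integral_combine[symmetric] line_integrable g) auto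
    also have "integral {1..1 + s} ?G = integral {0..s} ?G"
      using integral_shift_cbox[of 1 1 "1 + s" ?G] per[of _ 1]
      by (simp add: scaleR_left_distrib flip: add.assoc)
    also have "integral {s..1} ?G + \<dots> = integral {0..1} ?G"
      using s Henstock_Kurzweil_Integration.integral_combine[of 0 s 1 ?G] line_integrable[OF g]
      by (simp add: add.commute)
    finally show ?thesis by (simp add: line_avg_def)
  qed
  have "line_avg i g (x + s *\<^sub>R ?k) = line_avg i g x" for x s
  proof -
    have "line_avg i g (x + s *\<^sub>R ?k) = line_avg i g (x + frac s *\<^sub>R ?k + of_int \<lfloor>s\<rfloor> *\<^sub>R ?k)"
      by (simp add: frac_def algebra_simps)
    also have "\<dots> = line_avg i g (x + frac s *\<^sub>R ?k)"
      using torus_periodic_int pcont_line_avg[OF g] pcont_def by blast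
    also have "\<dots> = line_avg i g x"
      by (rule small) (auto simp: frac_lt_1 less_imp_le)
    finally show ?thesis .
  qed
  then show ?thesis by (simp add: inv_along_def)
qed

lemma inv_along_all_const:
  assumes "\<And>i. inv_along i g" shows "g x = g 0"
proof -
  have "g (\<Sum>i\<in>S. (x $ i) *\<^sub>R axis i 1) = g 0" if "finite S" for S
    using that
  proof (induction S)
    case (insert i S)
    then show ?case
      using assms[of i] by (simp add: inv_along_def) (metis add.commute)
  qed simp
  from this[of UNIV] show ?thesis
    using basis_expansion[of x] by (simp add: scalar_mult_eq_scaleR)
qed

lemma integral_pos_real:
  fixes G :: "real \<Rightarrow> real"
  assumes "continuous_on {0..1} G" "\<And>s. s \<in> {0..1} \<Longrightarrow> 0 < G s"
  shows "0 < integral {0..1} G"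
proof -
  obtain s where s: "s \<in> {0..1}" "\<And>r. r \<in> {0..1} \<Longrightarrow> G s \<le> G r"
    using continuous_attains_inf[of "{0..1::real}" G] assms(1) by force
  have "integral {0..1::real} (\<lambda>r. G s) \<le> integral {0..1} G"
    by (intro integral_le integrable_continuous_real assms s) auto
  with assms(2)[OF s(1)] show ?thesis by simp
qed

text \<open>Hoelder's inequality for \<open>card I\<close> factors with equal exponents: each factor
  is divided by its integral, the geometric mean is bounded pointwise by the arithmetic mean, and
  the latter integrates to 1. Positivity makes the division legitimate and the roots
  continuous.\<close>

lemma hoelder_prod_real:
  fixes G :: "'i \<Rightarrow> real \<Rightarrow> real"
  assumes I: "finite I" "I \<noteq> {}"
    and G: "\<And>i. i \<in> I \<Longrightarrow> continuous_on {0..1} (G i)" "\<And>i s. i \<in> I \<Longrightarrow> s \<in> {0..1} \<Longrightarrow> 0 < G i s"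
  shows "integral {0..1} (\<lambda>s. \<Prod>i\<in>I. G i s powr (1 / card I))
      \<le> (\<Prod>i\<in>I. integral {0..1} (G i) powr (1 / card I))"
proof -
  let ?m = "1 / card I"
  let ?J = "\<lambda>i. integral {0..1} (G i)"
  have J: "0 < ?J i" if "i \<in> I" for i
    using that G by (intro integral_pos_real) auto
  have int: "(\<lambda>s. G i s / ?J i / card I) integrable_on {0..1}" if "i \<in> I" for i
    using that G J by (intro integrable_continuous_real continuous_intros) (auto simp: less_le I)
  have le: "(\<Prod>i\<in>I. G i s powr ?m) \<le> (\<Prod>i\<in>I. ?J i powr ?m) * (\<Sum>i\<in>I. G i s / ?J i / card I)"
    if s: "s \<in> {0..1}" for s
  proof -
    have "(\<Prod>i\<in>I. G i s powr ?m) = (\<Prod>i\<in>I. ?J i powr ?m) * (\<Prod>i\<in>I. (G i s / ?J i) powr ?m)"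
      unfolding prod.distrib[symmetric]
      by (rule prod.cong) (use G(2) J s in \<open>auto simp: less_le powr_divide\<close>)
    also have "(\<Prod>i\<in>I. (G i s / ?J i) powr ?m) = (\<Prod>i\<in>I. G i s / ?J i) powr ?m"
      by (rule prod_powr_distrib[symmetric])
    also have "\<dots> \<le> (\<Sum>i\<in>I. G i s / ?J i / card I)"
      by (rule arith_geom_mean) (use I G(2) J s in \<open>auto simp: less_imp_le\<close>)
    finally show ?thesis
      by (simp add: mult_left_mono prod_nonneg)
  qed
  have "integral {0..1} (\<lambda>s. \<Prod>i\<in>I. G i s powr ?m)
      \<le> integral {0..1} (\<lambda>s. (\<Prod>i\<in>I. ?J i powr ?m) * (\<Sum>i\<in>I. G i s / ?J i / card I))"
  proof (rule integral_le)
    show "(\<lambda>s. \<Prod>i\<in>I. G i s powr ?m) integrable_on {0..1}"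
      by (intro integrable_continuous_real continuous_intros) (use G in \<open>auto simp: less_le\<close>)
    show "(\<lambda>s. (\<Prod>i\<in>I. ?J i powr ?m) * (\<Sum>i\<in>I. G i s / ?J i / card I)) integrable_on {0..1}"
      using int I by (intro integrable_on_mult_right integrable_sum) auto
  qed (use le in auto)
  also have "\<dots> = (\<Prod>i\<in>I. ?J i powr ?m) * (\<Sum>i\<in>I. integral {0..1} (\<lambda>s. G i s / ?J i / card I))"
    using int I by (simp add: integral_sum)
  also have "(\<Sum>i\<in>I. integral {0..1} (\<lambda>s. G i s / ?J i / card I)) = (\<Sum>i\<in>I. 1 / card I)"
    using J by (intro sum.cong) (auto simp: less_le)
  also have "\<dots> = 1" using I by simp
  finally show ?thesis by simp
qed

primrec lines_avg :: "'n::finite list \<Rightarrow> (real ^ 'n \<Rightarrow> real) \<Rightarrow> real ^ 'n \<Rightarrow> real" where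
  "lines_avg [] g = g"
| "lines_avg (i # l) g = line_avg i (lines_avg l g)"

lemma pcont_lines_avg: "pcont g \<Longrightarrow> pcont (lines_avg l g)"
  by (induction l) (auto intro: pcont_line_avg)

lemma lines_avg_pos: "pcont g \<Longrightarrow> (\<And>x. 0 < g x) \<Longrightarrow> 0 < lines_avg l g x"
  by (induction l arbitrary: x) (auto intro!: line_avg_pos pcont_lines_avg)

lemma tint_lines_avg: "pcont g \<Longrightarrow> tint (lines_avg l g) = tint g"
  by (induction l) (auto simp: tint_line_avg pcont_lines_avg)

lemma inv_along_lines_avg_other: "inv_along j g \<Longrightarrow> inv_along j (lines_avg l g)"
  by (induction l) (auto intro: inv_along_line_avg_other)

lemma inv_along_lines_avg: "pcont g \<Longrightarrow> i \<in> set l \<Longrightarrow> inv_along i (lines_avg l g)"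
  by (induction l) (auto intro: inv_along_line_avg_other inv_along_line_avg pcont_lines_avg)

text \<open>The averages are taken in one direction after another. In direction \<open>j\<close> the
  factor \<open>g j\<close> is constant and can be pulled out, so that only N - 1 factors remain, as
  many as the exponent \<open>m\<close> requires for Hoelder's inequality. Once all directions are
  averaged, both sides are constants, namely the integrals.\<close>

lemma loomis_whitney:
  fixes g :: "'n::finite \<Rightarrow> real ^ 'n \<Rightarrow> real"
  assumes n: "CARD('n) \<ge> 2"
    and g: "\<And>i. pcont (g i)" "\<And>i x. 0 < g i x" "\<And>i. inv_along i (g i)"
  defines "m \<equiv> 1 / (real CARD('n) - 1)"
  shows "tint (\<lambda>x. \<Prod>i\<in>UNIV. g i x powr m) \<le> (\<Prod>i\<in>UNIV. tint (g i) powr m)"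
proof -
  let ?P = "\<lambda>x. \<Prod>i\<in>UNIV. g i x powr m"
  have pP: "pcont ?P" by (intro pcont_prod pcont_powr g)
  have pG: "pcont (lines_avg l (g i))" for l i by (rule pcont_lines_avg[OF g(1)])
  have G0: "0 < lines_avg l (g i) x" for l i x by (rule lines_avg_pos[OF g(1,2)])
  have main: "lines_avg l ?P x \<le> (\<Prod>i\<in>UNIV. lines_avg l (g i) x powr m)" for l x
  proof (induction l arbitrary: x)
    case (Cons j l)
    let ?G = "\<lambda>i. lines_avg l (g i)"
    let ?I = "UNIV - {j}"
    have cI: "m = 1 / card ?I" using n by (simp add: m_def of_nat_diff)
    have "?I \<noteq> {}"
    proof
      assume "?I = {}"
      then have "card ?I = 0" by (simp only: card.empty)
      with n show False by (simp add: card_Diff_singleton)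
    qed
    have invj: "inv_along j (?G j)" by (rule inv_along_lines_avg_other[OF g(3)])
    have split: "(\<Prod>i\<in>UNIV. f i) = f j * (\<Prod>i\<in>?I. f i)" for f :: "'n \<Rightarrow> real"
      by (simp add: prod.remove[of UNIV j])
    have "lines_avg (j # l) ?P x \<le> line_avg j (\<lambda>x. \<Prod>i\<in>UNIV. ?G i x powr m) x"
      using Cons.IH by (auto intro!: line_avg_mono pcont_lines_avg pP pcont_prod pcont_powr pG G0)
    also have "\<dots> = ?G j x powr m * line_avg j (\<lambda>x. \<Prod>i\<in>?I. ?G i x powr m) x"
      using invj by (simp add: split line_avg_def inv_along_def)
    also have "\<dots> \<le> ?G j x powr m * (\<Prod>i\<in>?I. line_avg j (?G i) x powr m)"
      unfolding line_avg_def cI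
      by (intro mult_left_mono hoelder_prod_real \<open>?I \<noteq> {}\<close> G0 pcont_comp_cont[OF pG] continuous_intros) auto
    also have "?G j x = line_avg j (?G j) x"
      using line_avg_inv[OF invj] by simp
    finally show ?case by (simp add: split)
  qed simp
  obtain l :: "'n list" where l: "set l = UNIV"
    using finite_list[OF finite[of "UNIV :: 'n set"]] by blast
  have const: "lines_avg l (g i) x = tint (g i)" for i x
  proof -
    have eq: "lines_avg l (g i) = (\<lambda>x. lines_avg l (g i) 0)"
      by (rule ext, rule inv_along_all_const) (use l in \<open>auto intro: inv_along_lines_avg g\<close>)
    have "tint (lines_avg l (g i)) = lines_avg l (g i) 0"
      by (subst eq) simp
    then show ?thesis using fun_cong[OF eq, of x] tint_lines_avg[OF g(1), of l i] by simp
  qed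
  have "tint ?P = tint (lines_avg l ?P)" by (simp add: tint_lines_avg[OF pP])
  also have "\<dots> \<le> tint (\<lambda>x :: real ^ 'n. \<Prod>i\<in>UNIV. tint (g i) powr m)"
    using main[of l] const by (intro tint_mono pcont_lines_avg pP pcont_const) simp
  finally show ?thesis by simp
qed

text \<open>The value at \<open>x\<close> is at most the value at any other point of the line plus
  the variation along one period; averaging over that point gives a majorant independent of the i-th
  coordinate, the input required by \<open>loomis_whitney\<close>.\<close>

lemma le_line_avg:
  assumes h: "pcont h" "has_partial i h h'" "pcont h'"
  shows "h x \<le> line_avg i (\<lambda>x. h x + \<bar>h' x\<bar>) x"
proof -
  let ?k = "axis i 1 :: real ^ 'a"
  let ?c = "integral {0..1} (\<lambda>r. \<bar>h' (x + r *\<^sub>R ?k)\<bar>)"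
  have le: "h x \<le> h (x + r *\<^sub>R ?k) + ?c" if r: "r \<in> {0..1}" for r
  proof -
    have "h x - h (x + r *\<^sub>R ?k) = - integral {0..r} (\<lambda>s. h' (x + s *\<^sub>R ?k))"
      using integral_unique[OF has_partial_ftc[OF h(2), of r x]] r by simp
    also have "\<dots> \<le> integral {0..r} (\<lambda>s. \<bar>h' (x + s *\<^sub>R ?k)\<bar>)"
      using integral_norm_bound_integral[of "\<lambda>s. h' (x + s *\<^sub>R ?k)" "{0..r}" "\<lambda>s. \<bar>h' (x + s *\<^sub>R ?k)\<bar>"]
        line_integrable[OF h(3)] line_integrable[OF pcont_abs[OF h(3)]] by simp
    also have "\<dots> \<le> ?c"
      using r by (intro integral_subset_le line_integrable pcont_abs h) auto
    finally show ?thesis by simp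
  qed
  have "h x = integral {0..1::real} (\<lambda>r. h x)" by simp
  also have "\<dots> \<le> integral {0..1} (\<lambda>r. h (x + r *\<^sub>R ?k) + ?c)"
    by (intro integral_le le integrable_add line_integrable h) auto
  also have "\<dots> = line_avg i (\<lambda>x. h x + \<bar>h' x\<bar>) x"
    unfolding line_avg_def
    using integral_add[OF line_integrable[OF h(1), where a = 0 and b = 1] integrable_const_ivl[of ?c 0 1]]
      integral_add[OF line_integrable[OF h(1), where a = 0 and b = 1]
        line_integrable[OF pcont_abs[OF h(3)], where a = 0 and b = 1]]
    by simp
  finally show ?thesis .
qed

text \<open>The function lies below each of N majorants, the i-th of which does not depend on the
  i-th coordinate; hence its power \<open>N / (N - 1)\<close> lies below the product that
  \<open>loomis_whitney\<close> integrates. The term of order zero on the right stands in for a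
  condition on the mean of \<open>h\<close>.\<close>

lemma gagliardo_nirenberg:
  fixes h :: "real ^ 'n::finite \<Rightarrow> real"
  assumes n: "CARD('n) \<ge> 2"
    and h: "pcont h" "\<And>x. 0 < h x" "\<And>i. has_partial i h (h' i)" "\<And>i. pcont (h' i)"
  defines "N \<equiv> real CARD('n)"
  shows "tint (\<lambda>x. h x powr (N / (N - 1)))
      \<le> (\<Prod>i\<in>UNIV. tint (\<lambda>x. h x + \<bar>h' i x\<bar>) powr (1 / (N - 1)))"
proof -
  define g where "g i = line_avg i (\<lambda>x. h x + \<bar>h' i x\<bar>)" for i
  have pc: "pcont (\<lambda>x. h x + \<bar>h' i x\<bar>)" for i by (intro pcont_add pcont_abs h)
  have g: "pcont (g i)" "0 < g i x" "inv_along i (g i)" "h x \<le> g i x" for i x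
    unfolding g_def
    by (auto intro!: pcont_line_avg line_avg_pos inv_along_line_avg le_line_avg pc h add_pos_nonneg)
  have N: "N \<ge> 2" using n by (simp add: N_def)
  have "tint (\<lambda>x. h x powr (N / (N - 1))) \<le> tint (\<lambda>x. \<Prod>i\<in>UNIV. g i x powr (1 / (N - 1)))"
  proof (rule tint_mono)
    fix x
    have "h x powr (N / (N - 1)) = (\<Prod>i\<in>(UNIV :: 'n set). h x powr (1 / (N - 1)))"
      using h(2)[of x] by (simp add: powr_powr N_def flip: powr_realpow)
    also have "\<dots> \<le> (\<Prod>i\<in>UNIV. g i x powr (1 / (N - 1)))"
      using g(4) h(2)[of x] N by (intro prod_mono) (auto intro!: powr_mono2 simp: less_imp_le)
    finally show "h x powr (N / (N - 1)) \<le> (\<Prod>i\<in>UNIV. g i x powr (1 / (N - 1)))" .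
  qed (intro pcont_powr pcont_prod h g)+
  also have "\<dots> \<le> (\<Prod>i\<in>UNIV. tint (g i) powr (1 / (N - 1)))"
    unfolding N_def by (intro loomis_whitney n g)
  also have "\<dots> = (\<Prod>i\<in>UNIV. tint (\<lambda>x. h x + \<bar>h' i x\<bar>) powr (1 / (N - 1)))"
    unfolding g_def using pc by (simp add: tint_line_avg)
  finally show ?thesis .
qed

text \<open>The previous inequality is applied to \<open>h = z powr S\<close> with
  \<open>z = w^2 + \<delta>\<close>. The exponent \<open>S\<close> makes
  \<open>h powr (N / (N - 1))\<close> equal to \<open>z powr q\<close>, so that Cauchy-Schwarz
  produces the left-hand side \<open>Y\<close> again on the right, with a power below 1, and
  \<open>Y\<close> can be solved for. The positive \<open>\<delta>\<close> keeps all real powers of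
  \<open>z\<close> smooth.\<close>

lemma sobolev:
  fixes w :: "real ^ 'n::finite \<Rightarrow> real"
  assumes n: "CARD('n) \<ge> 3" and \<delta>: "\<delta> > 0"
    and w: "pcont w" "\<And>i. has_partial i w (w' i)" "\<And>i. pcont (w' i)"
  defines "N \<equiv> real CARD('n)"
  shows "tint (\<lambda>x. ((w x)\<^sup>2 + \<delta>) powr (N / (N - 2)))
    \<le> (2 * (tint (\<lambda>x. (w x)\<^sup>2) + \<delta>) + 32 * (\<Sum>i\<in>UNIV. tint (\<lambda>x. (w' i x)\<^sup>2))) powr (N / (N - 2))"
proof -
  have N: "N \<ge> 3" using n by (simp add: N_def)
  define q S where "q = N / (N - 2)" and "S = (N - 1) / (N - 2)"
  define z where "z x = (w x)\<^sup>2 + \<delta>" for x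
  define h where "h x = z x powr S" for x
  define h' where "h' i x = S * z x powr (S - 1) * (2 * w x * w' i x)" for i x
  define W where "W = (\<Sum>i\<in>UNIV. tint (\<lambda>x. (w' i x)\<^sup>2))"
  define Y where "Y = tint (\<lambda>x. z x powr q)"
  define R where "R = 2 * (tint (\<lambda>x. (w x)\<^sup>2) + \<delta>) + 32 * W"
  have S: "1 < S" "S \<le> 2" "S - 1 = 1 / (N - 2)" using N by (auto simp: S_def field_simps)
  have exps: "S = q / 2 + 1 / 2" "S - 1 + 1 / 2 = q / 2"
    using N by (auto simp: S_def q_def field_simps)
  have exps': "S * (N / (N - 1)) = q"
    using N by (simp add: S_def q_def)
  have z0: "0 < z x" for x using \<delta> by (simp add: z_def add_nonneg_pos)
  have pz: "pcont z" unfolding z_def[abs_def] by (intro pcont_add pcont_power pcont_const w)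
  have tz: "tint z = tint (\<lambda>x. (w x)\<^sup>2) + \<delta>"
    unfolding z_def[abs_def] using w by (simp add: tint_add pcont_power)
  have hz: "has_partial i z (\<lambda>x. 2 * w x * w' i x)" for i
    using has_partial_add[OF has_partial_mult[OF w(2,2)] has_partial_const, of i \<delta>]
    by (simp add: z_def[abs_def] power2_eq_square algebra_simps)
  have ph: "pcont h" "0 < h x" for x
    using pcont_powr[OF pz z0] z0[of x] by (auto simp: h_def[abs_def])
  have hh: "has_partial i h (h' i)" for i
  proof -
    have "((\<lambda>y. y powr S) has_real_derivative S * z x powr (S - 1)) (at (z x))" for x
      by (rule has_real_derivative_powr[OF z0])
    from has_partial_chain[OF hz this] show ?thesis by (simp add: h_def[abs_def] h'_def[abs_def])
  qed
  have ph': "pcont (h' i)" for i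
    unfolding h'_def[abs_def] by (intro pcont_mult pcont_const pcont_powr pz z0 w)
  have W0: "0 \<le> tint (\<lambda>x. (w' i x)\<^sup>2)" for i by (intro tint_nonneg pcont_power w) auto
  have Wi: "tint (\<lambda>x. (w' i x)\<^sup>2) \<le> W" for i
    unfolding W_def by (rule member_le_sum) (auto simp: W0)
  have pq: "pcont (\<lambda>x. z x powr a)" for a by (intro pcont_powr pz z0)
  have Y: "0 < Y" unfolding Y_def using z0 by (intro tint_pos pq) (metis less_irrefl powr_gt_zero)
  have "W \<ge> 0" unfolding W_def by (intro sum_nonneg W0)
  moreover have "0 \<le> tint (\<lambda>x. (w x)\<^sup>2)" by (intro tint_nonneg pcont_power w) auto
  ultimately have R: "0 < R" using \<delta> by (simp add: R_def)
  have bound: "tint (\<lambda>x. h x + \<bar>h' i x\<bar>) \<le> (Y * R) powr (1 / 2)" for i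
  proof -
    \<comment> \<open>By \<open>S \<le> 2\<close>, which uses N \<ge> 3, and by |w| \<le> sqrt z,
      the derivative of \<open>h\<close> is at most \<open>?a\<close> times 4 |w'|. Squaring the sum
      in \<open>?b\<close> at the price of a factor 2 turns the 4 into the 32 of
      \<open>R\<close>.\<close>
    let ?a = "\<lambda>x. z x powr (q / 2)" and ?b = "\<lambda>x. z x powr (1 / 2) + 4 * \<bar>w' i x\<bar>"
    have pb: "pcont ?b" by (intro pcont_add pq pcont_mult pcont_abs w pcont_const)
    have "tint (\<lambda>x. h x + \<bar>h' i x\<bar>) \<le> tint (\<lambda>x. ?a x * ?b x)"
    proof (rule tint_mono)
      fix x
      have "\<bar>w x\<bar> \<le> z x powr (1 / 2)"
        using \<delta> by (simp add: powr_half_sqrt z_def real_le_rsqrt add_nonneg_pos less_imp_le)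
      then have "S * (z x powr (S - 1) * (\<bar>w x\<bar> * (2 * \<bar>w' i x\<bar>)))
          \<le> 2 * (z x powr (S - 1) * (z x powr (1 / 2) * (2 * \<bar>w' i x\<bar>)))"
        using S by (intro mult_mono) auto
      also have "\<dots> = ?a x * (4 * \<bar>w' i x\<bar>)"
        using powr_add[of "z x" "S - 1" "1 / 2"] unfolding exps(2) by simp
      finally have "\<bar>h' i x\<bar> \<le> ?a x * (4 * \<bar>w' i x\<bar>)"
        using S by (simp add: h'_def abs_mult mult_ac)
      moreover have "h x = ?a x * z x powr (1 / 2)"
        unfolding h_def exps(1) by (rule powr_add)
      ultimately show "h x + \<bar>h' i x\<bar> \<le> ?a x * ?b x"
        by (simp add: distrib_left)
    qed (intro pcont_add pcont_mult pcont_abs ph ph' pb pq)+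
    moreover have "(tint (\<lambda>x. ?a x * ?b x))\<^sup>2 \<le> Y * R"
    proof -
      have "(tint (\<lambda>x. ?a x * ?b x))\<^sup>2 \<le> tint (\<lambda>x. (?a x)\<^sup>2) * tint (\<lambda>x. (?b x)\<^sup>2)"
        by (rule tint_cauchy_schwarz[OF pq pb])
      also have "tint (\<lambda>x. (?a x)\<^sup>2) = Y"
        unfolding Y_def by (simp add: power2_eq_square flip: powr_add)
      also have "tint (\<lambda>x. (?b x)\<^sup>2) \<le> tint (\<lambda>x. 2 * z x + 32 * (w' i x)\<^sup>2)"
      proof (rule tint_mono)
        fix x
        have "(?b x)\<^sup>2 \<le> 2 * (z x powr (1 / 2))\<^sup>2 + 2 * (4 * \<bar>w' i x\<bar>)\<^sup>2"
          using zero_le_power2[of "z x powr (1 / 2) - 4 * \<bar>w' i x\<bar>"]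
          by (simp add: power2_eq_square algebra_simps)
        also have "(z x powr (1 / 2))\<^sup>2 = z x"
          using z0[of x] by (simp add: powr_half_sqrt)
        finally show "(?b x)\<^sup>2 \<le> 2 * z x + 32 * (w' i x)\<^sup>2" by (simp add: power_mult_distrib)
      qed (intro pcont_add pcont_mult pcont_power pcont_const w pz pb)+
      also have "\<dots> = 2 * (tint (\<lambda>x. (w x)\<^sup>2) + \<delta>) + 32 * tint (\<lambda>x. (w' i x)\<^sup>2)"
        using tint_add[of "\<lambda>x. 2 * z x" "\<lambda>x. 32 * (w' i x)\<^sup>2"] pz w
        by (simp add: tz pcont_mult pcont_power)
      also have "\<dots> \<le> R" using Wi[of i] by (simp add: R_def)
      finally show ?thesis using Y by (simp add: mult_left_mono)
    qed
    then have "tint (\<lambda>x. ?a x * ?b x) \<le> (Y * R) powr (1 / 2)"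
      using Y R by (simp add: powr_half_sqrt real_le_rsqrt)
    ultimately show ?thesis by linarith
  qed
  have "Y = tint (\<lambda>x. h x powr (N / (N - 1)))"
    unfolding Y_def h_def powr_powr exps' ..
  also have "\<dots> \<le> (\<Prod>i\<in>UNIV. tint (\<lambda>x. h x + \<bar>h' i x\<bar>) powr (1 / (N - 1)))"
    unfolding N_def by (rule gagliardo_nirenberg) (use n ph hh ph' in auto)
  also have "\<dots> \<le> (\<Prod>i\<in>(UNIV :: 'n set). ((Y * R) powr (1 / 2)) powr (1 / (N - 1)))"
    using bound N by (intro prod_mono conjI powr_mono2 tint_nonneg pcont_add pcont_abs ph ph') (auto simp: less_imp_le[OF ph(2)])
  also have "\<dots> = (Y * R) powr (N / (2 * (N - 1)))"
    using Y R by (simp add: powr_powr N_def flip: powr_realpow)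
  finally have YR: "Y \<le> (Y * R) powr (N / (2 * (N - 1)))" .
  \<comment> \<open>Logarithms turn the implicit bound into a linear inequality for
    \<open>ln Y\<close> whose net coefficient 2 (N - 1) - N = N - 2 is positive.\<close>
  have "ln Y \<le> ln ((Y * R) powr (N / (2 * (N - 1))))"
    using Y YR by (intro iffD2[OF ln_le_cancel_iff]) auto
  also have "\<dots> = N / (2 * (N - 1)) * (ln Y + ln R)"
    using Y R by (simp add: ln_powr ln_mult)
  finally have "2 * (N - 1) * ln Y \<le> N * (ln Y + ln R)"
    using N by (simp add: field_simps)
  then have "ln Y \<le> q * ln R"
    using N by (simp add: q_def field_simps)
  also have "\<dots> = ln (R powr q)" using R by (simp add: ln_powr)
  finally have "ln Y \<le> ln (R powr q)" .
  moreover have "0 < R powr q" using R by simp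
  ultimately have "Y \<le> R powr q" by (simp only: ln_le_cancel_iff[OF Y])
  then show ?thesis by (simp add: Y_def R_def W_def q_def z_def)
qed

text \<open>Hoelder's inequality with the conjugate exponents N / 2 and N / (N - 2), obtained from
  Young's inequality after dividing by \<open>M + 1\<close> and \<open>R\<close>. The Sobolev
  inequality bounds the second factor, and the Poincare inequality absorbs the integral of
  \<open>w^2\<close>, since \<open>w\<close> has mean zero. Normalising by \<open>M + 1\<close>
  instead of \<open>M\<close> avoids division by zero.\<close>

lemma weighted_sobolev:
  fixes w :: "real ^ 'n::finite \<Rightarrow> real"
  assumes n: "CARD('n) \<ge> 3"
    and w: "pcont w" "\<And>i. has_partial i w (w' i)" "\<And>i. pcont (w' i)" "tint w = 0"
    and r: "Lp_bounded (real CARD('n) / 2) M r" "\<And>x. 0 \<le> r x" "set_integrable lborel torus r"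
  shows "set_integrable lborel torus (\<lambda>x. r x * (w x)\<^sup>2)"
    and "(LINT x:torus|lborel. r x * (w x)\<^sup>2)
      \<le> (M + 1) * (2 ^ (CARD('n) + 1) + 32) * (\<Sum>i\<in>UNIV. tint (\<lambda>x. (w' i x)\<^sup>2))"
proof -
  define N where "N = real CARD('n)"
  have N: "N \<ge> 3" using n by (simp add: N_def)
  define p q where "p = N / 2" and "q = N / (N - 2)"
  have pq: "1 < p" "1 < q" "1 / p + 1 / q = 1" using N by (auto simp: p_def q_def field_simps)
  define W where "W = (\<Sum>i\<in>UNIV. tint (\<lambda>x. (w' i x)\<^sup>2))"
  define A where "A = (LINT x:torus|lborel. \<bar>r x\<bar> powr p)"
  have int_p: "set_integrable lborel torus (\<lambda>x. \<bar>r x\<bar> powr p)" and AM: "A powr (1 / p) \<le> M"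
    using r(1) by (auto simp: Lp_bounded_def A_def p_def N_def)
  have M: "0 \<le> M" using AM powr_ge_zero order_trans by blast
  have "0 \<le> A" unfolding A_def set_lebesgue_integral_def by (rule Bochner_Integration.integral_nonneg) auto
  then have "A = (A powr (1 / p)) powr p" using pq by (simp add: powr_powr)
  also have "\<dots> \<le> (M + 1) powr p" using AM pq M by (intro powr_mono2) auto
  finally have A: "A \<le> (M + 1) powr p" .
  have int_mult: "set_integrable lborel torus (\<lambda>x. r x * b x)" if b: "pcont b" for b
  proof -
    obtain B where B: "\<And>x. \<bar>b x\<bar> \<le> B" using pcont_bounded[OF b] by blast
    have m: "b \<in> borel_measurable lborel"
      using pcont_cont[OF b] by (simp add: borel_measurable_continuous_onI)
    have "integrable lborel (\<lambda>x. B * (indicator torus x *\<^sub>R r x))"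
      using r(3) by (simp add: set_integrable_def)
    then show ?thesis
      unfolding set_integrable_def
    proof (rule Bochner_Integration.integrable_bound)
      have "(\<lambda>x. (indicator torus x *\<^sub>R r x) * b x) \<in> borel_measurable lborel"
        using r(3) m unfolding set_integrable_def by (intro borel_measurable_times) auto
      then show "(\<lambda>x. indicator torus x *\<^sub>R (r x * b x)) \<in> borel_measurable lborel"
        by (simp add: mult.assoc)
      show "AE x in lborel. norm (indicator torus x *\<^sub>R (r x * b x)) \<le> norm (B * (indicator torus x *\<^sub>R r x))"
      proof (rule AE_I2)
        fix x
        have "\<bar>b x\<bar> \<le> \<bar>B\<bar>" using B[of x] by linarith
        then have "\<bar>r x\<bar> * \<bar>b x\<bar> \<le> \<bar>B\<bar> * \<bar>r x\<bar>" by (simp add: mult.commute mult_right_mono)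
        then show "norm (indicator torus x *\<^sub>R (r x * b x)) \<le> norm (B * (indicator torus x *\<^sub>R r x))"
          by (simp add: abs_mult indicator_def)
      qed
    qed
  qed
  show int_w: "set_integrable lborel torus (\<lambda>x. r x * (w x)\<^sup>2)"
    by (intro int_mult pcont_power w)
  have w2: "tint (\<lambda>x. (w x)\<^sup>2) \<le> 2 ^ CARD('n) * W"
    using poincare[of w w'] w by (simp add: W_def)
  have "(LINT x:torus|lborel. r x * (w x)\<^sup>2) \<le> (M + 1) * (2 ^ (CARD('n) + 1) + 32) * W + e"
    if e: "e > 0" for e
  proof -
    \<comment> \<open>The regularisation contributes \<open>2 * \<delta>\<close> to
      \<open>R\<close>, hence exactly \<open>e\<close> after multiplication by
      \<open>M + 1\<close>.\<close>
    define \<delta> where "\<delta> = e / (2 * (M + 1))"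
    have \<delta>: "\<delta> > 0" using e M by (simp add: \<delta>_def)
    define R where "R = 2 * (tint (\<lambda>x. (w x)\<^sup>2) + \<delta>) + 32 * W"
    define z where "z x = (w x)\<^sup>2 + \<delta>" for x
    have z0: "0 < z x" for x using \<delta> by (simp add: z_def add_nonneg_pos)
    have pz: "pcont z" unfolding z_def[abs_def] by (intro pcont_add pcont_power pcont_const w)
    have "W \<ge> 0" unfolding W_def by (intro sum_nonneg tint_nonneg pcont_power w) auto
    moreover have "0 \<le> tint (\<lambda>x. (w x)\<^sup>2)" by (intro tint_nonneg pcont_power w) auto
    ultimately have R: "0 < R" using \<delta> by (simp add: R_def)
    have pzq: "pcont (\<lambda>x. z x powr q)" by (intro pcont_powr pz z0)
    have Y: "tint (\<lambda>x. z x powr q) \<le> R powr q"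
      using sobolev[OF n \<delta> w(1-3)] by (simp add: z_def R_def W_def q_def N_def)
    have "(LINT x:torus|lborel. r x * (w x)\<^sup>2) \<le> (LINT x:torus|lborel. (M + 1) * R *
        (inverse (p * (M + 1) powr p) * \<bar>r x\<bar> powr p + inverse (q * R powr q) * z x powr q))"
    proof (rule set_integral_mono[OF int_w])
      show "set_integrable lborel torus (\<lambda>x. (M + 1) * R *
        (inverse (p * (M + 1) powr p) * \<bar>r x\<bar> powr p + inverse (q * R powr q) * z x powr q))"
        using int_p pcont_set_integrable(1)[OF pzq]
        by (intro set_integrable_mult_right set_integral_add)
      fix x
      have "r x * (w x)\<^sup>2 \<le> r x * z x"
        using r(2)[of x] \<delta> by (intro mult_left_mono) (auto simp: z_def)
      also have "r x * z x = (M + 1) * R * (\<bar>r x\<bar> / (M + 1) * (z x / R))"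
        using M R r(2)[of x] by simp
      also have "\<bar>r x\<bar> / (M + 1) * (z x / R) \<le> (\<bar>r x\<bar> / (M + 1)) powr p / p + (z x / R) powr q / q"
        using M R z0[of x] by (intro Youngs_inequality pq) auto
      also have "\<dots> = inverse (p * (M + 1) powr p) * \<bar>r x\<bar> powr p + inverse (q * R powr q) * z x powr q"
        using M R z0[of x] by (simp add: powr_divide field_simps)
      finally show "r x * (w x)\<^sup>2 \<le> (M + 1) * R *
        (inverse (p * (M + 1) powr p) * \<bar>r x\<bar> powr p + inverse (q * R powr q) * z x powr q)"
        using M R by (simp add: mult_left_mono)
    qed
    also have "\<dots> = (M + 1) * R * (inverse (p * (M + 1) powr p) * A
        + inverse (q * R powr q) * tint (\<lambda>x. z x powr q))"
      using int_p pcont_set_integrable[OF pzq]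
      by (subst set_integral_mult_right, subst set_integral_add)
        (auto simp: set_integral_mult_right A_def intro!: set_integrable_mult_right)
    also have "\<dots> \<le> (M + 1) * R * (inverse (p * (M + 1) powr p) * (M + 1) powr p
        + inverse (q * R powr q) * R powr q)"
      using A Y M R pq by (intro mult_left_mono add_mono) auto
    also have "\<dots> = (M + 1) * R * (1 / p + 1 / q)"
      using M R pq by (simp add: field_simps)
    also have "\<dots> = (M + 1) * R" using pq by simp
    also have "\<dots> \<le> (M + 1) * ((2 ^ (CARD('n) + 1) + 32) * W + 2 * \<delta>)"
      using w2 M by (intro mult_left_mono) (auto simp: R_def algebra_simps)
    also have "\<dots> = (M + 1) * (2 ^ (CARD('n) + 1) + 32) * W + e"
      using M by (simp add: \<delta>_def field_simps)
    finally show ?thesis .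
  qed
  then show "(LINT x:torus|lborel. r x * (w x)\<^sup>2) \<le> (M + 1) * (2 ^ (CARD('n) + 1) + 32) * (\<Sum>i\<in>UNIV. tint (\<lambda>x. (w' i x)\<^sup>2))"
    unfolding W_def by (rule field_le_epsilon)
qed

subsection \<open>Potentials of smooth approximations of the identity\<close>

definition conv :: "(real ^ 'n::finite \<Rightarrow> real) \<Rightarrow> (real ^ 'n \<Rightarrow> real) \<Rightarrow> real ^ 'n \<Rightarrow> real" where
  "conv G g x = tint (\<lambda>y. G (x - y) * g y)"

lemma continuous_on_conv_integrand:
  assumes "pcont G" "pcont g"
  shows "continuous_on S (\<lambda>(x, y). G (x - y) * g y)" "continuous_on S (\<lambda>(y, x). G (x - y) * g y)"
  unfolding case_prod_beta
  by (intro continuous_on_mult pcont_comp_cont[OF assms(1)] pcont_comp_cont[OF assms(2)] continuous_intros)+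

lemma pcont_conv:
  assumes "pcont G" "pcont g" shows "pcont (conv G g)"
proof -
  have "G (x + axis i 1 - y) = G (x - y)" for x i y
    using pcont_shift_minus[OF assms(1), of y] by (simp add: pcont_def torus_periodic_def)
  moreover have "continuous_on UNIV (conv G g)"
    unfolding conv_def[abs_def]
    by (rule tint_continuous_param) (rule continuous_on_conv_integrand[OF assms])
  ultimately show ?thesis by (simp add: pcont_def torus_periodic_def conv_def)
qed

text \<open>The derivative falls on the kernel, so \<open>g\<close> may be merely
  continuous.\<close>

lemma has_partial_conv:
  assumes G: "pcont G" "has_partial i G G'" "pcont G'" and g: "pcont g"
  shows "has_partial i (conv G g) (conv G' g)"
  unfolding has_partial_def
proof
  fix x
  have "((\<lambda>s. tint (\<lambda>y. G (x + s *\<^sub>R axis i 1 - y) * g y)) has_real_derivative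
      tint (\<lambda>y. G' (x + 0 *\<^sub>R axis i 1 - y) * g y)) (at 0)"
  proof (rule tint_derivative[where U = UNIV])
    show "((\<lambda>s. G (x + s *\<^sub>R axis i 1 - y) * g y) has_real_derivative
        G' (x + s *\<^sub>R axis i 1 - y) * g y) (at s)" for s y
      using has_partialD[OF G(2), of "x - y" s UNIV]
      by (auto intro!: derivative_eq_intros simp: algebra_simps)
    show "continuous_on UNIV (\<lambda>y. G (x + s *\<^sub>R axis i 1 - y) * g y)" for s
      by (intro pcont_cont pcont_mult pcont_reflect G g)
    show "continuous_on (UNIV \<times> UNIV) (\<lambda>(s, y). G' (x + s *\<^sub>R axis i 1 - y) * g y)"
      unfolding case_prod_beta
      by (intro continuous_on_mult pcont_comp_cont[OF G(3)] pcont_comp_cont[OF g] continuous_intros)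
  qed auto
  then show "((\<lambda>s. conv G g (x + s *\<^sub>R axis i 1)) has_real_derivative conv G' g x) (at 0)"
    by (simp add: conv_def)
qed

lemma tint_conv:
  assumes "pcont G" "pcont g" shows "tint (conv G g) = tint G * tint g"
proof -
  have "tint (conv G g) = tint (\<lambda>y. tint (\<lambda>x. G (x - y) * g y))"
    unfolding conv_def[abs_def] by (rule tint_swap) (rule continuous_on_conv_integrand[OF assms])
  also have "\<dots> = tint (\<lambda>y. tint G * g y)"
    using tint_shift[OF assms(1), of "- _"] by simp
  finally show ?thesis by simp
qed

lemma conv_diff_const: "pcont G \<Longrightarrow> pcont g \<Longrightarrow> conv G (\<lambda>y. g y - c) x = conv G g x - tint G * c"
  using tint_diff[of "\<lambda>y. G (x - y) * g y" "\<lambda>y. G (x - y) * c"] tint_reflect[of G x]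
  by (simp add: conv_def algebra_simps pcont_mult pcont_reflect)

lemma conv_diff_kernel: "pcont G \<Longrightarrow> pcont g \<Longrightarrow> conv (\<lambda>y. G y - c) g x = conv G g x - c * tint g"
  using tint_diff[of "\<lambda>y. G (x - y) * g y" "\<lambda>y. c * g y"]
  by (simp add: conv_def algebra_simps pcont_mult pcont_reflect)

lemma conv_sum_kernel:
  assumes "finite I" "\<And>i. i \<in> I \<Longrightarrow> pcont (G i)" "pcont g"
  shows "conv (\<lambda>y. \<Sum>i\<in>I. G i y) g x = (\<Sum>i\<in>I. conv (G i) g x)"
  using tint_sum[of I "\<lambda>i y. G i (x - y) * g y"] assms
  by (simp add: conv_def sum_distrib_right pcont_mult pcont_reflect)

text \<open>For fixed \<open>x\<close> the kernel is a probability density in \<open>y\<close>, and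
  the variance of \<open>g\<close> under it is nonnegative; integrating over \<open>x\<close>
  removes the kernel.\<close>

lemma conv_square_le:
  assumes K: "pcont K" "\<And>x. 0 \<le> K x" "tint K = 1" and g: "pcont g"
  shows "tint (\<lambda>x. (conv K g x)\<^sup>2) \<le> tint (\<lambda>x. (g x)\<^sup>2)"
proof -
  have "(conv K g x)\<^sup>2 \<le> conv K (\<lambda>y. (g y)\<^sup>2) x" for x
  proof -
    define c where "c = conv K g x"
    have pk: "pcont (\<lambda>y. K (x - y))" by (rule pcont_reflect[OF K(1)])
    have "0 \<le> tint (\<lambda>y. K (x - y) * (g y - c)\<^sup>2)"
      by (intro tint_nonneg pcont_mult pk pcont_power pcont_diff g pcont_const) (simp add: K)
    also have "\<dots> = tint (\<lambda>y. (K (x - y) * (g y)\<^sup>2 - 2 * c * (K (x - y) * g y)) + c\<^sup>2 * K (x - y))"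
      by (intro arg_cong[where f = tint]) (auto simp: power2_eq_square algebra_simps)
    also have "\<dots> = conv K (\<lambda>y. (g y)\<^sup>2) x - 2 * c * c + c\<^sup>2"
      using pk g tint_reflect[OF K(1), of x] K(3)
      by (simp add: tint_add tint_diff pcont_diff pcont_mult pcont_power conv_def c_def)
    finally show ?thesis by (simp add: c_def power2_eq_square)
  qed
  then have "tint (\<lambda>x. (conv K g x)\<^sup>2) \<le> tint (conv K (\<lambda>y. (g y)\<^sup>2))"
    by (intro tint_mono pcont_power pcont_conv K g)
  also have "\<dots> = tint (\<lambda>x. (g x)\<^sup>2)"
    using tint_conv[OF K(1) pcont_power[OF g]] K(3) by simp
  finally show ?thesis .
qed

text \<open>\<open>\<Phi>1\<close> and \<open>\<Phi>2\<close> are the gradient and the Hessian of a periodic solution \<open>\<Phi>\<close> of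
  \<open>\<Delta>\<Phi> = K - c\<close>.\<close>

definition potential ::
  "(real ^ 'n::finite \<Rightarrow> real) \<Rightarrow> real \<Rightarrow> ('n \<Rightarrow> real ^ 'n \<Rightarrow> real) \<Rightarrow> ('n \<Rightarrow> 'n \<Rightarrow> real ^ 'n \<Rightarrow> real) \<Rightarrow> bool"
where
  "potential K c \<Phi>1 \<Phi>2 \<longleftrightarrow>
     (\<exists>\<Phi>. pcont \<Phi> \<and> (\<forall>i. has_partial i \<Phi> (\<Phi>1 i))) \<and> (\<forall>i. pcont (\<Phi>1 i)) \<and>
     (\<forall>i j. has_partial j (\<Phi>1 i) (\<Phi>2 i j) \<and> pcont (\<Phi>2 i j) \<and> \<Phi>2 i j = \<Phi>2 j i) \<and>
     (\<forall>x. (\<Sum>i\<in>UNIV. \<Phi>2 i i x) = K x - c)"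

text \<open>Integer frequencies make the waves periodic. The class is closed under products, so it
  contains the powers of a bump, and yet the Laplacian can be inverted on it wave by wave.\<close>

inductive cosine_poly :: "(real ^ 'n::finite \<Rightarrow> real) \<Rightarrow> bool" where
  cosine: "(\<forall>i. \<xi> $ i \<in> \<int>) \<Longrightarrow> cosine_poly (\<lambda>x. cos (2 * pi * (\<xi> \<bullet> x)))"
| scale: "cosine_poly f \<Longrightarrow> cosine_poly (\<lambda>x. a * f x)"
| add: "cosine_poly f \<Longrightarrow> cosine_poly g \<Longrightarrow> cosine_poly (\<lambda>x. f x + g x)"

lemma cosine_poly_const: "cosine_poly (\<lambda>x. a)"
  using cosine_poly.scale[OF cosine_poly.cosine[of 0], of a] by simp

lemma cosine_poly_mult:
  assumes "cosine_poly f" "cosine_poly g" shows "cosine_poly (\<lambda>x. f x * g x)"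
  using assms(1)
proof induction
  case (cosine \<xi>)
  show ?case using assms(2)
  proof induction
    case (cosine \<eta>)
    have "cosine_poly (\<lambda>x. (1 / 2) * (cos (2 * pi * ((\<xi> - \<eta>) \<bullet> x)) + cos (2 * pi * ((\<xi> + \<eta>) \<bullet> x))))"
      using cosine \<open>\<forall>i. \<xi> $ i \<in> \<int>\<close> by (intro cosine_poly.intros) auto
    then show ?case
      unfolding cos_times_cos by (simp add: inner_diff_left inner_add_left right_diff_distrib distrib_left add_divide_distrib)
  next
    case (scale f a)
    from cosine_poly.scale[OF scale(2), of a] show ?case by (simp add: algebra_simps)
  next
    case (add f g)
    from cosine_poly.add[OF add(3,4)] show ?case by (simp add: algebra_simps)
  qed
next
  case (scale f a)
  from cosine_poly.scale[OF scale(2), of a] show ?case by (simp add: algebra_simps)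
next
  case (add f g)
  from cosine_poly.add[OF add(3,4)] show ?case by (simp add: algebra_simps)
qed

lemma cosine_poly_power: "cosine_poly f \<Longrightarrow> cosine_poly (\<lambda>x. f x ^ n)"
  by (induction n) (auto intro: cosine_poly_const cosine_poly_mult)

lemma cosine_poly_prod: "(\<And>i. i \<in> I \<Longrightarrow> cosine_poly (f i)) \<Longrightarrow> cosine_poly (\<lambda>x. \<Prod>i\<in>I. f i x)"
  by (induction I rule: infinite_finite_induct) (auto intro: cosine_poly_const cosine_poly_mult)

lemma pcont_wave:
  assumes "\<forall>i. \<xi> $ i \<in> \<int>"
  shows "pcont (\<lambda>x. cos (2 * pi * (\<xi> \<bullet> x)))" "pcont (\<lambda>x. sin (2 * pi * (\<xi> \<bullet> x)))"
proof -
  have shift: "\<exists>n :: int. 2 * pi * (\<xi> \<bullet> (x + axis i 1)) = 2 * pi * (\<xi> \<bullet> x) + 2 * pi * of_int n" for x i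
  proof -
    obtain n where "\<xi> $ i = of_int n" using assms Ints_cases by blast
    then have "2 * pi * (\<xi> \<bullet> (x + axis i 1)) = 2 * pi * (\<xi> \<bullet> x) + 2 * pi * of_int n"
      by (simp add: inner_add_right inner_axis algebra_simps)
    then show ?thesis ..
  qed
  have "cos (2 * pi * (\<xi> \<bullet> (x + axis i 1))) = cos (2 * pi * (\<xi> \<bullet> x)) \<and>
    sin (2 * pi * (\<xi> \<bullet> (x + axis i 1))) = sin (2 * pi * (\<xi> \<bullet> x))" for x i
  proof -
    obtain n :: int where n: "2 * pi * (\<xi> \<bullet> (x + axis i 1)) = 2 * pi * (\<xi> \<bullet> x) + 2 * pi * of_int n"
      using shift by blast
    show ?thesis
      unfolding n cos_add sin_add by simp
  qed
  then show "pcont (\<lambda>x. cos (2 * pi * (\<xi> \<bullet> x)))" "pcont (\<lambda>x. sin (2 * pi * (\<xi> \<bullet> x)))"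
    by (auto simp: pcont_def torus_periodic_def intro!: continuous_intros)
qed

lemma has_partial_wave:
  "has_partial i (\<lambda>x. a * cos (2 * pi * (\<xi> \<bullet> x))) (\<lambda>x. - (a * (2 * pi * \<xi> $ i)) * sin (2 * pi * (\<xi> \<bullet> x)))"
  "has_partial i (\<lambda>x. a * sin (2 * pi * (\<xi> \<bullet> x))) (\<lambda>x. a * (2 * pi * \<xi> $ i) * cos (2 * pi * (\<xi> \<bullet> x)))"
  by (auto simp: has_partial_def inner_add_right inner_axis intro!: derivative_eq_intros)

lemma cosine_poly_pcont: "cosine_poly f \<Longrightarrow> pcont f"
  by (induction rule: cosine_poly.induct) (auto intro: pcont_wave pcont_mult pcont_add)

text \<open>Each wave of nonzero frequency is an eigenfunction of the Laplacian with a nonzero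
  eigenvalue. Frequency zero is the only obstruction, and its coefficient is collected in the
  constant \<open>c\<close>.\<close>

lemma cosine_poly_potential:
  assumes "cosine_poly K" shows "\<exists>c \<Phi>1 \<Phi>2. potential K c \<Phi>1 \<Phi>2"
  using assms
proof induction
  case (cosine \<xi>)
  show ?case
  proof (cases "\<xi> = 0")
    case True
    then have "potential (\<lambda>x. cos (2 * pi * (\<xi> \<bullet> x))) 1 (\<lambda>i x. 0) (\<lambda>i j x. 0)"
      unfolding potential_def using pcont_const has_partial_const by (auto intro: exI[of _ "\<lambda>x. 0"])
    then show ?thesis by blast
  next
    case False
    \<comment> \<open>The reciprocal of the eigenvalue of the Laplacian on the wave of frequency
      \<open>\<xi>\<close>.\<close>
    define a where "a = - 1 / (4 * pi\<^sup>2 * (\<xi> \<bullet> \<xi>))"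
    define \<Phi>1 where "\<Phi>1 i = (\<lambda>x. - (a * (2 * pi * \<xi> $ i)) * sin (2 * pi * (\<xi> \<bullet> x)))" for i
    define \<Phi>2 where "\<Phi>2 i j = (\<lambda>x. - (a * (2 * pi * \<xi> $ i)) * (2 * pi * \<xi> $ j) * cos (2 * pi * (\<xi> \<bullet> x)))" for i j
    have "(\<Sum>i\<in>UNIV. \<Phi>2 i i x) = cos (2 * pi * (\<xi> \<bullet> x)) - 0" for x
    proof -
      have "(\<Sum>i\<in>UNIV. \<Phi>2 i i x) = - a * (4 * pi\<^sup>2) * (\<Sum>i\<in>UNIV. \<xi> $ i * \<xi> $ i) * cos (2 * pi * (\<xi> \<bullet> x))"
        by (simp add: \<Phi>2_def sum_distrib_left sum_distrib_right power2_eq_square sum_negf algebra_simps)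
      also have "(\<Sum>i\<in>UNIV. \<xi> $ i * \<xi> $ i) = \<xi> \<bullet> \<xi>" by (simp add: inner_vec_def)
      finally show ?thesis using False by (simp add: a_def)
    qed
    moreover have "pcont (\<lambda>x. a * cos (2 * pi * (\<xi> \<bullet> x)))" "pcont (\<Phi>1 i)" "pcont (\<Phi>2 i j)" for i j
      unfolding \<Phi>1_def \<Phi>2_def by (intro pcont_mult pcont_const pcont_wave[OF cosine])+
    moreover have "has_partial i (\<lambda>x. a * cos (2 * pi * (\<xi> \<bullet> x))) (\<Phi>1 i)" "has_partial j (\<Phi>1 i) (\<Phi>2 i j)"
        "\<Phi>2 i j = \<Phi>2 j i" for i j
      unfolding \<Phi>1_def \<Phi>2_def by (rule has_partial_wave, rule has_partial_wave, simp add: mult_ac)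
    ultimately have "potential (\<lambda>x. cos (2 * pi * (\<xi> \<bullet> x))) 0 \<Phi>1 \<Phi>2"
      unfolding potential_def by blast
    then show ?thesis by blast
  qed
next
  case (scale f a)
  then obtain c \<Phi>1 \<Phi>2 where P: "potential f c \<Phi>1 \<Phi>2" by blast
  then obtain \<Phi> where \<Phi>: "pcont \<Phi>" "\<forall>i. has_partial i \<Phi> (\<Phi>1 i)" by (auto simp: potential_def)
  have "potential (\<lambda>x. a * f x) (a * c) (\<lambda>i x. a * \<Phi>1 i x) (\<lambda>i j x. a * \<Phi>2 i j x)"
    using P \<Phi> unfolding potential_def
    by (auto intro!: exI[of _ "\<lambda>x. a * \<Phi> x"] has_partial_cmult pcont_mult
        simp: sum_distrib_left[symmetric] right_diff_distrib)
  then show ?case by blast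
next
  case (add f g)
  then obtain c \<Phi>1 \<Phi>2 d \<Psi>1 \<Psi>2 where P: "potential f c \<Phi>1 \<Phi>2" and R: "potential g d \<Psi>1 \<Psi>2" by blast
  then obtain \<Phi> \<Psi> where \<Phi>: "pcont \<Phi>" "\<forall>i. has_partial i \<Phi> (\<Phi>1 i)"
    and \<Psi>: "pcont \<Psi>" "\<forall>i. has_partial i \<Psi> (\<Psi>1 i)" by (auto simp: potential_def)
  have "potential (\<lambda>x. f x + g x) (c + d) (\<lambda>i x. \<Phi>1 i x + \<Psi>1 i x) (\<lambda>i j x. \<Phi>2 i j x + \<Psi>2 i j x)"
    using P R \<Phi> \<Psi> unfolding potential_def
    by (auto intro!: exI[of _ "\<lambda>x. \<Phi> x + \<Psi> x"] has_partial_add pcont_add simp: sum.distrib)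
  then show ?case by blast
qed

text \<open>Derivatives of periodic functions have mean zero; taking the mean of the trace of the
  Hessian therefore forces \<open>c\<close> to be the mean of \<open>K\<close>.\<close>

lemma potentialD:
  assumes P: "potential K c \<Phi>1 \<Phi>2" and K: "pcont K"
  shows "\<And>i. pcont (\<Phi>1 i)" "\<And>i j. pcont (\<Phi>2 i j)" "\<And>i j. has_partial j (\<Phi>1 i) (\<Phi>2 i j)"
    "\<And>i j. \<Phi>2 i j = \<Phi>2 j i" "\<And>x. (\<Sum>i\<in>UNIV. \<Phi>2 i i x) = K x - c" "c = tint K"
    "\<And>i. tint (\<Phi>1 i) = 0" "\<And>i j. tint (\<Phi>2 i j) = 0"
proof -
  show 1: "\<And>i. pcont (\<Phi>1 i)" "\<And>i j. pcont (\<Phi>2 i j)" "\<And>i j. has_partial j (\<Phi>1 i) (\<Phi>2 i j)"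
    "\<And>i j. \<Phi>2 i j = \<Phi>2 j i" "\<And>x. (\<Sum>i\<in>UNIV. \<Phi>2 i i x) = K x - c"
    using P unfolding potential_def by blast+
  show "tint (\<Phi>1 i) = 0" for i
    using P 1 tint_partial unfolding potential_def by blast
  show 2: "tint (\<Phi>2 i j) = 0" for i j
    using 1 tint_partial by blast
  have "0 = tint (\<lambda>x. \<Sum>i\<in>UNIV. \<Phi>2 i i x)" 
    using tint_sum[of UNIV "\<lambda>i. \<Phi>2 i i"] 1(2) 2 by simp
  also have "\<dots> = tint K - c" using K by (simp add: 1 tint_diff)
  finally show "c = tint K" by simp
qed

text \<open>The Hessian of the potential is bounded on \<open>L\<^sup>2\<close> because, by exchanging derivatives, the sum of
  the squared norms of its entries is the squared norm of the Laplacian.\<close>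

lemma conv_hessian_square_le:
  assumes K: "pcont K" "\<And>x. 0 \<le> K x" "tint K = 1" and P: "potential K c \<Phi>1 \<Phi>2" and g: "pcont g"
  shows "tint (\<lambda>x. (conv (\<Phi>2 i j) g x)\<^sup>2) \<le> tint (\<lambda>x. (g x)\<^sup>2)"
proof -
  note P = potentialD[OF P K(1)]
  let ?\<phi> = "\<lambda>i j. conv (\<Phi>2 i j) g"
  have p: "pcont (?\<phi> i j)" for i j by (intro pcont_conv P g)
  have hp: "has_partial j (conv (\<Phi>1 i) g) (?\<phi> i j)" for i j by (intro has_partial_conv P g)
  have nn: "0 \<le> tint (\<lambda>x. (?\<phi> i j x)\<^sup>2)" for i j by (intro tint_nonneg pcont_power p) auto
  have ex: "tint (\<lambda>x. (?\<phi> i j x)\<^sup>2) = tint (\<lambda>x. ?\<phi> i i x * ?\<phi> j j x)" for i j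
  proof -
    have "tint (\<lambda>x. (?\<phi> i j x)\<^sup>2) = tint (\<lambda>x. ?\<phi> i j x * ?\<phi> j i x)"
      using P(4)[of i j] by (simp add: power2_eq_square)
    also have "\<dots> = tint (\<lambda>x. ?\<phi> i i x * ?\<phi> j j x)"
      by (rule tint_partial_exchange[OF hp hp _ p p hp hp _ p p]) (intro pcont_conv P g)+
    finally show ?thesis .
  qed
  have "tint (\<lambda>x. (?\<phi> i j x)\<^sup>2) \<le> (\<Sum>j\<in>UNIV. tint (\<lambda>x. (?\<phi> i j x)\<^sup>2))"
    by (rule member_le_sum) (auto simp: nn)
  also have "\<dots> \<le> (\<Sum>i\<in>UNIV. \<Sum>j\<in>UNIV. tint (\<lambda>x. (?\<phi> i j x)\<^sup>2))"
    by (rule member_le_sum[of i UNIV "\<lambda>i. \<Sum>j\<in>UNIV. tint (\<lambda>x. (?\<phi> i j x)\<^sup>2)"]) (auto simp: nn sum_nonneg)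
  also have "\<dots> = tint (\<lambda>x. \<Sum>i\<in>UNIV. \<Sum>j\<in>UNIV. ?\<phi> i i x * ?\<phi> j j x)"
    unfolding ex by (simp add: tint_sum pcont_sum pcont_mult p)
  also have "\<dots> = tint (\<lambda>x. (\<Sum>i\<in>UNIV. ?\<phi> i i x)\<^sup>2)"
    by (simp add: power2_eq_square sum_product)
  also have "(\<lambda>x. \<Sum>i\<in>UNIV. ?\<phi> i i x) = (\<lambda>x. conv K g x - tint (conv K g))"
  proof
    fix x
    have "(\<Sum>i\<in>UNIV. ?\<phi> i i x) = conv (\<lambda>y. K y - c) g x"
      using conv_sum_kernel[of UNIV "\<lambda>i. \<Phi>2 i i" g x] P(2) g by (simp add: P(5))
    then show "(\<Sum>i\<in>UNIV. ?\<phi> i i x) = conv K g x - tint (conv K g)"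
      by (simp add: conv_diff_kernel K g P(6) tint_conv)
  qed
  also have "tint (\<lambda>x. (conv K g x - tint (conv K g))\<^sup>2) \<le> tint (\<lambda>x. (conv K g x)\<^sup>2)"
    using tint_variance[OF pcont_conv[OF K(1) g]] by simp
  also have "\<dots> \<le> tint (\<lambda>x. (g x)\<^sup>2)" by (rule conv_square_le[OF K g])
  finally show ?thesis .
qed

text \<open>A product of squares \<open>cos (pi * x $ i) ^ 2\<close>; its normalised powers are the
  de la Vallee Poussin kernels, a nonnegative approximate identity consisting of trigonometric
  polynomials.\<close>

definition bump :: "real ^ 'n::finite \<Rightarrow> real" where
  "bump x = (\<Prod>i\<in>UNIV. (1 + cos (2 * pi * x $ i)) / 2)"

lemma cosine_poly_bump: "cosine_poly bump"
proof -
  have "cosine_poly (\<lambda>x. (1 / 2) * (1 + cos (2 * pi * (axis i 1 \<bullet> x))))" for i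
    by (intro cosine_poly.intros cosine_poly_const) (simp add: axis_nth_if)
  from cosine_poly_prod[of UNIV, OF this] show ?thesis
    by (simp add: bump_def[abs_def] inner_axis' add_divide_distrib)
qed

lemma bump_factor: "0 \<le> (1 + cos (t :: real)) / 2 \<and> (1 + cos t) / 2 \<le> 1"
proof -
  define c where "c = cos t"
  have "- 1 \<le> c" "c \<le> 1" by (auto simp: c_def)
  then show ?thesis by (simp add: c_def[symmetric])
qed

lemma bump_bounds: "0 \<le> bump x" "bump x \<le> 1"
proof -
  have "0 \<le> (1 + cos (2 * pi * x $ i)) / 2 \<and> (1 + cos (2 * pi * x $ i)) / 2 \<le> 1" for i
    by (rule bump_factor)
  then show "0 \<le> bump x" "bump x \<le> 1"
    unfolding bump_def by (auto intro!: prod_nonneg prod_le_1)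
qed

lemma bump_eq_1:
  fixes x :: "real ^ 'n::finite"
  assumes "bump x = 1" shows "x $ i \<in> \<int>"
proof -
  let ?f = "\<lambda>i. (1 + cos (2 * pi * x $ i)) / 2"
  have f: "0 \<le> ?f i \<and> ?f i \<le> 1" for i
    by (rule bump_factor)
  have "bump x = ?f i * (\<Prod>j\<in>UNIV - {i}. ?f j)"
    unfolding bump_def by (rule prod.remove) auto
  also have "\<dots> \<le> ?f i * 1"
    using f by (intro mult_left_mono prod_le_1) auto
  finally have "1 \<le> cos (2 * pi * x $ i)" using assms by simp
  then have "cos (2 * pi * x $ i) = 1" using cos_le_one[of "2 * pi * x $ i"] by (rule antisym[rotated])
  then obtain n :: int where "2 * pi * x $ i = real_of_int n * 2 * pi" using cos_one_2pi_int by blast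
  then show ?thesis by simp
qed

text \<open>Laplace's method. Where \<open>h\<close> differs from \<open>h 0\<close> by at least
  \<open>e / 2\<close>, the bump is at most some \<open>\<theta> < 1\<close>, while its total mass
  decays no faster than \<open>\<eta> ^ n\<close> for an \<open>\<eta>\<close> between
  \<open>\<theta>\<close> and 1. The bad part contributes a multiple of
  \<open>(\<theta> / \<eta>) ^ n\<close>.\<close>

lemma bump_concentration:
  fixes h :: "real ^ 'n::finite \<Rightarrow> real"
  assumes h: "pcont h"
  shows "(\<lambda>n. tint (\<lambda>x. bump x ^ n * h x) / tint (\<lambda>x :: real ^ 'n. bump x ^ n)) \<longlonglongrightarrow> h 0"
proof -
  let ?w = "bump :: real ^ 'n \<Rightarrow> real"
  have pw: "pcont ?w" by (rule cosine_poly_pcont[OF cosine_poly_bump])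
  have w0: "?w 0 = 1" by (simp add: bump_def)
  have pos: "0 < tint (\<lambda>x. g x)" if g: "pcont g" "\<And>x. 0 \<le> g x" "0 < g 0" for g :: "real ^ 'n \<Rightarrow> real"
  proof -
    have "box (0 :: real ^ 'n) One \<noteq> {}" by (simp add: box_ne_empty inner_sum_left_Basis)
    then have "tint g \<noteq> 0"
      using integral_cbox_eq_0_iff[of 0 One g] g pcont_cont[OF g(1)] mem_torus[of 0]
      by (auto simp: torus_def)
    with tint_nonneg[OF g(1,2)] show ?thesis by simp
  qed
  have pwn: "pcont (\<lambda>x. ?w x ^ n)" for n by (intro pcont_power pw)
  have Z: "0 < tint (\<lambda>x. ?w x ^ n)" for n
    by (intro pos pwn) (auto simp: bump_bounds w0)
  obtain H where H: "H > 0" "\<And>x. \<bar>h x - h 0\<bar> \<le> H"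
    using pcont_bounded[OF pcont_diff[OF h pcont_const]] by blast
  show ?thesis
  proof (rule LIMSEQ_I)
    fix e :: real assume e: "e > 0"
    define D where "D = torus \<inter> {x. e / 2 \<le> \<bar>h x - h 0\<bar>}"
    have "closed {x. e / 2 \<le> \<bar>h x - h 0\<bar>}"
      by (intro closed_Collect_le continuous_intros pcont_cont[OF h])
    then have D: "compact D" unfolding D_def by (intro compact_Int_closed compact_torus)
    have "\<exists>\<theta>. 0 \<le> \<theta> \<and> \<theta> < 1 \<and> (\<forall>x\<in>D. ?w x \<le> \<theta>)"
    proof (cases "D = {}")
      case True then show ?thesis by (auto intro: exI[of _ 0])
    next
      case False
      then obtain y where y: "y \<in> D" "\<And>x. x \<in> D \<Longrightarrow> ?w x \<le> ?w y"
        using continuous_attains_sup[OF D False pcont_cont[OF pw]] by blast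
      \<comment> \<open>The bump equals 1 at every corner of the cube, not only at 0. Corners are
        integer points, so periodicity gives \<open>h y = h 0\<close> there and keeps them out of
        \<open>D\<close>.\<close>
      have "?w y \<noteq> 1"
      proof
        assume "?w y = 1"
        then have "\<forall>i. \<exists>n::int. y $ i = of_int n" using bump_eq_1 Ints_cases by metis
        then obtain n :: "'n \<Rightarrow> int" where "\<And>i. y $ i = of_int (n i)" by metis
        then have "y = 0 + (\<chi> i. of_int (n i))" by (simp add: vec_eq_iff)
        then have "h y = h 0"
          using torus_periodic_int_vec[of h 0 n] h by (simp add: pcont_def)
        with y(1) e show False by (simp add: D_def)
      qed
      with bump_bounds[of y] y show ?thesis by (intro exI[of _ "?w y"]) auto
    qed
    then obtain \<theta> where \<theta>: "0 \<le> \<theta>" "\<theta> < 1" "\<And>x. x \<in> D \<Longrightarrow> ?w x \<le> \<theta>" by blast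
    define \<eta> where "\<eta> = (1 + \<theta>) / 2"
    have \<eta>: "0 < \<eta>" "\<theta> < \<eta>" "\<eta> < 1" using \<theta> by (auto simp: \<eta>_def)
    \<comment> \<open>The positive part of the bump above level \<open>\<eta>\<close> is continuous,
      at most 1, and vanishes where the bump is below \<open>\<eta>\<close>; so
      \<open>\<eta> ^ n * \<beta>\<close> is a minorant of the n-th power with positive
      integral.\<close>
    define \<beta> where "\<beta> x = max 0 (?w x - \<eta>)" for x
    have p\<beta>: "pcont \<beta>" unfolding \<beta>_def[abs_def]
      by (rule pcont_compose[where H = "\<lambda>s. max 0 (s - \<eta>)", OF _ pw]) (intro continuous_intros)
    define b where "b = tint \<beta>"
    have b: "0 < b" unfolding b_def by (rule pos[OF p\<beta>]) (auto simp: \<beta>_def w0 \<eta>)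
    have lower: "\<eta> ^ n * b \<le> tint (\<lambda>x. ?w x ^ n)" for n
    proof -
      have "tint (\<lambda>x. \<eta> ^ n * \<beta> x) \<le> tint (\<lambda>x. ?w x ^ n)"
      proof (rule tint_mono)
        fix x
        show "\<eta> ^ n * \<beta> x \<le> ?w x ^ n"
        proof (cases "?w x \<le> \<eta>")
          case True then show ?thesis using bump_bounds[of x] by (simp add: \<beta>_def)
        next
          case False
          then have "\<eta> ^ n * \<beta> x \<le> ?w x ^ n * 1"
            using \<eta> bump_bounds[of x] by (intro mult_mono power_mono) (auto simp: \<beta>_def)
          then show ?thesis by simp
        qed
      qed (intro pcont_mult pcont_const p\<beta> pwn)+
      then show ?thesis by (simp add: b_def)
    qed
    have upper: "\<bar>tint (\<lambda>x. ?w x ^ n * h x) / tint (\<lambda>x. ?w x ^ n) - h 0\<bar> \<le> e / 2 + H / b * (\<theta> / \<eta>) ^ n" for n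
    proof -
      let ?Z = "tint (\<lambda>x. ?w x ^ n)"
      have pd: "pcont (\<lambda>x. h x - h 0)" by (intro pcont_diff h pcont_const)
      have "tint (\<lambda>x. ?w x ^ n * h x) / ?Z - h 0 = tint (\<lambda>x. ?w x ^ n * (h x - h 0)) / ?Z"
        using Z[of n] pwn[of n] h tint_diff[of "\<lambda>x. ?w x ^ n * h x" "\<lambda>x. ?w x ^ n * h 0"]
        by (simp add: field_simps pcont_mult)
      also have "\<bar>\<dots>\<bar> \<le> tint (\<lambda>x. e / 2 * ?w x ^ n + H * \<theta> ^ n) / ?Z"
      proof -
        have "\<bar>tint (\<lambda>x. ?w x ^ n * (h x - h 0))\<bar> \<le> tint (\<lambda>x. \<bar>?w x ^ n * (h x - h 0)\<bar>)"
          by (intro tint_abs pcont_mult pwn pd)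
        also have "\<dots> \<le> tint (\<lambda>x. e / 2 * ?w x ^ n + H * \<theta> ^ n)"
        proof (rule integral_le)
          fix x :: "real ^ 'n" assume x: "x \<in> torus"
          show "\<bar>?w x ^ n * (h x - h 0)\<bar> \<le> e / 2 * ?w x ^ n + H * \<theta> ^ n"
          proof (cases "x \<in> D")
            case True
            have "?w x ^ n * \<bar>h x - h 0\<bar> \<le> \<theta> ^ n * H"
              using \<theta>(3)[OF True] H(2)[of x] bump_bounds[of x] \<theta>(1)
              by (intro mult_mono power_mono) auto
            then show ?thesis using e bump_bounds[of x] by (simp add: abs_mult mult.commute add_increasing)
          next
            case False
            then have "?w x ^ n * \<bar>h x - h 0\<bar> \<le> ?w x ^ n * (e / 2)"
              using x bump_bounds[of x] by (intro mult_left_mono) (auto simp: D_def)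
            then show ?thesis using H(1) \<theta>(1) bump_bounds[of x] by (simp add: abs_mult mult.commute add_increasing2)
          qed
        qed (intro pcont_integrable pcont_abs pcont_mult pcont_add pcont_const pwn pd)+
        finally show ?thesis using Z[of n] by (simp add: divide_right_mono)
      qed
      also have "\<dots> = e / 2 + H * \<theta> ^ n / ?Z"
      proof -
        have "tint (\<lambda>x. e / 2 * ?w x ^ n + H * \<theta> ^ n) = e / 2 * ?Z + H * \<theta> ^ n"
          using tint_add[OF pcont_mult[OF pcont_const pwn] pcont_const, of "e / 2" n "H * \<theta> ^ n"]
          by simp
        then show ?thesis using Z[of n] by (simp add: add_divide_distrib)
      qed
      also have "H * \<theta> ^ n / ?Z \<le> H * \<theta> ^ n / (\<eta> ^ n * b)"
        using lower[of n] \<eta> b H(1) \<theta>(1) Z[of n] by (intro divide_left_mono) auto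
      also have "\<dots> = H / b * (\<theta> / \<eta>) ^ n" by (simp add: power_divide)
      finally show ?thesis by simp
    qed
    have "(\<lambda>n. H / b * (\<theta> / \<eta>) ^ n) \<longlonglongrightarrow> H / b * 0"
      using \<eta> \<theta> by (intro tendsto_mult tendsto_const LIMSEQ_realpow_zero) auto
    then have "eventually (\<lambda>n. H / b * (\<theta> / \<eta>) ^ n < e / 2) sequentially"
      using e by (intro order_tendstoD(2)) auto
    then obtain n0 where n0: "\<And>n. n \<ge> n0 \<Longrightarrow> H / b * (\<theta> / \<eta>) ^ n < e / 2"
      by (auto simp: eventually_sequentially)
    have "norm (tint (\<lambda>x. ?w x ^ n * h x) / tint (\<lambda>x. ?w x ^ n) - h 0) < e" if "n0 \<le> n" for n
      using n0[OF that] upper[of n] unfolding real_norm_def by linarith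
    then show "\<exists>n0. \<forall>n\<ge>n0. norm (tint (\<lambda>x. ?w x ^ n * h x) / tint (\<lambda>x. ?w x ^ n) - h 0) < e"
      by blast
  qed
qed

text \<open>Tested with \<open>q\<close>, the convolution becomes the integral of \<open>K n\<close>
  against the correlation \<open>h\<close> of \<open>q\<close> and \<open>g\<close>. This is a
  continuous periodic function, so concentration at the single point 0 suffices, and
  \<open>h 0\<close> is the desired limit. Normalising \<open>K n\<close> to mean 1 makes the
  constant of its potential 1.\<close>

lemma approximate_identity_potentials:
  obtains K :: "nat \<Rightarrow> real ^ 'n::finite \<Rightarrow> real" and \<Phi>1 \<Phi>2
  where "\<And>n. pcont (K n)" "\<And>n x. 0 \<le> K n x" "\<And>n. tint (K n) = 1"
    "\<And>n. potential (K n) 1 (\<Phi>1 n) (\<Phi>2 n)"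
    "\<And>q g. pcont q \<Longrightarrow> pcont g \<Longrightarrow>
      (\<lambda>n. tint (\<lambda>x. q x * conv (K n) g x)) \<longlonglongrightarrow> tint (\<lambda>x. q x * g x)"
proof -
  define Z :: "nat \<Rightarrow> real" where "Z n = tint (\<lambda>x :: real ^ 'n. bump x ^ n)" for n
  define K :: "nat \<Rightarrow> real ^ 'n \<Rightarrow> real" where "K n x = (1 / Z n) * bump x ^ n" for n x
  have cK: "cosine_poly (K n)" for n
    unfolding K_def[abs_def] by (intro cosine_poly.scale cosine_poly_power cosine_poly_bump)
  have pK: "pcont (K n)" for n by (rule cosine_poly_pcont[OF cK])
  have pb: "pcont (\<lambda>x :: real ^ 'n. bump x ^ n)" for n
    by (intro pcont_power cosine_poly_pcont cosine_poly_bump)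
  have Z: "0 < Z n" for n
  proof -
    have "Z n \<noteq> 0"
    proof
      assume Z0: "Z n = 0"
      have "box (0 :: real ^ 'n) One \<noteq> {}" by (simp add: box_ne_empty inner_sum_left_Basis)
      then have "\<forall>x\<in>cbox 0 (One :: real ^ 'n). bump x ^ n = 0"
        using Z0 integral_cbox_eq_0_iff[of 0 One "\<lambda>x :: real ^ 'n. bump x ^ n"] pcont_cont[OF pb, of _ n]
        by (simp add: Z_def torus_def bump_bounds)
      moreover have "(0 :: real ^ 'n) \<in> cbox 0 One" using mem_torus[of 0] by (simp add: torus_def)
      ultimately have "bump (0 :: real ^ 'n) ^ n = 0" by blast
      then show False by (simp add: bump_def)
    qed
    moreover have "0 \<le> Z n" unfolding Z_def by (intro tint_nonneg pb) (simp add: bump_bounds)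
    ultimately show ?thesis by simp
  qed
  have K0: "0 \<le> K n x" for n x using Z[of n] bump_bounds[of x] by (simp add: K_def)
  have tK: "tint (K n) = 1" for n unfolding K_def[abs_def] using Z[of n] by (simp add: Z_def)
  have "\<exists>\<Phi>1 \<Phi>2. potential (K n) 1 \<Phi>1 \<Phi>2" for n
    using cosine_poly_potential[OF cK, of n] potentialD(6)[OF _ pK, of n] tK[of n] by metis
  then obtain \<Phi>1 \<Phi>2 where P: "\<And>n. potential (K n) 1 (\<Phi>1 n) (\<Phi>2 n)" by metis
  have conv: "(\<lambda>n. tint (\<lambda>x. q x * conv (K n) g x)) \<longlonglongrightarrow> tint (\<lambda>x. q x * g x)"
    if q: "pcont q" and g: "pcont g" for q g
  proof -
    define h where "h y = tint (\<lambda>x. q x * g (x - y))" for y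
    have ph: "pcont h"
    proof -
      have "g (x - (y + axis i 1)) = g (x - y)" for x y i
        using pcont_reflect[OF g, of x] by (simp add: pcont_def torus_periodic_def)
      moreover have "continuous_on UNIV h"
        unfolding h_def[abs_def]
        by (rule tint_continuous_param) (unfold case_prod_beta,
            intro continuous_on_mult pcont_comp_cont[OF q] pcont_comp_cont[OF g] continuous_intros)
      ultimately show ?thesis by (simp add: pcont_def torus_periodic_def h_def)
    qed
    have "tint (\<lambda>x. q x * conv (K n) g x) = tint (\<lambda>x. bump x ^ n * h x) / tint (\<lambda>x :: real ^ 'n. bump x ^ n)" for n
    proof -
      have "conv (K n) g x = tint (\<lambda>y. K n y * g (x - y))" for x
        using tint_reflect[of "\<lambda>y. K n (x - y) * g y" x]
        by (simp add: conv_def pcont_mult pcont_reflect pK g)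
      then have "tint (\<lambda>x. q x * conv (K n) g x) = tint (\<lambda>x. tint (\<lambda>y. K n y * (q x * g (x - y))))"
        by (simp add: mult.left_commute flip: integral_mult_right)
      also have "\<dots> = tint (\<lambda>y. tint (\<lambda>x. K n y * (q x * g (x - y))))"
        by (rule tint_swap, unfold case_prod_beta)
          (intro continuous_on_mult pcont_comp_cont[OF q] pcont_comp_cont[OF g] pcont_comp_cont[OF pK] continuous_intros)
      also have "\<dots> = tint (\<lambda>y. 1 / Z n * (bump y ^ n * h y))"
        by (simp add: h_def K_def mult.assoc)
      also have "\<dots> = 1 / Z n * tint (\<lambda>y. bump y ^ n * h y)"
        by (rule integral_mult_right)
      finally show ?thesis by (simp add: Z_def)
    qed
    with bump_concentration[OF ph] show ?thesis by (simp add: h_def)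
  qed
  from that[OF pK K0 tK P conv] show thesis .
qed

subsection \<open>Energy balance of the fluid\<close>

text \<open>Joint continuity in time and space. The unknowns satisfy it for
  \<open>S = {0..}\<close>, their derivatives only for \<open>S = {0<..}\<close>.\<close>

definition tcont :: "real set \<Rightarrow> (real \<Rightarrow> real ^ 'n::finite \<Rightarrow> real) \<Rightarrow> bool" where
  "tcont S F \<longleftrightarrow> continuous_on (S \<times> UNIV) (\<lambda>(t, x). F t x) \<and> (\<forall>t\<in>S. torus_periodic (F t))"

lemma tcont_const: "tcont S (\<lambda>t x. c)"
  and tcont_add: "tcont S F \<Longrightarrow> tcont S G \<Longrightarrow> tcont S (\<lambda>t x. F t x + G t x)"
  and tcont_diff: "tcont S F \<Longrightarrow> tcont S G \<Longrightarrow> tcont S (\<lambda>t x. F t x - G t x)"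
  and tcont_mult: "tcont S F \<Longrightarrow> tcont S G \<Longrightarrow> tcont S (\<lambda>t x. F t x * G t x)"
  and tcont_minus: "tcont S F \<Longrightarrow> tcont S (\<lambda>t x. - F t x)"
  and tcont_power: "tcont S F \<Longrightarrow> tcont S (\<lambda>t x. F t x ^ k)"
  by (auto simp: tcont_def torus_periodic_def case_prod_beta intro!: continuous_intros)

lemma tcont_sum: "(\<And>i. i \<in> I \<Longrightarrow> tcont S (F i)) \<Longrightarrow> tcont S (\<lambda>t x. \<Sum>i\<in>I. F i t x)"
  by (auto simp: tcont_def torus_periodic_def case_prod_beta intro!: continuous_intros)

lemma tcont_powr:
  "tcont S F \<Longrightarrow> (\<And>t x. t \<in> S \<Longrightarrow> 0 \<le> F t x) \<Longrightarrow> 0 < a \<Longrightarrow> tcont S (\<lambda>t x. F t x powr a)"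
  unfolding tcont_def torus_periodic_def case_prod_beta
  by (intro conjI continuous_on_powr' continuous_on_const) auto

lemma tcont_subset: "tcont S F \<Longrightarrow> T \<subseteq> S \<Longrightarrow> tcont T F"
  by (auto simp: tcont_def elim!: continuous_on_subset)

lemma tcont_cong: "tcont S F \<Longrightarrow> (\<And>t x. t \<in> S \<Longrightarrow> G t x = F t x) \<Longrightarrow> tcont S G"
proof -
  assume "tcont S F" and eq: "\<And>t x. t \<in> S \<Longrightarrow> G t x = F t x"
  moreover have "continuous_on (S \<times> UNIV) (\<lambda>(t, x). G t x) \<longleftrightarrow> continuous_on (S \<times> UNIV) (\<lambda>(t, x). F t x)"
    by (rule continuous_on_cong) (auto simp: eq)
  ultimately show ?thesis by (simp add: tcont_def torus_periodic_def)
qed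

lemma continuous_on_tcont_compose:
  assumes "tcont S F" "continuous_on A h" "continuous_on A k" "\<And>z. z \<in> A \<Longrightarrow> h z \<in> S"
  shows "continuous_on A (\<lambda>z. F (h z) (k z))"
proof -
  have "continuous_on (S \<times> UNIV) (\<lambda>q. F (fst q) (snd q))"
    using assms(1) by (simp add: tcont_def case_prod_beta)
  from continuous_on_compose2[OF this continuous_on_Pair[OF assms(2,3)]] assms(4)
  show ?thesis by (simp add: image_subset_iff)
qed

lemma tcont_pcont: "tcont S F \<Longrightarrow> t \<in> S \<Longrightarrow> pcont (F t)"
  using continuous_on_tcont_compose[of S F UNIV "\<lambda>x. t" "\<lambda>x. x"]
  by (simp add: pcont_def tcont_def)

lemma tcont_tint: "tcont S F \<Longrightarrow> continuous_on S (\<lambda>t. tint (F t))"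
  by (rule tint_continuous_param) (simp add: tcont_def)

lemma tcont_conv:
  assumes G: "pcont G" and F: "tcont S F"
  shows "tcont S (\<lambda>t. conv G (F t))"
proof -
  have "continuous_on ((S \<times> UNIV) \<times> UNIV) (\<lambda>(p, y). G (snd p - y) * (\<lambda>(t, x). F t x) (fst p, y))"
    unfolding case_prod_beta fst_conv snd_conv
    by (intro continuous_on_mult pcont_comp_cont[OF G] continuous_on_tcont_compose[OF F] continuous_intros) auto
  then have "continuous_on (S \<times> UNIV) (\<lambda>p. tint (\<lambda>y. G (snd p - y) * F (fst p) y))"
    by (intro tint_continuous_param) (simp add: case_prod_beta)
  moreover have "torus_periodic (conv G (F t))" if "t \<in> S" for t
    using pcont_conv[OF G tcont_pcont[OF F that]] by (simp add: pcont_def)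
  ultimately show ?thesis by (simp add: tcont_def conv_def case_prod_beta)
qed

definition has_time_deriv ::
  "(real \<Rightarrow> real ^ 'n::finite \<Rightarrow> real) \<Rightarrow> (real \<Rightarrow> real ^ 'n \<Rightarrow> real) \<Rightarrow> bool" where
  "has_time_deriv F F' \<longleftrightarrow> (\<forall>t>0. \<forall>x. ((\<lambda>s. F s x) has_real_derivative F' t x) (at t))"

lemma tint_time_deriv:
  assumes "has_time_deriv F F'" "tcont {0<..} F" "tcont {0<..} F'" "t > 0"
  shows "((\<lambda>s. tint (F s)) has_real_derivative tint (F' t)) (at t)"
proof (rule tint_derivative[where U = "{0<..}"])
  show "continuous_on UNIV (F s)" if "s \<in> {0<..}" for s
    using tcont_pcont[OF assms(2) that] by (simp add: pcont_def)
qed (use assms in \<open>auto simp: has_time_deriv_def tcont_def\<close>)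

text \<open>For exponents above 1 the power, continued by 0 to negative arguments, is differentiable
  on the whole line, also at 0. This makes the chain rule for the pressure applicable at points of
  vacuum.\<close>

lemma max_0_powr_derivative:
  fixes a :: real
  assumes a: "a > 1"
  shows "((\<lambda>s. max 0 s powr a) has_real_derivative a * max 0 s powr (a - 1)) (at s)"
proof -
  consider "s > 0" | "s < 0" | "s = 0" by linarith
  then show ?thesis
  proof cases
    case 1
    have "((\<lambda>s. s powr a) has_real_derivative a * s powr (a - 1)) (at s)"
      by (rule has_real_derivative_powr[OF 1])
    then have "((\<lambda>s. max 0 s powr a) has_real_derivative a * s powr (a - 1)) (at s)"
      by (rule has_field_derivative_transform_within_open[where S = "{0<..}"]) (use 1 in auto)
    then show ?thesis using 1 by simp
  next
    case 2
    have "((\<lambda>s. max 0 s powr a) has_real_derivative 0) (at s)"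
      by (rule has_field_derivative_transform_within_open[where S = "{..<0}" and f = "\<lambda>s. 0"])
        (use 2 a in auto)
    then show ?thesis using 2 a by simp
  next
    case 3
    have "((\<lambda>h. \<bar>h\<bar> powr (a - 1)) \<longlongrightarrow> \<bar>0\<bar> powr (a - 1)) (at (0 :: real))"
      using a by (intro tendsto_powr' tendsto_rabs tendsto_ident_at tendsto_const) auto
    then have lim: "((\<lambda>h. \<bar>h\<bar> powr (a - 1)) \<longlongrightarrow> 0) (at (0 :: real))" using a by simp
    have "((\<lambda>h. (max 0 (0 + h) powr a - max 0 0 powr a) / h) \<longlongrightarrow> 0) (at 0)"
    proof (rule Lim_null_comparison[OF _ lim])
      have "norm ((max 0 (0 + h) powr a - max 0 0 powr a) / h) \<le> \<bar>h\<bar> powr (a - 1)" if "h \<noteq> 0" for h :: real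
        
      proof (cases "h > 0")
        case False
        then show ?thesis using that by simp
      qed (use that a in \<open>simp add: powr_diff\<close>)
      then show "\<forall>\<^sub>F h in at 0. norm ((max 0 (0 + h) powr a - max 0 0 powr a) / h) \<le> \<bar>h\<bar> powr (a - 1)"
        by (auto simp: eventually_at_filter)
    qed
    then show ?thesis using 3 a by (simp add: DERIV_def)
  qed
qed

text \<open>\<open>u i\<close> is the \<open>i\<close>-th component of the velocity, \<open>ux i j\<close> and \<open>uxx i j k\<close> are its derivatives
  \<open>\<partial>\<^sub>j u\<^sub>i\<close> and \<open>\<partial>\<^sub>k \<partial>\<^sub>j u\<^sub>i\<close>, and \<open>F\<close> is the drag force exerted on the particles. The momentum equation
  is in non-conservative form.\<close>

locale fluid_flow =
  fixes \<gamma> \<mu> lam :: real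
    and \<rho> \<rho>t :: "real \<Rightarrow> real ^ 'n::finite \<Rightarrow> real"
    and \<rho>x u ut F :: "'n \<Rightarrow> real \<Rightarrow> real ^ 'n \<Rightarrow> real"
    and ux :: "'n \<Rightarrow> 'n \<Rightarrow> real \<Rightarrow> real ^ 'n \<Rightarrow> real"
    and uxx :: "'n \<Rightarrow> 'n \<Rightarrow> 'n \<Rightarrow> real \<Rightarrow> real ^ 'n \<Rightarrow> real"
  assumes \<gamma>: "\<gamma> > 1" and \<mu>: "\<mu> > 0" and lam: "2 * \<mu> + lam > 0"
    and tcont_\<rho>: "tcont {0..} \<rho>" and tcont_u: "tcont {0..} (u i)"
    and tcont_\<rho>t: "tcont {0<..} \<rho>t" and tcont_ut: "tcont {0<..} (ut i)"
    and tcont_\<rho>x: "tcont {0<..} (\<rho>x i)" and tcont_ux: "tcont {0<..} (ux i j)"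
    and tcont_uxx: "tcont {0<..} (uxx i j k)"
    and deriv_\<rho>: "has_time_deriv \<rho> \<rho>t" and deriv_u: "has_time_deriv (u i) (ut i)"
    and partial_\<rho>: "t > 0 \<Longrightarrow> has_partial i (\<rho> t) (\<rho>x i t)"
    and partial_u: "t > 0 \<Longrightarrow> has_partial j (u i t) (ux i j t)"
    and partial_ux: "t > 0 \<Longrightarrow> has_partial k (ux i j t) (uxx i j k t)"
    and \<rho>_nonneg: "t \<ge> 0 \<Longrightarrow> 0 \<le> \<rho> t x"
    and mass_eq: "t > 0 \<Longrightarrow> \<rho>t t x = - (\<Sum>j\<in>UNIV. \<rho>x j t x * u j t x + \<rho> t x * ux j j t x)"
    and momentum_eq: "t > 0 \<Longrightarrow> \<rho> t x * ut i t x =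
      - \<rho> t x * (\<Sum>j\<in>UNIV. u j t x * ux i j t x) - \<gamma> * \<rho> t x powr (\<gamma> - 1) * \<rho>x i t x
      + \<mu> * (\<Sum>j\<in>UNIV. uxx i j j t x) + (\<mu> + lam) * (\<Sum>j\<in>UNIV. uxx j j i t x) - F i t x"
begin

definition p where "p t x = \<rho> t x powr \<gamma>"
definition px where "px i t x = \<gamma> * \<rho> t x powr (\<gamma> - 1) * \<rho>x i t x"
definition divu where "divu t x = (\<Sum>i\<in>UNIV. ux i i t x)"

lemma tcont_pos: "tcont {0<..} \<rho>" "tcont {0<..} (u i)"
  by (rule tcont_subset[OF tcont_\<rho>] tcont_subset[OF tcont_u]; auto)+

lemma tcont_p: "tcont {0..} p" "tcont {0<..} p"
  and tcont_px: "tcont {0<..} (px i)" and tcont_divu: "tcont {0<..} divu"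
  unfolding p_def[abs_def] px_def[abs_def] divu_def[abs_def]
  using \<gamma> \<rho>_nonneg
  by (auto intro!: tcont_powr tcont_mult tcont_const tcont_sum tcont_\<rho> tcont_pos tcont_\<rho>x tcont_ux)

text \<open>The drag is an integral over all velocities, and its continuity is not among the
  assumptions; the momentum equation expresses it by continuous functions.\<close>

lemma tcont_F: "tcont {0<..} (F i)"
proof (rule tcont_cong)
  show "tcont {0<..} (\<lambda>t x. - \<rho> t x * (\<Sum>j\<in>UNIV. u j t x * ux i j t x) - px i t x
      + \<mu> * (\<Sum>j\<in>UNIV. uxx i j j t x) + (\<mu> + lam) * (\<Sum>j\<in>UNIV. uxx j j i t x) - \<rho> t x * ut i t x)"
    by (intro tcont_diff tcont_add tcont_mult tcont_minus tcont_sum tcont_const tcont_pos tcont_px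
        tcont_ux tcont_uxx tcont_ut)
qed (use momentum_eq in \<open>auto simp: px_def\<close>)

lemmas tconts = tcont_\<rho> tcont_u tcont_pos tcont_\<rho>t tcont_ut tcont_\<rho>x tcont_ux tcont_uxx
  tcont_p tcont_px tcont_divu tcont_F

lemma pconts:
  assumes "t > 0"
  shows "pcont (\<rho> t)" "pcont (u i t)" "pcont (\<rho>t t)" "pcont (ut i t)" "pcont (\<rho>x i t)"
    "pcont (ux i j t)" "pcont (uxx i j k t)" "pcont (p t)" "pcont (px i t)" "pcont (divu t)" "pcont (F i t)"
  using assms by (auto intro: tcont_pcont tconts)

lemma p_max: "t \<ge> 0 \<Longrightarrow> p t x = max 0 (\<rho> t x) powr \<gamma>"
  using \<rho>_nonneg[of t x] by (simp add: p_def)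

lemma partial_p:
  assumes "t > 0" shows "has_partial i (p t) (px i t)"
proof -
  have "has_partial i (\<lambda>x. max 0 (\<rho> t x) powr \<gamma>) (\<lambda>x. \<gamma> * max 0 (\<rho> t x) powr (\<gamma> - 1) * \<rho>x i t x)"
    by (rule has_partial_chain[OF partial_\<rho>[OF assms] max_0_powr_derivative[OF \<gamma>]])
  moreover have "(\<lambda>x. max 0 (\<rho> t x) powr \<gamma>) = p t"
    using assms by (auto simp: p_max)
  moreover have "(\<lambda>x. \<gamma> * max 0 (\<rho> t x) powr (\<gamma> - 1) * \<rho>x i t x) = px i t"
    using assms \<rho>_nonneg[of t] by (auto simp: px_def)
  ultimately show ?thesis by simp
qed

lemma deriv_p: "has_time_deriv p (\<lambda>t x. \<gamma> * \<rho> t x powr (\<gamma> - 1) * \<rho>t t x)"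
  unfolding has_time_deriv_def
proof (intro allI impI)
  fix t :: real and x assume t: "t > 0"
  have "((\<lambda>s. max 0 (\<rho> s x) powr \<gamma>) has_real_derivative \<gamma> * max 0 (\<rho> t x) powr (\<gamma> - 1) * \<rho>t t x) (at t)"
    using deriv_\<rho> t by (intro DERIV_chain2[OF max_0_powr_derivative[OF \<gamma>]]) (auto simp: has_time_deriv_def)
  then have "(((\<lambda>s. max 0 (\<rho> s x) powr \<gamma>) has_real_derivative \<gamma> * \<rho> t x powr (\<gamma> - 1) * \<rho>t t x)) (at t)"
    using t \<rho>_nonneg[of t x] by simp
  then show "((\<lambda>s. p s x) has_real_derivative \<gamma> * \<rho> t x powr (\<gamma> - 1) * \<rho>t t x) (at t)"
    by (rule has_field_derivative_transform_within_open[where S = "{0<..}"]) (use t p_max in auto)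
qed

lemma \<rho>_powr: "t \<ge> 0 \<Longrightarrow> \<rho> t x powr (\<gamma> - 1) * \<rho> t x = p t x"
  using \<rho>_nonneg[of t x] by (cases "\<rho> t x = 0") (auto simp: p_def powr_diff)

lemma partial_divu: "t > 0 \<Longrightarrow> has_partial i (divu t) (\<lambda>x. \<Sum>j\<in>UNIV. uxx j j i t x)"
  unfolding divu_def[abs_def] by (intro has_partial_sum partial_ux)

text \<open>Balance laws are verified as pointwise identities of the form divergence plus remainder;
  only the remainder survives integration.\<close>

lemma tint_divergence:
  assumes "\<And>j. has_partial j (\<Psi> j) (\<Psi>' j)" "\<And>j. pcont (\<Psi> j)" "\<And>j. pcont (\<Psi>' j)" "pcont H"
  shows "tint (\<lambda>x. (\<Sum>j\<in>UNIV. \<Psi>' j x) + H x) = tint H"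
  using assms tint_partial[OF assms(1-3)] by (simp add: tint_add tint_sum pcont_sum)

definition dissipation where "dissipation t = (\<Sum>i\<in>UNIV. \<Sum>j\<in>UNIV. tint (\<lambda>x. (ux i j t x)\<^sup>2))"

definition visc where
  "visc t = \<mu> * dissipation t + (\<mu> + lam) * tint (\<lambda>x. (divu t x)\<^sup>2)"

text \<open>Exchanging derivatives turns the products of diagonal entries of the velocity gradient
  into products of mirrored off-diagonal entries, which are bounded by the mean of their
  squares.\<close>

lemma tint_divu_le:
  assumes t: "t > 0" shows "tint (\<lambda>x. (divu t x)\<^sup>2) \<le> dissipation t"
proof -
  note pc = pconts[OF t]
  have "tint (\<lambda>x. (divu t x)\<^sup>2) = (\<Sum>i\<in>UNIV. \<Sum>j\<in>UNIV. tint (\<lambda>x. ux i i t x * ux j j t x))"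
    by (simp add: divu_def power2_eq_square sum_product tint_sum pcont_sum pcont_mult pc)
  also have "\<dots> \<le> (\<Sum>i\<in>UNIV. \<Sum>j\<in>UNIV. (tint (\<lambda>x. (ux i j t x)\<^sup>2) + tint (\<lambda>x. (ux j i t x)\<^sup>2)) / 2)"
  proof (intro sum_mono)
    fix i j
    have "tint (\<lambda>x. ux i i t x * ux j j t x) = tint (\<lambda>x. ux i j t x * ux j i t x)"
      by (rule tint_partial_exchange[OF partial_u[OF t] partial_u[OF t] pc(2) pc(6) pc(6)
          partial_u[OF t] partial_u[OF t] pc(2) pc(6) pc(6), symmetric])
    also have "\<dots> \<le> tint (\<lambda>x. ((ux i j t x)\<^sup>2 + (ux j i t x)\<^sup>2) * (1 / 2))"
    proof (rule tint_mono)
      fix x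
      show "ux i j t x * ux j i t x \<le> ((ux i j t x)\<^sup>2 + (ux j i t x)\<^sup>2) * (1 / 2)"
        using sum_squares_bound[of "ux i j t x" "ux j i t x"] by simp
    qed (intro pcont_mult pcont_add pcont_power pcont_const pc)+
    also have "\<dots> = (tint (\<lambda>x. (ux i j t x)\<^sup>2) + tint (\<lambda>x. (ux j i t x)\<^sup>2)) / 2"
      using tint_add[OF pcont_power[OF pc(6)] pcont_power[OF pc(6)], of i j 2 j i 2] by simp
    finally show "tint (\<lambda>x. ux i i t x * ux j j t x)
        \<le> (tint (\<lambda>x. (ux i j t x)\<^sup>2) + tint (\<lambda>x. (ux j i t x)\<^sup>2)) / 2" .
  qed
  also have "\<dots> = dissipation t"
  proof -
    have "(\<Sum>i\<in>UNIV. \<Sum>j\<in>UNIV. tint (\<lambda>x. (ux j i t x)\<^sup>2)) = dissipation t"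
      unfolding dissipation_def by (rule sum.swap)
    then show ?thesis
      by (simp add: add_divide_distrib sum.distrib dissipation_def flip: sum_divide_distrib)
  qed
  finally show ?thesis .
qed

lemma dissipation_nonneg: "t > 0 \<Longrightarrow> 0 \<le> dissipation t"
  unfolding dissipation_def by (intro sum_nonneg tint_nonneg pcont_power pconts) auto

text \<open>If \<open>\<mu> + lam\<close> is negative, the bulk term is bounded below by the same
  multiple of the full gradient norm, which leaves the coefficient
  \<open>2 * \<mu> + lam\<close>.\<close>

lemma visc_ge:
  assumes t: "t > 0" shows "min \<mu> (2 * \<mu> + lam) * dissipation t \<le> visc t"
proof -
  let ?D = "dissipation t" and ?d = "tint (\<lambda>x. (divu t x)\<^sup>2)"
  have d: "0 \<le> ?d" "?d \<le> ?D"
    using tint_divu_le[OF t] by (auto intro!: tint_nonneg pcont_power pconts t)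
  then have D: "0 \<le> ?D" by simp
  show ?thesis
  proof (cases "\<mu> + lam \<ge> 0")
    case True
    have "min \<mu> (2 * \<mu> + lam) * ?D \<le> \<mu> * ?D" using D by (intro mult_right_mono) auto
    moreover have "0 \<le> (\<mu> + lam) * ?d" using True d by simp
    ultimately show ?thesis by (simp add: visc_def)
  next
    case False
    have "min \<mu> (2 * \<mu> + lam) * ?D \<le> (2 * \<mu> + lam) * ?D" using D by (intro mult_right_mono) auto
    also have "\<dots> = \<mu> * ?D + (\<mu> + lam) * ?D" by (simp add: algebra_simps)
    also have "\<dots> \<le> visc t" using False d by (simp add: visc_def mult_left_mono_neg)
    finally show ?thesis .
  qed
qed

definition kin where "kin V t = tint (\<lambda>x. \<rho> t x * (\<Sum>i\<in>UNIV. (u i t x - V i)\<^sup>2))"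

definition fluid_energy where
  "fluid_energy V t = kin V t / 2 + tint (p t) / (\<gamma> - 1)"

lemma fluid_energy_continuous: "continuous_on {0..} (fluid_energy V)" "continuous_on {0..} (kin V)"
  unfolding fluid_energy_def[abs_def] kin_def[abs_def] using \<gamma>
  by (auto intro!: continuous_intros tcont_tint tconts tcont_mult tcont_sum tcont_power tcont_diff tcont_const)

text \<open>After inserting the equations, the time derivative of the energy density is the
  divergence of an energy flux plus the viscous dissipation and the work of the drag. Only the
  kinetic energy refers to the frame \<open>V\<close>, whose constancy makes \<open>u - V\<close>
  and \<open>u\<close> have the same derivatives.\<close>

lemma fluid_energy_derivative:
  assumes t: "t > 0"
  shows "(fluid_energy V has_real_derivative
    - visc t - tint (\<lambda>x. \<Sum>i\<in>UNIV. (u i t x - V i) * F i t x)) (at t)"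
proof -
  note pc = pconts[OF t]
  define w where "w i x = u i t x - V i" for i x
  have pw: "pcont (w i)" and hw: "has_partial j (w i) (ux i j t)" for i j
    using has_partial_diff[OF partial_u[OF t] has_partial_const]
    by (auto simp: w_def[abs_def] intro!: pcont_diff pc)
  define W where "W x = (\<Sum>i\<in>UNIV. (w i x)\<^sup>2)" for x
  have pW: "pcont W" unfolding W_def[abs_def] by (intro pcont_sum pcont_power pw)
  have hW: "has_partial j W (\<lambda>x. \<Sum>i\<in>UNIV. ux i j t x * w i x + w i x * ux i j t x)" for j
    unfolding W_def[abs_def] power2_eq_square by (intro has_partial_sum has_partial_mult hw)
  let ?k' = "\<lambda>s x. (1/2) * (\<rho>t s x * (\<Sum>i\<in>UNIV. (u i s x - V i)\<^sup>2)
    + \<rho> s x * (\<Sum>i\<in>UNIV. 2 * (u i s x - V i) * ut i s x))"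
  let ?e' = "\<lambda>s x. 1 / (\<gamma> - 1) * (\<gamma> * \<rho> s x powr (\<gamma> - 1) * \<rho>t s x)"
  have D: "((\<lambda>s. tint (\<lambda>x. (1/2) * (\<rho> s x * (\<Sum>i\<in>UNIV. (u i s x - V i)\<^sup>2)) + 1 / (\<gamma> - 1) * p s x))
      has_real_derivative tint (\<lambda>x. ?k' t x + ?e' t x)) (at t)"
  proof (rule tint_time_deriv[OF _ _ _ t])
    show "has_time_deriv (\<lambda>s x. (1/2) * (\<rho> s x * (\<Sum>i\<in>UNIV. (u i s x - V i)\<^sup>2)) + 1 / (\<gamma> - 1) * p s x)
        (\<lambda>t x. ?k' t x + ?e' t x)"
      unfolding has_time_deriv_def
    proof (intro allI impI)
      fix s :: real and x assume s: "s > 0"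
      have d: "((\<lambda>s. \<rho> s x) has_real_derivative \<rho>t s x) (at s)"
        "((\<lambda>s. u i s x) has_real_derivative ut i s x) (at s)"
        "((\<lambda>s. p s x) has_real_derivative \<gamma> * \<rho> s x powr (\<gamma> - 1) * \<rho>t s x) (at s)" for i
        using deriv_\<rho> deriv_u[of i] deriv_p s by (auto simp: has_time_deriv_def)
      show "((\<lambda>s. (1/2) * (\<rho> s x * (\<Sum>i\<in>UNIV. (u i s x - V i)\<^sup>2)) + 1 / (\<gamma> - 1) * p s x)
          has_real_derivative ?k' s x + ?e' s x) (at s)"
        using \<gamma> by (auto intro!: derivative_eq_intros d sum.cong simp: mult_ac)
    qed
    show "tcont {0<..} (\<lambda>s x. (1/2) * (\<rho> s x * (\<Sum>i\<in>UNIV. (u i s x - V i)\<^sup>2)) + 1 / (\<gamma> - 1) * p s x)"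
      by (intro tcont_add tcont_mult tcont_const tcont_sum tcont_power tcont_diff tconts)
    show "tcont {0<..} (\<lambda>t x. ?k' t x + ?e' t x)"
      using \<gamma> \<rho>_nonneg
      by (intro tcont_add tcont_mult tcont_const tcont_sum tcont_power tcont_diff tconts tcont_powr) auto
  qed
  \<comment> \<open>The energy flux: transport of kinetic energy, work of the pressure, work of the
    two viscous stresses, and transport of internal energy.\<close>
  define \<Psi> where "\<Psi> j x = - (1/2) * (\<rho> t x * u j t x * W x) - w j x * p t x
    + \<mu> * (\<Sum>i\<in>UNIV. w i x * ux i j t x) + (\<mu> + lam) * (w j x * divu t x)
    - 1 / (\<gamma> - 1) * (p t x * u j t x)" for j x
  define \<Psi>' where "\<Psi>' j x = - (1/2) * ((\<rho>x j t x * u j t x + \<rho> t x * ux j j t x) * W x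
      + \<rho> t x * u j t x * (\<Sum>i\<in>UNIV. ux i j t x * w i x + w i x * ux i j t x))
    - (ux j j t x * p t x + w j x * px j t x)
    + \<mu> * (\<Sum>i\<in>UNIV. ux i j t x * ux i j t x + w i x * uxx i j j t x)
    + (\<mu> + lam) * (ux j j t x * divu t x + w j x * (\<Sum>i\<in>UNIV. uxx i i j t x))
    - 1 / (\<gamma> - 1) * (px j t x * u j t x + p t x * ux j j t x)" for j x
  define H where "H x = - \<mu> * (\<Sum>i\<in>UNIV. \<Sum>j\<in>UNIV. (ux i j t x)\<^sup>2) - (\<mu> + lam) * (divu t x)\<^sup>2
    - (\<Sum>i\<in>UNIV. w i x * F i t x)" for x
  have eq: "?k' t x + ?e' t x = (\<Sum>j\<in>UNIV. \<Psi>' j x) + H x" for x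
  proof -
    let ?S = "\<Sum>j\<in>UNIV. \<rho>x j t x * u j t x + \<rho> t x * ux j j t x"
    let ?A = "\<Sum>i\<in>UNIV. \<Sum>j\<in>UNIV. w i x * (u j t x * ux i j t x)"
    let ?P = "\<Sum>i\<in>UNIV. w i x * px i t x"
    let ?L = "\<Sum>i\<in>UNIV. \<Sum>j\<in>UNIV. w i x * uxx i j j t x"
    let ?G = "\<Sum>i\<in>UNIV. \<Sum>j\<in>UNIV. w i x * uxx j j i t x"
    let ?F = "\<Sum>i\<in>UNIV. w i x * F i t x"
    let ?pu = "\<Sum>j\<in>UNIV. px j t x * u j t x"
    let ?D = "\<Sum>i\<in>UNIV. \<Sum>j\<in>UNIV. (ux i j t x)\<^sup>2"
    have "\<rho> t x * (\<Sum>i\<in>UNIV. 2 * (u i t x - V i) * ut i t x) = 2 * (\<Sum>i\<in>UNIV. w i x * (\<rho> t x * ut i t x))"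
      unfolding w_def sum_distrib_left by (intro sum.cong refl) (simp add: algebra_simps)
    also have "(\<Sum>i\<in>UNIV. w i x * (\<rho> t x * ut i t x)) = - \<rho> t x * ?A - ?P + \<mu> * ?L + (\<mu> + lam) * ?G - ?F"
      unfolding momentum_eq[OF t] px_def
      by (simp add: algebra_simps sum.distrib sum_subtractf sum_distrib_left sum_negf)
    finally have 0: "\<rho> t x * (\<Sum>i\<in>UNIV. 2 * (u i t x - V i) * ut i t x)
      = 2 * (- \<rho> t x * ?A - ?P + \<mu> * ?L + (\<mu> + lam) * ?G - ?F)" .
    have 1: "?k' t x = - (1/2) * ?S * W x + (- \<rho> t x * ?A - ?P + \<mu> * ?L + (\<mu> + lam) * ?G - ?F)"
      unfolding 0 mass_eq[OF t] W_def w_def by (simp add: algebra_simps)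
    have pe: "\<gamma> * \<rho> t x powr (\<gamma> - 1) * \<rho>t t x = - (?pu + \<gamma> * (\<rho> t x powr (\<gamma> - 1) * \<rho> t x) * divu t x)"
      unfolding mass_eq[OF t] px_def divu_def
      by (simp add: algebra_simps sum.distrib sum_distrib_left)
    have 2: "?e' t x = - 1 / (\<gamma> - 1) * (?pu + \<gamma> * p t x * divu t x)"
      unfolding pe \<rho>_powr[OF less_imp_le[OF t]] by (simp only: mult_minus_right minus_divide_left mult_minus_left)
    have 3: "(\<Sum>j\<in>UNIV. \<Psi>' j x) = - (1/2) * (?S * W x + 2 * (\<rho> t x * ?A)) - (divu t x * p t x + ?P)
      + \<mu> * (?D + ?L) + (\<mu> + lam) * ((divu t x)\<^sup>2 + ?G) - 1 / (\<gamma> - 1) * (?pu + p t x * divu t x)"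
    proof -
      have a: "(\<Sum>j\<in>UNIV. \<rho> t x * u j t x * (\<Sum>i\<in>UNIV. ux i j t x * w i x + w i x * ux i j t x)) = 2 * (\<rho> t x * ?A)"
        by (subst sum.swap[of _ UNIV UNIV]) (simp add: sum_distrib_left algebra_simps)
      have b: "(\<Sum>j\<in>UNIV. \<Sum>i\<in>UNIV. ux i j t x * ux i j t x + w i x * uxx i j j t x) = ?D + ?L"
        by (subst sum.swap) (simp add: sum.distrib power2_eq_square)
      have c: "(\<Sum>j\<in>UNIV. ux j j t x * divu t x + w j x * (\<Sum>i\<in>UNIV. uxx i i j t x)) = (divu t x)\<^sup>2 + ?G"
      proof -
        have "(\<Sum>j\<in>UNIV. ux j j t x * divu t x) = (divu t x)\<^sup>2"
          unfolding sum_distrib_right[symmetric] by (simp add: divu_def power2_eq_square)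
        then show ?thesis by (simp add: sum.distrib sum_distrib_left)
      qed
      have gen: "(\<Sum>j\<in>UNIV. r * (a1 j + a2 j) - a3 j + r1 * a4 j + r2 * a5 j - r3 * a6 j)
        = r * (sum a1 UNIV + sum a2 UNIV) - sum a3 UNIV + r1 * sum a4 UNIV + r2 * sum a5 UNIV - r3 * sum a6 UNIV"
        for r r1 r2 r3 and a1 a2 a3 a4 a5 a6 :: "'n \<Rightarrow> real"
        by (simp add: sum.distrib sum_subtractf flip: sum_distrib_left)
      have d: "(\<Sum>j\<in>UNIV. (\<rho>x j t x * u j t x + \<rho> t x * ux j j t x) * W x) = ?S * W x"
        by (simp only: sum_distrib_right)
      have e: "(\<Sum>j\<in>UNIV. ux j j t x * p t x + w j x * px j t x) = divu t x * p t x + ?P"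
        by (simp add: sum.distrib divu_def sum_distrib_right)
      have f: "(\<Sum>j\<in>UNIV. px j t x * u j t x + p t x * ux j j t x) = ?pu + p t x * divu t x"
        by (simp add: sum.distrib divu_def sum_distrib_left)
      show ?thesis
        unfolding \<Psi>'_def gen a b c d e f ..
    qed
    \<comment> \<open>Since \<gamma> / (\<gamma> - 1) exceeds 1 / (\<gamma> - 1) by 1, compressing
      the gas leaves one extra \<open>p * divu\<close>, which matches the work of the pressure in
      \<open>\<Psi>\<close>.\<close>
    have 4: "1 / (\<gamma> - 1) * (?pu + \<gamma> * p t x * divu t x)
        = 1 / (\<gamma> - 1) * (?pu + p t x * divu t x) + p t x * divu t x"
    proof -
      define k where "k = 1 / (\<gamma> - 1)"
      have k: "k * \<gamma> = k + 1" using \<gamma> by (simp add: k_def field_simps)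
      have "k * (?pu + \<gamma> * p t x * divu t x) = k * ?pu + (k * \<gamma>) * (p t x * divu t x)"
        by (simp add: algebra_simps)
      then show ?thesis unfolding k k_def[symmetric] by (simp add: algebra_simps)
    qed
    show ?thesis using 1 2 3 4 by (simp add: H_def algebra_simps)
  qed
  have "tint (\<lambda>x. ?k' t x + ?e' t x) = tint H"
    unfolding eq
  proof (rule tint_divergence)
    show "has_partial j (\<Psi> j) (\<Psi>' j)" for j
      unfolding \<Psi>_def[abs_def] \<Psi>'_def[abs_def]
      by (intro has_partial_diff has_partial_add has_partial_cmult has_partial_mult has_partial_sum
          hw hW partial_\<rho>[OF t] partial_u[OF t] partial_ux[OF t] partial_p[OF t] partial_divu[OF t])
    show "pcont (\<Psi> j)" "pcont (\<Psi>' j)" "pcont H" for j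
      unfolding \<Psi>_def[abs_def] \<Psi>'_def[abs_def] H_def[abs_def]
      by (intro pcont_diff pcont_add pcont_mult pcont_sum pcont_power pcont_const pc pw pW)+
  qed
  also have "tint H = - visc t - tint (\<lambda>x. \<Sum>i\<in>UNIV. w i x * F i t x)"
    unfolding H_def[abs_def] visc_def dissipation_def
    by (subst tint_diff tint_sum | intro pcont_diff pcont_mult pcont_sum pcont_power pcont_const pc pw | simp)+
  finally have D': "((\<lambda>s. tint (\<lambda>x. (1/2) * (\<rho> s x * (\<Sum>i\<in>UNIV. (u i s x - V i)\<^sup>2)) + 1 / (\<gamma> - 1) * p s x))
      has_real_derivative - visc t - tint (\<lambda>x. \<Sum>i\<in>UNIV. (u i t x - V i) * F i t x)) (at t)"
    using D by (simp add: w_def)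
  show ?thesis
  proof (rule has_field_derivative_transform_within_open[OF D', where S = "{0<..}"])
    fix s :: real assume "s \<in> {0<..}"
    then have s: "s > 0" by simp
    show "tint (\<lambda>x. (1/2) * (\<rho> s x * (\<Sum>i\<in>UNIV. (u i s x - V i)\<^sup>2)) + 1 / (\<gamma> - 1) * p s x)
        = fluid_energy V s"
    proof (subst tint_add)
      show "pcont (\<lambda>x. (1/2) * (\<rho> s x * (\<Sum>i\<in>UNIV. (u i s x - V i)\<^sup>2)))" "pcont (\<lambda>x. 1 / (\<gamma> - 1) * p s x)"
        by (intro pcont_mult pcont_sum pcont_power pcont_diff pcont_const pconts[OF s])+
    qed (simp add: fluid_energy_def kin_def)
  qed (use t in auto)
qed

end

section \<open>Testing the momentum equation\<close>

lemma tint_young: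
  assumes "pcont a" "pcont b" "\<delta> > 0"
  shows "\<bar>tint (\<lambda>x. a x * b x)\<bar> \<le> tint (\<lambda>x. (a x)\<^sup>2) / \<delta> + \<delta> * tint (\<lambda>x. (b x)\<^sup>2)"
proof -
  have "\<bar>tint (\<lambda>x. a x * b x)\<bar> \<le> tint (\<lambda>x. \<bar>a x * b x\<bar>)"
    by (intro tint_abs pcont_mult assms)
  also have "\<dots> \<le> tint (\<lambda>x. inverse \<delta> * (a x)\<^sup>2 + \<delta> * (b x)\<^sup>2)"
  proof (rule tint_mono)
    fix x
    have "0 \<le> (\<bar>a x\<bar> - \<delta> * \<bar>b x\<bar>)\<^sup>2" by simp
    then have "2 * \<delta> * (\<bar>a x\<bar> * \<bar>b x\<bar>) \<le> (a x)\<^sup>2 + \<delta>\<^sup>2 * (b x)\<^sup>2"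
      by (simp add: power2_diff power_mult_distrib mult_ac)
    then have "2 * (\<bar>a x\<bar> * \<bar>b x\<bar>) \<le> inverse \<delta> * (a x)\<^sup>2 + \<delta> * (b x)\<^sup>2"
      using assms(3) by (simp add: field_simps power2_eq_square)
    moreover have "0 \<le> \<bar>a x\<bar> * \<bar>b x\<bar>" by simp
    ultimately show "\<bar>a x * b x\<bar> \<le> inverse \<delta> * (a x)\<^sup>2 + \<delta> * (b x)\<^sup>2"
      unfolding abs_mult by linarith
  qed (intro pcont_abs pcont_add pcont_mult pcont_power pcont_const assms)+
  also have "\<dots> = inverse \<delta> * tint (\<lambda>x. (a x)\<^sup>2) + \<delta> * tint (\<lambda>x. (b x)\<^sup>2)"
    by (subst tint_add) (simp_all add: pcont_mult pcont_power assms)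
  finally show ?thesis by (simp add: divide_inverse mult.commute)
qed

lemma tint_sum_square_le:
  fixes a :: "'i::finite \<Rightarrow> real ^ 'n::finite \<Rightarrow> real"
  assumes "\<And>i. pcont (a i)"
  shows "tint (\<lambda>x. (\<Sum>i\<in>UNIV. a i x)\<^sup>2) \<le> real CARD('i) * (\<Sum>i\<in>UNIV. tint (\<lambda>x. (a i x)\<^sup>2))"
proof -
  have "tint (\<lambda>x. (\<Sum>i\<in>UNIV. a i x)\<^sup>2) \<le> tint (\<lambda>x. real CARD('i) * (\<Sum>i\<in>UNIV. (a i x)\<^sup>2))"
  proof (rule tint_mono)
    fix x
    show "(\<Sum>i\<in>UNIV. a i x)\<^sup>2 \<le> real CARD('i) * (\<Sum>i\<in>UNIV. (a i x)\<^sup>2)"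
      using Cauchy_Schwarz_ineq_sum[of "\<lambda>i. 1" "\<lambda>i. a i x" "UNIV :: 'i set"] by simp
  qed (intro pcont_power pcont_sum pcont_mult pcont_const assms)+
  also have "\<dots> = real CARD('i) * (\<Sum>i\<in>UNIV. tint (\<lambda>x. (a i x)\<^sup>2))"
    by (simp add: tint_sum pcont_power assms)
  finally show ?thesis .
qed

context fluid_flow begin

text \<open>By the continuity equation \<open>\<rho> * (u - V)\<close> obeys the same conservative
  balance as \<open>\<rho> * u\<close>, for any constant \<open>V\<close>. On the right no
  derivative of \<open>\<rho>\<close> and no second derivative of \<open>u\<close> remains; these
  have been moved to the test field.\<close>

lemma weak_momentum:
  assumes t: "t > 0"
    and B: "\<And>i. pcont (B i)" "\<And>i j. has_partial j (B i) (Bx i j)" "\<And>i j. pcont (Bx i j)"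
  shows "tint (\<lambda>x. \<Sum>i\<in>UNIV. (\<rho>t t x * (u i t x - V i) + \<rho> t x * ut i t x) * B i x)
    = tint (\<lambda>x. (\<Sum>i\<in>UNIV. \<Sum>j\<in>UNIV. Bx i j x * (\<rho> t x * u j t x * (u i t x - V i) - \<mu> * ux i j t x))
        + (p t x - (\<mu> + lam) * divu t x) * (\<Sum>i\<in>UNIV. Bx i i x) - (\<Sum>i\<in>UNIV. F i t x * B i x))"
    (is "tint ?G = tint ?H")
proof -
  note pc = pconts[OF t]
  define w where "w i x = u i t x - V i" for i x
  have pw: "pcont (w i)" and hw: "has_partial j (w i) (ux i j t)" for i j
    using has_partial_diff[OF partial_u[OF t] has_partial_const]
    by (auto simp: w_def[abs_def] intro!: pcont_diff pc)
  define \<Psi> where "\<Psi> j x = (\<Sum>i\<in>UNIV. B i x * (\<mu> * ux i j t x - \<rho> t x * u j t x * w i x))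
    + ((\<mu> + lam) * divu t x - p t x) * B j x" for j x
  define \<Psi>' where "\<Psi>' j x = (\<Sum>i\<in>UNIV. Bx i j x * (\<mu> * ux i j t x - \<rho> t x * u j t x * w i x)
      + B i x * (\<mu> * uxx i j j t x - ((\<rho>x j t x * u j t x + \<rho> t x * ux j j t x) * w i x + \<rho> t x * u j t x * ux i j t x)))
    + (((\<mu> + lam) * (\<Sum>k\<in>UNIV. uxx k k j t x) - px j t x) * B j x
      + ((\<mu> + lam) * divu t x - p t x) * Bx j j x)" for j x
  have eq: "?G x = (\<Sum>j\<in>UNIV. \<Psi>' j x) + ?H x" for x
  proof -
    have 1: "(\<rho>t t x * (u i t x - V i) + \<rho> t x * ut i t x) * B i x
      = (\<Sum>j\<in>UNIV. B i x * (\<mu> * uxx i j j t x - ((\<rho>x j t x * u j t x + \<rho> t x * ux j j t x) * w i x + \<rho> t x * u j t x * ux i j t x)))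
        + ((\<mu> + lam) * (\<Sum>k\<in>UNIV. uxx k k i t x) - px i t x) * B i x - F i t x * B i x" for i
      unfolding mass_eq[OF t] momentum_eq[OF t] px_def w_def
      by (simp add: sum_distrib_left sum_distrib_right sum.distrib sum_subtractf algebra_simps sum_negf)
    have gen: "(\<Sum>j\<in>UNIV. (\<Sum>i\<in>UNIV. a i j + b i j) + (c j + d * e j))
      = (\<Sum>i\<in>UNIV. \<Sum>j\<in>UNIV. a i j) + (\<Sum>i\<in>UNIV. \<Sum>j\<in>UNIV. b i j) + sum c UNIV + d * sum e UNIV"
      for a b :: "'n \<Rightarrow> 'n \<Rightarrow> real" and c e d
      using sum.swap[of a UNIV UNIV] sum.swap[of b UNIV UNIV]
      by (simp add: sum.distrib sum_distrib_left)
    have "(\<Sum>j\<in>UNIV. \<Psi>' j x)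
      = (\<Sum>i\<in>UNIV. \<Sum>j\<in>UNIV. Bx i j x * (\<mu> * ux i j t x - \<rho> t x * u j t x * w i x))
      + (\<Sum>i\<in>UNIV. \<Sum>j\<in>UNIV. B i x * (\<mu> * uxx i j j t x - ((\<rho>x j t x * u j t x + \<rho> t x * ux j j t x) * w i x + \<rho> t x * u j t x * ux i j t x)))
      + (\<Sum>i\<in>UNIV. ((\<mu> + lam) * (\<Sum>k\<in>UNIV. uxx k k i t x) - px i t x) * B i x)
      + ((\<mu> + lam) * divu t x - p t x) * (\<Sum>i\<in>UNIV. Bx i i x)"
      unfolding \<Psi>'_def by (rule gen)
    moreover have "(\<Sum>i\<in>UNIV. \<Sum>j\<in>UNIV. Bx i j x * (\<mu> * ux i j t x - \<rho> t x * u j t x * w i x))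
      = - (\<Sum>i\<in>UNIV. \<Sum>j\<in>UNIV. Bx i j x * (\<rho> t x * u j t x * (u i t x - V i) - \<mu> * ux i j t x))"
      unfolding sum_negf[symmetric] w_def by (intro sum.cong refl) (simp add: algebra_simps)
    moreover have "((\<mu> + lam) * divu t x - p t x) * c = - ((p t x - (\<mu> + lam) * divu t x) * c)" for c
      by (simp add: algebra_simps)
    ultimately show ?thesis
      unfolding 1 sum.distrib sum_subtractf by simp
  qed
  show ?thesis
    unfolding eq
  proof (rule tint_divergence)
    show "has_partial j (\<Psi> j) (\<Psi>' j)" for j
      unfolding \<Psi>_def[abs_def] \<Psi>'_def[abs_def]
      by (intro has_partial_diff has_partial_add has_partial_cmult has_partial_mult has_partial_sum
          hw B partial_\<rho>[OF t] partial_u[OF t] partial_ux[OF t] partial_p[OF t] partial_divu[OF t])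
    show "pcont (\<Psi> j)" "pcont (\<Psi>' j)" "pcont ?H" for j
      unfolding \<Psi>_def[abs_def] \<Psi>'_def[abs_def]
      by (intro pcont_diff pcont_add pcont_mult pcont_sum pcont_power pcont_const pc pw B)+
  qed
qed

lemma const_of_zero_derivative:
  fixes f :: "real \<Rightarrow> real"
  assumes "continuous_on {0..} f" "\<And>t. t > 0 \<Longrightarrow> (f has_real_derivative 0) (at t)" "t \<ge> 0"
  shows "f t = f 0"
proof (cases "t = 0")
  case False
  then show ?thesis
    using assms by (intro DERIV_isconst_end) (auto elim: continuous_on_subset)
qed simp

lemma tint_mass_derivative:
  assumes t: "t > 0" shows "tint (\<rho>t t) = 0"
proof -
  have "\<rho>t t = (\<lambda>x. - (\<Sum>j\<in>UNIV. \<rho>x j t x * u j t x + \<rho> t x * ux j j t x))"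
    using mass_eq[OF t] by auto
  moreover have "tint (\<lambda>x. (\<Sum>j\<in>UNIV. \<rho>x j t x * u j t x + \<rho> t x * ux j j t x) + 0)
      = tint (\<lambda>x :: real ^ 'n. 0)"
    by (rule tint_divergence[where \<Psi> = "\<lambda>j x. \<rho> t x * u j t x"])
      (intro has_partial_mult partial_\<rho>[OF t] partial_u[OF t] pcont_add pcont_mult pcont_const pconts[OF t])+
  ultimately show ?thesis by simp
qed

lemma mass_conservation: "t \<ge> 0 \<Longrightarrow> tint (\<rho> t) = tint (\<rho> 0)"
proof (rule const_of_zero_derivative)
  show "continuous_on {0..} (\<lambda>t. tint (\<rho> t))" by (intro tcont_tint tconts)
  show "((\<lambda>t. tint (\<rho> t)) has_real_derivative 0) (at t)" if "t > 0" for t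
    using tint_time_deriv[OF deriv_\<rho> tcont_pos(1) tcont_\<rho>t that] tint_mass_derivative[OF that] by simp
qed

lemma fluid_momentum_derivative:
  assumes t: "t > 0"
  shows "((\<lambda>s. tint (\<lambda>x. \<rho> s x * u i s x)) has_real_derivative - tint (F i t)) (at t)"
proof -
  have "((\<lambda>s. tint (\<lambda>x. \<rho> s x * u i s x)) has_real_derivative
      tint (\<lambda>x. \<rho>t t x * u i t x + ut i t x * \<rho> t x)) (at t)"
  proof (rule tint_time_deriv[OF _ _ _ t])
    show "has_time_deriv (\<lambda>s x. \<rho> s x * u i s x) (\<lambda>s x. \<rho>t s x * u i s x + ut i s x * \<rho> s x)"
      using deriv_\<rho> deriv_u[of i] by (auto simp: has_time_deriv_def intro!: DERIV_mult)
  qed (intro tcont_add tcont_mult tconts)+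
  \<comment> \<open>The test field is the constant i-th unit vector, for which all flux terms
    vanish.\<close>
  also have "tint (\<lambda>x. \<rho>t t x * u i t x + ut i t x * \<rho> t x)
    = tint (\<lambda>x. \<Sum>k\<in>UNIV. (\<rho>t t x * (u k t x - 0) + \<rho> t x * ut k t x) * (if k = i then 1 else 0))"
    by (simp add: if_distrib mult.commute cong: if_cong)
  also have "\<dots> = - tint (F i t)"
    by (subst weak_momentum[OF t, where V = "\<lambda>k. 0" and Bx = "\<lambda>k j x. 0"])
      (simp_all add: has_partial_const if_distrib cong: if_cong)
  finally show ?thesis .
qed

definition var where "var t = tint (\<lambda>x. (\<rho> t x - tint (\<rho> 0))\<^sup>2)"

lemma pcont_var: "t \<ge> 0 \<Longrightarrow> pcont (\<lambda>x. \<rho> t x - c)"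
  by (intro pcont_diff pcont_const tcont_pcont[OF tcont_\<rho>]) auto

lemma var_nonneg: "t \<ge> 0 \<Longrightarrow> 0 \<le> var t"
  unfolding var_def by (intro tint_nonneg pcont_power pcont_var) auto

lemma continuous_on_var: "continuous_on {0..} var"
  unfolding var_def[abs_def] by (intro tcont_tint tcont_power tcont_diff tcont_const tconts)

lemma pcont_momentum: "t \<ge> 0 \<Longrightarrow> pcont (\<lambda>x. \<rho> t x * (u i t x - V i))"
  by (intro pcont_mult pcont_diff pcont_const tcont_pcont[OF tcont_\<rho>] tcont_pcont[OF tcont_u]) auto

lemma kin_eq:
  assumes "t \<ge> 0" shows "kin V t = (\<Sum>i\<in>UNIV. tint (\<lambda>x. \<rho> t x * (u i t x - V i)\<^sup>2))"
  unfolding kin_def sum_distrib_left using assms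
  by (intro tint_sum pcont_mult pcont_power pcont_diff pcont_const tcont_pcont[OF tcont_\<rho>] tcont_pcont[OF tcont_u]) auto

lemma kin_term_nonneg: "t \<ge> 0 \<Longrightarrow> 0 \<le> tint (\<lambda>x. \<rho> t x * (u i t x - V i)\<^sup>2)"
  by (intro tint_nonneg pcont_mult pcont_power pcont_diff pcont_const tcont_pcont[OF tcont_\<rho>] tcont_pcont[OF tcont_u])
    (auto simp: \<rho>_nonneg)

lemma kin_nonneg: "t \<ge> 0 \<Longrightarrow> 0 \<le> kin V t"
  using kin_term_nonneg by (simp add: kin_eq sum_nonneg)

text \<open>With \<open>\<Phi> = \<Phi>1\<close> the convolutions are the gradient of the mollified
  solution of the Poisson equation with right-hand side \<open>\<rho>\<close> minus its mean, so
  this is the relative momentum tested with that gradient.\<close>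

definition pairing where
  "pairing V \<Phi> t = tint (\<lambda>x. \<Sum>i\<in>UNIV. \<rho> t x * (u i t x - V i) * conv (\<Phi> i) (\<rho> t) x)"

definition pairing' where
  "pairing' V \<Phi> t = tint (\<lambda>x. \<Sum>i\<in>UNIV. (\<rho>t t x * (u i t x - V i) + \<rho> t x * ut i t x) * conv (\<Phi> i) (\<rho> t) x
    + \<rho> t x * (u i t x - V i) * conv (\<Phi> i) (\<rho>t t) x)"

lemma conv_time_deriv:
  assumes G: "pcont G" shows "has_time_deriv (\<lambda>t. conv G (\<rho> t)) (\<lambda>t. conv G (\<rho>t t))"
  unfolding has_time_deriv_def conv_def
proof (intro allI impI)
  fix t :: real and x assume "t > 0"
  show "((\<lambda>s. tint (\<lambda>y. G (x - y) * \<rho> s y)) has_real_derivative tint (\<lambda>y. G (x - y) * \<rho>t t y)) (at t)"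
  proof (rule tint_time_deriv[OF _ _ _ \<open>t > 0\<close>])
    show "has_time_deriv (\<lambda>s y. G (x - y) * \<rho> s y) (\<lambda>s y. G (x - y) * \<rho>t s y)"
      using deriv_\<rho> by (auto simp: has_time_deriv_def intro!: DERIV_cmult)
    have "tcont {0<..} (\<lambda>s y. G (x - y))"
      using pcont_reflect[OF G, of x] unfolding tcont_def case_prod_beta
      by (auto intro!: pcont_comp_cont[OF G] continuous_intros simp: pcont_def)
    then show "tcont {0<..} (\<lambda>s y. G (x - y) * \<rho> s y)" "tcont {0<..} (\<lambda>s y. G (x - y) * \<rho>t s y)"
      by (intro tcont_mult tconts; assumption)+
  qed
qed

lemma tcont_pairing':
  assumes \<Phi>: "\<And>i. pcont (\<Phi> i)"
  shows "tcont {0<..} (\<lambda>t x. \<Sum>i\<in>UNIV. (\<rho>t t x * (u i t x - V i) + \<rho> t x * ut i t x) * conv (\<Phi> i) (\<rho> t) x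
    + \<rho> t x * (u i t x - V i) * conv (\<Phi> i) (\<rho>t t) x)"
  by (intro tcont_sum tcont_add tcont_mult tcont_diff tcont_const tconts tcont_conv[OF \<Phi>])

lemma pairing_derivative:
  assumes \<Phi>: "\<And>i. pcont (\<Phi> i)" and t: "t > 0"
  shows "(pairing V \<Phi> has_real_derivative pairing' V \<Phi> t) (at t)"
  unfolding pairing_def[abs_def] pairing'_def
proof (rule tint_time_deriv[OF _ _ tcont_pairing'[OF \<Phi>] t])
  show "has_time_deriv (\<lambda>t x. \<Sum>i\<in>UNIV. \<rho> t x * (u i t x - V i) * conv (\<Phi> i) (\<rho> t) x)
     (\<lambda>t x. \<Sum>i\<in>UNIV. (\<rho>t t x * (u i t x - V i) + \<rho> t x * ut i t x) * conv (\<Phi> i) (\<rho> t) x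
        + \<rho> t x * (u i t x - V i) * conv (\<Phi> i) (\<rho>t t) x)"
    unfolding has_time_deriv_def
  proof (intro allI impI DERIV_sum)
    fix s :: real and x i assume s: "s > 0"
    have d: "((\<lambda>s. \<rho> s x) has_real_derivative \<rho>t s x) (at s)"
      "((\<lambda>s. u i s x) has_real_derivative ut i s x) (at s)"
      "((\<lambda>s. conv (\<Phi> i) (\<rho> s) x) has_real_derivative conv (\<Phi> i) (\<rho>t s) x) (at s)"
      using deriv_\<rho> deriv_u[of i] conv_time_deriv[OF \<Phi>[of i]] s by (auto simp: has_time_deriv_def)
    show "((\<lambda>s. \<rho> s x * (u i s x - V i) * conv (\<Phi> i) (\<rho> s) x) has_real_derivative
      (\<rho>t s x * (u i s x - V i) + \<rho> s x * ut i s x) * conv (\<Phi> i) (\<rho> s) x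
        + \<rho> s x * (u i s x - V i) * conv (\<Phi> i) (\<rho>t s) x) (at s)"
      by (auto intro!: derivative_eq_intros d simp: algebra_simps)
  qed
qed (intro tcont_sum tcont_add tcont_mult tcont_diff tcont_const tconts tcont_conv[OF \<Phi>])

text \<open>All that the fluid estimates need to know about the particles. In the coupled system
  \<open>e\<close> is the slip and \<open>S\<close> the constant of the weighted Sobolev
  inequality.\<close>

definition drag_bound where
  "drag_bound S e t \<longleftrightarrow> (\<forall>B Bx \<delta>. (\<forall>i. pcont (B i) \<and> tint (B i) = 0) \<longrightarrow>
    (\<forall>i j. has_partial j (B i) (Bx i j) \<and> pcont (Bx i j)) \<longrightarrow> \<delta> > 0 \<longrightarrow>
    \<bar>tint (\<lambda>x. \<Sum>i\<in>UNIV. F i t x * B i x)\<bar>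
      \<le> e / \<delta> + \<delta> * S * (\<Sum>i\<in>UNIV. \<Sum>j\<in>UNIV. tint (\<lambda>x. (Bx i j x)\<^sup>2)))"

end

subsection \<open>Dissipation of density fluctuations\<close>

lemma set_integral_le_AE:
  assumes "set_integrable lborel A f" "set_integrable lborel A g"
    and "AE x in lborel. x \<in> A \<longrightarrow> f x \<le> (g x :: real)"
  shows "(LINT x:A|lborel. f x) \<le> (LINT x:A|lborel. g x)"
  unfolding set_lebesgue_integral_def
  using assms unfolding set_integrable_def
  by (intro integral_mono_AE) (auto simp: indicator_def elim!: AE_mp)

text \<open>Writing \<open>s powr \<gamma>\<close> as \<open>s * s powr (\<gamma> - 1)\<close>, the
  difference of the two sides is \<open>r\<close> times a product that is nonnegative by
  monotonicity. The constant does not degenerate at vacuum, r = 0.\<close>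

lemma powr_diff_mult_ge:
  fixes r a :: real
  assumes "0 \<le> r" "0 < a" "1 < \<gamma>"
  shows "a powr (\<gamma> - 1) * (r - a)\<^sup>2 \<le> (r powr \<gamma> - a powr \<gamma>) * (r - a)"
proof -
  have e: "s powr \<gamma> = s * s powr (\<gamma> - 1)" if "0 \<le> s" for s :: real
    using that assms(3) by (cases "s = 0") (auto simp: powr_diff)
  have "(r powr \<gamma> - a powr \<gamma>) * (r - a) - a powr (\<gamma> - 1) * (r - a)\<^sup>2
      = r * ((r powr (\<gamma> - 1) - a powr (\<gamma> - 1)) * (r - a))"
    unfolding e[OF assms(1)] e[OF less_imp_le[OF assms(2)]] by (simp add: power2_eq_square algebra_simps)
  moreover have "0 \<le> (r powr (\<gamma> - 1) - a powr (\<gamma> - 1)) * (r - a)"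
  proof (cases "r \<ge> a")
    case True
    then show ?thesis using assms by (intro mult_nonneg_nonneg) (auto intro!: powr_mono2)
  next
    case False
    then show ?thesis using assms by (intro mult_nonpos_nonpos) (auto intro!: powr_mono2)
  qed
  ultimately show ?thesis
    using assms(1) by (metis diff_ge_0_iff_ge mult_nonneg_nonneg)
qed

context fluid_flow begin

context
  fixes R U S :: real and V :: "'n \<Rightarrow> real"
  assumes \<rho>_le: "\<And>t x. t \<ge> 0 \<Longrightarrow> \<rho> t x \<le> R"
    and u_le: "\<And>t x i. t \<ge> 0 \<Longrightarrow> \<bar>u i t x\<bar> \<le> U"
    and S: "S \<ge> 0"
begin

text \<open>A crude common majorant of the coefficients arising when the pairing and its time
  derivative are estimated: the sum of all of them, plus 1.\<close>

definition bound_const where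
  "bound_const = 2 * R * U\<^sup>2 * real CARD('n) + 2 * \<mu>\<^sup>2 + \<bar>\<mu> + lam\<bar> + R + 2 * (real CARD('n))\<^sup>2 * R + 2 * (real CARD('n))\<^sup>2 * (\<Sum>i\<in>UNIV. (V i)\<^sup>2)
    + (1 + S) * (real CARD('n))\<^sup>2 + 2 ^ CARD('n) * (real CARD('n))\<^sup>2 + 1"

lemma R_nonneg: "R \<ge> 0"
  using \<rho>_nonneg[of 0 0] \<rho>_le[of 0 0] by simp

lemma bound_const_ge:
  "2 * R * U\<^sup>2 * real CARD('n) + 2 * \<mu>\<^sup>2 + \<bar>\<mu> + lam\<bar> + R + 2 * (real CARD('n))\<^sup>2 * R \<le> bound_const"
  "\<bar>\<mu> + lam\<bar> + 2 * (real CARD('n))\<^sup>2 * (\<Sum>i\<in>UNIV. (V i)\<^sup>2) + (1 + S) * (real CARD('n))\<^sup>2 \<le> bound_const"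
  "R + 2 ^ CARD('n) * (real CARD('n))\<^sup>2 \<le> bound_const" "1 \<le> bound_const"
proof -
  have nonneg: "0 \<le> 2 * R * U\<^sup>2 * real CARD('n)" "0 \<le> 2 * \<mu>\<^sup>2" "0 \<le> \<bar>\<mu> + lam\<bar>" "0 \<le> R" "0 \<le> 2 * (real CARD('n))\<^sup>2 * R"
    "0 \<le> 2 * (real CARD('n))\<^sup>2 * (\<Sum>i\<in>UNIV. (V i)\<^sup>2)" "0 \<le> (1 + S) * (real CARD('n))\<^sup>2" "0 \<le> 2 ^ CARD('n) * (real CARD('n))\<^sup>2"
    using R_nonneg S by (auto intro!: mult_nonneg_nonneg sum_nonneg)
  show "2 * R * U\<^sup>2 * real CARD('n) + 2 * \<mu>\<^sup>2 + \<bar>\<mu> + lam\<bar> + R + 2 * (real CARD('n))\<^sup>2 * R \<le> bound_const"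
    "\<bar>\<mu> + lam\<bar> + 2 * (real CARD('n))\<^sup>2 * (\<Sum>i\<in>UNIV. (V i)\<^sup>2) + (1 + S) * (real CARD('n))\<^sup>2 \<le> bound_const"
    "R + 2 ^ CARD('n) * (real CARD('n))\<^sup>2 \<le> bound_const" "1 \<le> bound_const"
    using nonneg unfolding bound_const_def by linarith+
qed

lemma tint_momentum_square_le:
  assumes t: "t \<ge> 0"
  shows "tint (\<lambda>x. (\<rho> t x * (u i t x - V i))\<^sup>2) \<le> R * tint (\<lambda>x. \<rho> t x * (u i t x - V i)\<^sup>2)"
proof -
  have "tint (\<lambda>x. (\<rho> t x * (u i t x - V i))\<^sup>2) \<le> tint (\<lambda>x. R * (\<rho> t x * (u i t x - V i)\<^sup>2))"
  proof (rule tint_mono)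
    fix x
    have "\<rho> t x * (\<rho> t x * (u i t x - V i)\<^sup>2) \<le> R * (\<rho> t x * (u i t x - V i)\<^sup>2)"
      using \<rho>_le[OF t] \<rho>_nonneg[OF t] by (intro mult_right_mono) auto
    then show "(\<rho> t x * (u i t x - V i))\<^sup>2 \<le> R * (\<rho> t x * (u i t x - V i)\<^sup>2)"
      by (simp add: power2_eq_square mult_ac)
  qed (use t in \<open>intro pcont_power pcont_momentum pcont_mult pcont_const pcont_diff tcont_pcont[OF tcont_\<rho>] tcont_pcont[OF tcont_u]; simp\<close>)+
  then show ?thesis by simp
qed

context
  fixes K :: "real ^ 'n \<Rightarrow> real" and \<Phi>1 \<Phi>2
  assumes K: "pcont K" "\<And>x. 0 \<le> K x" "tint K = 1" and \<Phi>: "potential K 1 \<Phi>1 \<Phi>2"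
begin

lemmas P = potentialD[OF \<Phi> K(1)]

text \<open>The Hessian kernels have mean zero and annihilate constants; this is how the density is
  replaced by its fluctuation.\<close>

lemma conv_\<Phi>2_shift:
  assumes "pcont g" shows "conv (\<Phi>2 i j) (\<lambda>x. g x - c) = conv (\<Phi>2 i j) g"
  using conv_diff_const[OF P(2) assms] P(8) by auto

lemma hessian_bound:
  assumes t: "t \<ge> 0" shows "tint (\<lambda>x. (conv (\<Phi>2 i j) (\<rho> t) x)\<^sup>2) \<le> var t"
proof -
  have "tint (\<lambda>x. (conv (\<Phi>2 i j) (\<lambda>x. \<rho> t x - tint (\<rho> 0)) x)\<^sup>2) \<le> var t"
    unfolding var_def by (rule conv_hessian_square_le[OF K \<Phi> pcont_var[OF t]])
  then show ?thesis
    using t by (subst (asm) conv_\<Phi>2_shift) (auto intro: tcont_pcont[OF tcont_\<rho>])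
qed

lemma sum_hessian_bound:
  assumes t: "t \<ge> 0"
  shows "(\<Sum>i\<in>UNIV. \<Sum>j\<in>UNIV. tint (\<lambda>x. (conv (\<Phi>2 i j) (\<rho> t) x)\<^sup>2)) \<le> (real CARD('n))\<^sup>2 * var t"
proof -
  have "(\<Sum>i\<in>UNIV. \<Sum>j\<in>UNIV. tint (\<lambda>x. (conv (\<Phi>2 i j) (\<rho> t) x)\<^sup>2)) \<le> (\<Sum>i\<in>(UNIV :: 'n set). \<Sum>j\<in>(UNIV :: 'n set). var t)"
    by (intro sum_mono hessian_bound t)
  then show ?thesis by (simp add: power2_eq_square)
qed

text \<open>These are the boundary terms of the time integration, so no dissipation may appear.
  Young's inequality separates momentum and test field; the latter has mean zero and is bounded by
  the Poincare inequality and the Hessian estimate.\<close>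

lemma pairing_abs_le:
  assumes t: "t \<ge> 0"
  shows "\<bar>pairing V \<Phi>1 t\<bar> \<le> bound_const * (kin V t + var t)"
proof -
  let ?B = "\<lambda>i. conv (\<Phi>1 i) (\<rho> t)"
  have \<rho>: "pcont (\<rho> t)" using t by (intro tcont_pcont[OF tcont_\<rho>]) auto
  have pB: "pcont (?B i)" for i by (intro pcont_conv P \<rho>)
  have "pairing V \<Phi>1 t = (\<Sum>i\<in>UNIV. tint (\<lambda>x. \<rho> t x * (u i t x - V i) * ?B i x))"
    unfolding pairing_def by (intro tint_sum finite pcont_mult pcont_momentum t pB)
  also have "\<bar>\<dots>\<bar> \<le> (\<Sum>i\<in>UNIV. R * tint (\<lambda>x. \<rho> t x * (u i t x - V i)\<^sup>2)
      + 2 ^ CARD('n) * (\<Sum>j\<in>UNIV. tint (\<lambda>x. (conv (\<Phi>2 i j) (\<rho> t) x)\<^sup>2)))"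
  proof (rule order.trans[OF sum_abs sum_mono])
    fix i
    have "\<bar>tint (\<lambda>x. \<rho> t x * (u i t x - V i) * ?B i x)\<bar>
      \<le> tint (\<lambda>x. (\<rho> t x * (u i t x - V i))\<^sup>2) / 1 + 1 * tint (\<lambda>x. (?B i x)\<^sup>2)"
      by (intro tint_young pcont_momentum t pB) simp
    also have "tint (\<lambda>x. (?B i x)\<^sup>2) = tint (\<lambda>x. (?B i x - tint (?B i))\<^sup>2)"
      using tint_conv[OF P(1) \<rho>] P(7) by simp
    also have "\<dots> \<le> 2 ^ CARD('n) * (\<Sum>j\<in>UNIV. tint (\<lambda>x. (conv (\<Phi>2 i j) (\<rho> t) x)\<^sup>2))"
      by (intro poincare has_partial_conv pcont_conv P \<rho>)
    finally show "\<bar>tint (\<lambda>x. \<rho> t x * (u i t x - V i) * ?B i x)\<bar> \<le> R * tint (\<lambda>x. \<rho> t x * (u i t x - V i)\<^sup>2)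
      + 2 ^ CARD('n) * (\<Sum>j\<in>UNIV. tint (\<lambda>x. (conv (\<Phi>2 i j) (\<rho> t) x)\<^sup>2))"
      using tint_momentum_square_le[OF t, of i] by simp
  qed
  also have "\<dots> = R * kin V t + 2 ^ CARD('n) * (\<Sum>i\<in>UNIV. \<Sum>j\<in>UNIV. tint (\<lambda>x. (conv (\<Phi>2 i j) (\<rho> t) x)\<^sup>2))"
    by (simp add: sum.distrib kin_eq[OF t] flip: sum_distrib_left)
  also have "\<dots> \<le> R * kin V t + 2 ^ CARD('n) * ((real CARD('n))\<^sup>2 * var t)"
    using sum_hessian_bound[OF t] by (simp add: mult_left_mono)
  also have "\<dots> \<le> (R + 2 ^ CARD('n) * (real CARD('n))\<^sup>2) * (kin V t + var t)"
    using R_nonneg kin_nonneg[OF t, of V] var_nonneg[OF t]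
    by (simp add: distrib_left distrib_right add_increasing add_increasing2)
  also have "\<dots> \<le> bound_const * (kin V t + var t)"
    using kin_nonneg[OF t, of V] var_nonneg[OF t] by (intro mult_right_mono bound_const_ge) auto
  finally show ?thesis .
qed

text \<open>By the continuity equation the derivative moves from \<open>\<rho> * u\<close> to the
  kernel, giving convolutions with the bounded Hessian kernels. These annihilate constants, so
  \<open>V j\<close> times the mean density may be subtracted, and what is left splits into
  \<open>\<rho> * (u - V)\<close> and \<open>V\<close> times the density fluctuation.\<close>

lemma conv_\<rho>t_bound:
  assumes t: "t > 0"
  shows "tint (\<lambda>x. (conv (\<Phi>1 i) (\<rho>t t) x)\<^sup>2)
    \<le> real CARD('n) * (2 * R * kin V t + 2 * (\<Sum>i\<in>UNIV. (V i)\<^sup>2) * var t)"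
proof -
  note pc = pconts[OF t]
  have t0: "t \<ge> 0" using t by simp
  let ?m = "tint (\<rho> 0)"
  let ?g = "\<lambda>j x. \<rho> t x * u j t x - V j * ?m"
  have pg: "pcont (?g j)" for j by (intro pcont_diff pcont_mult pc pcont_const)
  have refl: "has_partial j (\<lambda>y. G (x - y)) (\<lambda>y. - G' (x - y))" if "has_partial j G G'" for G G' x j
    unfolding has_partial_def
  proof
    fix y
    have "((\<lambda>s. G (x - y + (- s) *\<^sub>R axis j 1)) has_real_derivative G' (x - y + (- 0) *\<^sub>R axis j 1) * (-1)) (at 0)"
      by (rule DERIV_chain2[OF has_partialD[OF that]]) (auto intro!: derivative_eq_intros)
    then show "((\<lambda>s. G (x - (y + s *\<^sub>R axis j 1))) has_real_derivative - G' (x - y)) (at 0)"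
      by (simp add: algebra_simps)
  qed
  have eq: "conv (\<Phi>1 i) (\<rho>t t) x = - (\<Sum>j\<in>UNIV. conv (\<Phi>2 i j) (?g j) x)" for x
  proof -
    have \<rho>t: "\<rho>t t = (\<lambda>y. - (\<Sum>j\<in>UNIV. \<rho>x j t y * u j t y + \<rho> t y * ux j j t y))"
      using mass_eq[OF t] by auto
    have "conv (\<Phi>1 i) (\<rho>t t) x
      = - (\<Sum>j\<in>UNIV. tint (\<lambda>y. \<Phi>1 i (x - y) * (\<rho>x j t y * u j t y + \<rho> t y * ux j j t y)))"
      unfolding conv_def \<rho>t
      by (subst tint_sum[symmetric])
        (auto simp: sum_distrib_left sum_negf intro!: pcont_mult pcont_reflect P pcont_add pc)
    also have "\<dots> = - (\<Sum>j\<in>UNIV. conv (\<Phi>2 i j) (?g j) x)"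
    proof -
      have "tint (\<lambda>y. \<Phi>1 i (x - y) * (\<rho>x j t y * u j t y + \<rho> t y * ux j j t y)) = conv (\<Phi>2 i j) (?g j) x" for j
      proof -
      have "tint (\<lambda>y. \<Phi>1 i (x - y) * (\<rho>x j t y * u j t y + \<rho> t y * ux j j t y))
        = - tint (\<lambda>y. - \<Phi>2 i j (x - y) * (\<rho> t y * u j t y))"
        by (rule tint_by_parts[OF refl[OF P(3)]])
          (intro pcont_minus pcont_reflect P has_partial_mult partial_\<rho>[OF t] partial_u[OF t] pcont_mult pcont_add pc)+
      also have "\<dots> = conv (\<Phi>2 i j) (\<lambda>y. \<rho> t y * u j t y) x"
        by (simp add: conv_def)
      also have "\<dots> = conv (\<Phi>2 i j) (?g j) x"
        by (subst conv_\<Phi>2_shift) (auto intro: pcont_mult pc)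
        finally show ?thesis .
      qed
      then show ?thesis by simp
    qed
    finally show ?thesis .
  qed
  have "tint (\<lambda>x. (conv (\<Phi>1 i) (\<rho>t t) x)\<^sup>2) = tint (\<lambda>x. (\<Sum>j\<in>UNIV. conv (\<Phi>2 i j) (?g j) x)\<^sup>2)"
    unfolding eq by simp
  also have "\<dots> \<le> real CARD('n) * (\<Sum>j\<in>UNIV. tint (\<lambda>x. (conv (\<Phi>2 i j) (?g j) x)\<^sup>2))"
    by (intro tint_sum_square_le pcont_conv P pg)
  also have "\<dots> \<le> real CARD('n) * (\<Sum>j\<in>UNIV. 2 * R * tint (\<lambda>x. \<rho> t x * (u j t x - V j)\<^sup>2) + 2 * (V j)\<^sup>2 * var t)"
  proof (intro mult_left_mono sum_mono)
    fix j
    have "tint (\<lambda>x. (conv (\<Phi>2 i j) (?g j) x)\<^sup>2) \<le> tint (\<lambda>x. (?g j x)\<^sup>2)"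
      by (rule conv_hessian_square_le[OF K \<Phi> pg])
    also have "\<dots> \<le> tint (\<lambda>x. 2 * (\<rho> t x * (u j t x - V j))\<^sup>2 + 2 * (V j)\<^sup>2 * (\<rho> t x - ?m)\<^sup>2)"
    proof (rule tint_mono)
      fix x
      have "(a + b)\<^sup>2 \<le> 2 * a\<^sup>2 + 2 * b\<^sup>2" for a b :: real
        using zero_le_power2[of "a - b"] by (simp add: power2_eq_square algebra_simps)
      from this[of "\<rho> t x * (u j t x - V j)" "V j * (\<rho> t x - ?m)"]
      show "(?g j x)\<^sup>2 \<le> 2 * (\<rho> t x * (u j t x - V j))\<^sup>2 + 2 * (V j)\<^sup>2 * (\<rho> t x - ?m)\<^sup>2"
        by (simp add: power_mult_distrib) (simp add: algebra_simps)
    qed (intro pcont_power pg pcont_add pcont_mult pcont_const pcont_diff pc)+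
    also have "\<dots> = 2 * tint (\<lambda>x. (\<rho> t x * (u j t x - V j))\<^sup>2) + 2 * (V j)\<^sup>2 * var t"
    proof (subst tint_add)
      show "pcont (\<lambda>x. 2 * (\<rho> t x * (u j t x - V j))\<^sup>2)" "pcont (\<lambda>x. 2 * (V j)\<^sup>2 * (\<rho> t x - ?m)\<^sup>2)"
        by (intro pcont_power pcont_mult pcont_const pcont_diff pc)+
    qed (simp add: var_def)
    also have "\<dots> \<le> 2 * R * tint (\<lambda>x. \<rho> t x * (u j t x - V j)\<^sup>2) + 2 * (V j)\<^sup>2 * var t"
      using tint_momentum_square_le[OF t0, of j] by simp
    finally show "tint (\<lambda>x. (conv (\<Phi>2 i j) (?g j) x)\<^sup>2)
      \<le> 2 * R * tint (\<lambda>x. \<rho> t x * (u j t x - V j)\<^sup>2) + 2 * (V j)\<^sup>2 * var t" .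
  qed simp
  also have "\<dots> = real CARD('n) * (2 * R * kin V t + 2 * (\<Sum>i\<in>UNIV. (V i)\<^sup>2) * var t)"
    by (simp add: sum.distrib kin_eq[OF t0] sum_distrib_left sum_distrib_right mult.assoc)
  finally show ?thesis .
qed

text \<open>Isolates the pressure. In all other terms Young's inequality puts the small
  \<open>\<delta>\<close> on the density fluctuation, so that \<open>var\<close> can later be
  absorbed, and the large \<open>1 / \<delta>\<close> on quantities controlled by
  dissipation.\<close>

lemma pairing'_ge:
  assumes t: "t > 0" and \<delta>: "0 < \<delta>" "\<delta> \<le> 1" and drag: "drag_bound S e t"
  shows "tint (\<lambda>x. p t x * (conv K (\<rho> t) x - tint (\<rho> 0)))
    \<le> pairing' V \<Phi>1 t + bound_const / \<delta> * (dissipation t + kin V t) + \<delta> * bound_const * var t + e / \<delta>"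
proof -
  note pc = pconts[OF t]
  have t0: "t \<ge> 0" using t by simp
  let ?B = "\<lambda>i. conv (\<Phi>1 i) (\<rho> t)" and ?Bx = "\<lambda>i j. conv (\<Phi>2 i j) (\<rho> t)" and ?T = "\<lambda>i. conv (\<Phi>1 i) (\<rho>t t)"
  let ?Y = "\<lambda>i j x. \<rho> t x * u j t x * (u i t x - V i) - \<mu> * ux i j t x"
  let ?dB = "\<lambda>x. \<Sum>i\<in>UNIV. ?Bx i i x"
  let ?VV = "\<Sum>i\<in>UNIV. (V i)\<^sup>2"
  have B: "pcont (?B i)" "has_partial j (?B i) (?Bx i j)" "pcont (?Bx i j)" "tint (?B i) = 0" "pcont (?T i)" for i j
    using P(7) by (auto intro!: pcont_conv has_partial_conv P pc simp: tint_conv P pc)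
  have pY: "pcont (?Y i j)" for i j by (intro pcont_diff pcont_mult pcont_const pc)
  have pdB: "pcont ?dB" by (intro pcont_sum B)
  have dB: "?dB x = conv K (\<rho> t) x - tint (\<rho> 0)" for x
    using conv_sum_kernel[of UNIV "\<lambda>i. \<Phi>2 i i" "\<rho> t" x] P(2) pc(1) mass_conservation[OF t0]
    by (simp add: P(5) conv_diff_kernel K)
  \<comment> \<open>\<open>?I1\<close> holds convection and shear viscosity, \<open>?I2\<close> the
    pressure, \<open>?I3\<close> the bulk viscosity, \<open>?I4\<close> the drag; \<open>?I5\<close>
    comes from the time derivative of the test field.\<close>
  let ?I1 = "\<Sum>i\<in>UNIV. \<Sum>j\<in>UNIV. tint (\<lambda>x. ?Bx i j x * ?Y i j x)"
  let ?I2 = "tint (\<lambda>x. p t x * ?dB x)"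
  let ?I3 = "tint (\<lambda>x. divu t x * ?dB x)"
  let ?I4 = "tint (\<lambda>x. \<Sum>i\<in>UNIV. F i t x * ?B i x)"
  let ?I5 = "\<Sum>i\<in>UNIV. tint (\<lambda>x. \<rho> t x * (u i t x - V i) * ?T i x)"
  have split: "pairing' V \<Phi>1 t = ?I1 + ?I2 - (\<mu> + lam) * ?I3 - ?I4 + ?I5"
  proof -
    have "pairing' V \<Phi>1 t = tint (\<lambda>x. \<Sum>i\<in>UNIV. (\<rho>t t x * (u i t x - V i) + \<rho> t x * ut i t x) * ?B i x)
      + tint (\<lambda>x. \<Sum>i\<in>UNIV. \<rho> t x * (u i t x - V i) * ?T i x)"
      unfolding pairing'_def sum.distrib
      by (intro tint_add pcont_sum pcont_mult pcont_add pcont_diff pcont_const pc B)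
    also have "tint (\<lambda>x. \<Sum>i\<in>UNIV. (\<rho>t t x * (u i t x - V i) + \<rho> t x * ut i t x) * ?B i x)
      = tint (\<lambda>x. (\<Sum>i\<in>UNIV. \<Sum>j\<in>UNIV. ?Bx i j x * ?Y i j x)
        + (p t x - (\<mu> + lam) * divu t x) * ?dB x - (\<Sum>i\<in>UNIV. F i t x * ?B i x))"
      by (rule weak_momentum[OF t B(1-3)])
    also have "\<dots> = tint (\<lambda>x. ((\<Sum>i\<in>UNIV. \<Sum>j\<in>UNIV. ?Bx i j x * ?Y i j x)
        + (p t x * ?dB x - (\<mu> + lam) * (divu t x * ?dB x))) - (\<Sum>i\<in>UNIV. F i t x * ?B i x))"
      by (simp add: algebra_simps)
    also have "\<dots> = tint (\<lambda>x. \<Sum>i\<in>UNIV. \<Sum>j\<in>UNIV. ?Bx i j x * ?Y i j x) + (?I2 - tint (\<lambda>x. (\<mu> + lam) * (divu t x * ?dB x))) - ?I4"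
      by (subst tint_diff tint_add;
          (intro pcont_sum pcont_mult pcont_diff pcont_add pcont_const pc B pY pdB)?)+ (rule refl)
    also have "tint (\<lambda>x. \<Sum>i\<in>UNIV. \<Sum>j\<in>UNIV. ?Bx i j x * ?Y i j x) = ?I1"
      by (subst tint_sum; (intro finite pcont_sum pcont_mult B pY)?)
        (intro sum.cong refl tint_sum finite pcont_mult B pY)
    also have "tint (\<lambda>x. \<Sum>i\<in>UNIV. \<rho> t x * (u i t x - V i) * ?T i x) = ?I5"
      by (intro tint_sum finite pcont_mult pcont_diff pcont_const pc B)
    finally show ?thesis by simp
  qed
  have b1: "- ?I1 \<le> (2 * R * U\<^sup>2 * real CARD('n) * kin V t + 2 * \<mu>\<^sup>2 * dissipation t) / \<delta> + \<delta> * ((real CARD('n))\<^sup>2 * var t)"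
  proof -
    have "- ?I1 = (\<Sum>i\<in>UNIV. \<Sum>j\<in>UNIV. - tint (\<lambda>x. ?Y i j x * ?Bx i j x))"
      by (simp add: sum_negf mult.commute)
    also have "\<dots> \<le> (\<Sum>i\<in>UNIV. \<Sum>j\<in>UNIV. (2 * R * U\<^sup>2 * tint (\<lambda>x. \<rho> t x * (u i t x - V i)\<^sup>2)
        + 2 * \<mu>\<^sup>2 * tint (\<lambda>x. (ux i j t x)\<^sup>2)) / \<delta> + \<delta> * tint (\<lambda>x. (?Bx i j x)\<^sup>2))"
    proof (intro sum_mono)
      fix i j
      have "- tint (\<lambda>x. ?Y i j x * ?Bx i j x) \<le> tint (\<lambda>x. (?Y i j x)\<^sup>2) / \<delta> + \<delta> * tint (\<lambda>x. (?Bx i j x)\<^sup>2)"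
        using tint_young[where a = "?Y i j" and b = "?Bx i j", OF pY B(3) \<delta>(1)] by linarith
      moreover have "tint (\<lambda>x. (?Y i j x)\<^sup>2) \<le> tint (\<lambda>x. 2 * R * U\<^sup>2 * (\<rho> t x * (u i t x - V i)\<^sup>2) + 2 * \<mu>\<^sup>2 * (ux i j t x)\<^sup>2)"
      proof (rule tint_mono)
        fix x
        have "(a - b)\<^sup>2 \<le> 2 * a\<^sup>2 + 2 * b\<^sup>2" for a b :: real
          using zero_le_power2[of "a + b"] by (simp add: power2_eq_square algebra_simps)
        from this[of "\<rho> t x * u j t x * (u i t x - V i)" "\<mu> * ux i j t x"]
        have "(?Y i j x)\<^sup>2 \<le> 2 * (\<rho> t x * ((u j t x)\<^sup>2 * (\<rho> t x * (u i t x - V i)\<^sup>2))) + 2 * \<mu>\<^sup>2 * (ux i j t x)\<^sup>2"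
          by (simp add: power2_eq_square mult_ac)
        also have "\<rho> t x * ((u j t x)\<^sup>2 * (\<rho> t x * (u i t x - V i)\<^sup>2)) \<le> R * (U\<^sup>2 * (\<rho> t x * (u i t x - V i)\<^sup>2))"
          using \<rho>_le[OF t0] \<rho>_nonneg[OF t0] u_le[OF t0] R_nonneg
          by (intro mult_mono mult_nonneg_nonneg) (auto simp: abs_le_square_iff[symmetric] intro: order.trans[OF _ abs_ge_self])
        finally show "(?Y i j x)\<^sup>2 \<le> 2 * R * U\<^sup>2 * (\<rho> t x * (u i t x - V i)\<^sup>2) + 2 * \<mu>\<^sup>2 * (ux i j t x)\<^sup>2"
          by (simp add: mult_ac)
      qed (intro pcont_power pY pcont_add pcont_mult pcont_const pcont_diff pc)+
      moreover have "\<dots> = 2 * R * U\<^sup>2 * tint (\<lambda>x. \<rho> t x * (u i t x - V i)\<^sup>2) + 2 * \<mu>\<^sup>2 * tint (\<lambda>x. (ux i j t x)\<^sup>2)"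
        by (subst tint_add) (simp_all add: pcont_power pcont_mult pcont_diff pc)
      ultimately show "- tint (\<lambda>x. ?Y i j x * ?Bx i j x) \<le> (2 * R * U\<^sup>2 * tint (\<lambda>x. \<rho> t x * (u i t x - V i)\<^sup>2)
        + 2 * \<mu>\<^sup>2 * tint (\<lambda>x. (ux i j t x)\<^sup>2)) / \<delta> + \<delta> * tint (\<lambda>x. (?Bx i j x)\<^sup>2)"
        using \<delta>(1) by (smt (verit) divide_right_mono)
    qed
    also have "\<dots> = (2 * R * U\<^sup>2 * real CARD('n) * kin V t + 2 * \<mu>\<^sup>2 * dissipation t) / \<delta>
        + \<delta> * (\<Sum>i\<in>UNIV. \<Sum>j\<in>UNIV. tint (\<lambda>x. (?Bx i j x)\<^sup>2))"
      unfolding sum.distrib kin_eq[OF t0] dissipation_def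
      by (simp add: sum_distrib_left sum.distrib sum_divide_distrib add_divide_distrib mult_ac)
    also have "\<dots> \<le> (2 * R * U\<^sup>2 * real CARD('n) * kin V t + 2 * \<mu>\<^sup>2 * dissipation t) / \<delta> + \<delta> * ((real CARD('n))\<^sup>2 * var t)"
      using sum_hessian_bound[OF t0] \<delta>(1) by (simp add: mult_left_mono)
    finally show ?thesis .
  qed
  have b3: "(\<mu> + lam) * ?I3 \<le> \<bar>\<mu> + lam\<bar> * (dissipation t / \<delta> + \<delta> * var t)"
  proof -
    have "\<bar>?I3\<bar> \<le> tint (\<lambda>x. (divu t x)\<^sup>2) / \<delta> + \<delta> * tint (\<lambda>x. (?dB x)\<^sup>2)"
      by (rule tint_young[OF pc(10) pdB \<delta>(1)])
    moreover have "tint (\<lambda>x. (?dB x)\<^sup>2) \<le> var t"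
    proof -
      have "tint (\<lambda>x. (?dB x)\<^sup>2) = tint (\<lambda>x. (conv K (\<lambda>x. \<rho> t x - tint (\<rho> 0)) x)\<^sup>2)"
        by (simp add: dB conv_diff_const K pc)
      also have "\<dots> \<le> var t"
        unfolding var_def by (rule conv_square_le[OF K pcont_var[OF t0]])
      finally show ?thesis .
    qed
    ultimately have "\<bar>?I3\<bar> \<le> dissipation t / \<delta> + \<delta> * var t"
      using tint_divu_le[OF t] \<delta>(1) by (smt (verit) divide_right_mono mult_left_mono)
    then have "\<bar>\<mu> + lam\<bar> * \<bar>?I3\<bar> \<le> \<bar>\<mu> + lam\<bar> * (dissipation t / \<delta> + \<delta> * var t)"
      by (intro mult_left_mono) auto
    moreover have "(\<mu> + lam) * ?I3 \<le> \<bar>\<mu> + lam\<bar> * \<bar>?I3\<bar>"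
      unfolding abs_mult[symmetric] by (rule abs_ge_self)
    ultimately show ?thesis by linarith
  qed
  have b4: "?I4 \<le> e / \<delta> + \<delta> * (S * ((real CARD('n))\<^sup>2 * var t))"
  proof -
    have "\<bar>?I4\<bar> \<le> e / \<delta> + \<delta> * S * (\<Sum>i\<in>UNIV. \<Sum>j\<in>UNIV. tint (\<lambda>x. (?Bx i j x)\<^sup>2))"
      using drag[unfolded drag_bound_def, THEN spec[of _ ?B], THEN spec[of _ ?Bx], THEN spec[of _ \<delta>]] B \<delta>(1)
      by simp
    also have "\<dots> \<le> e / \<delta> + \<delta> * S * ((real CARD('n))\<^sup>2 * var t)"
      using sum_hessian_bound[OF t0] \<delta>(1) S by (intro add_left_mono mult_left_mono) auto
    finally show ?thesis by (simp add: mult.assoc)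
  qed
  have b5: "- ?I5 \<le> R * kin V t / \<delta> + \<delta> * (real CARD('n) * (real CARD('n) * (2 * R * kin V t + 2 * ?VV * var t)))"
  proof -
    have "- ?I5 = (\<Sum>i\<in>UNIV. - tint (\<lambda>x. \<rho> t x * (u i t x - V i) * ?T i x))"
      by (simp add: sum_negf)
    also have "\<dots> \<le> (\<Sum>i\<in>UNIV. R * tint (\<lambda>x. \<rho> t x * (u i t x - V i)\<^sup>2) / \<delta>
        + \<delta> * (real CARD('n) * (2 * R * kin V t + 2 * ?VV * var t)))"
    proof (rule sum_mono)
      fix i
      have "- tint (\<lambda>x. \<rho> t x * (u i t x - V i) * ?T i x)
        \<le> tint (\<lambda>x. (\<rho> t x * (u i t x - V i))\<^sup>2) / \<delta> + \<delta> * tint (\<lambda>x. (?T i x)\<^sup>2)"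
        using tint_young[OF pcont_momentum[OF t0, where i = i and V = V] B(5)[where i = i] \<delta>(1)] by linarith
      also have "\<dots> \<le> R * tint (\<lambda>x. \<rho> t x * (u i t x - V i)\<^sup>2) / \<delta>
        + \<delta> * (real CARD('n) * (2 * R * kin V t + 2 * ?VV * var t))"
        using tint_momentum_square_le[OF t0, of i] conv_\<rho>t_bound[OF t, of i] \<delta>(1)
        by (intro add_mono divide_right_mono mult_left_mono) auto
      finally show "- tint (\<lambda>x. \<rho> t x * (u i t x - V i) * ?T i x)
        \<le> R * tint (\<lambda>x. \<rho> t x * (u i t x - V i)\<^sup>2) / \<delta> + \<delta> * (real CARD('n) * (2 * R * kin V t + 2 * ?VV * var t))" .
    qed
    also have "\<dots> = R * kin V t / \<delta> + \<delta> * (real CARD('n) * (real CARD('n) * (2 * R * kin V t + 2 * ?VV * var t)))"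
      by (simp add: sum.distrib kin_eq[OF t0] sum_distrib_left sum_divide_distrib)
    finally show ?thesis .
  qed
  let ?k = "kin V t" and ?D = "dissipation t" and ?v = "var t"
  have nn: "0 \<le> ?k" "0 \<le> ?D" "0 \<le> ?v"
    using kin_nonneg[OF t0] dissipation_nonneg[OF t] var_nonneg[OF t0] by auto
  \<comment> \<open>The bound for \<open>?I5\<close> carries \<open>kin\<close> also with the factor
    \<open>\<delta>\<close>; as \<open>\<delta> \<le> 1\<close> it can join the terms with
    \<open>1 / \<delta>\<close>.\<close>
  have "\<delta> * (real CARD('n) * (real CARD('n) * (2 * R * ?k))) \<le> 1 / \<delta> * (real CARD('n) * (real CARD('n) * (2 * R * ?k)))"
  proof (rule mult_right_mono)
    have "\<delta> \<le> 1" "1 \<le> 1 / \<delta>" using \<delta> by auto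
    then show "\<delta> \<le> 1 / \<delta>" by linarith
  qed (use nn R_nonneg in auto)
  then have "?I2 - pairing' V \<Phi>1 t \<le>
      1 / \<delta> * ((2 * R * U\<^sup>2 * real CARD('n) + R + 2 * (real CARD('n))\<^sup>2 * R) * ?k + (2 * \<mu>\<^sup>2 + \<bar>\<mu> + lam\<bar>) * ?D)
      + \<delta> * ((\<bar>\<mu> + lam\<bar> + 2 * (real CARD('n))\<^sup>2 * ?VV + (1 + S) * (real CARD('n))\<^sup>2) * ?v) + e / \<delta>"
    using split b1 b3 b4 b5 by (simp add: algebra_simps power2_eq_square add_divide_distrib)
  also have "\<dots> \<le> 1 / \<delta> * (bound_const * ?k + bound_const * ?D) + \<delta> * (bound_const * ?v) + e / \<delta>"
  proof -
    have "2 * R * U\<^sup>2 * real CARD('n) + R + 2 * (real CARD('n))\<^sup>2 * R \<le> bound_const" "2 * \<mu>\<^sup>2 + \<bar>\<mu> + lam\<bar> \<le> bound_const"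
      using bound_const_ge(1) R_nonneg
      by (smt (verit) mult_nonneg_nonneg of_nat_0_le_iff zero_le_power2)+
    then show ?thesis
      using bound_const_ge(2) \<delta>(1) nn
      by (intro add_mono mult_left_mono mult_right_mono) auto
  qed
  finally show ?thesis
    by (simp add: dB algebra_simps add_divide_distrib)
qed

end

text \<open>The estimate is integrated in time for each kernel \<open>K n\<close>. Its right-hand
  side does not depend on \<open>n\<close>, so the limit may be taken on the left, where the
  mollified density becomes the density and monotonicity of the pressure yields \<open>var\<close>.
  The error \<open>E\<close> is a free function because the drag bound holds only for almost every
  time.\<close>

lemma density_dissipation:
  assumes m: "0 < tint (\<rho> 0)"
  shows "\<exists>C>0. \<forall>s t E. 0 < s \<longrightarrow> s \<le> t \<longrightarrow> set_integrable lborel {s..t} E \<longrightarrow> (\<forall>\<tau>. 0 \<le> E \<tau>) \<longrightarrow>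
    (AE \<tau> in lborel. \<tau> \<in> {s..t} \<longrightarrow> drag_bound S (E \<tau>) \<tau>) \<longrightarrow>
    integral {s..t} var \<le> C * (kin V s + var s + kin V t + var t
      + integral {s..t} (\<lambda>\<tau>. dissipation \<tau> + kin V \<tau>) + integral {s..t} E)"
proof -
  define c where "c = tint (\<rho> 0) powr (\<gamma> - 1)"
  define A where "A = bound_const"
  \<comment> \<open>Small enough for half of the left-hand side to absorb
    \<open>\<delta> * A\<close> times the integral of \<open>var\<close>, and at most 1 as
    \<open>pairing'_ge\<close> demands.\<close>
  define \<delta> where "\<delta> = min 1 (c / (2 * A))"
  have c: "c > 0" using m by (simp add: c_def)
  have A: "A \<ge> 1" unfolding A_def by (rule bound_const_ge)
  have \<delta>: "0 < \<delta>" "\<delta> \<le> 1" "\<delta> * A \<le> c / 2"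
  proof -
    show "0 < \<delta>" "\<delta> \<le> 1" using c A by (auto simp: \<delta>_def)
    have "\<delta> * A \<le> c / (2 * A) * A" using A by (intro mult_right_mono) (auto simp: \<delta>_def)
    then show "\<delta> * A \<le> c / 2" using A by simp
  qed
  obtain K :: "nat \<Rightarrow> real ^ 'n \<Rightarrow> real" and \<Phi>1 \<Phi>2
    where K: "\<And>n. pcont (K n)" "\<And>n x. 0 \<le> K n x" "\<And>n. tint (K n) = 1"
      and \<Phi>: "\<And>n. potential (K n) 1 (\<Phi>1 n) (\<Phi>2 n)"
      and lim: "\<And>q g. pcont q \<Longrightarrow> pcont g \<Longrightarrow>
        (\<lambda>n. tint (\<lambda>x. q x * conv (K n) g x)) \<longlonglongrightarrow> tint (\<lambda>x. q x * g x)"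
    using approximate_identity_potentials by blast
  have p\<Phi>: "pcont (\<Phi>1 n i)" for n i using potentialD(1)[OF \<Phi> K(1)] .
  have main: "integral {s..t} var \<le> 2 * A / (\<delta> * c) * (kin V s + var s + kin V t + var t
      + integral {s..t} (\<lambda>\<tau>. dissipation \<tau> + kin V \<tau>) + integral {s..t} E)"
    if s: "0 < s" and st: "s \<le> t" and E: "set_integrable lborel {s..t} E" "\<And>\<tau>. 0 \<le> E \<tau>"
      and drag: "AE \<tau> in lborel. \<tau> \<in> {s..t} \<longrightarrow> drag_bound S (E \<tau>) \<tau>" for s t E
  proof -
    have sub: "{s..t} \<subseteq> {0<..}" "{s..t} \<subseteq> {0..}" using s by auto
    have pos: "0 < \<tau>" "0 \<le> \<tau>" if "\<tau> \<in> {s..t}" for \<tau> using that s by auto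
    have cvar: "continuous_on {s..t} var" by (rule continuous_on_subset[OF continuous_on_var sub(2)])
    have cD: "continuous_on {s..t} (\<lambda>\<tau>. dissipation \<tau> + kin V \<tau>)"
      unfolding dissipation_def
      by (intro continuous_on_add continuous_on_sum continuous_on_subset[OF _ sub(1)] tcont_tint tcont_power tconts
          continuous_on_subset[OF fluid_energy_continuous(2) sub(2)])
    let ?Q = "\<lambda>n \<tau>. tint (\<lambda>x. p \<tau> x * (conv (K n) (\<rho> \<tau>) x - tint (\<rho> 0)))"
    let ?q = "\<lambda>\<tau>. tint (\<lambda>x. p \<tau> x * (\<rho> \<tau> x - tint (\<rho> 0)))"
    have cQ: "continuous_on {s..t} (?Q n)" for n
      by (rule continuous_on_subset[OF tcont_tint sub(1)])
        (intro tcont_mult tcont_diff tcont_const tconts tcont_conv K)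
    have cpair: "continuous_on {s..t} (pairing' V (\<Phi>1 n))" for n
      unfolding pairing'_def[abs_def] by (rule continuous_on_subset[OF tcont_tint[OF tcont_pairing'[OF p\<Phi>]] sub(1)])
    define RHS where "RHS = A * (kin V s + var s + kin V t + var t)
      + A / \<delta> * integral {s..t} (\<lambda>\<tau>. dissipation \<tau> + kin V \<tau>) + \<delta> * A * integral {s..t} var + integral {s..t} E / \<delta>"
    have Qle: "integral {s..t} (?Q n) \<le> RHS" for n
    proof -
      let ?g1 = "\<lambda>\<tau>. pairing' V (\<Phi>1 n) \<tau>" and ?g2 = "\<lambda>\<tau>. A / \<delta> * (dissipation \<tau> + kin V \<tau>)"
        and ?g3 = "\<lambda>\<tau>. \<delta> * A * var \<tau>" and ?g4 = "\<lambda>\<tau>. E \<tau> / \<delta>"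
      have si: "set_integrable lborel {s..t} ?g1" "set_integrable lborel {s..t} ?g2"
        "set_integrable lborel {s..t} ?g3" "set_integrable lborel {s..t} ?g4"
        by (intro borel_integrable_atLeastAtMost' cpair continuous_on_mult continuous_on_const cD cvar
            set_integrable_divide E)+
      have "integral {s..t} (?Q n) = (LINT \<tau>:{s..t}|lborel. ?Q n \<tau>)"
        by (intro set_borel_integral_eq_integral(2)[symmetric] borel_integrable_atLeastAtMost' cQ)
      also have "\<dots> \<le> (LINT \<tau>:{s..t}|lborel. ?g1 \<tau> + ?g2 \<tau> + ?g3 \<tau> + ?g4 \<tau>)"
      proof (rule set_integral_le_AE)
        show "AE \<tau> in lborel. \<tau> \<in> {s..t} \<longrightarrow> ?Q n \<tau> \<le> ?g1 \<tau> + ?g2 \<tau> + ?g3 \<tau> + ?g4 \<tau>"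
          using drag
        proof eventually_elim
          case (elim \<tau>)
          then show ?case
            using pairing'_ge[OF K \<Phi>, of \<tau> \<delta> "E \<tau>" n] pos[of \<tau>] \<delta> by (auto simp: A_def)
        qed
      qed (intro borel_integrable_atLeastAtMost' cQ set_integral_add si)+
      also have "\<dots> = integral {s..t} ?g1 + integral {s..t} ?g2 + integral {s..t} ?g3 + integral {s..t} ?g4"
        by (simp only: set_integral_add si set_borel_integral_eq_integral(2))
      also have "integral {s..t} ?g1 = pairing V (\<Phi>1 n) t - pairing V (\<Phi>1 n) s"
        using pairing_derivative[OF p\<Phi>] pos st
        by (intro integral_unique fundamental_theorem_of_calculus)
          (auto simp: has_real_derivative_iff_has_vector_derivative[symmetric] intro: has_field_derivative_at_within)
      also have "\<dots> \<le> A * (kin V s + var s + kin V t + var t)"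
        using pairing_abs_le[OF K \<Phi>, of t n] pairing_abs_le[OF K \<Phi>, of s n] s st
        by (simp add: A_def algebra_simps abs_le_iff)
      finally show ?thesis by (simp add: RHS_def)
    qed
    \<comment> \<open>At each time this is the weak convergence of the mollified density. The
      majorant exists because \<open>K n\<close> is a probability density, so the mollified density,
      like the mean, stays between 0 and \<open>R\<close>.\<close>
    have "(\<lambda>n. integral {s..t} (?Q n)) \<longlonglongrightarrow> integral {s..t} ?q"
    proof (rule dominated_convergence(2)[where h = "\<lambda>\<tau>. R powr \<gamma> * (2 * R)"])
      show "?Q n integrable_on {s..t}" for n by (intro integrable_continuous_real cQ)
      fix \<tau> assume \<tau>: "\<tau> \<in> {s..t}"
      note pc = pconts[OF pos(1)[OF \<tau>]]
      have Q: "?Q n \<tau> = tint (\<lambda>x. p \<tau> x * conv (K n) (\<rho> \<tau>) x) - tint (p \<tau>) * tint (\<rho> 0)" for n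
        using tint_diff[of "\<lambda>x. p \<tau> x * conv (K n) (\<rho> \<tau>) x" "\<lambda>x. p \<tau> x * tint (\<rho> 0)"] pc K(1)
        by (simp add: right_diff_distrib pcont_mult pcont_conv)
      have q: "?q \<tau> = tint (\<lambda>x. p \<tau> x * \<rho> \<tau> x) - tint (p \<tau>) * tint (\<rho> 0)"
        using tint_diff[of "\<lambda>x. p \<tau> x * \<rho> \<tau> x" "\<lambda>x. p \<tau> x * tint (\<rho> 0)"] pc
        by (simp add: right_diff_distrib pcont_mult)
      show "(\<lambda>n. ?Q n \<tau>) \<longlonglongrightarrow> ?q \<tau>"
        unfolding Q q by (intro tendsto_diff tendsto_const lim pc)
      have \<rho>R: "0 \<le> \<rho> \<sigma> x" "\<rho> \<sigma> x \<le> R" if "\<sigma> \<ge> 0" for \<sigma> x using \<rho>_nonneg \<rho>_le that by auto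
      have conv: "0 \<le> conv (K n) (\<rho> \<tau>) x" "conv (K n) (\<rho> \<tau>) x \<le> R" for n x
      proof -
        have pk: "pcont (\<lambda>y. K n (x - y))" by (rule pcont_reflect[OF K(1)])
        show "0 \<le> conv (K n) (\<rho> \<tau>) x" unfolding conv_def
          by (intro tint_nonneg pcont_mult pk pc mult_nonneg_nonneg K \<rho>R pos(2)[OF \<tau>])
        have "conv (K n) (\<rho> \<tau>) x \<le> tint (\<lambda>y. K n (x - y) * R)" unfolding conv_def
          by (intro tint_mono pcont_mult pk pc pcont_const mult_left_mono K \<rho>R pos(2)[OF \<tau>])
        also have "\<dots> = R" using tint_reflect[OF K(1)[of n], of x] K(3) by simp
        finally show "conv (K n) (\<rho> \<tau>) x \<le> R" .
      qed
      have m': "tint (\<rho> 0) \<le> R"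
      proof -
        have "tint (\<rho> 0) \<le> tint (\<lambda>x :: real ^ 'n. R)"
          by (intro tint_mono tcont_pcont[OF tcont_\<rho>] pcont_const \<rho>R) auto
        then show ?thesis by simp
      qed
      fix n
      have pint: "pcont (\<lambda>x. p \<tau> x * (conv (K n) (\<rho> \<tau>) x - tint (\<rho> 0)))"
        by (intro pcont_mult pcont_diff pcont_conv pcont_const pc K)
      have "\<bar>?Q n \<tau>\<bar> \<le> tint (\<lambda>x. \<bar>p \<tau> x * (conv (K n) (\<rho> \<tau>) x - tint (\<rho> 0))\<bar>)"
        by (rule tint_abs[OF pint])
      also have "\<dots> \<le> tint (\<lambda>x :: real ^ 'n. R powr \<gamma> * (2 * R))"
      proof (rule tint_mono)
        fix x
        have "\<bar>conv (K n) (\<rho> \<tau>) x - tint (\<rho> 0)\<bar> \<le> 2 * R"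
          using conv[of n x] m m' by linarith
        moreover have "\<bar>p \<tau> x\<bar> \<le> R powr \<gamma>"
          using \<rho>R[OF pos(2)[OF \<tau>], of x] \<gamma> by (auto simp: p_def intro!: powr_mono2)
        ultimately show "\<bar>p \<tau> x * (conv (K n) (\<rho> \<tau>) x - tint (\<rho> 0))\<bar> \<le> R powr \<gamma> * (2 * R)"
          unfolding abs_mult by (intro mult_mono) auto
      qed (intro pcont_abs pint pcont_const)+
      finally show "norm (?Q n \<tau>) \<le> R powr \<gamma> * (2 * R)" by simp
    qed auto
    then have "integral {s..t} ?q \<le> RHS"
      by (rule LIMSEQ_le_const2) (use Qle in auto)
    moreover have "c * integral {s..t} var \<le> integral {s..t} ?q"
    proof -
      have "integral {s..t} (\<lambda>\<tau>. c * var \<tau>) \<le> integral {s..t} ?q"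
      proof (rule integral_le)
        show "(\<lambda>\<tau>. c * var \<tau>) integrable_on {s..t}"
          by (intro integrable_continuous_real continuous_on_mult continuous_on_const cvar)
        show "?q integrable_on {s..t}"
          by (intro integrable_continuous_real continuous_on_subset[OF tcont_tint sub(1)] tcont_mult tcont_diff tcont_const tconts)
        fix \<tau> assume \<tau>: "\<tau> \<in> {s..t}"
        note pc = pconts[OF pos(1)[OF \<tau>]]
        have "c * var \<tau> = tint (\<lambda>x. c * (\<rho> \<tau> x - tint (\<rho> 0))\<^sup>2)" by (simp add: var_def)
        \<comment> \<open>The subtracted multiple of the fluctuation integrates to zero by
          conservation of mass; it is inserted to compare the pressure with its value at the mean
          density.\<close>
        also have "\<dots> \<le> tint (\<lambda>x. p \<tau> x * (\<rho> \<tau> x - tint (\<rho> 0)) - tint (\<rho> 0) powr \<gamma> * (\<rho> \<tau> x - tint (\<rho> 0)))"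
        proof (rule tint_mono)
          show "c * (\<rho> \<tau> x - tint (\<rho> 0))\<^sup>2 \<le> p \<tau> x * (\<rho> \<tau> x - tint (\<rho> 0)) - tint (\<rho> 0) powr \<gamma> * (\<rho> \<tau> x - tint (\<rho> 0))" for x
            using powr_diff_mult_ge[OF \<rho>_nonneg[OF pos(2)[OF \<tau>]] m \<gamma>, of x]
            by (simp add: c_def p_def left_diff_distrib)
        qed (intro pcont_mult pcont_diff pcont_power pcont_const pc)+
        also have "\<dots> = ?q \<tau> - tint (\<rho> 0) powr \<gamma> * (tint (\<rho> \<tau>) - tint (\<rho> 0))"
        proof (subst tint_diff)
          show "pcont (\<lambda>x. p \<tau> x * (\<rho> \<tau> x - tint (\<rho> 0)))" "pcont (\<lambda>x. tint (\<rho> 0) powr \<gamma> * (\<rho> \<tau> x - tint (\<rho> 0)))"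
            by (intro pcont_mult pcont_diff pcont_const pc)+
        qed (simp add: tint_diff pc)
        also have "\<dots> = ?q \<tau>" using mass_conservation[OF pos(2)[OF \<tau>]] by simp
        finally show "c * var \<tau> \<le> ?q \<tau>" .
      qed
      then show ?thesis by simp
    qed
    moreover have "\<delta> * A * integral {s..t} var \<le> c / 2 * integral {s..t} var"
      using \<delta>(3) var_nonneg pos
      by (intro mult_right_mono integral_nonneg integrable_continuous_real cvar) auto
    ultimately have "c / 2 * integral {s..t} var \<le> A * (kin V s + var s + kin V t + var t)
      + A / \<delta> * integral {s..t} (\<lambda>\<tau>. dissipation \<tau> + kin V \<tau>) + integral {s..t} E / \<delta>"
      unfolding RHS_def by linarith
    also have "\<dots> \<le> A / \<delta> * (kin V s + var s + kin V t + var t)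
      + A / \<delta> * integral {s..t} (\<lambda>\<tau>. dissipation \<tau> + kin V \<tau>) + A / \<delta> * integral {s..t} E"
    proof (intro add_mono mult_right_mono order.refl)
      show "A \<le> A / \<delta>" using \<delta> A by (simp add: pos_le_divide_eq mult_left_le)
      show "0 \<le> kin V s + var s + kin V t + var t"
        using kin_nonneg[of _ V] var_nonneg s st by (simp add: add_nonneg_nonneg)
      show "0 \<le> integral {s..t} (\<lambda>\<tau>. dissipation \<tau> + kin V \<tau>)"
        using dissipation_nonneg kin_nonneg[of _ V] pos
        by (intro integral_nonneg integrable_continuous_real cD) (auto intro!: add_nonneg_nonneg)
      have "0 \<le> integral {s..t} E"
        by (intro integral_nonneg set_borel_integral_eq_integral(1) E)
      then have "1 * integral {s..t} E \<le> A * integral {s..t} E" using A by (intro mult_right_mono) auto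
      then show "integral {s..t} E / \<delta> \<le> A / \<delta> * integral {s..t} E"
        using \<delta>(1) by (simp add: divide_right_mono)
    qed
    finally have "c / 2 * integral {s..t} var \<le> A / \<delta> * (kin V s + var s + kin V t + var t
      + integral {s..t} (\<lambda>\<tau>. dissipation \<tau> + kin V \<tau>) + integral {s..t} E)"
      by (simp add: distrib_left)
    then show ?thesis using c \<delta>(1) by (simp add: field_simps)
  qed
  show ?thesis
    using main A c \<delta> by (intro exI[of _ "2 * A / (\<delta> * c)"]) auto
qed

end

end

subsection \<open>Moments of the kinetic equation\<close>

lemma has_partial_periodic:
  assumes "torus_periodic g" "has_partial i g g'" shows "torus_periodic g'"
  unfolding torus_periodic_def
proof (intro allI)
  fix x j
  have "((\<lambda>s. g (x + axis j 1 + s *\<^sub>R axis i 1)) has_real_derivative g' (x + axis j 1)) (at 0)"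
    using assms(2) by (simp add: has_partial_def)
  moreover have "g (x + axis j 1 + s *\<^sub>R axis i 1) = g (x + s *\<^sub>R axis i 1)" for s
    using assms(1) by (simp add: torus_periodic_def add.assoc add.commute[of "axis j 1"]) (simp flip: add.assoc)
  ultimately have "((\<lambda>s. g (x + s *\<^sub>R axis i 1)) has_real_derivative g' (x + axis j 1)) (at 0)"
    by simp
  with assms(2) show "g' (x + axis j 1) = g' x"
    unfolding has_partial_def using DERIV_unique by blast
qed

lemma integral_eq_superset:
  fixes g :: "'a::euclidean_space \<Rightarrow> real"
  assumes "S \<subseteq> T" "\<And>x. x \<in> T \<Longrightarrow> x \<notin> S \<Longrightarrow> g x = 0"
  shows "integral T g = integral S g"
proof -
  have "integral T g = integral UNIV (\<lambda>x. if x \<in> T then g x else 0)" by (simp add: integral_restrict_UNIV)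
  also have "\<dots> = integral UNIV (\<lambda>x. if x \<in> S then g x else 0)"
    using assms by (intro arg_cong[where f = "integral UNIV"] ext) auto
  also have "\<dots> = integral S g" by (simp add: integral_restrict_UNIV)
  finally show ?thesis .
qed

text \<open>Cubes instead of balls, so that their product with the torus is again a box, on which
  the Leibniz rule and the exchange of integrals hold for continuous integrands.\<close>

definition cube :: "real \<Rightarrow> (real ^ 'n::finite) set" where
  "cube r = cbox (- (\<chi> i. r)) (\<chi> i. r)"

lemma mem_cube: "v \<in> cube r \<longleftrightarrow> (\<forall>i. \<bar>v $ i\<bar> \<le> r)"
  by (auto simp: cube_def mem_box_cart abs_le_iff) (metis minus_le_iff)+

abbreviation box_xv :: "real \<Rightarrow> ((real ^ 'n::finite) \<times> (real ^ 'n)) set" where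
  "box_xv r \<equiv> cbox (0, - (\<chi> i. r)) (One, \<chi> i. r)"

lemma box_xv_eq: "box_xv r = torus \<times> cube r"
  by (auto simp: torus_def cube_def)

text \<open>The same averaging over unit shifts as on the torus. The larger cube of half-width
  \<open>r + 1\<close> contains the supports of all shifted functions, so its integral does not
  notice the shift.\<close>

lemma integral_partial_compact_support:
  fixes g :: "real ^ 'n::finite \<Rightarrow> real"
  assumes g: "has_partial i g g'" "continuous_on UNIV g" "continuous_on UNIV g'"
    and supp: "\<And>v. v \<notin> cube r \<Longrightarrow> g v = 0" "\<And>v. v \<notin> cube r \<Longrightarrow> g' v = 0"
  shows "integral (cube r) g' = 0"
proof -
  let ?k = "axis i 1 :: real ^ 'n"
  let ?b = "(\<chi> i. r + 1) :: real ^ 'n"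
  have shift: "integral (cbox (- ?b) ?b) (\<lambda>v. h (v + s *\<^sub>R ?k)) = integral (cube r) h"
    if s: "0 \<le> s" "s \<le> 1" and h: "\<And>v. v \<notin> cube r \<Longrightarrow> h v = 0" for s and h :: "real ^ 'n \<Rightarrow> real"
  proof -
    have "integral (cbox (- ?b) ?b) (\<lambda>v. h (v + s *\<^sub>R ?k)) = integral (cbox (- ?b + s *\<^sub>R ?k) (?b + s *\<^sub>R ?k)) h"
      using integral_shift_cbox[of "- ?b + s *\<^sub>R ?k" "s *\<^sub>R ?k" "?b + s *\<^sub>R ?k" h] by simp
    also have "\<dots> = integral (cube r) h"
    proof (rule integral_eq_superset)
      show "cube r \<subseteq> cbox (- ?b + s *\<^sub>R ?k) (?b + s *\<^sub>R ?k)"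
      proof
        fix v :: "real ^ 'n" assume v: "v \<in> cube r"
        have "- (r + 1) + s * ?k $ j \<le> v $ j \<and> v $ j \<le> r + 1 + s * ?k $ j" for j
          using v s by (auto simp: mem_cube axis_nth_if abs_le_iff) (smt (verit))+
        then show "v \<in> cbox (- ?b + s *\<^sub>R ?k) (?b + s *\<^sub>R ?k)" unfolding mem_box_cart by (simp add: algebra_simps)
      qed
    qed (rule h)
    finally show ?thesis .
  qed
  have c: "continuous_on UNIV (\<lambda>(v, s). g' (v + s *\<^sub>R ?k))"
    unfolding case_prod_beta by (intro continuous_on_comp_UNIV[OF g(3)] continuous_intros)
  have int: "(\<lambda>v. g (v + s *\<^sub>R ?k)) integrable_on cbox (- ?b) ?b" for s
    by (intro integrable_continuous continuous_on_comp_UNIV[OF g(2)] continuous_intros)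
  have "integral (cbox (- ?b) ?b) (\<lambda>v. g (v + 1 *\<^sub>R ?k) - g (v + 0 *\<^sub>R ?k))
      = integral (cbox (- ?b) ?b) (\<lambda>v. g (v + 1 *\<^sub>R ?k)) - integral (cbox (- ?b) ?b) (\<lambda>v. g (v + 0 *\<^sub>R ?k))"
    by (rule integral_diff[OF int int])
  also have "\<dots> = 0" using shift[of 1 g] shift[of 0 g] supp(1) by simp
  finally have "0 = integral (cbox (- ?b) ?b) (\<lambda>v. g (v + ?k) - g v)" by simp
  also have "(\<lambda>v. g (v + ?k) - g v) = (\<lambda>v. integral {0..1} (\<lambda>s. g' (v + s *\<^sub>R ?k)))"
    using integral_unique[OF has_partial_ftc[OF g(1), of 1]] by auto
  also have "integral (cbox (- ?b) ?b) \<dots> = integral {0..1} (\<lambda>s. integral (cbox (- ?b) ?b) (\<lambda>v. g' (v + s *\<^sub>R ?k)))"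
    unfolding cbox_interval[symmetric]
    by (rule integral_swap_continuous) (rule continuous_on_subset[OF c], simp)
  also have "\<dots> = integral {0..1::real} (\<lambda>s. integral (cube r) g')"
    by (rule integral_cong) (use shift[of _ g'] supp(2) in auto)
  finally show ?thesis by simp
qed

definition xvcont :: "real set \<Rightarrow> (real \<Rightarrow> real ^ 'n::finite \<Rightarrow> real ^ 'n \<Rightarrow> real) \<Rightarrow> bool" where
  "xvcont S F \<longleftrightarrow> continuous_on (S \<times> UNIV) (\<lambda>(t, x, v). F t x v)"

lemma xvcont_compose:
  assumes "xvcont S F" "continuous_on A h" "continuous_on A k" "continuous_on A l" "\<And>z. z \<in> A \<Longrightarrow> h z \<in> S"
  shows "continuous_on A (\<lambda>z. F (h z) (k z) (l z))"
proof -
  have "continuous_on (S \<times> UNIV) (\<lambda>q. F (fst q) (fst (snd q)) (snd (snd q)))"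
    using assms(1) by (simp add: xvcont_def case_prod_beta)
  from continuous_on_compose2[OF this continuous_on_Pair[OF assms(2) continuous_on_Pair[OF assms(3,4)]]] assms(5)
  show ?thesis by (simp add: image_subset_iff)
qed

text \<open>\<open>fx i\<close> and \<open>fv i\<close> are the derivatives of \<open>f\<close> in the \<open>i\<close>-th position and velocity coordinate, and
  \<open>q t\<close> is the interaction term at time \<open>t\<close>.\<close>

locale kinetic_flow =
  fixes f ft q :: "real \<Rightarrow> real ^ 'n::finite \<Rightarrow> real ^ 'n \<Rightarrow> real"
    and fx fv :: "'n \<Rightarrow> real \<Rightarrow> real ^ 'n \<Rightarrow> real ^ 'n \<Rightarrow> real"
    and u :: "'n \<Rightarrow> real \<Rightarrow> real ^ 'n \<Rightarrow> real"
    and U :: real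
  assumes cont_f: "xvcont {0..} f" and cont_ft: "xvcont {0<..} ft"
    and cont_fx: "xvcont {0<..} (fx i)" and cont_fv: "xvcont {0<..} (fv i)"
    and cont_u: "tcont {0..} (u i)"
    and u_bound: "t \<ge> 0 \<Longrightarrow> \<bar>u i t x\<bar> \<le> U"
    and periodic_f: "t \<ge> 0 \<Longrightarrow> torus_periodic (f t)"
    and f_nonneg: "t \<ge> 0 \<Longrightarrow> 0 \<le> f t x v"
    and deriv_f: "t > 0 \<Longrightarrow> ((\<lambda>s. f s x v) has_real_derivative ft t x v) (at t)"
    and partial_fx: "t > 0 \<Longrightarrow> has_partial i (\<lambda>x. f t x v) (\<lambda>x. fx i t x v)"
    and partial_fv: "t > 0 \<Longrightarrow> has_partial i (f t x) (fv i t x)"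
    and vlasov: "t > 0 \<Longrightarrow> ft t x v + (\<Sum>i\<in>UNIV. v $ i * fx i t x v)
      + (\<Sum>i\<in>UNIV. fv i t x v * (u i t x - v $ i) - f t x v) = q t x v"
    and moments_v: "t \<ge> 0 \<Longrightarrow> integrable lborel (\<lambda>v. (1 + norm v) * f t x v)"
    and moments_xv: "t \<ge> 0 \<Longrightarrow> set_integrable lborel phase_space (\<lambda>(x, v). (1 + (norm v)\<^sup>2) * f t x v)"
    and moments_txv: "T > 0 \<Longrightarrow> set_integrable lborel ({0..T} \<times> phase_space)
        (\<lambda>(t, x, v). (1 + (norm v)\<^sup>2) * f t x v)"
    and moments_q: "T > 0 \<Longrightarrow> set_integrable lborel ({0<..T} \<times> phase_space)
        (\<lambda>(t, x, v). (1 + (norm v)\<^sup>2) * q t x v)"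
    and interaction: "t > 0 \<Longrightarrow> interaction_conditions (q t)"
begin

text \<open>Nothing is assumed about the regularity of the interaction term; it is continuous
  because the equation expresses it by continuous functions.\<close>

lemma cont_q: "xvcont {0<..} q"
proof -
  have "continuous_on ({0<..} \<times> UNIV) (\<lambda>z. ft (fst z) (fst (snd z)) (snd (snd z))
      + (\<Sum>i\<in>UNIV. snd (snd z) $ i * fx i (fst z) (fst (snd z)) (snd (snd z)))
      + (\<Sum>i\<in>UNIV. fv i (fst z) (fst (snd z)) (snd (snd z)) * (u i (fst z) (fst (snd z)) - snd (snd z) $ i)
         - f (fst z) (fst (snd z)) (snd (snd z))))"
    by (intro continuous_on_add continuous_on_sum continuous_on_mult continuous_on_diff
        xvcont_compose[OF cont_ft] xvcont_compose[OF cont_fx] xvcont_compose[OF cont_fv] xvcont_compose[OF cont_f]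
        continuous_on_tcont_compose[OF cont_u] continuous_intros) auto
  moreover have "continuous_on ({0<..} \<times> UNIV) (\<lambda>(t, x, v). q t x v)
    \<longleftrightarrow> continuous_on ({0<..} \<times> UNIV) (\<lambda>z. ft (fst z) (fst (snd z)) (snd (snd z))
      + (\<Sum>i\<in>UNIV. snd (snd z) $ i * fx i (fst z) (fst (snd z)) (snd (snd z)))
      + (\<Sum>i\<in>UNIV. fv i (fst z) (fst (snd z)) (snd (snd z)) * (u i (fst z) (fst (snd z)) - snd (snd z) $ i)
         - f (fst z) (fst (snd z)) (snd (snd z))))"
    by (rule continuous_on_cong) (auto simp: vlasov)
  ultimately show ?thesis by (simp add: xvcont_def)
qed

text \<open>The integrand of the time derivative of the moment of \<open>\<phi>\<close>, after
  transport in \<open>x\<close> has integrated to zero and the divergence in \<open>v\<close> has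
  been moved onto \<open>\<phi>\<close>.\<close>

definition rate where
  "rate \<phi> \<phi>' t x v = (\<Sum>i\<in>UNIV. \<phi>' i v * (u i t x - v $ i)) * f t x v + \<phi> v * q t x v"

context
  fixes \<phi> :: "real ^ 'n \<Rightarrow> real" and \<phi>' :: "'n \<Rightarrow> real ^ 'n \<Rightarrow> real" and r :: real
  assumes \<phi>: "\<And>i. has_partial i \<phi> (\<phi>' i)" "continuous_on UNIV \<phi>" "\<And>i. continuous_on UNIV (\<phi>' i)"
    and supp: "\<And>v. v \<notin> cube r \<Longrightarrow> \<phi> v = 0" "\<And>i v. v \<notin> cube r \<Longrightarrow> \<phi>' i v = 0"
begin

lemma moment_continuous: "continuous_on {0..} (\<lambda>t. integral (box_xv r) (\<lambda>(x, v). \<phi> v * f t x v))"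
proof (rule integral_continuous_on_param)
  show "continuous_on ({0..} \<times> (box_xv r)) (\<lambda>(t, z). case z of (x, v) \<Rightarrow> \<phi> v * f t x v)"
    unfolding case_prod_beta
    by (intro continuous_on_mult continuous_on_comp_UNIV[OF \<phi>(2)] xvcont_compose[OF cont_f] continuous_intros) auto
qed

text \<open>Compact support makes the domain a fixed box with continuous integrands. There
  \<open>\<phi> * ft\<close> differs from \<open>rate\<close> by \<open>h1\<close>, a derivative in
  \<open>x\<close> of a periodic function, and \<open>h2\<close>, a derivative in \<open>v\<close>
  of a compactly supported one; both integrate to zero.\<close>

lemma moment_derivative_compact:
  assumes t: "t > 0"
  shows "((\<lambda>t. integral (box_xv r) (\<lambda>(x, v). \<phi> v * f t x v)) has_real_derivative
    integral (box_xv r) (\<lambda>(x, v). rate \<phi> \<phi>' t x v)) (at t)"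
proof -
  have "((\<lambda>t. integral (box_xv r) (\<lambda>(x, v). \<phi> v * f t x v)) has_real_derivative
    integral (box_xv r) (\<lambda>(x, v). \<phi> v * ft t x v)) (at t within {0<..})"
  proof (rule leibniz_rule_field_derivative)
    show "((\<lambda>t. case z of (x, v) \<Rightarrow> \<phi> v * f t x v) has_real_derivative (case z of (x, v) \<Rightarrow> \<phi> v * ft s x v)) (at s within {0<..})"
      if "s \<in> {0<..}" for s z
      using that unfolding case_prod_beta
      by (intro DERIV_cmult has_field_derivative_at_within[OF deriv_f]) simp
    show "(\<lambda>(x, v). \<phi> v * f s x v) integrable_on (box_xv r)" if "s \<in> {0<..}" for s
      unfolding case_prod_beta
      by (intro integrable_continuous continuous_on_mult continuous_on_comp_UNIV[OF \<phi>(2)] xvcont_compose[OF cont_f] continuous_intros)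
        (use that in auto)
    show "continuous_on ({0<..} \<times> (box_xv r)) (\<lambda>(s, z). case z of (x, v) \<Rightarrow> \<phi> v * ft s x v)"
      unfolding case_prod_beta
      by (intro continuous_on_mult continuous_on_comp_UNIV[OF \<phi>(2)] xvcont_compose[OF cont_ft] continuous_intros) auto
  qed (use t in auto)
  then have D: "((\<lambda>t. integral (box_xv r) (\<lambda>(x, v). \<phi> v * f t x v)) has_real_derivative
    integral (box_xv r) (\<lambda>(x, v). \<phi> v * ft t x v)) (at t)"
    using at_within_open[of t "{0<..}"] t by simp
  define h1 where "h1 i x v = \<phi> v * v $ i * fx i t x v" for i x v
  define h2 where "h2 i x v = \<phi>' i v * (f t x v * (u i t x - v $ i)) + (fv i t x v * (u i t x - v $ i) + f t x v * (- 1)) * \<phi> v" for i x v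
  have cf: "continuous_on A (\<lambda>z. f t (k z) (l z))" "continuous_on A (\<lambda>z. fx i t (k z) (l z))"
    "continuous_on A (\<lambda>z. fv i t (k z) (l z))" "continuous_on A (\<lambda>z. q t (k z) (l z))"
    if "continuous_on A k" "continuous_on A l" for A and k l :: "'c::topological_space \<Rightarrow> real ^ 'n" and i
    using t by (intro xvcont_compose[OF cont_f] xvcont_compose[OF cont_fx] xvcont_compose[OF cont_fv]
        xvcont_compose[OF cont_q] that continuous_on_const; simp)+
  have cu: "continuous_on A (\<lambda>z. u i t (k z))"
    if "continuous_on A k" for A and k :: "'c::topological_space \<Rightarrow> real ^ 'n" and i
    using t by (intro continuous_on_tcont_compose[OF cont_u] that continuous_on_const; simp)
  have cont1: "continuous_on A (\<lambda>z. h1 i (fst z) (snd z))" for A i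
    unfolding h1_def by (intro continuous_on_mult continuous_on_comp_UNIV[OF \<phi>(2)] cf cu continuous_intros)
  have cont2: "continuous_on A (\<lambda>z. h2 i (fst z) (snd z))" for A i
    unfolding h2_def
    by (intro continuous_on_add continuous_on_mult continuous_on_diff continuous_on_comp_UNIV[OF \<phi>(2)]
        continuous_on_comp_UNIV[OF \<phi>(3)] cf cu continuous_intros)
  have contr: "continuous_on A (\<lambda>z. rate \<phi> \<phi>' t (fst z) (snd z))" for A
    unfolding rate_def
    by (intro continuous_on_add continuous_on_sum continuous_on_mult continuous_on_diff continuous_on_comp_UNIV[OF \<phi>(2)]
        continuous_on_comp_UNIV[OF \<phi>(3)] cf cu continuous_intros)
  have zero1: "integral (box_xv r) (\<lambda>z. h1 i (fst z) (snd z)) = 0" for i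
  proof -
    have "integral (box_xv r) (\<lambda>z. h1 i (fst z) (snd z))
      = integral (cbox 0 One) (\<lambda>x. integral (cbox (- (\<chi> i. r)) (\<chi> i. r)) (\<lambda>v. h1 i x v))"
      by (subst integral_prod_continuous[OF cont1]) simp
    also have "\<dots> = integral (cbox (- (\<chi> i. r)) (\<chi> i. r)) (\<lambda>v. tint (\<lambda>x. h1 i x v))"
      unfolding torus_def using cont1[of _ i]
      by (intro integral_swap_continuous) (simp add: case_prod_beta)
    also have "\<dots> = 0"
    proof -
      have "tint (\<lambda>x. h1 i x v) = 0" for v
      proof -
        have per: "torus_periodic (\<lambda>x. f t x v)"
          using periodic_f[of t] t by (simp add: torus_periodic_def)
        have "tint (\<lambda>x. fx i t x v) = 0"
          using has_partial_periodic[OF per partial_fx[OF t]] per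
          by (intro tint_partial[OF partial_fx[OF t]]) (auto simp: pcont_def intro!: cf cu continuous_intros)
        then show ?thesis by (simp add: h1_def)
      qed
      then show ?thesis by simp
    qed
    finally show ?thesis .
  qed
  have zero2: "integral (box_xv r) (\<lambda>z. h2 i (fst z) (snd z)) = 0" for i
  proof -
    have "integral (box_xv r) (\<lambda>z. h2 i (fst z) (snd z)) = integral (cbox 0 One) (\<lambda>x. integral (cube r) (h2 i x))"
      unfolding cube_def by (subst integral_prod_continuous[OF cont2]) simp
    also have "\<dots> = 0"
    proof -
      have "integral (cube r) (h2 i x) = 0" for x
      proof (rule integral_partial_compact_support)
        have "has_partial i (\<lambda>v. u i t x - v $ i) (\<lambda>v. - 1)"
          by (auto simp: has_partial_def intro!: derivative_eq_intros)
        then show "has_partial i (\<lambda>v. \<phi> v * (f t x v * (u i t x - v $ i))) (h2 i x)"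
          unfolding h2_def
          using has_partial_mult[OF \<phi>(1)[of i] has_partial_mult[OF partial_fv[OF t, of i x]],
              of "\<lambda>v. u i t x - v $ i" "\<lambda>v. - 1"]
          by (simp add: mult.commute[of _ "\<phi> _"])
        show "continuous_on UNIV (\<lambda>v. \<phi> v * (f t x v * (u i t x - v $ i)))"
          by (intro continuous_on_mult continuous_on_diff \<phi> cf cu continuous_intros)
        have "continuous_on UNIV (\<lambda>v. (\<lambda>z. h2 i (fst z) (snd z)) (x, v))"
          by (rule continuous_on_comp_UNIV[OF cont2]) (intro continuous_intros)
        then show "continuous_on UNIV (h2 i x)" by simp
      qed (use supp in \<open>auto simp: h2_def\<close>)
      then show ?thesis by simp
    qed
    finally show ?thesis .
  qed
  have eq: "\<phi> v * ft t x v = rate \<phi> \<phi>' t x v - (\<Sum>i\<in>UNIV. h1 i x v) - (\<Sum>i\<in>UNIV. h2 i x v)" for x v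
  proof -
    have ft: "ft t x v = q t x v - (\<Sum>i\<in>UNIV. v $ i * fx i t x v)
      - (\<Sum>i\<in>UNIV. fv i t x v * (u i t x - v $ i) - f t x v)"
      using vlasov[OF t, of x v] by linarith
    show ?thesis
      unfolding ft rate_def h1_def h2_def
      by (simp add: sum.distrib sum_subtractf sum_distrib_left sum_distrib_right algebra_simps)
  qed
  have "integral (box_xv r) (\<lambda>(x, v). \<phi> v * ft t x v)
    = integral (box_xv r) (\<lambda>z. rate \<phi> \<phi>' t (fst z) (snd z) - (\<Sum>i\<in>UNIV. h1 i (fst z) (snd z)) - (\<Sum>i\<in>UNIV. h2 i (fst z) (snd z)))"
    unfolding case_prod_beta eq ..
  also have "\<dots> = integral (box_xv r) (\<lambda>z. rate \<phi> \<phi>' t (fst z) (snd z))"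
    by (subst integral_diff integral_sum; (intro integrable_diff integrable_sum finite integrable_continuous contr cont1 cont2)?)+
      (simp add: zero1 zero2)
  finally show ?thesis using D unfolding case_prod_beta by simp
qed

end

end

section \<open>Fubini's theorem, quadratic weights and velocity cutoffs\<close>

lemma set_integral_product:
  fixes h :: "'a::euclidean_space \<times> 'b::euclidean_space \<Rightarrow> real"
  assumes h: "set_integrable lborel (A \<times> B) h"
  shows "AE x in lborel. x \<in> A \<longrightarrow> set_integrable lborel B (\<lambda>y. h (x, y))"
    and "set_integrable lborel A (\<lambda>x. LINT y:B|lborel. h (x, y))"
    and "(LINT z:A \<times> B|lborel. h z) = (LINT x:A|lborel. LINT y:B|lborel. h (x, y))"
proof -
  have pair: "pair_sigma_finite (lborel :: 'a measure) (lborel :: 'b measure)" ..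
  let ?g = "\<lambda>z. indicator (A \<times> B) z *\<^sub>R h z"
  have i: "integrable (lborel \<Otimes>\<^sub>M lborel) ?g"
    using h by (simp add: set_integrable_def lborel_prod)
  have g: "?g (x, y) = indicator A x *\<^sub>R (indicator B y *\<^sub>R h (x, y))" for x y
    by (simp add: indicator_times)
  show "AE x in lborel. x \<in> A \<longrightarrow> set_integrable lborel B (\<lambda>y. h (x, y))"
    using pair_sigma_finite.AE_integrable_fst'[OF pair i] unfolding g set_integrable_def
    by eventually_elim auto
  show "set_integrable lborel A (\<lambda>x. LINT y:B|lborel. h (x, y))"
    using pair_sigma_finite.integrable_fst'[OF pair i] unfolding g set_integrable_def set_lebesgue_integral_def by simp
  show "(LINT z:A \<times> B|lborel. h z) = (LINT x:A|lborel. LINT y:B|lborel. h (x, y))"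
    using pair_sigma_finite.integral_fst'[OF pair i] unfolding g set_lebesgue_integral_def by (simp add: lborel_prod)
qed

lemma set_integrable_mult_bounded:
  fixes g m :: "'a \<Rightarrow> real"
  assumes g: "set_integrable M A g" and m: "m \<in> borel_measurable M" and b: "\<And>z. z \<in> A \<Longrightarrow> \<bar>m z\<bar> \<le> c"
  shows "set_integrable M A (\<lambda>z. m z * g z)"
proof -
  have "set_integrable M A (\<lambda>z. c * g z)" using g by simp
  moreover have "set_borel_measurable M A (\<lambda>z. m z * g z)"
  proof -
    have "(\<lambda>z. m z * (indicator A z *\<^sub>R g z)) \<in> borel_measurable M"
      using g m unfolding set_integrable_def by (intro borel_measurable_times) auto
    then show ?thesis by (simp add: set_borel_measurable_def mult.left_commute)
  qed
  moreover have "AE z in M. z \<in> A \<longrightarrow> norm (m z * g z) \<le> norm (c * g z)"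
  proof (rule AE_I2, rule impI)
    fix z assume "z \<in> A"
    from b[OF this] have "\<bar>m z\<bar> \<le> \<bar>c\<bar>" by linarith
    then show "norm (m z * g z) \<le> norm (c * g z)"
      by (simp add: abs_mult mult_right_mono)
  qed
  ultimately show ?thesis by (rule set_integrable_bound)
qed

text \<open>The weight of the moment assumptions. Dividing by it turns integrands of quadratic
  growth into bounded multipliers of an integrable function.\<close>

definition wt :: "real ^ 'n::finite \<Rightarrow> real" where "wt v = 1 + (norm v)\<^sup>2"

lemma wt_ge: "1 \<le> wt v" "0 < wt v" "(1 + norm v)\<^sup>2 \<le> 2 * wt v" "1 + norm v \<le> 2 * wt v"
proof -
  show "1 \<le> wt v" "0 < wt v" by (auto simp: wt_def add_pos_nonneg)
  show 2: "(1 + norm v)\<^sup>2 \<le> 2 * wt v"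
    using zero_le_power2[of "1 - norm v"] by (simp add: wt_def power2_eq_square algebra_simps)
  have "1 + norm v \<le> (1 + norm v)\<^sup>2"
    by (simp add: power2_eq_square algebra_simps)
  with 2 show "1 + norm v \<le> 2 * wt v" by linarith
qed

lemma wt_cancel: "a / wt v * (wt v * b) = a * b"
  using wt_ge(2)[of v] by simp

lemma wt_measurable: "continuous_on UNIV h \<Longrightarrow> (\<lambda>z. wt (h z)) \<in> borel_measurable borel"
  unfolding wt_def[abs_def] by (intro borel_measurable_continuous_onI continuous_intros)

lemma wt_bounds_mult:
  fixes a b :: real
  assumes "\<bar>a\<bar> \<le> c * (1 + norm v)" "\<bar>b\<bar> \<le> d * (1 + norm v)" "0 \<le> c"
  shows "\<bar>a * b\<bar> \<le> 2 * c * d * wt v"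
proof -
  have "0 \<le> d * (1 + norm v)" using assms(2) by (rule order.trans[OF abs_ge_zero])
  moreover have "0 < 1 + norm v" by (simp add: add_pos_nonneg)
  ultimately have d: "0 \<le> d" by (simp add: zero_le_mult_iff)
  have "\<bar>a * b\<bar> \<le> (c * (1 + norm v)) * (d * (1 + norm v))"
    unfolding abs_mult using assms by (intro mult_mono) auto
  also have "\<dots> = c * d * (1 + norm v)\<^sup>2" by (simp add: power2_eq_square)
  also have "\<dots> \<le> c * d * (2 * wt v)" using assms d by (intro mult_left_mono wt_ge) auto
  finally show ?thesis by simp
qed

text \<open>The square of a truncated quadratic polynomial is continuously differentiable with an
  explicit derivative and has compact support. The radius \<open>n + 1\<close> avoids a division by
  zero at \<open>n = 0\<close>.\<close>

definition cutoff :: "nat \<Rightarrow> real ^ 'n::finite \<Rightarrow> real" where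
  "cutoff n v = (max 0 (1 - (norm v)\<^sup>2 / (real n + 1)\<^sup>2))\<^sup>2"

definition cutoff' :: "nat \<Rightarrow> 'n::finite \<Rightarrow> real ^ 'n \<Rightarrow> real" where
  "cutoff' n i v = 2 * max 0 (1 - (norm v)\<^sup>2 / (real n + 1)\<^sup>2) * (- 2 * v $ i / (real n + 1)\<^sup>2)"

lemma has_partial_cutoff: "has_partial i (cutoff n) (cutoff' n i)"
proof -
  let ?R = "(real n + 1)\<^sup>2"
  have "has_partial i (\<lambda>v. 1 - c * (norm v)\<^sup>2) (\<lambda>v. - (c * (2 * v $ i)))" for c
    by (auto simp: has_partial_def power2_norm_eq_inner inner_add_left inner_add_right inner_axis inner_axis'
        intro!: derivative_eq_intros)
  from this[of "1 / ?R"] have "has_partial i (\<lambda>v. 1 - (norm v)\<^sup>2 / ?R) (\<lambda>v. - 2 * v $ i / ?R)"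
    by simp
  moreover have "((\<lambda>s :: real. (max 0 s)\<^sup>2) has_real_derivative 2 * max 0 s) (at s)" for s
  proof -
    have eq: "(\<lambda>s :: real. max 0 s powr 2) = (\<lambda>s. (max 0 s)\<^sup>2)"
    proof
      fix s :: real show "max 0 s powr 2 = (max 0 s)\<^sup>2" by (cases "s > 0") auto
    qed
    show ?thesis using max_0_powr_derivative[of 2 s] unfolding eq by simp
  qed
  ultimately show ?thesis
    unfolding cutoff_def[abs_def] cutoff'_def[abs_def] by (rule has_partial_chain)
qed

lemma continuous_cutoff: "continuous_on UNIV (cutoff n)" "continuous_on UNIV (cutoff' n i)"
  unfolding cutoff_def[abs_def] cutoff'_def[abs_def] by (intro continuous_intros; simp add: add_nonneg_eq_0_iff)+

lemma cutoff_bounds: "0 \<le> cutoff n v" "cutoff n v \<le> 1"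
  unfolding cutoff_def by (auto intro!: power_le_one)

lemma cutoff_nonpos:
  assumes "real n + 1 \<le> norm v" shows "1 - (norm v)\<^sup>2 / (real n + 1)\<^sup>2 \<le> 0"
proof -
  have "(real n + 1)\<^sup>2 \<le> (norm v)\<^sup>2" using assms by (intro power_mono) auto
  moreover have "0 < (real n + 1)\<^sup>2" by (intro zero_less_power) simp
  ultimately have "1 \<le> (norm v)\<^sup>2 / (real n + 1)\<^sup>2" by (simp only: le_divide_eq_1_pos)
  then show ?thesis by linarith
qed

lemma cutoff_support:
  assumes "v \<notin> cube (real n + 1)" shows "cutoff n v = 0" "cutoff' n i v = 0"
proof -
  obtain j where "real n + 1 < \<bar>v $ j\<bar>" using assms by (auto simp: mem_cube not_le)
  also have "\<dots> \<le> norm v" by (rule component_le_norm_cart)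
  finally have "1 - (norm v)\<^sup>2 / (real n + 1)\<^sup>2 \<le> 0" by (intro cutoff_nonpos less_imp_le)
  then show "cutoff n v = 0" "cutoff' n i v = 0" by (simp_all add: cutoff_def cutoff'_def)
qed

text \<open>On the support the weight is at most \<open>2 * (n + 1)^2\<close>, which offsets the
  denominator of the derivative. The bound is uniform in \<open>n\<close>: the cutoff of a function
  of quadratic growth gains only a derivative of linear growth, as dominated convergence
  requires.\<close>

lemma cutoff'_bound: "wt v * \<bar>cutoff' n i v\<bar> \<le> 8 * norm v"
proof (cases "norm v \<le> real n + 1")
  case True
  let ?R = "(real n + 1)\<^sup>2"
  have R: "1 \<le> ?R" by (simp add: power2_eq_square algebra_simps)
  have "(norm v)\<^sup>2 \<le> ?R" using True by (intro power_mono) auto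
  then have w: "wt v \<le> 2 * ?R" unfolding wt_def using R by linarith
  have m: "0 \<le> max 0 (1 - (norm v)\<^sup>2 / ?R)" "max 0 (1 - (norm v)\<^sup>2 / ?R) \<le> 1" by auto
  have "wt v * \<bar>cutoff' n i v\<bar> = (wt v / ?R) * (4 * (max 0 (1 - (norm v)\<^sup>2 / ?R) * \<bar>v $ i\<bar>))"
    by (simp add: cutoff'_def abs_mult)
  also have "\<dots> \<le> 2 * (4 * (1 * norm v))"
    using m w R wt_ge(2)[of v] component_le_norm_cart[of v i]
    by (intro mult_mono) (auto simp: pos_divide_le_eq)
  finally show ?thesis by simp
next
  case False
  then have "1 - (norm v)\<^sup>2 / (real n + 1)\<^sup>2 \<le> 0" by (intro cutoff_nonpos) simp
  then show ?thesis by (simp add: cutoff'_def)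
qed

lemma cutoff_limit: "(\<lambda>n. cutoff n v) \<longlonglongrightarrow> 1" "(\<lambda>n. cutoff' n i v) \<longlonglongrightarrow> 0"
proof -
  have inv: "(\<lambda>n. c / (real n + 1)\<^sup>2) \<longlonglongrightarrow> 0" for c :: real
  proof -
    have "(\<lambda>n. c * (inverse (real (Suc n)) * inverse (real (Suc n)))) \<longlonglongrightarrow> c * (0 * 0)"
      by (intro tendsto_intros LIMSEQ_inverse_real_of_nat)
    then show ?thesis by (simp add: field_simps power2_eq_square)
  qed
  have m: "(\<lambda>n. max 0 (1 - (norm v)\<^sup>2 / (real n + 1)\<^sup>2)) \<longlonglongrightarrow> max 0 (1 - 0)"
    by (intro tendsto_intros inv)
  show "(\<lambda>n. cutoff n v) \<longlonglongrightarrow> 1"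
    unfolding cutoff_def using tendsto_power[OF m, of 2] by simp
  show "(\<lambda>n. cutoff' n i v) \<longlonglongrightarrow> 0"
    unfolding cutoff'_def using tendsto_mult[OF tendsto_mult[OF tendsto_const m] inv[of "- 2 * v $ i"], of 2] by simp
qed

context kinetic_flow begin

lemma U_nonneg: "0 \<le> U"
  using u_bound[of 0 undefined 0] by linarith

lemma velocity_bound: "t \<ge> 0 \<Longrightarrow> \<bar>u i t x - v $ i\<bar> \<le> (U + 1) * (1 + norm v)"
proof -
  assume "t \<ge> 0"
  then have "\<bar>u i t x - v $ i\<bar> \<le> U + norm v"
    using u_bound[of t i x] component_le_norm_cart[of v i] by linarith
  also have "\<dots> \<le> (U + 1) * (1 + norm v)"
    using U_nonneg by (simp add: algebra_simps)
  finally show ?thesis .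
qed

text \<open>Freezing the velocity field at negative times makes it continuous, hence measurable, everywhere.\<close>

definition uu where "uu i t x = u i (max 0 t) x"

lemma continuous_uu: "continuous_on A h \<Longrightarrow> continuous_on A k \<Longrightarrow> continuous_on A (\<lambda>z. uu i (h z) (k z))"
  unfolding uu_def by (intro continuous_on_tcont_compose[OF cont_u] continuous_intros) auto

text \<open>The product is \<open>m / wt\<close>, bounded and measurable, times the weighted
  function, integrable by assumption. Time intervals are open at the left, since the interaction
  term is only known at positive times.\<close>

lemma integrable_weighted_f:
  assumes s: "0 \<le> s" "s \<le> t" and m: "(\<lambda>(t, x, v). m t x v) \<in> borel_measurable borel"
    and b: "\<And>\<tau> x v. 0 \<le> \<tau> \<Longrightarrow> \<bar>m \<tau> x v\<bar> \<le> c * wt v"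
  shows "set_integrable lborel ({s<..t} \<times> phase_space) (\<lambda>(t, x, v). m t x v * f t x v)"
proof -
  \<comment> \<open>The moment assumption asks for a positive time horizon, while \<open>t\<close>
    may be 0.\<close>
  have "set_integrable lborel ({0..t + 1} \<times> phase_space) (\<lambda>(t, x, v). wt v * f t x v)"
    using moments_txv[of "t + 1"] s by (simp add: wt_def)
  then have "set_integrable lborel ({s<..t} \<times> phase_space) (\<lambda>(t, x, v). wt v * f t x v)"
    by (rule set_integrable_subset) (use s in \<open>auto intro!: borel_Times measurable_torus\<close>)
  then have "set_integrable lborel ({s<..t} \<times> phase_space)
      (\<lambda>z. (case z of (t, x, v) \<Rightarrow> m t x v) / wt (snd (snd z)) * (case z of (t, x, v) \<Rightarrow> wt v * f t x v))"
  proof (rule set_integrable_mult_bounded)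
    show "(\<lambda>z. (case z of (t, x, v) \<Rightarrow> m t x v) / wt (snd (snd z))) \<in> borel_measurable lborel"
      using borel_measurable_divide[OF m wt_measurable[of "\<lambda>z. snd (snd z)"]] by (simp add: continuous_intros)
    show "\<bar>(case z of (t, x, v) \<Rightarrow> m t x v) / wt (snd (snd z))\<bar> \<le> c" if "z \<in> {s<..t} \<times> phase_space" for z
      using that s b[of "fst z" "fst (snd z)" "snd (snd z)"] wt_ge(2)[of "snd (snd z)"]
      by (auto simp: pos_divide_le_eq)
  qed
  moreover have "(\<lambda>z. (case z of (t, x, v) \<Rightarrow> m t x v) / wt (snd (snd z)) * (case z of (t, x, v) \<Rightarrow> wt v * f t x v))
    = (\<lambda>(t, x, v). m t x v * f t x v)"
    unfolding case_prod_beta wt_cancel ..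
  ultimately show ?thesis by simp
qed

lemma integrable_weighted_q:
  assumes s: "0 \<le> s" "s \<le> t" and m: "m \<in> borel_measurable borel"
    and b: "\<And>v. \<bar>m v\<bar> \<le> c * wt v"
  shows "set_integrable lborel ({s<..t} \<times> phase_space) (\<lambda>(t, x, v). m v * q t x v)"
proof -
  have "set_integrable lborel ({0<..t + 1} \<times> phase_space) (\<lambda>(t, x, v). wt v * q t x v)"
    using moments_q[of "t + 1"] s by (simp add: wt_def)
  then have "set_integrable lborel ({s<..t} \<times> phase_space) (\<lambda>(t, x, v). wt v * q t x v)"
    by (rule set_integrable_subset) (use s in \<open>auto intro!: borel_Times measurable_torus\<close>)
  then have "set_integrable lborel ({s<..t} \<times> phase_space)
      (\<lambda>z. m (snd (snd z)) / wt (snd (snd z)) * (case z of (t, x, v) \<Rightarrow> wt v * q t x v))"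
  proof (rule set_integrable_mult_bounded)
    have mm: "(\<lambda>z :: real \<times> (real ^ 'n) \<times> (real ^ 'n). m (snd (snd z))) \<in> borel_measurable borel"
      by (rule measurable_compose[OF borel_measurable_continuous_onI m]) (intro continuous_intros)
    show "(\<lambda>z :: real \<times> (real ^ 'n) \<times> (real ^ 'n). m (snd (snd z)) / wt (snd (snd z))) \<in> borel_measurable lborel"
      using borel_measurable_divide[OF mm wt_measurable[of "\<lambda>z. snd (snd z)"]] by (simp add: continuous_intros)
    show "\<bar>m (snd (snd z)) / wt (snd (snd z))\<bar> \<le> c" if "z \<in> {s<..t} \<times> phase_space" for z
      using b[of "snd (snd z)"] wt_ge(2)[of "snd (snd z)"] by (auto simp: pos_divide_le_eq)
  qed
  moreover have "(\<lambda>z. m (snd (snd z)) / wt (snd (snd z)) * (case z of (t, x, v) \<Rightarrow> wt v * q t x v))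
    = (\<lambda>(t, x, v). m v * q t x v)"
    unfolding case_prod_beta wt_cancel ..
  ultimately show ?thesis by simp
qed

lemma integrable_phase_weighted:
  assumes g: "set_integrable lborel phase_space (\<lambda>(x, v). wt v * g x v)"
    and m: "(\<lambda>(x, v). m x v) \<in> borel_measurable borel" and b: "\<And>x v. \<bar>m x v\<bar> \<le> c * wt v"
  shows "set_integrable lborel phase_space (\<lambda>(x, v). m x v * g x v)"
proof -
  have "set_integrable lborel phase_space
      (\<lambda>z. (case z of (x, v) \<Rightarrow> m x v) / wt (snd z) * (case z of (x, v) \<Rightarrow> wt v * g x v))"
    using g
  proof (rule set_integrable_mult_bounded)
    show "(\<lambda>z. (case z of (x, v) \<Rightarrow> m x v) / wt (snd z)) \<in> borel_measurable lborel"
      using borel_measurable_divide[OF m wt_measurable[of snd]] by (simp add: continuous_on_snd continuous_on_id)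
    show "\<bar>(case z of (x, v) \<Rightarrow> m x v) / wt (snd z)\<bar> \<le> c" for z
      using b[of "fst z" "snd z"] wt_ge(2)[of "snd z"] by (auto simp: case_prod_beta pos_divide_le_eq)
  qed
  moreover have "(\<lambda>z. (case z of (x, v) \<Rightarrow> m x v) / wt (snd z) * (case z of (x, v) \<Rightarrow> wt v * g x v))
    = (\<lambda>(x, v). m x v * g x v)"
    unfolding case_prod_beta wt_cancel ..
  ultimately show ?thesis by simp
qed

lemma integrable_phase_f:
  assumes "t \<ge> 0" "(\<lambda>(x, v). m x v) \<in> borel_measurable borel" "\<And>x v. \<bar>m x v\<bar> \<le> c * wt v"
  shows "set_integrable lborel phase_space (\<lambda>(x, v). m x v * f t x v)"
  by (rule integrable_phase_weighted[OF _ assms(2,3)]) (use moments_xv[OF assms(1)] in \<open>simp add: wt_def\<close>)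

definition moment where
  "moment \<phi> t = (LINT (x, v):phase_space|lborel. \<phi> v * f t x v)"

definition drag where
  "drag \<phi>' t = (LINT (x, v):phase_space|lborel. (\<Sum>i\<in>UNIV. \<phi>' i v * (u i t x - v $ i)) * f t x v)"

text \<open>Quadratic growth of \<open>\<phi>\<close> and linear growth of its gradient: multiplied
  by the relative velocity, the gradient is again quadratic, so second moments control every term of
  \<open>rate\<close>. The constant is explicit in order to be uniform for cutoffs.\<close>

definition growth where
  "growth c \<phi> \<phi>' \<longleftrightarrow> (\<forall>i. has_partial i \<phi> (\<phi>' i)) \<and> continuous_on UNIV \<phi> \<and> (\<forall>i. continuous_on UNIV (\<phi>' i)) \<and>
    (\<forall>v. \<bar>\<phi> v\<bar> \<le> c * wt v) \<and> (\<forall>i v. \<bar>\<phi>' i v\<bar> \<le> c * (1 + norm v)) \<and> 0 \<le> c"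

lemma flux_bound:
  assumes "growth c \<phi> \<phi>'" "t \<ge> 0"
  shows "\<bar>\<Sum>i\<in>UNIV. \<phi>' i v * (u i t x - v $ i)\<bar> \<le> real CARD('n) * (2 * c * (U + 1)) * wt v"
proof -
  have "\<bar>\<Sum>i\<in>UNIV. \<phi>' i v * (u i t x - v $ i)\<bar> \<le> (\<Sum>i\<in>(UNIV :: 'n set). 2 * c * (U + 1) * wt v)"
    using assms velocity_bound by (intro order.trans[OF sum_abs sum_mono] wt_bounds_mult) (auto simp: growth_def)
  then show ?thesis by simp
qed

lemma rate_integrable:
  assumes \<phi>: "growth c \<phi> \<phi>'" and s: "0 \<le> s" "s \<le> t"
  shows "set_integrable lborel ({s<..t} \<times> phase_space) (\<lambda>(t, x, v). (\<Sum>i\<in>UNIV. \<phi>' i v * (u i t x - v $ i)) * f t x v)"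
    and "set_integrable lborel ({s<..t} \<times> phase_space) (\<lambda>(t, x, v). \<phi> v * q t x v)"
    and "set_integrable lborel ({s<..t} \<times> phase_space) (\<lambda>(t, x, v). rate \<phi> \<phi>' t x v)"
proof -
  have c': "continuous_on UNIV (\<phi>' i)" for i using \<phi> by (simp add: growth_def)
  have 1: "set_integrable lborel ({s<..t} \<times> phase_space) (\<lambda>(t, x, v). (\<Sum>i\<in>UNIV. \<phi>' i v * (uu i t x - v $ i)) * f t x v)"
  proof (rule integrable_weighted_f[OF s])
    show "(\<lambda>(t, x, v). \<Sum>i\<in>UNIV. \<phi>' i v * (uu i t x - v $ i)) \<in> borel_measurable borel"
      unfolding case_prod_beta
      by (intro borel_measurable_continuous_onI continuous_on_sum continuous_on_mult continuous_on_diff continuous_uu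
          continuous_on_comp_UNIV[OF c'] continuous_intros)
    show "\<bar>\<Sum>i\<in>UNIV. \<phi>' i v * (uu i \<tau> x - v $ i)\<bar> \<le> real CARD('n) * (2 * c * (U + 1)) * wt v" if "0 \<le> \<tau>" for \<tau> x v
      using flux_bound[OF \<phi> that] that by (simp add: uu_def)
  qed
  have "set_integrable lborel ({s<..t} \<times> phase_space) (\<lambda>(t, x, v). (\<Sum>i\<in>UNIV. \<phi>' i v * (uu i t x - v $ i)) * f t x v)
    = set_integrable lborel ({s<..t} \<times> phase_space) (\<lambda>(t, x, v). (\<Sum>i\<in>UNIV. \<phi>' i v * (u i t x - v $ i)) * f t x v)"
    by (rule set_integrable_cong) (use s in \<open>auto simp: uu_def\<close>)
  with 1 show 2: "set_integrable lborel ({s<..t} \<times> phase_space) (\<lambda>(t, x, v). (\<Sum>i\<in>UNIV. \<phi>' i v * (u i t x - v $ i)) * f t x v)"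
    by simp
  show 3: "set_integrable lborel ({s<..t} \<times> phase_space) (\<lambda>(t, x, v). \<phi> v * q t x v)"
    using \<phi> by (intro integrable_weighted_q[OF s]) (auto simp: growth_def intro: borel_measurable_continuous_onI)
  show "set_integrable lborel ({s<..t} \<times> phase_space) (\<lambda>(t, x, v). rate \<phi> \<phi>' t x v)"
    using set_integral_add(1)[OF 2 3] unfolding rate_def case_prod_beta .
qed

lemma phase_integral_compact:
  assumes h: "continuous_on UNIV (\<lambda>(x, v). h x v :: real)" and supp: "\<And>x v. v \<notin> cube r \<Longrightarrow> h x v = 0"
  shows "(LINT (x, v):phase_space|lborel. h x v) = integral (box_xv r) (\<lambda>(x, v). h x v)"
proof -
  have "integrable lborel (\<lambda>z. indicator (box_xv r) z *\<^sub>R (case z of (x, v) \<Rightarrow> h x v))"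
    by (intro borel_integrable_compact continuous_on_subset[OF h]) auto
  moreover have eq: "(\<lambda>z. indicator (box_xv r) z *\<^sub>R (case z of (x, v) \<Rightarrow> h x v))
      = (\<lambda>z. indicator phase_space z *\<^sub>R (case z of (x, v) \<Rightarrow> h x v))"
    unfolding box_xv_eq using supp by (auto simp: fun_eq_iff indicator_def)
  ultimately have "set_integrable lborel phase_space (\<lambda>(x, v). h x v)"
    by (simp add: set_integrable_def)
  then have "(LINT (x, v):phase_space|lborel. h x v) = integral phase_space (\<lambda>(x, v). h x v)"
    by (rule set_borel_integral_eq_integral(2))
  also have "\<dots> = integral (box_xv r) (\<lambda>(x, v). h x v)"
    using supp by (intro integral_eq_superset) (auto simp: box_xv_eq)
  finally show ?thesis .
qed

text \<open>The moment is continuous up to time 0 and differentiable after it, so the fundamental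
  theorem of calculus also covers \<open>s = 0\<close>.\<close>

lemma moment_balance_compact:
  assumes \<phi>: "growth c \<phi> \<phi>'" and supp: "\<And>v. v \<notin> cube r \<Longrightarrow> \<phi> v = 0" "\<And>i v. v \<notin> cube r \<Longrightarrow> \<phi>' i v = 0"
    and s: "0 \<le> s" "s \<le> t"
  shows "(LINT (t, x, v):{s<..t} \<times> phase_space|lborel. rate \<phi> \<phi>' t x v) = moment \<phi> t - moment \<phi> s"
proof -
  have \<phi>': "\<And>i. has_partial i \<phi> (\<phi>' i)" "continuous_on UNIV \<phi>" "\<And>i. continuous_on UNIV (\<phi>' i)"
    using \<phi> by (auto simp: growth_def)
  let ?M = "\<lambda>t. integral (box_xv r) (\<lambda>(x, v). \<phi> v * f t x v)"
  let ?J = "\<lambda>t. integral (box_xv r) (\<lambda>(x, v). rate \<phi> \<phi>' t x v)"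
  have M: "moment \<phi> \<tau> = ?M \<tau>" if "\<tau> \<ge> 0" for \<tau>
    unfolding moment_def
  proof (rule phase_integral_compact)
    show "continuous_on UNIV (\<lambda>(x, v). \<phi> v * f \<tau> x v)"
      unfolding case_prod_beta using that
      by (intro continuous_on_mult continuous_on_comp_UNIV[OF \<phi>'(2)] xvcont_compose[OF cont_f] continuous_intros) auto
  qed (simp add: supp)
  have J: "(LINT (x, v):phase_space|lborel. rate \<phi> \<phi>' \<tau> x v) = ?J \<tau>" if "\<tau> > 0" for \<tau>
  proof (rule phase_integral_compact)
    show "continuous_on UNIV (\<lambda>(x, v). rate \<phi> \<phi>' \<tau> x v)"
      unfolding rate_def case_prod_beta using that
      by (intro continuous_on_add continuous_on_sum continuous_on_mult continuous_on_diff continuous_on_comp_UNIV[OF \<phi>'(2)]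
          continuous_on_comp_UNIV[OF \<phi>'(3)] xvcont_compose[OF cont_f] xvcont_compose[OF cont_q]
          continuous_on_tcont_compose[OF cont_u] continuous_intros) auto
  qed (simp add: rate_def supp)
  have "(?J has_integral (?M t - ?M s)) {s..t}"
  proof (rule fundamental_theorem_of_calculus_interior[OF s(2)])
    show "continuous_on {s..t} ?M"
      by (rule continuous_on_subset[OF moment_continuous[OF \<phi>' supp]]) (use s in auto)
    show "(?M has_vector_derivative ?J \<tau>) (at \<tau>)" if "\<tau> \<in> {s<..<t}" for \<tau>
      using moment_derivative_compact[OF \<phi>' supp, where t = \<tau>] that s
      by (simp add: has_real_derivative_iff_has_vector_derivative)
  qed
  then have I: "((\<lambda>\<tau>. if \<tau> \<in> {s..t} then ?J \<tau> else 0) has_integral (?M t - ?M s)) UNIV"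
    by (simp only: has_integral_restrict_UNIV)
  \<comment> \<open>One point of time is given up: at \<open>\<tau> = s\<close>, possibly 0, the
    interaction term is not controlled.\<close>
  have eq: "indicator {s<..t} \<tau> *\<^sub>R (LINT (x, v):phase_space|lborel. rate \<phi> \<phi>' \<tau> x v)
      = (if \<tau> \<in> {s..t} then ?J \<tau> else 0)" if \<tau>: "\<tau> \<in> UNIV - {s}" for \<tau>
  proof (cases "\<tau> \<in> {s<..t}")
      case True
      then show ?thesis using J[of \<tau>] s by (simp only: indicator_simps scaleR_one) simp
  qed (use \<tau> in auto)
  have I2: "((\<lambda>\<tau>. indicator {s<..t} \<tau> *\<^sub>R (LINT (x, v):phase_space|lborel. rate \<phi> \<phi>' \<tau> x v)) has_integral (?M t - ?M s)) UNIV"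
    by (rule has_integral_spike[OF negligible_sing eq I])
  note F = set_integral_product[OF rate_integrable(3)[OF \<phi> s]]
  have I3: "((\<lambda>\<tau>. indicator {s<..t} \<tau> *\<^sub>R (LINT (x, v):phase_space|lborel. rate \<phi> \<phi>' \<tau> x v)) has_integral
      (LINT \<tau>:{s<..t}|lborel. LINT (x, v):phase_space|lborel. rate \<phi> \<phi>' \<tau> x v)) UNIV"
    using F(2) unfolding set_integrable_def set_lebesgue_integral_def
    by (intro has_integral_integral_lborel) (simp add: case_prod_beta)
  have "(LINT \<tau>:{s<..t}|lborel. LINT (x, v):phase_space|lborel. rate \<phi> \<phi>' \<tau> x v) = ?M t - ?M s"
    by (rule has_integral_unique[OF I3 I2])
  with F(3) M s show ?thesis by simp
qed

text \<open>In the product rule \<open>\<phi>'\<close> keeps its constant \<open>c\<close>, and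
  \<open>\<phi> * cutoff'\<close> adds \<open>8 * c\<close> by \<open>cutoff'_bound\<close>. The sum
  does not depend on \<open>n\<close>.\<close>

lemma growth_cutoff:
  assumes \<phi>: "growth c \<phi> \<phi>'"
  shows "growth (9 * c) (\<lambda>v. \<phi> v * cutoff n v) (\<lambda>i v. \<phi>' i v * cutoff n v + \<phi> v * cutoff' n i v)"
  unfolding growth_def
proof (intro conjI allI)
  note g = \<phi>[unfolded growth_def]
  have c: "0 \<le> c" using g by simp
  show "has_partial i (\<lambda>v. \<phi> v * cutoff n v) (\<lambda>v. \<phi>' i v * cutoff n v + \<phi> v * cutoff' n i v)" for i
    using g by (intro has_partial_mult has_partial_cutoff) auto
  show "continuous_on UNIV (\<lambda>v. \<phi> v * cutoff n v)" "continuous_on UNIV (\<lambda>v. \<phi>' i v * cutoff n v + \<phi> v * cutoff' n i v)" for i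
    using g by (intro continuous_on_add continuous_on_mult continuous_cutoff; simp)+
  fix v
  have 1: "\<bar>\<phi> v * cutoff n v\<bar> \<le> \<bar>\<phi> v\<bar>" "\<bar>\<phi>' i v * cutoff n v\<bar> \<le> \<bar>\<phi>' i v\<bar>" for i
    using cutoff_bounds[of n v] by (auto simp: abs_mult mult_left_le)
  have "c * wt v \<le> 9 * c * wt v" using c wt_ge(2)[of v] by simp
  moreover have "\<bar>\<phi> v\<bar> \<le> c * wt v" using g by simp
  ultimately show "\<bar>\<phi> v * cutoff n v\<bar> \<le> 9 * c * wt v"
    using 1(1) by linarith
  fix i
  have "\<bar>\<phi> v * cutoff' n i v\<bar> \<le> (c * wt v) * \<bar>cutoff' n i v\<bar>"
    unfolding abs_mult using g by (intro mult_right_mono) auto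
  also have "\<dots> \<le> c * (8 * norm v)"
    unfolding mult.assoc by (intro mult_left_mono cutoff'_bound c)
  also have "\<dots> \<le> 8 * c * (1 + norm v)" using c by (simp add: algebra_simps)
  finally have "\<bar>\<phi> v * cutoff' n i v\<bar> \<le> 8 * c * (1 + norm v)" .
  moreover have "\<bar>\<phi>' i v * cutoff n v\<bar> \<le> c * (1 + norm v)" using 1(2)[of i] g by (meson order_trans)
  ultimately have "\<bar>\<phi>' i v * cutoff n v + \<phi> v * cutoff' n i v\<bar> \<le> c * (1 + norm v) + 8 * c * (1 + norm v)"
    by linarith
  then show "\<bar>\<phi>' i v * cutoff n v + \<phi> v * cutoff' n i v\<bar> \<le> 9 * c * (1 + norm v)"
    by (simp add: algebra_simps)
qed (use \<phi> in \<open>auto simp: growth_def\<close>)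

end

lemma set_dominated_convergence:
  fixes F :: "nat \<Rightarrow> 'a \<Rightarrow> real"
  assumes F: "\<And>n. set_integrable M A (F n)" "set_integrable M A G" and w: "set_integrable M A w"
    and b: "\<And>n z. z \<in> A \<Longrightarrow> \<bar>F n z\<bar> \<le> w z" and l: "\<And>z. z \<in> A \<Longrightarrow> (\<lambda>n. F n z) \<longlonglongrightarrow> G z"
  shows "(\<lambda>n. LINT z:A|M. F n z) \<longlonglongrightarrow> (LINT z:A|M. G z)"
  unfolding set_lebesgue_integral_def
proof (rule integral_dominated_convergence)
  show "integrable M (\<lambda>z. indicator A z *\<^sub>R w z)" "(\<lambda>z. indicator A z *\<^sub>R G z) \<in> borel_measurable M"
    "(\<lambda>z. indicator A z *\<^sub>R F n z) \<in> borel_measurable M" for n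
    using F w by (auto simp: set_integrable_def)
  show "AE z in M. (\<lambda>n. indicator A z *\<^sub>R F n z) \<longlonglongrightarrow> indicator A z *\<^sub>R G z"
    using l by (intro AE_I2) (auto simp: indicator_def)
  show "AE z in M. norm (indicator A z *\<^sub>R F n z) \<le> indicator A z *\<^sub>R w z" for n
    using b by (intro AE_I2) (auto simp: indicator_def)
qed

context kinetic_flow begin

lemma moment_integrable: "growth c \<phi> \<phi>' \<Longrightarrow> t \<ge> 0 \<Longrightarrow> set_integrable lborel phase_space (\<lambda>(x, v). \<phi> v * f t x v)"
proof (rule integrable_phase_f)
  assume g: "growth c \<phi> \<phi>'"
  then have "continuous_on UNIV \<phi>" by (simp add: growth_def)
  from continuous_on_comp_UNIV[OF this, of UNIV snd]
  show "(\<lambda>(x :: real ^ 'n, v). \<phi> v) \<in> borel_measurable borel"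
    unfolding case_prod_beta by (intro borel_measurable_continuous_onI) (simp add: continuous_on_snd)
  show "\<bar>\<phi> v\<bar> \<le> c * wt v" for v using g by (simp add: growth_def)
qed

text \<open>The cutoff is removed by dominated convergence on both sides; the growth constant,
  uniform in \<open>n\<close>, supplies the majorant. The balance is integrated in time because that
  is the form in which the weighted integrals are finite.\<close>

lemma moment_balance:
  assumes \<phi>: "growth c \<phi> \<phi>'" and s: "0 \<le> s" "s \<le> t"
  shows "(LINT (t, x, v):{s<..t} \<times> phase_space|lborel. rate \<phi> \<phi>' t x v) = moment \<phi> t - moment \<phi> s"
proof -
  let ?\<phi> = "\<lambda>n v. \<phi> v * cutoff n v" and ?\<phi>' = "\<lambda>n i v. \<phi>' i v * cutoff n v + \<phi> v * cutoff' n i v"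
  note g = growth_cutoff[OF \<phi>]
  have c: "0 \<le> c" using \<phi> by (simp add: growth_def)
  let ?A = "{s<..t} \<times> (phase_space :: ((real ^ 'n) \<times> (real ^ 'n)) set)"
  have lim\<phi>: "(\<lambda>n. ?\<phi> n v) \<longlonglongrightarrow> \<phi> v" "(\<lambda>n. ?\<phi>' n i v) \<longlonglongrightarrow> \<phi>' i v" for i v
    using tendsto_mult[OF tendsto_const cutoff_limit(1)[of v], of "\<phi> v"]
      tendsto_add[OF tendsto_mult[OF tendsto_const cutoff_limit(1)[of v], of "\<phi>' i v"]
        tendsto_mult[OF tendsto_const cutoff_limit(2)[where v = v and i = i], of "\<phi> v"]]
    by simp_all
  have "(\<lambda>n. LINT (t, x, v):?A|lborel. rate (?\<phi> n) (?\<phi>' n) t x v) \<longlonglongrightarrow> (LINT (t, x, v):?A|lborel. rate \<phi> \<phi>' t x v)"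
  proof (rule set_dominated_convergence)
    show "set_integrable lborel ?A (\<lambda>(t, x, v). rate (?\<phi> n) (?\<phi>' n) t x v)" for n
      by (rule rate_integrable(3)[OF g s])
    show "set_integrable lborel ?A (\<lambda>(t, x, v). rate \<phi> \<phi>' t x v)"
      by (rule rate_integrable(3)[OF \<phi> s])
    let ?K = "real CARD('n) * (2 * (9 * c) * (U + 1))"
    have "set_integrable lborel ?A (\<lambda>(t, x, v). wt v * f t x v)"
    proof (rule integrable_weighted_f[OF s])
      show "(\<lambda>(t :: real, x :: real ^ 'n, v :: real ^ 'n). wt v) \<in> borel_measurable borel"
        unfolding case_prod_beta by (intro wt_measurable continuous_intros)
      show "\<bar>wt v\<bar> \<le> 1 * wt v" for v :: "real ^ 'n" using wt_ge(2)[of v] by simp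
    qed
    moreover have "set_integrable lborel ?A (\<lambda>(t, x, v). wt v * q t x v)"
    proof (rule integrable_weighted_q[OF s])
      show "wt \<in> borel_measurable borel" using wt_measurable[of "\<lambda>v. v"] by (simp add: continuous_on_id)
      show "\<bar>wt v\<bar> \<le> 1 * wt v" for v :: "real ^ 'n" using wt_ge(2)[of v] by simp
    qed
    ultimately show "set_integrable lborel ?A (\<lambda>z. ?K * (case z of (t, x, v) \<Rightarrow> wt v * f t x v)
        + (9 * c) * \<bar>case z of (t, x, v) \<Rightarrow> wt v * q t x v\<bar>)"
      by (intro set_integral_add set_integrable_mult_right set_integrable_abs)
    fix z assume z: "z \<in> ?A"
    obtain \<tau> x v where zz: "z = (\<tau>, x, v)" by (cases z) auto
    have \<tau>: "\<tau> \<ge> 0" using z s by (auto simp: zz)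
    show "\<bar>case z of (t, x, v) \<Rightarrow> rate (?\<phi> n) (?\<phi>' n) t x v\<bar> \<le> ?K * (case z of (t, x, v) \<Rightarrow> wt v * f t x v)
        + (9 * c) * \<bar>case z of (t, x, v) \<Rightarrow> wt v * q t x v\<bar>" for n
    proof -
      have "\<bar>(\<Sum>i\<in>UNIV. ?\<phi>' n i v * (u i \<tau> x - v $ i)) * f \<tau> x v\<bar> \<le> (?K * wt v) * f \<tau> x v"
        unfolding abs_mult using flux_bound[OF g[of n] \<tau>, where x = x and v = v] f_nonneg[OF \<tau>, of x v]
        by (simp add: mult_right_mono)
      moreover have "\<bar>?\<phi> n v * q \<tau> x v\<bar> \<le> (9 * c * wt v) * \<bar>q \<tau> x v\<bar>"
        unfolding abs_mult[of _ "q \<tau> x v"] using g[of n] by (intro mult_right_mono) (auto simp: growth_def)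
      moreover have "\<bar>wt v * q \<tau> x v\<bar> = wt v * \<bar>q \<tau> x v\<bar>"
        using wt_ge(2)[of v] by (simp add: abs_mult)
      ultimately show ?thesis
        unfolding zz rate_def prod.case by (simp only: mult.assoc)
    qed
    show "(\<lambda>n. case z of (t, x, v) \<Rightarrow> rate (?\<phi> n) (?\<phi>' n) t x v) \<longlonglongrightarrow> (case z of (t, x, v) \<Rightarrow> rate \<phi> \<phi>' t x v)"
      unfolding zz rate_def prod.case by (intro tendsto_intros lim\<phi>)
  qed
  moreover have "(LINT (t, x, v):?A|lborel. rate (?\<phi> n) (?\<phi>' n) t x v) = moment (?\<phi> n) t - moment (?\<phi> n) s" for n
    by (rule moment_balance_compact[OF g _ _ s, where r = "real n + 1"]) (auto simp: cutoff_support)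
  moreover have "(\<lambda>n. moment (?\<phi> n) \<tau>) \<longlonglongrightarrow> moment \<phi> \<tau>" if \<tau>: "\<tau> \<ge> 0" for \<tau>
    unfolding moment_def
  proof (rule set_dominated_convergence)
    show "set_integrable lborel phase_space (\<lambda>(x, v). ?\<phi> n v * f \<tau> x v)" for n
      by (rule moment_integrable[OF g \<tau>])
    show "set_integrable lborel phase_space (\<lambda>(x, v). \<phi> v * f \<tau> x v)"
      by (rule moment_integrable[OF \<phi> \<tau>])
    then show "set_integrable lborel phase_space (\<lambda>z. \<bar>case z of (x, v) \<Rightarrow> \<phi> v * f \<tau> x v\<bar>)"
      by (rule set_integrable_abs)
    show "\<bar>case z of (x, v) \<Rightarrow> ?\<phi> n v * f \<tau> x v\<bar> \<le> \<bar>case z of (x, v) \<Rightarrow> \<phi> v * f \<tau> x v\<bar>" for n z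
      using cutoff_bounds[of n "snd z"]
      by (simp add: case_prod_beta abs_mult mult_left_le mult_right_mono)
    show "(\<lambda>n. case z of (x, v) \<Rightarrow> ?\<phi> n v * f \<tau> x v) \<longlonglongrightarrow> (case z of (x, v) \<Rightarrow> \<phi> v * f \<tau> x v)" for z
      unfolding case_prod_beta by (intro tendsto_mult lim\<phi> tendsto_const)
  qed
  then have "(\<lambda>n. moment (?\<phi> n) t - moment (?\<phi> n) s) \<longlonglongrightarrow> moment \<phi> t - moment \<phi> s"
    using s by (intro tendsto_diff) auto
  ultimately show ?thesis using LIMSEQ_unique by simp
qed

lemma drag_integrable:
  assumes "growth c \<phi> \<phi>'" "0 \<le> s" "s \<le> t"
  shows "set_integrable lborel {s<..t} (drag \<phi>')"
  using set_integral_product(2)[OF rate_integrable(1)[OF assms]]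
  unfolding drag_def[abs_def] case_prod_beta fst_conv snd_conv .

text \<open>The hypothesis on the interaction term is required only at times where its weighted
  integral over phase space exists, which by Fubini's theorem is almost every time.\<close>

lemma moment_inequality:
  assumes \<phi>: "growth c \<phi> \<phi>'" and s: "0 \<le> s" "s \<le> t"
    and q: "\<And>\<tau>. \<tau> > 0 \<Longrightarrow> set_integrable lborel phase_space (\<lambda>(x, v). wt v * q \<tau> x v) \<Longrightarrow>
      (LINT (x, v):phase_space|lborel. \<phi> v * q \<tau> x v) \<le> 0"
  shows "moment \<phi> t - moment \<phi> s \<le> (LINT \<tau>:{s<..t}|lborel. drag \<phi>' \<tau>)"
proof -
  note I = rate_integrable[OF \<phi> s]
  have "moment \<phi> t - moment \<phi> s = (LINT (t, x, v):{s<..t} \<times> phase_space|lborel. rate \<phi> \<phi>' t x v)"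
    by (rule moment_balance[OF \<phi> s, symmetric])
  also have "\<dots> = (LINT (t, x, v):{s<..t} \<times> phase_space|lborel. (\<Sum>i\<in>UNIV. \<phi>' i v * (u i t x - v $ i)) * f t x v)
      + (LINT (t, x, v):{s<..t} \<times> phase_space|lborel. \<phi> v * q t x v)"
    using set_integral_add(2)[OF I(1,2)] unfolding rate_def case_prod_beta .
  also have "(LINT (t, x, v):{s<..t} \<times> phase_space|lborel. (\<Sum>i\<in>UNIV. \<phi>' i v * (u i t x - v $ i)) * f t x v)
      = (LINT \<tau>:{s<..t}|lborel. drag \<phi>' \<tau>)"
    unfolding set_integral_product(3)[OF I(1)] drag_def case_prod_beta fst_conv snd_conv ..
  also have "(LINT (t, x, v):{s<..t} \<times> phase_space|lborel. \<phi> v * q t x v) \<le> 0"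
  proof -
    have "set_integrable lborel ({0<..t + 1} \<times> phase_space) (\<lambda>(t, x, v). wt v * q t x v)"
      using moments_q[of "t + 1"] s by (simp add: wt_def)
    then have "AE \<tau> in lborel. \<tau> \<in> {0<..t + 1} \<longrightarrow>
        set_integrable lborel phase_space (\<lambda>y. (\<lambda>(t, x, v). wt v * q t x v) (\<tau>, y))"
      by (rule set_integral_product(1))
    then have AE: "AE \<tau> in lborel. \<tau> \<in> {s<..t} \<longrightarrow> (LINT y:phase_space|lborel. (\<lambda>(t, x, v). \<phi> v * q t x v) (\<tau>, y)) \<le> 0"
      by eventually_elim (use q s in auto)
    have "(LINT (t, x, v):{s<..t} \<times> phase_space|lborel. \<phi> v * q t x v)
        = (LINT \<tau>:{s<..t}|lborel. LINT y:phase_space|lborel. (\<lambda>(t, x, v). \<phi> v * q t x v) (\<tau>, y))"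
      by (rule set_integral_product(3)[OF I(2)])
    also have "\<dots> \<le> (LINT \<tau>:{s<..t}|lborel. 0)"
      by (rule set_integral_le_AE[OF set_integral_product(2)[OF I(2)] _ AE]) (simp add: set_integrable_def)
    finally show ?thesis by (simp add: set_lebesgue_integral_def)
  qed
  finally show ?thesis by simp
qed

text \<open>Mass and momentum vanish at each position separately. Carrying this over to phase space
  needs Fubini's theorem, hence the assumed integrability.\<close>

lemma q_moments:
  assumes t: "t > 0" and q: "set_integrable lborel phase_space (\<lambda>(x, v). wt v * q t x v)"
  shows "set_integrable lborel phase_space (\<lambda>(x, v). q t x v)" "(LINT (x, v):phase_space|lborel. q t x v) = 0"
    "set_integrable lborel phase_space (\<lambda>(x, v). q t x v * v $ i)" "(LINT (x, v):phase_space|lborel. q t x v * v $ i) = 0"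
    "set_integrable lborel phase_space (\<lambda>(x, v). q t x v * (norm v)\<^sup>2)" "(LINT (x, v):phase_space|lborel. q t x v * (norm v)\<^sup>2) \<le> 0"
proof -
  note ic = interaction[OF t, unfolded interaction_conditions_def]
  show 1: "set_integrable lborel phase_space (\<lambda>(x, v). q t x v)"
  proof -
    have "set_integrable lborel phase_space (\<lambda>(x, v). 1 * q t x v)"
      by (rule integrable_phase_weighted[OF q, where c = 1]) (simp_all add: wt_ge)
    then show ?thesis by simp
  qed
  show "(LINT (x, v):phase_space|lborel. q t x v) = 0"
    unfolding set_integral_product(3)[OF 1] using ic by (simp add: set_lebesgue_integral_def)
  have "set_integrable lborel phase_space (\<lambda>(x, v). v $ i * q t x v)"
  proof (rule integrable_phase_weighted[OF q])
    show "(\<lambda>(x :: real ^ 'n, v :: real ^ 'n). v $ i) \<in> borel_measurable borel"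
      unfolding case_prod_beta by (intro borel_measurable_continuous_onI continuous_intros)
    show "\<bar>v $ i\<bar> \<le> 2 * wt v" for v :: "real ^ 'n"
      using component_le_norm_cart[of v i] wt_ge(4)[of v] by linarith
  qed
  then show 2: "set_integrable lborel phase_space (\<lambda>(x, v). q t x v * v $ i)" by (simp add: mult.commute)
  show "(LINT (x, v):phase_space|lborel. q t x v * v $ i) = 0"
    unfolding set_integral_product(3)[OF 2] using ic by (simp add: set_lebesgue_integral_def)
  show "set_integrable lborel phase_space (\<lambda>(x, v). q t x v * (norm v)\<^sup>2)" "(LINT (x, v):phase_space|lborel. q t x v * (norm v)\<^sup>2) \<le> 0"
    using ic by auto
qed

section \<open>Conservation of particle mass and balance of particle momentum\<close>

lemma growth_const: "growth 1 (\<lambda>v. a) (\<lambda>i v. 0)" if "\<bar>a\<bar> \<le> 1"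
  unfolding growth_def using that wt_ge(1) by (auto intro: has_partial_const order_trans add_nonneg_nonneg)

lemma has_partial_component: "has_partial j (\<lambda>v. a * (v $ i - b)) (\<lambda>v. if j = i then a else 0)"
  by (auto simp: has_partial_def axis_nth_if intro!: derivative_eq_intros)

lemma growth_component: "growth 2 (\<lambda>v. a * v $ (i :: 'n)) (\<lambda>j v. if j = i then a else 0)" if "\<bar>a\<bar> \<le> 1"
  unfolding growth_def
proof (intro conjI allI)
  show "has_partial j (\<lambda>v. a * v $ i) (\<lambda>v. if j = i then a else 0)" for j
    using has_partial_component[of j a i 0] by simp
  show "\<bar>a * v $ i\<bar> \<le> 2 * wt v" for v :: "real ^ 'n"
  proof -
    have "\<bar>a\<bar> * \<bar>v $ i\<bar> \<le> 1 * \<bar>v $ i\<bar>" using that by (intro mult_right_mono) auto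
    then show ?thesis using component_le_norm_cart[of v i] wt_ge(4)[of v] by (simp add: abs_mult)
  qed
  show "\<bar>if j = i then a else 0\<bar> \<le> 2 * (1 + norm v)" for j and v :: "real ^ 'n"
  proof -
    have "\<bar>if j = i then a else 0\<bar> \<le> 1" using that by simp
    moreover have "1 \<le> 2 * (1 + norm v)" using mult_mono[of 1 2 1 "1 + norm v"] by simp
    ultimately show ?thesis by (rule order.trans)
  qed
qed (auto intro!: continuous_intros)

text \<open>For an invariant of the interaction the moment inequality holds with either sign of the
  test function, and the two inequalities combine to an equality. Particle momentum is treated in
  the same way.\<close>

lemma particle_mass_conservation: "t \<ge> 0 \<Longrightarrow> moment (\<lambda>v. 1) t = moment (\<lambda>v. 1) 0"
proof -
  assume t: "t \<ge> 0"
  have neg: "moment (\<lambda>v. - 1) \<tau> = - moment (\<lambda>v. 1) \<tau>" for \<tau>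
    unfolding moment_def set_lebesgue_integral_def
    by (simp add: case_prod_beta flip: Bochner_Integration.integral_minus)
  have drag0: "drag (\<lambda>i v. 0) \<tau> = 0" for \<tau> by (simp add: drag_def set_lebesgue_integral_def)
  have "moment (\<lambda>v. a) t - moment (\<lambda>v. a) 0 \<le> 0" if "\<bar>a\<bar> \<le> 1" for a
  proof -
    have "moment (\<lambda>v. a) t - moment (\<lambda>v. a) 0 \<le> (LINT \<tau>:{0<..t}|lborel. drag (\<lambda>i v. 0) \<tau>)"
    proof (rule moment_inequality[OF growth_const[OF that] _ t])
      fix \<tau> :: real assume "\<tau> > 0" "set_integrable lborel phase_space (\<lambda>(x, v). wt v * q \<tau> x v)"
      from q_moments(2)[OF this] show "(LINT (x, v):phase_space|lborel. a * q \<tau> x v) \<le> 0"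
        unfolding case_prod_beta set_integral_mult_right by simp
    qed simp
    then show ?thesis by (simp add: drag0 set_lebesgue_integral_def[of lborel "{0<..t}"])
  qed
  from this[of 1] this[of "- 1"] show ?thesis by (simp add: neg)
qed

lemma particle_momentum_balance:
  assumes s: "0 \<le> s" "s \<le> t"
  shows "moment (\<lambda>v. v $ i) t - moment (\<lambda>v. v $ i) s
    = (LINT \<tau>:{s<..t}|lborel. LINT (x, v):phase_space|lborel. (u i \<tau> x - v $ i) * f \<tau> x v)"
proof -
  have m: "moment (\<lambda>v. a * v $ i) \<tau> = a * moment (\<lambda>v. v $ i) \<tau>" for a \<tau>
    unfolding moment_def case_prod_beta mult.assoc set_integral_mult_right ..
  have d: "drag (\<lambda>j v. if j = i then a else 0) \<tau> = a * (LINT (x, v):phase_space|lborel. (u i \<tau> x - v $ i) * f \<tau> x v)" for a \<tau>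
  proof -
    have "(\<Sum>j\<in>UNIV. (if j = i then a else 0) * (u j \<tau> x - v $ j)) * f \<tau> x v = a * ((u i \<tau> x - v $ i) * f \<tau> x v)" for x v
      by (simp add: if_distrib[of "\<lambda>z. z * _"] cong: if_cong)
    then show ?thesis unfolding drag_def case_prod_beta by (simp only: set_integral_mult_right)
  qed
  have "moment (\<lambda>v. a * v $ i) t - moment (\<lambda>v. a * v $ i) s
      \<le> (LINT \<tau>:{s<..t}|lborel. drag (\<lambda>j v. if j = i then a else 0) \<tau>)" if a: "\<bar>a\<bar> \<le> 1" for a
  proof (rule moment_inequality[OF growth_component[OF a] s])
    fix \<tau> :: real assume "\<tau> > 0" "set_integrable lborel phase_space (\<lambda>(x, v). wt v * q \<tau> x v)"
    from q_moments(4)[OF this, of i] have "(LINT (x, v):phase_space|lborel. v $ i * q \<tau> x v) = 0"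
      by (simp add: mult.commute)
    then show "(LINT (x, v):phase_space|lborel. a * v $ i * q \<tau> x v) \<le> 0"
      unfolding case_prod_beta mult.assoc set_integral_mult_right by simp
  qed
  from this[of 1] this[of "- 1"] show ?thesis
    unfolding m d set_integral_mult_right by (simp add: set_integral_mult_right)
qed

end

section \<open>Drag force, slip and coercivity\<close>

context kinetic_flow begin

definition force where "force i t x = (LINT v|lborel. f t x v * (u i t x - v $ i))"

definition slip where
  "slip t = (LINT (x, v):phase_space|lborel. (\<Sum>i\<in>UNIV. (u i t x - v $ i)\<^sup>2) * f t x v)"

definition kinetic_energy where
  "kinetic_energy V t = moment (\<lambda>v. \<Sum>i\<in>UNIV. (v $ i - V i)\<^sup>2 / 2) t"

lemma continuous_u: "t \<ge> 0 \<Longrightarrow> continuous_on A k \<Longrightarrow> continuous_on A (\<lambda>z. u i t (k z))"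
  by (intro continuous_on_tcont_compose[OF cont_u] continuous_intros) auto

lemma sum_square_bound:
  fixes a :: "'n \<Rightarrow> real"
  assumes "\<And>i. \<bar>a i\<bar> \<le> c * (1 + norm (v :: real ^ 'n))" "0 \<le> c"
  shows "\<bar>\<Sum>i\<in>UNIV. (a i)\<^sup>2\<bar> \<le> real CARD('n) * (2 * c * c) * wt v"
proof -
  have "\<bar>\<Sum>i\<in>UNIV. a i * a i\<bar> \<le> (\<Sum>i\<in>(UNIV :: 'n set). 2 * c * c * wt v)"
    using assms by (intro order.trans[OF sum_abs sum_mono] wt_bounds_mult) auto
  then show ?thesis by (simp add: power2_eq_square)
qed

lemma slip_integrable:
  assumes "t \<ge> 0"
  shows "set_integrable lborel phase_space (\<lambda>(x, v). (\<Sum>i\<in>UNIV. (u i t x - v $ i)\<^sup>2) * f t x v)"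
proof (rule integrable_phase_f[OF assms])
  show "(\<lambda>(x, v). \<Sum>i\<in>UNIV. (u i t x - v $ i)\<^sup>2) \<in> borel_measurable borel"
    unfolding case_prod_beta
    by (intro borel_measurable_continuous_onI continuous_on_sum continuous_on_power continuous_on_diff continuous_u assms continuous_intros)
  show "\<bar>\<Sum>i\<in>UNIV. (u i t x - v $ i)\<^sup>2\<bar> \<le> real CARD('n) * (2 * (U + 1) * (U + 1)) * wt v" for x v
    using U_nonneg by (intro sum_square_bound velocity_bound assms) auto
qed

lemma slip_nonneg: "t \<ge> 0 \<Longrightarrow> 0 \<le> slip t"
  unfolding slip_def set_lebesgue_integral_def
  by (intro Bochner_Integration.integral_nonneg)
    (auto simp: indicator_def case_prod_beta intro!: mult_nonneg_nonneg sum_nonneg f_nonneg)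

lemma slip_time_integrable:
  assumes s: "0 \<le> s" "s \<le> t" shows "set_integrable lborel {s<..t} slip"
proof -
  have 1: "set_integrable lborel ({s<..t} \<times> phase_space) (\<lambda>(t, x, v). (\<Sum>i\<in>UNIV. (uu i t x - v $ i)\<^sup>2) * f t x v)"
  proof (rule integrable_weighted_f[OF s])
    show "(\<lambda>(t, x, v). \<Sum>i\<in>UNIV. (uu i t x - v $ i)\<^sup>2) \<in> borel_measurable borel"
      unfolding case_prod_beta
      by (intro borel_measurable_continuous_onI continuous_on_sum continuous_on_power continuous_on_diff continuous_uu continuous_intros)
    show "\<bar>\<Sum>i\<in>UNIV. (uu i \<tau> x - v $ i)\<^sup>2\<bar> \<le> real CARD('n) * (2 * (U + 1) * (U + 1)) * wt v" if "0 \<le> \<tau>" for \<tau> x v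
      unfolding uu_def using U_nonneg by (intro sum_square_bound velocity_bound) auto
  qed
  have "set_integrable lborel {s<..t} (\<lambda>t. LINT (x, v):phase_space|lborel. (\<Sum>i\<in>UNIV. (uu i t x - v $ i)\<^sup>2) * f t x v)"
    using set_integral_product(2)[OF 1] unfolding case_prod_beta fst_conv snd_conv .
  moreover have "set_integrable lborel {s<..t} (\<lambda>t. LINT (x, v):phase_space|lborel. (\<Sum>i\<in>UNIV. (uu i t x - v $ i)\<^sup>2) * f t x v)
    \<longleftrightarrow> set_integrable lborel {s<..t} slip"
    by (rule set_integrable_cong) (use s in \<open>auto simp: uu_def slip_def\<close>)
  ultimately show ?thesis by simp
qed

lemma f_velocity_integrable:
  assumes t: "t \<ge> 0"
  shows "integrable lborel (f t x)" "integrable lborel (\<lambda>v. f t x v * (u i t x - v $ i))"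
proof -
  have fm: "f t x \<in> borel_measurable borel"
    using t by (intro borel_measurable_continuous_onI xvcont_compose[OF cont_f] continuous_intros) auto
  have b: "f t x v \<le> (1 + norm v) * f t x v" for v
    using f_nonneg[OF t, of x v] by (simp add: algebra_simps)
  show "integrable lborel (f t x)"
  proof (rule Bochner_Integration.integrable_bound[OF moments_v[OF t, of x]])
    show "AE v in lborel. norm (f t x v) \<le> norm ((1 + norm v) * f t x v)"
      using b f_nonneg[OF t, of x] by (intro AE_I2) (auto simp: abs_mult)
  qed (use fm in simp)
  have "integrable lborel (\<lambda>v. (U + 1) * ((1 + norm v) * f t x v))"
    using moments_v[OF t, of x] by simp
  then show "integrable lborel (\<lambda>v. f t x v * (u i t x - v $ i))"
  proof (rule Bochner_Integration.integrable_bound)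
    have "(\<lambda>v :: real ^ 'n. u i t x - v $ i) \<in> borel_measurable borel"
      by (intro borel_measurable_continuous_onI continuous_intros)
    then show "(\<lambda>v. f t x v * (u i t x - v $ i)) \<in> borel_measurable lborel" using fm by simp
    show "AE v in lborel. norm (f t x v * (u i t x - v $ i)) \<le> norm ((U + 1) * ((1 + norm v) * f t x v))"
    proof (rule AE_I2)
      fix v
      have "\<bar>u i t x - v $ i\<bar> * f t x v \<le> (U + 1) * (1 + norm v) * f t x v"
        using velocity_bound[OF t] f_nonneg[OF t] by (intro mult_right_mono) auto
      then show "norm (f t x v * (u i t x - v $ i)) \<le> norm ((U + 1) * ((1 + norm v) * f t x v))"
        using f_nonneg[OF t, of x v] U_nonneg by (simp add: abs_mult mult_ac)
    qed
  qed
qed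

text \<open>Translates between the drag as an integral over phase space and as a force field on the
  torus, by integrating out the velocity.\<close>

lemma force_pairing:
  assumes t: "t \<ge> 0" and w: "\<And>i. continuous_on UNIV (w i)" "\<And>i x. \<bar>w i x\<bar> \<le> b"
  shows "set_integrable lborel phase_space (\<lambda>(x, v). (\<Sum>i\<in>UNIV. w i x * (u i t x - v $ i)) * f t x v)"
    and "set_integrable lborel torus (\<lambda>x. \<Sum>i\<in>UNIV. w i x * force i t x)"
    and "(LINT (x, v):phase_space|lborel. (\<Sum>i\<in>UNIV. w i x * (u i t x - v $ i)) * f t x v)
      = (LINT x:torus|lborel. \<Sum>i\<in>UNIV. w i x * force i t x)"
proof -
  have b: "0 \<le> b" using w(2)[of undefined 0] by linarith
  show 1: "set_integrable lborel phase_space (\<lambda>(x, v). (\<Sum>i\<in>UNIV. w i x * (u i t x - v $ i)) * f t x v)"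
  proof (rule integrable_phase_f[OF t])
    show "(\<lambda>(x, v). \<Sum>i\<in>UNIV. w i x * (u i t x - v $ i)) \<in> borel_measurable borel"
      unfolding case_prod_beta
      by (intro borel_measurable_continuous_onI continuous_on_sum continuous_on_mult continuous_on_diff continuous_u t
          continuous_on_comp_UNIV[OF w(1)] continuous_intros)
    show "\<bar>\<Sum>i\<in>UNIV. w i x * (u i t x - v $ i)\<bar> \<le> real CARD('n) * (2 * b * (U + 1)) * wt v" for x v
    proof -
      have "\<bar>w i x\<bar> \<le> b * (1 + norm v)" for i
        using w(2)[of i x] b mult_left_mono[of 1 "1 + norm v" b] by simp
      then have "\<bar>\<Sum>i\<in>UNIV. w i x * (u i t x - v $ i)\<bar> \<le> (\<Sum>i\<in>(UNIV :: 'n set). 2 * b * (U + 1) * wt v)"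
        using b velocity_bound[OF t] by (intro order.trans[OF sum_abs sum_mono] wt_bounds_mult) auto
      then show ?thesis by simp
    qed
  qed
  have inner: "(LINT v:UNIV|lborel. (\<Sum>i\<in>UNIV. w i x * (u i t x - v $ i)) * f t x v) = (\<Sum>i\<in>UNIV. w i x * force i t x)" for x
  proof -
    have "(\<Sum>i\<in>UNIV. w i x * (u i t x - v $ i)) * f t x v = (\<Sum>i\<in>UNIV. w i x * (f t x v * (u i t x - v $ i)))" for v
      by (simp add: sum_distrib_left sum_distrib_right mult_ac)
    then show ?thesis
      using f_velocity_integrable(2)[OF t, of x] by (simp add: set_lebesgue_integral_def force_def)
  qed
  show "set_integrable lborel torus (\<lambda>x. \<Sum>i\<in>UNIV. w i x * force i t x)"
    using set_integral_product(2)[OF 1] unfolding prod.case inner .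
  show "(LINT (x, v):phase_space|lborel. (\<Sum>i\<in>UNIV. w i x * (u i t x - v $ i)) * f t x v)
      = (LINT x:torus|lborel. \<Sum>i\<in>UNIV. w i x * force i t x)"
    using set_integral_product(3)[OF 1] unfolding prod.case inner .
qed

lemma density_pairing:
  assumes t: "t \<ge> 0" and w: "continuous_on UNIV w" "\<And>x. \<bar>w x\<bar> \<le> b"
  shows "set_integrable lborel phase_space (\<lambda>(x, v). w x * f t x v)"
    and "set_integrable lborel torus (\<lambda>x. w x * particle_density (f t) x)"
    and "(LINT (x, v):phase_space|lborel. w x * f t x v) = (LINT x:torus|lborel. w x * particle_density (f t) x)"
proof -
  have b: "0 \<le> b" using w(2)[of 0] by linarith
  show 1: "set_integrable lborel phase_space (\<lambda>(x, v). w x * f t x v)"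
  proof (rule integrable_phase_f[OF t])
    show "(\<lambda>(x :: real ^ 'n, v :: real ^ 'n). w x) \<in> borel_measurable borel"
      unfolding case_prod_beta
      by (intro borel_measurable_continuous_onI continuous_on_comp_UNIV[OF w(1)] continuous_intros)
    show "\<bar>w x\<bar> \<le> b * wt v" for x and v :: "real ^ 'n"
      using w(2)[of x] b mult_left_mono[OF wt_ge(1)[of v] b] by simp
  qed
  have inner: "(LINT v:UNIV|lborel. w x * f t x v) = w x * particle_density (f t) x" for x
    by (simp add: set_lebesgue_integral_def particle_density_def)
  show "set_integrable lborel torus (\<lambda>x. w x * particle_density (f t) x)"
    using set_integral_product(2)[OF 1] unfolding prod.case inner .
  show "(LINT (x, v):phase_space|lborel. w x * f t x v) = (LINT x:torus|lborel. w x * particle_density (f t) x)"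
    using set_integral_product(3)[OF 1] unfolding prod.case inner .
qed

lemma weighted_sobolev_phase:
  assumes n: "CARD('n) \<ge> 3" and t: "t \<ge> 0" and M: "Lp_bounded (real CARD('n) / 2) M (particle_density (f t))"
    and w: "pcont w" "\<And>i. has_partial i w (w' i)" "\<And>i. pcont (w' i)" "tint w = 0"
  shows "set_integrable lborel phase_space (\<lambda>(x, v). (w x)\<^sup>2 * f t x v)"
    "(LINT (x, v):phase_space|lborel. (w x)\<^sup>2 * f t x v)
      \<le> (M + 1) * (2 ^ (CARD('n) + 1) + 32) * (\<Sum>i\<in>UNIV. tint (\<lambda>x. (w' i x)\<^sup>2))"
proof -
  obtain b where b: "\<And>x. \<bar>(w x)\<^sup>2\<bar> \<le> b" using pcont_bounded[OF pcont_power[OF w(1)]] by blast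
  note D = density_pairing[OF t pcont_cont[OF pcont_power[OF w(1), of 2]] b]
  show "set_integrable lborel phase_space (\<lambda>(x, v). (w x)\<^sup>2 * f t x v)" by (rule D(1))
  have "set_integrable lborel torus (particle_density (f t))"
    using density_pairing(2)[OF t continuous_on_const, of 1 1] by simp
  moreover have "0 \<le> particle_density (f t) x" for x
    unfolding particle_density_def by (intro Bochner_Integration.integral_nonneg f_nonneg t)
  ultimately show "(LINT (x, v):phase_space|lborel. (w x)\<^sup>2 * f t x v)
      \<le> (M + 1) * (2 ^ (CARD('n) + 1) + 32) * (\<Sum>i\<in>UNIV. tint (\<lambda>x. (w' i x)\<^sup>2))"
    using weighted_sobolev(2)[OF n w M] unfolding D(3) by (simp add: mult.commute)
qed

lemma set_integral_sum:
  fixes g :: "'i \<Rightarrow> 'b \<Rightarrow> real"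
  assumes "finite I" "\<And>i. i \<in> I \<Longrightarrow> set_integrable M' A (g i)"
  shows "set_integrable M' A (\<lambda>z. \<Sum>i\<in>I. g i z)" "(LINT z:A|M'. \<Sum>i\<in>I. g i z) = (\<Sum>i\<in>I. LINT z:A|M'. g i z)"
  using assms unfolding set_integrable_def set_lebesgue_integral_def real_scaleR_def sum_distrib_left
  by - (rule Bochner_Integration.integrable_sum Bochner_Integration.integral_sum, assumption)+

text \<open>Under the measure with density \<open>f\<close>, Young's inequality splits the product
  of \<open>B\<close> and the relative velocity. The first part is the slip; the second is an
  integral of \<open>B^2\<close> weighted by the particle density, controlled by the weighted
  Sobolev inequality because \<open>B\<close> has mean zero.\<close>

lemma force_bound:
  assumes n: "CARD('n) \<ge> 3" and t: "t \<ge> 0" and M: "Lp_bounded (real CARD('n) / 2) M (particle_density (f t))"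
    and B: "\<And>i. pcont (B i)" "\<And>i. tint (B i) = 0" "\<And>i j. has_partial j (B i) (Bx i j)" "\<And>i j. pcont (Bx i j)"
    and \<delta>: "\<delta> > 0"
  shows "\<bar>LINT x:torus|lborel. \<Sum>i\<in>UNIV. force i t x * B i x\<bar>
    \<le> slip t / \<delta> + \<delta> * ((M + 1) * (2 ^ (CARD('n) + 1) + 32)) * (\<Sum>i\<in>UNIV. \<Sum>j\<in>UNIV. tint (\<lambda>x. (Bx i j x)\<^sup>2))"
proof -
  let ?S = "(M + 1) * (2 ^ (CARD('n) + 1) + 32)"
  have "\<exists>b. \<forall>x. \<bar>B i x\<bar> \<le> b" for i using pcont_bounded[OF B(1)] by blast
  then obtain b where b: "\<And>i x. \<bar>B i x\<bar> \<le> b i" by metis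
  have bb: "\<bar>B i x\<bar> \<le> Max (range b)" for i x
    using b[of i x] Max_ge[of "range b" "b i"] by (meson finite finite_imageI order_trans rangeI)
  note P = force_pairing[OF t, where w = B, OF pcont_cont[OF B(1)] bb]
  note sob = weighted_sobolev_phase[OF n t M B(1,3,4,2)]
  have "\<bar>LINT x:torus|lborel. \<Sum>i\<in>UNIV. force i t x * B i x\<bar>
    = \<bar>LINT (x, v):phase_space|lborel. (\<Sum>i\<in>UNIV. B i x * (u i t x - v $ i)) * f t x v\<bar>"
    unfolding P(3) by (simp add: mult.commute)
  also have "\<dots> \<le> (LINT (x, v):phase_space|lborel. \<bar>(\<Sum>i\<in>UNIV. B i x * (u i t x - v $ i)) * f t x v\<bar>)"
    unfolding set_lebesgue_integral_def
    by (rule order.trans[OF integral_abs_bound]) (simp add: abs_mult case_prod_beta)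
  also have "\<dots> \<le> (LINT z:phase_space|lborel. inverse \<delta> * (case z of (x, v) \<Rightarrow> (\<Sum>i\<in>UNIV. (u i t x - v $ i)\<^sup>2) * f t x v)
      + \<delta> * (\<Sum>i\<in>UNIV. case z of (x, v) \<Rightarrow> (B i x)\<^sup>2 * f t x v))"
  proof (rule set_integral_mono)
    show "set_integrable lborel phase_space (\<lambda>(x, v). \<bar>(\<Sum>i\<in>UNIV. B i x * (u i t x - v $ i)) * f t x v\<bar>)"
      using set_integrable_abs[OF P(1)] unfolding case_prod_beta .
    show "set_integrable lborel phase_space (\<lambda>z. inverse \<delta> * (case z of (x, v) \<Rightarrow> (\<Sum>i\<in>UNIV. (u i t x - v $ i)\<^sup>2) * f t x v)
      + \<delta> * (\<Sum>i\<in>UNIV. case z of (x, v) \<Rightarrow> (B i x)\<^sup>2 * f t x v))"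
      by (intro set_integral_add set_integrable_mult_right slip_integrable[OF t] set_integral_sum(1) finite sob(1))
    fix z :: "(real ^ 'n) \<times> (real ^ 'n)"
    obtain x v where z: "z = (x, v)" by (cases z)
    have "\<bar>\<Sum>i\<in>UNIV. B i x * (u i t x - v $ i)\<bar> \<le> (\<Sum>i\<in>UNIV. inverse \<delta> * (u i t x - v $ i)\<^sup>2 + \<delta> * (B i x)\<^sup>2)"
    proof (rule order.trans[OF sum_abs sum_mono])
      fix i
      have "0 \<le> (\<bar>u i t x - v $ i\<bar> - \<delta> * \<bar>B i x\<bar>)\<^sup>2" by simp
      then have "2 * \<delta> * (\<bar>B i x\<bar> * \<bar>u i t x - v $ i\<bar>) \<le> (u i t x - v $ i)\<^sup>2 + \<delta>\<^sup>2 * (B i x)\<^sup>2"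
        unfolding power2_diff[of "\<bar>u i t x - v $ i\<bar>"] power_mult_distrib power2_abs by (simp add: mult_ac)
      then have "2 * (\<bar>B i x\<bar> * \<bar>u i t x - v $ i\<bar>) \<le> inverse \<delta> * (u i t x - v $ i)\<^sup>2 + \<delta> * (B i x)\<^sup>2"
        using \<delta> by (simp add: field_simps power2_eq_square[of \<delta>])
      moreover have "0 \<le> \<bar>B i x\<bar> * \<bar>u i t x - v $ i\<bar>" by simp
      ultimately show "\<bar>B i x * (u i t x - v $ i)\<bar> \<le> inverse \<delta> * (u i t x - v $ i)\<^sup>2 + \<delta> * (B i x)\<^sup>2"
        unfolding abs_mult by linarith
    qed
    then have le: "\<bar>\<Sum>i\<in>UNIV. B i x * (u i t x - v $ i)\<bar> * f t x v
      \<le> (\<Sum>i\<in>UNIV. inverse \<delta> * (u i t x - v $ i)\<^sup>2 + \<delta> * (B i x)\<^sup>2) * f t x v"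
      by (rule mult_right_mono[OF _ f_nonneg[OF t]])
    have R: "(\<Sum>i\<in>UNIV. inverse \<delta> * (u i t x - v $ i)\<^sup>2 + \<delta> * (B i x)\<^sup>2) * f t x v
      = inverse \<delta> * ((\<Sum>i\<in>UNIV. (u i t x - v $ i)\<^sup>2) * f t x v) + \<delta> * (\<Sum>i\<in>UNIV. (B i x)\<^sup>2 * f t x v)"
      by (simp add: sum.distrib sum_distrib_left algebra_simps)
    show "(case z of (x, v) \<Rightarrow> \<bar>(\<Sum>i\<in>UNIV. B i x * (u i t x - v $ i)) * f t x v\<bar>)
      \<le> inverse \<delta> * (case z of (x, v) \<Rightarrow> (\<Sum>i\<in>UNIV. (u i t x - v $ i)\<^sup>2) * f t x v)
      + \<delta> * (\<Sum>i\<in>UNIV. case z of (x, v) \<Rightarrow> (B i x)\<^sup>2 * f t x v)"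
      using le unfolding z prod.case abs_mult abs_of_nonneg[OF f_nonneg[OF t]] R .
  qed
  also have "\<dots> = inverse \<delta> * slip t + \<delta> * (\<Sum>i\<in>UNIV. LINT (x, v):phase_space|lborel. (B i x)\<^sup>2 * f t x v)"
    unfolding slip_def
    by (subst set_integral_add(2); (intro set_integrable_mult_right slip_integrable[OF t] set_integral_sum(1) finite sob(1))?)
      (simp add: set_integral_mult_right set_integral_sum(2)[OF finite sob(1)])
  also have "\<dots> \<le> inverse \<delta> * slip t + \<delta> * (\<Sum>i\<in>UNIV. ?S * (\<Sum>j\<in>UNIV. tint (\<lambda>x. (Bx i j x)\<^sup>2)))"
    using \<delta> sob(2) by (intro add_left_mono mult_left_mono sum_mono) auto
  finally show ?thesis
    unfolding sum_distrib_left[symmetric] by (simp add: divide_inverse mult_ac)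
qed

text \<open>Particles relax to \<open>u\<close> at the cost of slip, and \<open>u\<close> is close
  to its mean at the cost of gradient, also when weighted by the particle density. The frame has to
  be the spatial mean of \<open>u\<close>, since the Sobolev inequality is used for functions of
  mean zero.\<close>

lemma coercivity:
  assumes n: "CARD('n) \<ge> 3" and t: "t \<ge> 0" and M: "Lp_bounded (real CARD('n) / 2) M (particle_density (f t))"
    and ux: "\<And>i j. has_partial j (u i t) (ux i j)" "\<And>i j. pcont (ux i j)"
  shows "kinetic_energy (\<lambda>i. tint (u i t)) t
    \<le> slip t + (M + 1) * (2 ^ (CARD('n) + 1) + 32) * (\<Sum>i\<in>UNIV. \<Sum>j\<in>UNIV. tint (\<lambda>x. (ux i j x)\<^sup>2))"
proof -
  let ?S = "(M + 1) * (2 ^ (CARD('n) + 1) + 32)"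
  let ?w = "\<lambda>i x. u i t x - tint (u i t)"
  have pu: "pcont (u i t)" for i using t by (intro tcont_pcont[OF cont_u]) auto
  have w: "pcont (?w i)" "has_partial j (?w i) (ux i j)" "tint (?w i) = 0" for i j
    using has_partial_diff[OF ux(1) has_partial_const] by (auto intro!: pcont_diff pu simp: tint_diff pu)
  note sob = weighted_sobolev_phase[OF n t M w(1,2) ux(2) w(3)]
  have "kinetic_energy (\<lambda>i. tint (u i t)) t
    \<le> (LINT z:phase_space|lborel. (case z of (x, v) \<Rightarrow> (\<Sum>i\<in>UNIV. (u i t x - v $ i)\<^sup>2) * f t x v)
      + (\<Sum>i\<in>UNIV. case z of (x, v) \<Rightarrow> (?w i x)\<^sup>2 * f t x v))"
    unfolding kinetic_energy_def moment_def
  proof (rule set_integral_mono)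
    define m where "m = Max (range (\<lambda>i. \<bar>tint (u i t)\<bar>))"
    have m: "\<bar>tint (u i t)\<bar> \<le> m" for i unfolding m_def by (intro Max_ge) auto
    have m0: "0 \<le> m" using m[of undefined] by linarith
    show "set_integrable lborel phase_space (\<lambda>(x, v). (\<Sum>i\<in>UNIV. (v $ i - tint (u i t))\<^sup>2 / 2) * f t x v)"
    proof (rule integrable_phase_f[OF t])
      show "(\<lambda>(x :: real ^ 'n, v). \<Sum>i\<in>UNIV. (v $ i - tint (u i t))\<^sup>2 / 2) \<in> borel_measurable borel"
        unfolding case_prod_beta by (intro borel_measurable_continuous_onI continuous_intros) auto
      show "\<bar>\<Sum>i\<in>UNIV. (v $ i - tint (u i t))\<^sup>2 / 2\<bar> \<le> real CARD('n) * (2 * (m + 1) * (m + 1)) * wt v" for v :: "real ^ 'n"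
      proof -
        have "\<bar>v $ i - tint (u i t)\<bar> \<le> (m + 1) * (1 + norm v)" for i
        proof -
          have "\<bar>v $ i - tint (u i t)\<bar> \<le> norm v + m"
            using component_le_norm_cart[of v i] m[of i] by linarith
          also have "\<dots> \<le> (m + 1) * (1 + norm v)" using m0 by (simp add: algebra_simps)
          finally show ?thesis .
        qed
        then have "\<bar>\<Sum>i\<in>UNIV. (v $ i - tint (u i t))\<^sup>2\<bar> \<le> real CARD('n) * (2 * (m + 1) * (m + 1)) * wt v"
          using m0 by (intro sum_square_bound) auto
        moreover have "0 \<le> (\<Sum>i\<in>UNIV. (v $ i - tint (u i t))\<^sup>2)" by (simp add: sum_nonneg)
        ultimately show ?thesis by (simp add: sum_divide_distrib[symmetric])
      qed
    qed
    show "set_integrable lborel phase_space (\<lambda>z. (case z of (x, v) \<Rightarrow> (\<Sum>i\<in>UNIV. (u i t x - v $ i)\<^sup>2) * f t x v)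
      + (\<Sum>i\<in>UNIV. case z of (x, v) \<Rightarrow> (?w i x)\<^sup>2 * f t x v))"
      by (intro set_integral_add slip_integrable[OF t] set_integral_sum(1) finite sob(1))
    fix z :: "(real ^ 'n) \<times> (real ^ 'n)"
    obtain x v where z: "z = (x, v)" by (cases z)
    have "(a - c)\<^sup>2 \<le> 2 * ((b - a)\<^sup>2 + (b - c)\<^sup>2)" for a b c :: real
      using zero_le_power2[of "a + c - 2 * b"] by (simp add: power2_eq_square algebra_simps)
    then have "(v $ i - tint (u i t))\<^sup>2 / 2 \<le> (u i t x - v $ i)\<^sup>2 + (?w i x)\<^sup>2" for i
      by (simp add: mult.commute)
    then have "(\<Sum>i\<in>UNIV. (v $ i - tint (u i t))\<^sup>2 / 2) * f t x v \<le> (\<Sum>i\<in>UNIV. (u i t x - v $ i)\<^sup>2 + (?w i x)\<^sup>2) * f t x v"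
      by (intro mult_right_mono sum_mono f_nonneg t)
    then show "(case z of (x, v) \<Rightarrow> (\<Sum>i\<in>UNIV. (v $ i - tint (u i t))\<^sup>2 / 2) * f t x v)
      \<le> (case z of (x, v) \<Rightarrow> (\<Sum>i\<in>UNIV. (u i t x - v $ i)\<^sup>2) * f t x v)
      + (\<Sum>i\<in>UNIV. case z of (x, v) \<Rightarrow> (?w i x)\<^sup>2 * f t x v)"
      unfolding z prod.case by (simp add: sum.distrib sum_distrib_right distrib_right)
  qed
  also have "\<dots> = slip t + (\<Sum>i\<in>UNIV. LINT (x, v):phase_space|lborel. (?w i x)\<^sup>2 * f t x v)"
    unfolding slip_def
    by (subst set_integral_add(2); (intro slip_integrable[OF t] set_integral_sum(1) finite sob(1))?)
      (simp add: set_integral_sum(2)[OF finite sob(1)])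
  also have "\<dots> \<le> slip t + (\<Sum>i\<in>UNIV. ?S * (\<Sum>j\<in>UNIV. tint (\<lambda>x. (ux i j x)\<^sup>2)))"
    using sob(2) by (intro add_left_mono sum_mono) auto
  finally show ?thesis by (simp add: sum_distrib_left)
qed

end

subsection \<open>Convexity of the pressure potential\<close>

text \<open>On \<open>{a / 2..max R a}\<close> the mean value theorem applies, and the derivative,
  monotone in one sense or the other, lies between its values at the ends. Below
  \<open>a / 2\<close>, where the derivative may vanish or blow up at 0, both sides are bounded away
  from zero and infinity, and constants suffice.\<close>

lemma powr_diff_two_sided:
  fixes a \<beta> R :: real
  assumes a: "a > 0" and \<beta>: "\<beta> > 0"
  shows "\<exists>c>0. \<exists>C>0. \<forall>r. 0 \<le> r \<longrightarrow> r \<le> R \<longrightarrow>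
    c * (r - a)\<^sup>2 \<le> (r powr \<beta> - a powr \<beta>) * (r - a) \<and> (r powr \<beta> - a powr \<beta>) * (r - a) \<le> C * (r - a)\<^sup>2"
proof -
  \<comment> \<open>The maximum covers the case that \<open>a\<close> lies above
    \<open>R\<close>.\<close>
  define T where "T = max R a"
  define lo where "lo = \<beta> * min ((a / 2) powr (\<beta> - 1)) (T powr (\<beta> - 1))"
  define hi where "hi = \<beta> * max ((a / 2) powr (\<beta> - 1)) (T powr (\<beta> - 1))"
  define d where "d = a powr \<beta> - (a / 2) powr \<beta>"
  have T: "0 < T" "a \<le> T" "R \<le> T" using a by (auto simp: T_def)
  have pos: "0 < lo" "0 < hi" "0 < d"
    using a \<beta> T by (auto simp: lo_def hi_def d_def powr_less_mono2 less_max_iff_disj)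
  have deriv: "lo \<le> \<beta> * z powr (\<beta> - 1)" "\<beta> * z powr (\<beta> - 1) \<le> hi" if z: "a / 2 \<le> z" "z \<le> T" for z
  proof -
    have "min ((a / 2) powr (\<beta> - 1)) (T powr (\<beta> - 1)) \<le> z powr (\<beta> - 1)
      \<and> z powr (\<beta> - 1) \<le> max ((a / 2) powr (\<beta> - 1)) (T powr (\<beta> - 1))"
    proof (cases "\<beta> \<ge> 1")
      case True
      then have "(a / 2) powr (\<beta> - 1) \<le> z powr (\<beta> - 1)" "z powr (\<beta> - 1) \<le> T powr (\<beta> - 1)"
        using a z by (auto intro!: powr_mono2)
      then show ?thesis by auto
    next
      case False
      then have "z powr (\<beta> - 1) \<le> (a / 2) powr (\<beta> - 1)" "T powr (\<beta> - 1) \<le> z powr (\<beta> - 1)"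
        using a z by (auto intro!: powr_mono2')
      then show ?thesis by auto
    qed
    then show "lo \<le> \<beta> * z powr (\<beta> - 1)" "\<beta> * z powr (\<beta> - 1) \<le> hi"
      using \<beta> by (auto simp: lo_def hi_def)
  qed
  have mvt: "lo * (y - x)\<^sup>2 \<le> (y powr \<beta> - x powr \<beta>) * (y - x) \<and> (y powr \<beta> - x powr \<beta>) * (y - x) \<le> hi * (y - x)\<^sup>2"
    if xy: "a / 2 \<le> x" "x < y" "y \<le> T" for x y
  proof -
    have "\<exists>z>x. z < y \<and> y powr \<beta> - x powr \<beta> = (y - x) * (\<beta> * z powr (\<beta> - 1))"
    proof (rule MVT2[OF xy(2)])
      fix z assume "x \<le> z" "z \<le> y"
      then have "0 < z" using xy a by linarith
      then show "((\<lambda>z. z powr \<beta>) has_real_derivative \<beta> * z powr (\<beta> - 1)) (at z)"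
        by (rule has_real_derivative_powr)
    qed
    then obtain z where z: "x < z" "z < y" "y powr \<beta> - x powr \<beta> = (y - x) * (\<beta> * z powr (\<beta> - 1))" by blast
    have eq: "(y powr \<beta> - x powr \<beta>) * (y - x) = \<beta> * z powr (\<beta> - 1) * (y - x)\<^sup>2"
      unfolding z(3) by (simp add: power2_eq_square)
    have "a / 2 \<le> z" "z \<le> T" using z(1,2) xy by linarith+
    then show ?thesis unfolding eq by (intro conjI mult_right_mono deriv) auto
  qed
  have "min lo (d / a) * (r - a)\<^sup>2 \<le> (r powr \<beta> - a powr \<beta>) * (r - a) \<and>
      (r powr \<beta> - a powr \<beta>) * (r - a) \<le> max hi (2 * a powr \<beta> / a) * (r - a)\<^sup>2" if r: "0 \<le> r" "r \<le> R" for r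
  proof (cases "r < a / 2")
    case True
    have eq: "(r powr \<beta> - a powr \<beta>) * (r - a) = (a powr \<beta> - r powr \<beta>) * (a - r)" "(r - a)\<^sup>2 = (a - r) * (a - r)"
      by (simp_all add: algebra_simps power2_eq_square)
    have "r powr \<beta> \<le> (a / 2) powr \<beta>" using True r \<beta> by (intro powr_mono2) auto
    then have 1: "d \<le> a powr \<beta> - r powr \<beta>" "a powr \<beta> - r powr \<beta> \<le> a powr \<beta>" by (auto simp: d_def)
    have "d / a * (a - r) * (a - r) \<le> d * (a - r)"
    proof -
      have "d / a * (a - r) \<le> d" using pos a r by (simp add: field_simps)
      then show ?thesis using True a by (intro mult_right_mono) auto
    qed
    also have "\<dots> \<le> (a powr \<beta> - r powr \<beta>) * (a - r)" using 1 True a by (intro mult_right_mono) auto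
    finally have lower: "d / a * (a - r) * (a - r) \<le> (a powr \<beta> - r powr \<beta>) * (a - r)" .
    have "(a powr \<beta> - r powr \<beta>) * (a - r) \<le> a powr \<beta> * (a - r)" using 1 True a by (intro mult_right_mono) auto
    also have "\<dots> \<le> 2 * a powr \<beta> / a * (a - r) * (a - r)"
    proof -
      have "1 \<le> 2 / a * (a - r)" using True a by (simp add: field_simps)
      then have "a powr \<beta> * 1 \<le> a powr \<beta> * (2 / a * (a - r))" by (intro mult_left_mono) auto
      then have "a powr \<beta> * 1 * (a - r) \<le> a powr \<beta> * (2 / a * (a - r)) * (a - r)"
        using True a by (intro mult_right_mono) auto
      also have "\<dots> = 2 * a powr \<beta> / a * (a - r) * (a - r)" by simp
      finally show ?thesis by simp
    qed
    finally have upper: "(a powr \<beta> - r powr \<beta>) * (a - r) \<le> 2 * a powr \<beta> / a * (a - r) * (a - r)" .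
    have "min lo (d / a) * ((a - r) * (a - r)) \<le> d / a * ((a - r) * (a - r))"
      "2 * a powr \<beta> / a * ((a - r) * (a - r)) \<le> max hi (2 * a powr \<beta> / a) * ((a - r) * (a - r))"
      by (intro mult_right_mono; simp)+
    with lower upper show ?thesis unfolding eq by (simp only: mult.assoc) linarith
  next
    case False
    have main: "lo * (r - a)\<^sup>2 \<le> (r powr \<beta> - a powr \<beta>) * (r - a) \<and> (r powr \<beta> - a powr \<beta>) * (r - a) \<le> hi * (r - a)\<^sup>2"
    proof -
      consider "r = a" | "r < a" | "a < r" by linarith
      then show ?thesis
      proof cases
        case 2
        have "(r powr \<beta> - a powr \<beta>) * (r - a) = (a powr \<beta> - r powr \<beta>) * (a - r)" "(r - a)\<^sup>2 = (a - r)\<^sup>2"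
          by (simp_all add: algebra_simps power2_eq_square)
        then show ?thesis using mvt[of r a] 2 False T by simp
      qed (use mvt[of a r] r a T in auto)
    qed
    moreover have "min lo (d / a) * (r - a)\<^sup>2 \<le> lo * (r - a)\<^sup>2" "hi * (r - a)\<^sup>2 \<le> max hi (2 * a powr \<beta> / a) * (r - a)\<^sup>2"
      by (intro mult_right_mono; simp)+
    ultimately show ?thesis by linarith
  qed
  moreover have "0 < min lo (d / a)" "0 < max hi (2 * a powr \<beta> / a)" using pos a by auto
  ultimately show ?thesis by blast
qed

text \<open>Convexity in the form of Young's inequality for the exponents \<gamma> and \<gamma> /
  (\<gamma> - 1), which includes vanishing arguments.\<close>

lemma powr_tangent:
  fixes r s :: real
  assumes "0 \<le> r" "0 \<le> s" "1 < \<gamma>"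
  shows "s powr \<gamma> + \<gamma> * s powr (\<gamma> - 1) * (r - s) \<le> r powr \<gamma>"
proof -
  define q where "q = \<gamma> / (\<gamma> - 1)"
  have q: "1 < q" "1 / \<gamma> + 1 / q = 1" using assms(3) by (auto simp: q_def field_simps)
  have s1: "s * s powr (\<gamma> - 1) = s powr \<gamma>" using assms by (cases "s = 0") (auto simp: powr_diff)
  have "(s powr (\<gamma> - 1)) powr q = s powr \<gamma>" using assms(3) by (simp add: powr_powr q_def)
  then have "r * s powr (\<gamma> - 1) \<le> r powr \<gamma> / \<gamma> + s powr \<gamma> / q"
    using Youngs_inequality[OF assms(3) q assms(1), of "s powr (\<gamma> - 1)"] by simp
  then have "\<gamma> * (r * s powr (\<gamma> - 1)) \<le> \<gamma> * (r powr \<gamma> / \<gamma> + s powr \<gamma> / q)"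
    using assms(3) by (intro mult_left_mono) auto
  also have "\<dots> = r powr \<gamma> + (\<gamma> - 1) * s powr \<gamma>" using assms(3) by (simp add: q_def field_simps)
  finally show ?thesis using s1 by (simp add: algebra_simps)
qed

text \<open>The convex excess is compared with differences of the power \<gamma> - 1 by tangents,
  which avoids second derivatives that may be singular at 0. For the lower bound the tangents at
  \<open>a\<close> and at the midpoint of \<open>a\<close> and \<open>r\<close> are chained; the
  half distance, squared, gives the factor 1 / 4. For the upper bound the tangent at
  \<open>r\<close> is enough.\<close>

lemma pressure_potential_bounds:
  fixes a \<gamma> R :: real
  assumes a: "a > 0" and \<gamma>: "\<gamma> > 1"
  shows "\<exists>c>0. \<exists>C>0. \<forall>r. 0 \<le> r \<longrightarrow> r \<le> R \<longrightarrow>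
    c * (r - a)\<^sup>2 \<le> r powr \<gamma> - a powr \<gamma> - \<gamma> * a powr (\<gamma> - 1) * (r - a) \<and>
    r powr \<gamma> - a powr \<gamma> - \<gamma> * a powr (\<gamma> - 1) * (r - a) \<le> C * (r - a)\<^sup>2"
proof -
  obtain c C where cC: "c > 0" "C > 0" and b: "\<And>r. 0 \<le> r \<Longrightarrow> r \<le> max R a \<Longrightarrow>
    c * (r - a)\<^sup>2 \<le> (r powr (\<gamma> - 1) - a powr (\<gamma> - 1)) * (r - a) \<and>
    (r powr (\<gamma> - 1) - a powr (\<gamma> - 1)) * (r - a) \<le> C * (r - a)\<^sup>2"
    using powr_diff_two_sided[OF a, of "\<gamma> - 1" "max R a"] \<gamma> by auto
  have "\<gamma> * c / 4 * (r - a)\<^sup>2 \<le> r powr \<gamma> - a powr \<gamma> - \<gamma> * a powr (\<gamma> - 1) * (r - a) \<and>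
    r powr \<gamma> - a powr \<gamma> - \<gamma> * a powr (\<gamma> - 1) * (r - a) \<le> \<gamma> * C * (r - a)\<^sup>2" if r: "0 \<le> r" "r \<le> R" for r
  proof
    define s where "s = (a + r) / 2"
    have s: "0 \<le> s" "s \<le> max R a" using a r by (auto simp: s_def)
    have "s powr \<gamma> + \<gamma> * s powr (\<gamma> - 1) * (r - s) \<le> r powr \<gamma>" "a powr \<gamma> + \<gamma> * a powr (\<gamma> - 1) * (s - a) \<le> s powr \<gamma>"
      using powr_tangent[OF r(1) s(1) \<gamma>] powr_tangent[OF s(1) _ \<gamma>, of a] a by auto
    then have "\<gamma> * s powr (\<gamma> - 1) * (r - s) + \<gamma> * a powr (\<gamma> - 1) * (s - a) - \<gamma> * a powr (\<gamma> - 1) * (r - a)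
      \<le> r powr \<gamma> - a powr \<gamma> - \<gamma> * a powr (\<gamma> - 1) * (r - a)" by linarith
    moreover have "\<gamma> * s powr (\<gamma> - 1) * (r - s) + \<gamma> * a powr (\<gamma> - 1) * (s - a) - \<gamma> * a powr (\<gamma> - 1) * (r - a)
      = \<gamma> * ((s powr (\<gamma> - 1) - a powr (\<gamma> - 1)) * (s - a))"
      by (simp add: s_def field_simps)
    moreover have "\<gamma> * (c * (s - a)\<^sup>2) \<le> \<gamma> * ((s powr (\<gamma> - 1) - a powr (\<gamma> - 1)) * (s - a))"
      using b[OF s] \<gamma> by (intro mult_left_mono) auto
    moreover have "\<gamma> * (c * (s - a)\<^sup>2) = \<gamma> * c / 4 * (r - a)\<^sup>2"
      by (simp add: s_def power2_eq_square field_simps)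
    ultimately show "\<gamma> * c / 4 * (r - a)\<^sup>2 \<le> r powr \<gamma> - a powr \<gamma> - \<gamma> * a powr (\<gamma> - 1) * (r - a)" by linarith
    have "r powr \<gamma> + \<gamma> * r powr (\<gamma> - 1) * (a - r) \<le> a powr \<gamma>"
      using powr_tangent[OF _ r(1) \<gamma>, of a] a by auto
    then have "r powr \<gamma> - a powr \<gamma> - \<gamma> * a powr (\<gamma> - 1) * (r - a) \<le> \<gamma> * ((r powr (\<gamma> - 1) - a powr (\<gamma> - 1)) * (r - a))"
      by (simp add: algebra_simps)
    also have "\<dots> \<le> \<gamma> * (C * (r - a)\<^sup>2)" using b[of r] r \<gamma> by (intro mult_left_mono) auto
    finally show "r powr \<gamma> - a powr \<gamma> - \<gamma> * a powr (\<gamma> - 1) * (r - a) \<le> \<gamma> * C * (r - a)\<^sup>2" by simp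
  qed
  moreover have "0 < \<gamma> * c / 4" "0 < \<gamma> * C" using cC \<gamma> by auto
  ultimately show ?thesis by blast
qed

subsection \<open>Exponential decay\<close>

text \<open>The hypothesis excludes \<open>s = 0\<close>, so halving is iterated from time 1, and
  monotonicity covers the time before. The factor \<open>exp C2\<close> pays for this unit of delay
  and the factor 2 for rounding down the number of halvings.\<close>

lemma exponential_decay:
  fixes E :: "real \<Rightarrow> real"
  assumes mono: "\<And>s t. 0 \<le> s \<Longrightarrow> s \<le> t \<Longrightarrow> E t \<le> E s" and nonneg: "\<And>t. 0 \<le> t \<Longrightarrow> 0 \<le> E t"
    and K: "K > 0" "\<And>s t. 0 < s \<Longrightarrow> s \<le> t \<Longrightarrow> (t - s) * E t \<le> K * E s"
  shows "\<exists>C1>0. \<exists>C2>0. \<forall>t\<ge>0. E t \<le> C1 * E 0 * exp (- C2 * t)"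
proof -
  define L where "L = 2 * K"
  have L: "L > 0" using K by (simp add: L_def)
  have half: "E (s + L) \<le> E s / 2" if "s > 0" for s
    using K(2)[of s "s + L"] that K(1) by (simp add: L_def)
  have iter: "E (1 + real n * L) \<le> (1 / 2) ^ n * E 0" for n
  proof (induction n)
    case 0 show ?case using mono[of 0 1] by simp
  next
    case (Suc n)
    have "E (1 + real (Suc n) * L) = E (1 + real n * L + L)" by (simp add: algebra_simps)
    also have "\<dots> \<le> E (1 + real n * L) / 2" using L by (intro half) (simp add: add_pos_nonneg)
    also have "\<dots> \<le> (1 / 2) ^ n * E 0 / 2" using Suc by simp
    finally show ?case by simp
  qed
  define C2 where "C2 = ln 2 / L"
  have C2: "C2 > 0" using L by (simp add: C2_def)
  have "E t \<le> 2 * exp C2 * E 0 * exp (- C2 * t)" if t: "t \<ge> 0" for t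
  proof (cases "t \<le> 1")
    case True
    have "1 \<le> 2 * (exp C2 * exp (- C2 * t))"
    proof -
      have "1 \<le> exp (C2 * (1 - t))" using True C2 by simp
      moreover have "exp C2 * exp (- C2 * t) = exp (C2 * (1 - t))"
        by (simp add: exp_add[symmetric] algebra_simps)
      ultimately show ?thesis by linarith
    qed
    then have "1 * E 0 \<le> 2 * (exp C2 * exp (- C2 * t)) * E 0" using nonneg[of 0] by (intro mult_right_mono) auto
    then show ?thesis using mono[of 0 t] t by (simp add: mult_ac)
  next
    case False
    define n where "n = nat \<lfloor>(t - 1) / L\<rfloor>"
    have n: "real n \<le> (t - 1) / L" "(t - 1) / L < real n + 1" using False L by (auto simp: n_def)
    have "E t \<le> E (1 + real n * L)" using n(1) L by (intro mono) (auto simp: pos_le_divide_eq)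
    also have "\<dots> \<le> (1 / 2) ^ n * E 0" by (rule iter)
    also have "(1 / 2) ^ n \<le> 2 * (exp C2 * exp (- C2 * t))"
    proof -
      have "(1 / 2 :: real) ^ n = exp (- (real n * ln 2))"
        by (simp add: exp_minus exp_of_nat_mult power_one_over inverse_eq_divide)
      also have "\<dots> \<le> exp (ln 2 + (C2 - C2 * t))"
      proof -
        have "(t - 1) / L * ln 2 \<le> (real n + 1) * ln 2" using n(2) by (intro mult_right_mono) auto
        then show ?thesis by (simp add: C2_def algebra_simps diff_divide_distrib)
      qed
      also have "\<dots> = 2 * (exp C2 * exp (- C2 * t))" by (simp add: exp_add exp_diff exp_minus field_simps)
      finally show ?thesis .
    qed
    finally show ?thesis using nonneg[of 0] by (simp add: mult_right_mono mult_ac)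
  qed
  then show ?thesis using C2 by (intro exI[of _ "2 * exp C2"]) auto
qed

text \<open>Connects the Lebesgue integrals of the kinetic balances, over half-open intervals, with
  the integrals over closed intervals of the fundamental theorem of calculus.\<close>

lemma has_integral_Ioc:
  fixes g :: "real \<Rightarrow> real"
  assumes "set_integrable lborel {s<..t} g"
  shows "(g has_integral (LINT \<tau>:{s<..t}|lborel. g \<tau>)) {s..t}"
proof -
  have "(g has_integral (LINT \<tau>:{s<..t}|lborel. g \<tau>)) {s<..t}"
    using set_borel_integral_eq_integral[OF assms] by (simp add: has_integral_integral)
  moreover have "negligible {x \<in> {s<..t} - {s..t}. g x \<noteq> 0}" "negligible {x \<in> {s..t} - {s<..t}. g x \<noteq> 0}"
    by (auto intro: negligible_subset[of "{s}"])
  ultimately show ?thesis using has_integral_spike_set_eq by blast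
qed

subsection \<open>The coupled system\<close>

text \<open>The two flows meet in the common velocity \<open>u\<close> and in the identification of
  the abstract \<open>F\<close> with the drag computed from \<open>f\<close>. The bounds
  \<open>R\<close> and \<open>M\<close> are the weights in the Poincare and Sobolev
  estimates.\<close>

locale coupled_flow = fluid_flow \<gamma> \<mu> lam \<rho> \<rho>t \<rho>x u ut F ux uxx + kinetic_flow f ft q fx fv u U
  for \<gamma> \<mu> lam :: real and \<rho> \<rho>t :: "real \<Rightarrow> real ^ 'n::finite \<Rightarrow> real"
    and \<rho>x u ut F :: "'n \<Rightarrow> real \<Rightarrow> real ^ 'n \<Rightarrow> real"
    and ux :: "'n \<Rightarrow> 'n \<Rightarrow> real \<Rightarrow> real ^ 'n \<Rightarrow> real"
    and uxx :: "'n \<Rightarrow> 'n \<Rightarrow> 'n \<Rightarrow> real \<Rightarrow> real ^ 'n \<Rightarrow> real"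
    and f ft q :: "real \<Rightarrow> real ^ 'n \<Rightarrow> real ^ 'n \<Rightarrow> real"
    and fx fv :: "'n \<Rightarrow> real \<Rightarrow> real ^ 'n \<Rightarrow> real ^ 'n \<Rightarrow> real" and U +
  fixes R M :: real
  assumes force: "t > 0 \<Longrightarrow> F i t x = force i t x"
    and dim: "CARD('n) \<ge> 3"
    and density_le: "t \<ge> 0 \<Longrightarrow> \<rho> t x \<le> R"
    and density_bounded: "AE t in lborel. 0 \<le> t \<longrightarrow> Lp_bounded (real CARD('n) / 2) M (particle_density (f t))"
    and fluid_mass_pos: "0 < tint (\<rho> 0)"
    and particle_mass_pos: "0 < moment (\<lambda>v. 1) 0"
    and M_nonneg: "0 \<le> M"
begin

section \<open>Masses, mean velocities and the frame of the centre of mass\<close>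

definition fmass where "fmass = tint (\<rho> 0)"
definition pmass where "pmass = moment (\<lambda>v. 1) 0"
definition pvel where "pvel t i = moment (\<lambda>v. v $ i) t / pmass"
definition fvel where "fvel t i = tint (\<lambda>x. \<rho> t x * u i t x) / fmass"
definition mvel where "mvel i = (pmass * pvel 0 i + fmass * fvel 0 i) / (pmass + fmass)"
definition sob where "sob = (M + 1) * (2 ^ (CARD('n) + 1) + 32)"

lemma masses: "0 < fmass" "0 < pmass"
  using fluid_mass_pos particle_mass_pos by (auto simp: fmass_def pmass_def)

lemma sob_nonneg: "0 \<le> sob"
  using M_nonneg by (simp add: sob_def)

lemma growth_energy:
  fixes V :: "'n \<Rightarrow> real"
  shows "\<exists>c. growth c (\<lambda>v. \<Sum>i\<in>UNIV. (v $ i - V i)\<^sup>2 / 2) (\<lambda>i v. v $ i - V i)"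
proof -
  define m where "m = Max (range (\<lambda>i. \<bar>V i\<bar>))"
  have m: "\<bar>V i\<bar> \<le> m" for i unfolding m_def by (intro Max_ge) auto
  have m0: "0 \<le> m" using m[of undefined] by linarith
  have b: "\<bar>v $ i - V i\<bar> \<le> (m + 1) * (1 + norm v)" for i and v :: "real ^ 'n"
  proof -
    have "\<bar>v $ i - V i\<bar> \<le> norm v + m" using component_le_norm_cart[of v i] m[of i] by linarith
    also have "\<dots> \<le> (m + 1) * (1 + norm v)" using m0 by (simp add: algebra_simps)
    finally show ?thesis .
  qed
  define c where "c = real CARD('n) * (2 * (m + 1) * (m + 1)) + (m + 1)"
  have c: "0 \<le> c" "m + 1 \<le> c" "real CARD('n) * (2 * (m + 1) * (m + 1)) \<le> c" using m0 by (auto simp: c_def)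
  have "growth c (\<lambda>v. \<Sum>i\<in>UNIV. (v $ i - V i)\<^sup>2 / 2) (\<lambda>i v. v $ i - V i)"
    unfolding growth_def
  proof (intro conjI allI)
    fix j
    have "has_partial j (\<lambda>v. \<Sum>i\<in>UNIV. (v $ i - V i)\<^sup>2 / 2) (\<lambda>v. \<Sum>i\<in>UNIV. (v $ i - V i) * (if j = i then 1 else 0))"
    proof (rule has_partial_sum)
      fix i
      have "has_partial j (\<lambda>v :: real ^ 'n. (1 * (v $ i - V i))\<^sup>2 / 2) (\<lambda>v. (1 * (v $ i - V i)) * (if j = i then 1 else 0))"
        by (rule has_partial_chain[where H = "\<lambda>s. s\<^sup>2 / 2" and H' = "\<lambda>s. s", OF has_partial_component])
          (auto intro!: derivative_eq_intros)
      then show "has_partial j (\<lambda>v :: real ^ 'n. (v $ i - V i)\<^sup>2 / 2) (\<lambda>v. (v $ i - V i) * (if j = i then 1 else 0))"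
        by simp
    qed
    moreover have "(\<lambda>v :: real ^ 'n. \<Sum>i\<in>UNIV. (v $ i - V i) * (if j = i then 1 else 0)) = (\<lambda>v. v $ j - V j)"
      by (simp add: if_distrib cong: if_cong)
    ultimately show "has_partial j (\<lambda>v. \<Sum>i\<in>UNIV. (v $ i - V i)\<^sup>2 / 2) (\<lambda>v. v $ j - V j)" by simp
  next
    fix v :: "real ^ 'n"
    have "\<bar>\<Sum>i\<in>UNIV. (v $ i - V i)\<^sup>2\<bar> \<le> real CARD('n) * (2 * (m + 1) * (m + 1)) * wt v"
      using m0 b by (intro sum_square_bound) auto
    also have "\<dots> \<le> c * wt v" using c wt_ge(2)[of v] by (intro mult_right_mono) auto
    finally have "\<bar>\<Sum>i\<in>UNIV. (v $ i - V i)\<^sup>2\<bar> \<le> c * wt v" .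
    moreover have "0 \<le> (\<Sum>i\<in>UNIV. (v $ i - V i)\<^sup>2)" by (simp add: sum_nonneg)
    ultimately show "\<bar>\<Sum>i\<in>UNIV. (v $ i - V i)\<^sup>2 / 2\<bar> \<le> c * wt v" by (simp add: sum_divide_distrib[symmetric])
  next
    fix i and v :: "real ^ 'n"
    have "(m + 1) * (1 + norm v) \<le> c * (1 + norm v)" using c by (intro mult_right_mono) auto
    with b[of v i] show "\<bar>v $ i - V i\<bar> \<le> c * (1 + norm v)" by linarith
  qed (auto intro!: continuous_intros c)
  then show ?thesis by blast
qed

lemma tint_pairing:
  assumes t: "t > 0" and w: "\<And>i. pcont (w i)"
  shows "(LINT x:torus|lborel. \<Sum>i\<in>UNIV. w i x * force i t x) = tint (\<lambda>x. \<Sum>i\<in>UNIV. w i x * F i t x)"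
    and "(LINT (x, v):phase_space|lborel. (\<Sum>i\<in>UNIV. w i x * (u i t x - v $ i)) * f t x v)
      = tint (\<lambda>x. \<Sum>i\<in>UNIV. w i x * F i t x)"
    and "set_integrable lborel phase_space (\<lambda>(x, v). (\<Sum>i\<in>UNIV. w i x * (u i t x - v $ i)) * f t x v)"
proof -
  have p: "pcont (\<lambda>x. \<Sum>i\<in>UNIV. w i x * F i t x)" by (intro pcont_sum pcont_mult w pconts[OF t])
  show 1: "(LINT x:torus|lborel. \<Sum>i\<in>UNIV. w i x * force i t x) = tint (\<lambda>x. \<Sum>i\<in>UNIV. w i x * F i t x)"
    using pcont_set_integrable(2)[OF p] force[OF t] by simp
  have "\<exists>b. \<forall>x. \<bar>w i x\<bar> \<le> b" for i using pcont_bounded[OF w] by blast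
  then obtain b where b: "\<And>i x. \<bar>w i x\<bar> \<le> b i" by metis
  have bb: "\<bar>w i x\<bar> \<le> Max (range b)" for i x
    using b[of i x] Max_ge[of "range b" "b i"] by (meson finite finite_imageI order_trans rangeI)
  note P = force_pairing[OF less_imp_le[OF t], where w = w, OF pcont_cont[OF w] bb]
  show "(LINT (x, v):phase_space|lborel. (\<Sum>i\<in>UNIV. w i x * (u i t x - v $ i)) * f t x v)
      = tint (\<lambda>x. \<Sum>i\<in>UNIV. w i x * F i t x)" using P(3) 1 by simp
  show "set_integrable lborel phase_space (\<lambda>(x, v). (\<Sum>i\<in>UNIV. w i x * (u i t x - v $ i)) * f t x v)" by (rule P(1))
qed

text \<open>Particles gain and the fluid loses the integral of the same force. The force is known
  only at positive times, but the single time 0 does not affect the integrals.\<close>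

lemma momentum_conservation:
  assumes t: "t \<ge> 0"
  shows "pmass * pvel t i + fmass * fvel t i = (pmass + fmass) * mvel i"
proof -
  let ?K = "\<lambda>\<tau>. LINT (x, v):phase_space|lborel. (u i \<tau> x - v $ i) * f \<tau> x v"
  have K: "?K \<tau> = tint (F i \<tau>)" if "\<tau> > 0" for \<tau>
    using tint_pairing(2)[OF that, of "\<lambda>j x. if j = i then 1 else 0"]
    by (simp add: if_distrib[of "\<lambda>z. z * _"] cong: if_cong)
  have d: "drag (\<lambda>j v. if j = i then 1 else 0) = ?K"
    unfolding drag_def by (simp add: if_distrib[of "\<lambda>z. z * _"] cong: if_cong)
  have I1: "(?K has_integral (moment (\<lambda>v. v $ i) t - moment (\<lambda>v. v $ i) 0)) {0..t}"
    unfolding particle_momentum_balance[OF order.refl t]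
    using drag_integrable[OF growth_component[of 1 i] order.refl t] by (intro has_integral_Ioc) (simp add: d)
  have I2: "((\<lambda>\<tau>. - tint (F i \<tau>)) has_integral (tint (\<lambda>x. \<rho> t x * u i t x) - tint (\<lambda>x. \<rho> 0 x * u i 0 x))) {0..t}"
  proof (rule fundamental_theorem_of_calculus_interior[OF t])
    show "continuous_on {0..t} (\<lambda>t. tint (\<lambda>x. \<rho> t x * u i t x))"
      by (rule continuous_on_subset[OF tcont_tint, of "{0..}"]) (auto intro: tcont_mult tconts)
    show "((\<lambda>t. tint (\<lambda>x. \<rho> t x * u i t x)) has_vector_derivative - tint (F i \<tau>)) (at \<tau>)" if "\<tau> \<in> {0<..<t}" for \<tau>
      using fluid_momentum_derivative[of \<tau> i] that by (simp add: has_real_derivative_iff_has_vector_derivative)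
  qed
  have "((\<lambda>\<tau>. 0) has_integral (moment (\<lambda>v. v $ i) t - moment (\<lambda>v. v $ i) 0)
      + (tint (\<lambda>x. \<rho> t x * u i t x) - tint (\<lambda>x. \<rho> 0 x * u i 0 x))) {0..t}"
    by (rule has_integral_spike[OF negligible_sing[of 0] _ has_integral_add[OF I1 I2]]) (use K in auto)
  then have "moment (\<lambda>v. v $ i) t + tint (\<lambda>x. \<rho> t x * u i t x) = moment (\<lambda>v. v $ i) 0 + tint (\<lambda>x. \<rho> 0 x * u i 0 x)"
    by (simp add: has_integral_iff)
  then show ?thesis
    using masses by (simp add: pvel_def fvel_def mvel_def add_pos_pos[THEN less_imp_neq, THEN not_sym])
qed

text \<open>The Huygens-Steiner identity for the particles; the 1 / 2 belongs to the normalisation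
  of \<open>kinetic_energy\<close>, and the corresponding identity for \<open>kin\<close> has
  none.\<close>

lemma kinetic_energy_expand:
  assumes t: "t \<ge> 0"
  shows "kinetic_energy V t = kinetic_energy (pvel t) t + pmass / 2 * (\<Sum>i\<in>UNIV. (V i - pvel t i)\<^sup>2)"
proof -
  have expand: "kinetic_energy V t = kinetic_energy (\<lambda>i. 0) t - pmass * (\<Sum>i\<in>UNIV. V i * pvel t i) + pmass / 2 * (\<Sum>i\<in>UNIV. (V i)\<^sup>2)" for V
  proof -
    have m1: "moment (\<lambda>v. 1) t = pmass" using particle_mass_conservation[OF t] by (simp add: pmass_def)
    obtain c where c: "growth c (\<lambda>v :: real ^ 'n. \<Sum>i\<in>UNIV. (v $ i - 0)\<^sup>2 / 2) (\<lambda>i v. v $ i - 0)"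
      using growth_energy[of "\<lambda>i. 0"] by blast
    have I: "set_integrable lborel phase_space (\<lambda>(x, v). (\<Sum>i\<in>UNIV. (v $ i - 0)\<^sup>2 / 2) * f t x v)"
      "set_integrable lborel phase_space (\<lambda>(x, v). 1 * v $ i * f t x v)" "set_integrable lborel phase_space (\<lambda>(x, v). 1 * f t x v)" for i
      by (rule moment_integrable[OF c t], rule moment_integrable[OF growth_component t], simp,
          rule moment_integrable[OF growth_const t], simp)
    have eq: "(case z of (x, v) \<Rightarrow> (\<Sum>i\<in>UNIV. (v $ i - V i)\<^sup>2 / 2) * f t x v)
      = (case z of (x, v) \<Rightarrow> (\<Sum>i\<in>UNIV. (v $ i - 0)\<^sup>2 / 2) * f t x v)
      - (\<Sum>i\<in>UNIV. V i * (case z of (x, v) \<Rightarrow> 1 * v $ i * f t x v))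
      + (\<Sum>i\<in>UNIV. (V i)\<^sup>2) / 2 * (case z of (x, v) \<Rightarrow> 1 * f t x v)" for z
    proof -
      obtain x v where z: "z = (x, v)" by (cases z)
      have "(\<Sum>i\<in>UNIV. (v $ i - V i)\<^sup>2 / 2) = (\<Sum>i\<in>UNIV. (v $ i)\<^sup>2 / 2 - V i * v $ i + (V i)\<^sup>2 / 2)"
        by (intro sum.cong refl) (simp add: power2_eq_square field_simps)
      also have "\<dots> = (\<Sum>i\<in>UNIV. (v $ i - 0)\<^sup>2 / 2) - (\<Sum>i\<in>UNIV. V i * v $ i) + (\<Sum>i\<in>UNIV. (V i)\<^sup>2) / 2"
        by (simp add: sum.distrib sum_subtractf sum_divide_distrib)
      finally have e: "(\<Sum>i\<in>UNIV. (v $ i - V i)\<^sup>2 / 2)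
        = (\<Sum>i\<in>UNIV. (v $ i - 0)\<^sup>2 / 2) - (\<Sum>i\<in>UNIV. V i * v $ i) + (\<Sum>i\<in>UNIV. (V i)\<^sup>2) / 2" .
      have "(\<Sum>i\<in>UNIV. V i * (1 * v $ i * f t x v)) = (\<Sum>i\<in>UNIV. V i * v $ i) * f t x v"
        by (simp add: sum_distrib_right mult.assoc)
      then show ?thesis
        unfolding z prod.case e by (simp add: left_diff_distrib distrib_right)
    qed
    have "kinetic_energy V t = kinetic_energy (\<lambda>i. 0) t
      - (\<Sum>i\<in>UNIV. V i * moment (\<lambda>v. 1 * v $ i) t) + (\<Sum>i\<in>UNIV. (V i)\<^sup>2) / 2 * moment (\<lambda>v. 1) t"
      unfolding kinetic_energy_def moment_def eq
      by (subst set_integral_add(2) set_integral_diff(2) set_integral_sum(2);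
          (intro set_integral_diff(1) set_integral_sum(1) set_integrable_mult_right finite I)?)+
        (simp add: set_integral_mult_right)
    also have "(\<Sum>i\<in>UNIV. V i * moment (\<lambda>v. 1 * v $ i) t) = pmass * (\<Sum>i\<in>UNIV. V i * pvel t i)"
      using masses by (simp add: pvel_def sum_distrib_left)
    finally show ?thesis by (simp add: m1)
  qed
  have sq: "(\<Sum>i\<in>UNIV. (V i - pvel t i)\<^sup>2) = (\<Sum>i\<in>UNIV. (V i)\<^sup>2) - 2 * (\<Sum>i\<in>UNIV. V i * pvel t i) + (\<Sum>i\<in>UNIV. (pvel t i)\<^sup>2)"
    by (simp add: power2_diff sum.distrib sum_subtractf sum_distrib_left mult.assoc)
  show ?thesis
    unfolding expand[of V] expand[of "pvel t"] sq by (simp add: power2_eq_square algebra_simps)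
qed

lemma kin_expand:
  assumes t: "t \<ge> 0"
  shows "kin V t = kin (fvel t) t + fmass * (\<Sum>i\<in>UNIV. (V i - fvel t i)\<^sup>2)"
proof -
  have pc: "pcont (\<rho> t)" "pcont (u i t)" for i
    using t by (auto intro: tcont_pcont tconts)
  have expand: "tint (\<lambda>x. \<rho> t x * (u i t x - a)\<^sup>2)
    = tint (\<lambda>x. \<rho> t x * (u i t x)\<^sup>2) - 2 * fmass * (a * fvel t i) + fmass * a\<^sup>2" for i a
  proof -
    have "tint (\<lambda>x. \<rho> t x * (u i t x - a)\<^sup>2)
      = tint (\<lambda>x. (\<rho> t x * (u i t x)\<^sup>2 - 2 * a * (\<rho> t x * u i t x)) + a\<^sup>2 * \<rho> t x)"
      by (intro arg_cong[where f = tint] ext) (simp add: power2_eq_square algebra_simps)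
    also have "\<dots> = tint (\<lambda>x. \<rho> t x * (u i t x)\<^sup>2) - 2 * a * tint (\<lambda>x. \<rho> t x * u i t x) + a\<^sup>2 * tint (\<rho> t)"
    proof (subst tint_add)
      show "pcont (\<lambda>x. \<rho> t x * (u i t x)\<^sup>2 - 2 * a * (\<rho> t x * u i t x))" "pcont (\<lambda>x. a\<^sup>2 * \<rho> t x)"
        by (intro pcont_diff pcont_mult pcont_power pcont_const pc)+
      have "tint (\<lambda>x. \<rho> t x * (u i t x)\<^sup>2 - 2 * a * (\<rho> t x * u i t x))
        = tint (\<lambda>x. \<rho> t x * (u i t x)\<^sup>2) - tint (\<lambda>x. 2 * a * (\<rho> t x * u i t x))"
        by (intro tint_diff pcont_mult pcont_power pcont_const pc)
      then show "tint (\<lambda>x. \<rho> t x * (u i t x)\<^sup>2 - 2 * a * (\<rho> t x * u i t x)) + tint (\<lambda>x. a\<^sup>2 * \<rho> t x)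
        = tint (\<lambda>x. \<rho> t x * (u i t x)\<^sup>2) - 2 * a * tint (\<lambda>x. \<rho> t x * u i t x) + a\<^sup>2 * tint (\<rho> t)" by simp
    qed
    finally show ?thesis using mass_conservation[OF t] masses by (simp add: fvel_def fmass_def[symmetric])
  qed
  show ?thesis
    unfolding kin_eq[OF t] expand
    by (simp add: sum.distrib sum_subtractf sum_distrib_left power2_eq_square algebra_simps)
qed

text \<open>Subtracting a constant already gives the convex excess of the pressure potential: the
  linear term of the expansion at \<open>fmass\<close> integrates to zero by conservation of
  mass.\<close>

definition potential_energy where "potential_energy t = (tint (p t) - fmass powr \<gamma>) / (\<gamma> - 1)"

definition energy where "energy t = kinetic_energy mvel t + kin mvel t / 2 + potential_energy t"

lemma kinetic_energy_nonneg: "t \<ge> 0 \<Longrightarrow> 0 \<le> kinetic_energy V t"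
  unfolding kinetic_energy_def moment_def set_lebesgue_integral_def
  by (intro Bochner_Integration.integral_nonneg)
    (auto simp: indicator_def case_prod_beta intro!: mult_nonneg_nonneg sum_nonneg f_nonneg)

text \<open>By conservation of momentum \<open>mvel\<close> is the centre of mass of the two mean
  velocities at every time, hence the minimum of a quadratic function of \<open>V\<close>. This
  allows passing from the fixed frame to one that varies with time.\<close>

lemma energy_minimal:
  assumes t: "t \<ge> 0"
  shows "kinetic_energy mvel t + kin mvel t / 2 \<le> kinetic_energy V t + kin V t / 2"
proof -
  have "pmass * (mvel i - pvel t i)\<^sup>2 + fmass * (mvel i - fvel t i)\<^sup>2
      \<le> pmass * (V i - pvel t i)\<^sup>2 + fmass * (V i - fvel t i)\<^sup>2" for i
  proof -
    have z: "pmass * (mvel i - pvel t i) + fmass * (mvel i - fvel t i) = 0"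
      using momentum_conservation[OF t, of i] by (simp add: algebra_simps)
    have "pmass * (V i - pvel t i)\<^sup>2 + fmass * (V i - fvel t i)\<^sup>2
      = pmass * (mvel i - pvel t i)\<^sup>2 + fmass * (mvel i - fvel t i)\<^sup>2
        + (pmass + fmass) * (V i - mvel i)\<^sup>2 + 2 * (V i - mvel i) * (pmass * (mvel i - pvel t i) + fmass * (mvel i - fvel t i))"
      by (simp add: power2_eq_square algebra_simps)
    moreover have "0 \<le> (pmass + fmass) * (V i - mvel i)\<^sup>2" using masses by simp
    ultimately show ?thesis unfolding z by simp
  qed
  then have "(\<Sum>i\<in>UNIV. pmass * (mvel i - pvel t i)\<^sup>2 + fmass * (mvel i - fvel t i)\<^sup>2)
      \<le> (\<Sum>i\<in>UNIV. pmass * (V i - pvel t i)\<^sup>2 + fmass * (V i - fvel t i)\<^sup>2)" by (intro sum_mono)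
  then show ?thesis
    unfolding kinetic_energy_expand[OF t, of V] kinetic_energy_expand[OF t, of mvel] kin_expand[OF t, of V] kin_expand[OF t, of mvel]
    unfolding sum.distrib sum_distrib_left[symmetric] by argo
qed

lemma potential_energy_bounds:
  "\<exists>c>0. \<exists>C>0. \<forall>t\<ge>0. c * var t \<le> potential_energy t \<and> potential_energy t \<le> C * var t"
proof -
  obtain c C where cC: "c > 0" "C > 0" and b: "\<And>r. 0 \<le> r \<Longrightarrow> r \<le> R \<Longrightarrow>
    c * (r - fmass)\<^sup>2 \<le> r powr \<gamma> - fmass powr \<gamma> - \<gamma> * fmass powr (\<gamma> - 1) * (r - fmass) \<and>
    r powr \<gamma> - fmass powr \<gamma> - \<gamma> * fmass powr (\<gamma> - 1) * (r - fmass) \<le> C * (r - fmass)\<^sup>2"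
    using pressure_potential_bounds[OF masses(1) \<gamma>, of R] by blast
  have "c * var t \<le> tint (p t) - fmass powr \<gamma> \<and> tint (p t) - fmass powr \<gamma> \<le> C * var t" if t: "t \<ge> 0" for t
  proof -
    have pc: "pcont (\<rho> t)" "pcont (p t)" using t by (auto intro: tcont_pcont tconts)
    let ?h = "\<lambda>x. (p t x - fmass powr \<gamma>) - \<gamma> * fmass powr (\<gamma> - 1) * (\<rho> t x - fmass)"
    have ph: "pcont ?h" by (intro pcont_diff pcont_mult pcont_const pc)
    have h: "tint ?h = tint (p t) - fmass powr \<gamma>"
    proof (subst tint_diff)
      show "pcont (\<lambda>x. p t x - fmass powr \<gamma>)" "pcont (\<lambda>x. \<gamma> * fmass powr (\<gamma> - 1) * (\<rho> t x - fmass))"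
        by (intro pcont_diff pcont_mult pcont_const pc)+
    qed (use mass_conservation[OF t] in \<open>simp add: tint_diff pc fmass_def\<close>)
    have v: "k * var t = tint (\<lambda>x. k * (\<rho> t x - fmass)\<^sup>2)" for k by (simp add: var_def fmass_def)
    have pv: "pcont (\<lambda>x. k * (\<rho> t x - fmass)\<^sup>2)" for k by (intro pcont_diff pcont_mult pcont_power pcont_const pc)
    show ?thesis unfolding h[symmetric] v
      using b \<rho>_nonneg[OF t] density_le[OF t] by (intro conjI tint_mono ph pv) (auto simp: p_def)
  qed
  then have "c / (\<gamma> - 1) * var t \<le> potential_energy t \<and> potential_energy t \<le> C / (\<gamma> - 1) * var t" if "t \<ge> 0" for t
    using that \<gamma> by (simp add: potential_energy_def divide_right_mono)
  then show ?thesis using cC \<gamma> by (intro exI[of _ "c / (\<gamma> - 1)"] exI[of _ "C / (\<gamma> - 1)"] conjI) auto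
qed

end

section \<open>Energy dissipation and decay\<close>

context coupled_flow begin

text \<open>Replacing v - V by (u - V) - (u - v) splits the work done on the particles into the work
  lost by the fluid and the dissipated slip.\<close>

lemma drag_eq:
  assumes t: "t > 0"
  shows "drag (\<lambda>i v. v $ i - V i) t = tint (\<lambda>x. \<Sum>i\<in>UNIV. (u i t x - V i) * F i t x) - slip t"
proof -
  have w: "pcont (\<lambda>x. u i t x - V i)" for i by (intro pcont_diff pcont_const pconts[OF t])
  note P = tint_pairing[OF t, of "\<lambda>i x. u i t x - V i", OF w]
  have eq: "(case z of (x, v) \<Rightarrow> (\<Sum>i\<in>UNIV. (v $ i - V i) * (u i t x - v $ i)) * f t x v)
    = (case z of (x, v) \<Rightarrow> (\<Sum>i\<in>UNIV. (u i t x - V i) * (u i t x - v $ i)) * f t x v)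
      - (case z of (x, v) \<Rightarrow> (\<Sum>i\<in>UNIV. (u i t x - v $ i)\<^sup>2) * f t x v)" for z
  proof -
    obtain x v where z: "z = (x, v)" by (cases z)
    have "(\<Sum>i\<in>UNIV. (v $ i - V i) * (u i t x - v $ i))
      = (\<Sum>i\<in>UNIV. (u i t x - V i) * (u i t x - v $ i) - (u i t x - v $ i)\<^sup>2)"
      by (intro sum.cong refl) (simp add: power2_eq_square algebra_simps)
    then show ?thesis unfolding z prod.case by (simp add: sum_subtractf left_diff_distrib)
  qed
  show ?thesis
    unfolding drag_def eq slip_def P(2)[symmetric]
    by (rule set_integral_diff(2)[OF P(3) slip_integrable[OF less_imp_le[OF t]]])
qed

text \<open>The energy in any frame is a combination of the invariants 1 and \<open>v $ i\<close>
  and of \<open>(norm v)^2\<close>, whose interaction integral is nonpositive; thus the interaction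
  does not raise it.\<close>

lemma kinetic_energy_inequality:
  assumes s: "0 \<le> s" "s \<le> t"
  shows "kinetic_energy V t - kinetic_energy V s \<le> (LINT \<tau>:{s<..t}|lborel. drag (\<lambda>i v. v $ i - V i) \<tau>)"
proof -
  obtain c where c: "growth c (\<lambda>v :: real ^ 'n. \<Sum>i\<in>UNIV. (v $ i - V i)\<^sup>2 / 2) (\<lambda>i v. v $ i - V i)"
    using growth_energy by blast
  show ?thesis unfolding kinetic_energy_def
  proof (rule moment_inequality[OF c s])
    fix \<tau> :: real
    assume \<tau>: "\<tau> > 0" and q: "set_integrable lborel phase_space (\<lambda>(x, v). wt v * q \<tau> x v)"
    note m = q_moments[OF \<tau> q]
    have eq: "(case z of (x, v) \<Rightarrow> (\<Sum>i\<in>UNIV. (v $ i - V i)\<^sup>2 / 2) * q \<tau> x v)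
      = 1 / 2 * (case z of (x, v) \<Rightarrow> q \<tau> x v * (norm v)\<^sup>2)
        - (\<Sum>i\<in>UNIV. V i * (case z of (x, v) \<Rightarrow> q \<tau> x v * v $ i))
        + (\<Sum>i\<in>UNIV. (V i)\<^sup>2) / 2 * (case z of (x, v) \<Rightarrow> q \<tau> x v)" for z
    proof -
      obtain x v where z: "z = (x, v)" by (cases z)
      have "(norm v)\<^sup>2 = (\<Sum>i\<in>UNIV. (v $ i)\<^sup>2)" by (simp add: norm_vec_def L2_set_def sum_nonneg)
      moreover have "(\<Sum>i\<in>UNIV. (v $ i - V i)\<^sup>2 / 2) = (\<Sum>i\<in>UNIV. (v $ i)\<^sup>2 / 2 - V i * v $ i + (V i)\<^sup>2 / 2)"
        by (intro sum.cong refl) (simp add: power2_eq_square field_simps)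
      ultimately have e: "(\<Sum>i\<in>UNIV. (v $ i - V i)\<^sup>2 / 2)
        = 1 / 2 * (norm v)\<^sup>2 - (\<Sum>i\<in>UNIV. V i * v $ i) + (\<Sum>i\<in>UNIV. (V i)\<^sup>2) / 2"
        by (simp add: sum.distrib sum_subtractf sum_divide_distrib)
      have "(\<Sum>i\<in>UNIV. V i * (q \<tau> x v * v $ i)) = (\<Sum>i\<in>UNIV. V i * v $ i) * q \<tau> x v"
        by (simp add: sum_distrib_left mult_ac)
      then show ?thesis unfolding z prod.case e by (simp add: left_diff_distrib distrib_right)
    qed
    have "(LINT (x, v):phase_space|lborel. (\<Sum>i\<in>UNIV. (v $ i - V i)\<^sup>2 / 2) * q \<tau> x v)
      = 1 / 2 * (LINT (x, v):phase_space|lborel. q \<tau> x v * (norm v)\<^sup>2)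
        - (\<Sum>i\<in>UNIV. V i * (LINT (x, v):phase_space|lborel. q \<tau> x v * v $ i))
        + (\<Sum>i\<in>UNIV. (V i)\<^sup>2) / 2 * (LINT (x, v):phase_space|lborel. q \<tau> x v)"
      unfolding eq
      by (subst set_integral_add(2) set_integral_diff(2) set_integral_sum(2);
          (intro set_integral_diff(1) set_integral_sum(1) set_integrable_mult_right finite m)?)+
        (simp only: set_integral_mult_right)
    then show "(LINT (x, v):phase_space|lborel. (\<Sum>i\<in>UNIV. (v $ i - V i)\<^sup>2 / 2) * q \<tau> x v) \<le> 0"
      using m by simp
  qed
qed

text \<open>In the sum of the particle and the fluid balance the work of the drag cancels. It
  remains an inequality because the interaction may dissipate energy too.\<close>

lemma energy_dissipation:
  assumes s: "0 \<le> s" "s \<le> t"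
  shows "\<exists>I. ((\<lambda>\<tau>. visc \<tau> + slip \<tau>) has_integral I) {s..t} \<and> energy t + I \<le> energy s"
proof -
  let ?d = "drag (\<lambda>i v. v $ i - mvel i)"
  obtain c where c: "growth c (\<lambda>v :: real ^ 'n. \<Sum>i\<in>UNIV. (v $ i - mvel i)\<^sup>2 / 2) (\<lambda>i v. v $ i - mvel i)"
    using growth_energy by blast
  have 1: "(?d has_integral (LINT \<tau>:{s<..t}|lborel. ?d \<tau>)) {s..t}"
    by (rule has_integral_Ioc[OF drag_integrable[OF c s]])
  have 2: "((\<lambda>\<tau>. - visc \<tau> - tint (\<lambda>x. \<Sum>i\<in>UNIV. (u i \<tau> x - mvel i) * F i \<tau> x))
    has_integral (fluid_energy mvel t - fluid_energy mvel s)) {s..t}"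
  proof (rule fundamental_theorem_of_calculus_interior[OF s(2)])
    show "continuous_on {s..t} (fluid_energy mvel)"
      by (rule continuous_on_subset[OF fluid_energy_continuous(1)]) (use s in auto)
  qed (use fluid_energy_derivative[where V = mvel] s in \<open>auto simp: has_real_derivative_iff_has_vector_derivative\<close>)
  have 3: "((\<lambda>\<tau>. - visc \<tau> - slip \<tau>) has_integral
      ((LINT \<tau>:{s<..t}|lborel. ?d \<tau>) + (fluid_energy mvel t - fluid_energy mvel s))) {s..t}"
    by (rule has_integral_spike[OF negligible_sing[of s] _ has_integral_add[OF 1 2]])
      (use s drag_eq[where V = mvel] in auto)
  then have "((\<lambda>\<tau>. visc \<tau> + slip \<tau>) has_integral
      - ((LINT \<tau>:{s<..t}|lborel. ?d \<tau>) + (fluid_energy mvel t - fluid_energy mvel s))) {s..t}"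
    using has_integral_neg[OF 3] by (simp add: add.commute)
  moreover have "energy \<tau> = kinetic_energy mvel \<tau> + fluid_energy mvel \<tau> - fmass powr \<gamma> / (\<gamma> - 1)" for \<tau>
    by (simp add: energy_def fluid_energy_def potential_energy_def diff_divide_distrib)
  ultimately show ?thesis using kinetic_energy_inequality[OF s, of mvel] by fastforce
qed

lemma potential_energy_nonneg: "t \<ge> 0 \<Longrightarrow> 0 \<le> potential_energy t"
  using potential_energy_bounds var_nonneg by (meson less_imp_le mult_nonneg_nonneg order_trans)

lemma energy_ge:
  assumes "t \<ge> 0"
  shows "kinetic_energy mvel t \<le> energy t" "kin mvel t \<le> 2 * energy t" "potential_energy t \<le> energy t" "0 \<le> energy t"
  using kinetic_energy_nonneg[OF assms, of mvel] kin_nonneg[OF assms, of mvel] potential_energy_nonneg[OF assms]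
  by (auto simp: energy_def)

lemma kin_mean_le:
  assumes t: "t > 0"
  shows "kin (\<lambda>i. tint (u i t)) t \<le> R * 2 ^ CARD('n) * dissipation t"
proof -
  have R: "0 \<le> R" using \<rho>_nonneg[of 0 0] density_le[of 0 0] by simp
  have "tint (\<lambda>x. \<rho> t x * (u i t x - tint (u i t))\<^sup>2) \<le> R * (2 ^ CARD('n) * (\<Sum>j\<in>UNIV. tint (\<lambda>x. (ux i j t x)\<^sup>2)))" for i
  proof -
    have "tint (\<lambda>x. \<rho> t x * (u i t x - tint (u i t))\<^sup>2) \<le> tint (\<lambda>x. R * (u i t x - tint (u i t))\<^sup>2)"
      using t density_le by (intro tint_mono pcont_mult pcont_power pcont_diff pcont_const pconts) (auto intro: mult_right_mono)
    also have "\<dots> = R * tint (\<lambda>x. (u i t x - tint (u i t))\<^sup>2)" by simp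
    also have "\<dots> \<le> R * (2 ^ CARD('n) * (\<Sum>j\<in>UNIV. tint (\<lambda>x. (ux i j t x)\<^sup>2)))"
      using R t by (intro mult_left_mono poincare pconts partial_u) auto
    finally show ?thesis .
  qed
  then have "kin (\<lambda>i. tint (u i t)) t \<le> (\<Sum>i\<in>UNIV. R * (2 ^ CARD('n) * (\<Sum>j\<in>UNIV. tint (\<lambda>x. (ux i j t x)\<^sup>2))))"
    using t by (subst kin_eq) (auto intro: sum_mono)
  then show ?thesis by (simp add: dissipation_def sum_distrib_left mult.assoc)
qed

text \<open>The estimates hold in the frame given by the spatial mean of \<open>u\<close>, and
  minimality transfers them to \<open>mvel\<close>. Only the kinetic part of the energy is reached
  in this way.\<close>

lemma energy_coercive:
  assumes t: "t > 0" and M: "Lp_bounded (real CARD('n) / 2) M (particle_density (f t))"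
  shows "kinetic_energy mvel t + kin mvel t / 2 \<le> (1 + sob + R * 2 ^ CARD('n)) * (slip t + dissipation t)"
proof -
  have R: "0 \<le> R" using \<rho>_nonneg[of 0 0] density_le[of 0 0] by simp
  have t0: "t \<ge> 0" using t by simp
  have "kinetic_energy (\<lambda>i. tint (u i t)) t \<le> slip t + sob * dissipation t"
    unfolding sob_def dissipation_def using coercivity[OF dim t0 M partial_u[OF t] pconts(6)[OF t]] .
  with energy_minimal[OF t0, of "\<lambda>i. tint (u i t)"] kin_mean_le[OF t]
  have "kinetic_energy mvel t + kin mvel t / 2 \<le> slip t + sob * dissipation t + R * 2 ^ CARD('n) * dissipation t / 2"
    by linarith
  moreover have "0 \<le> slip t" "0 \<le> dissipation t" using slip_nonneg[OF t0] dissipation_nonneg[OF t] .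
  moreover from this have "0 \<le> sob * slip t" "0 \<le> R * 2 ^ CARD('n) * slip t" "0 \<le> R * 2 ^ CARD('n) * dissipation t"
    using sob_nonneg R by auto
  ultimately show ?thesis by (simp add: algebra_simps)
qed

lemma drag_bound_slip:
  assumes t: "t > 0" and M: "Lp_bounded (real CARD('n) / 2) M (particle_density (f t))"
  shows "drag_bound sob (slip t) t"
  unfolding drag_bound_def
proof (intro allI impI)
  fix B :: "'n \<Rightarrow> real ^ 'n \<Rightarrow> real" and Bx :: "'n \<Rightarrow> 'n \<Rightarrow> real ^ 'n \<Rightarrow> real" and \<delta> :: real
  assume B: "\<forall>i. pcont (B i) \<and> tint (B i) = 0" "\<forall>i j. has_partial j (B i) (Bx i j) \<and> pcont (Bx i j)" "0 < \<delta>"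
  have "(LINT x:torus|lborel. \<Sum>i\<in>UNIV. force i t x * B i x) = tint (\<lambda>x. \<Sum>i\<in>UNIV. F i t x * B i x)"
    using tint_pairing(1)[OF t, of B] B by (simp add: mult.commute)
  then show "\<bar>tint (\<lambda>x. \<Sum>i\<in>UNIV. F i t x * B i x)\<bar>
      \<le> slip t / \<delta> + \<delta> * sob * (\<Sum>i\<in>UNIV. \<Sum>j\<in>UNIV. tint (\<lambda>x. (Bx i j x)\<^sup>2))"
    using force_bound[OF dim less_imp_le[OF t] M, of B Bx \<delta>] B by (simp add: sob_def)
qed

lemma continuous_on_dissipation: "continuous_on {0<..} dissipation"
  unfolding dissipation_def[abs_def] by (intro continuous_on_sum tcont_tint tcont_power tconts)

lemma Ioc_integral:
  fixes g :: "real \<Rightarrow> real"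
  assumes "continuous_on {0<..} g" "0 < s"
  shows "set_integrable lborel {s<..t} g" "integral {s..t} g = (LINT \<tau>:{s<..t}|lborel. g \<tau>)"
proof -
  have "set_integrable lborel {s..t} g"
  proof -
    have "{s..t} \<subseteq> {0<..}" using assms(2) by auto
    from borel_integrable_compact[OF compact_Icc continuous_on_subset[OF assms(1) this]]
    show ?thesis by (simp add: set_integrable_def)
  qed
  then show 1: "set_integrable lborel {s<..t} g" by (rule set_integrable_subset) auto
  show "integral {s..t} g = (LINT \<tau>:{s<..t}|lborel. g \<tau>)"
    using has_integral_Ioc[OF 1] by (rule integral_unique)
qed

lemma energy_antimono:
  assumes s: "0 \<le> s" "s \<le> t"
  shows "energy t \<le> energy s"
proof -
  obtain I where I: "((\<lambda>\<tau>. visc \<tau> + slip \<tau>) has_integral I) {s..t}" "energy t + I \<le> energy s"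
    using energy_dissipation[OF s] by blast
  have "0 \<le> I"
  proof (rule has_integral_nonneg)
    \<comment> \<open>The integrand is altered at \<open>s\<close>: the value \<open>s = 0\<close>
      is allowed, but nonnegativity of \<open>visc\<close> is available only at positive
      times.\<close>
    show "((\<lambda>\<tau>. if \<tau> = s then 0 else visc \<tau> + slip \<tau>) has_integral I) {s..t}"
      by (rule has_integral_spike[OF negligible_sing[of s] _ I(1)]) auto
    show "0 \<le> (if \<tau> = s then 0 else visc \<tau> + slip \<tau>)" if "\<tau> \<in> {s..t}" for \<tau>
    proof (cases "\<tau> = s")
      case False
      then have \<tau>: "\<tau> > 0" using that s by auto
      have "0 \<le> min \<mu> (2 * \<mu> + lam) * dissipation \<tau>" using dissipation_nonneg[OF \<tau>] \<mu> lam by simp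
      then show ?thesis using visc_ge[OF \<tau>] slip_nonneg[of \<tau>] \<tau> by simp
    qed simp
  qed
  with I show ?thesis by linarith
qed

lemma total_dissipation:
  assumes s: "0 < s" "s \<le> t"
  shows "min 1 (min \<mu> (2 * \<mu> + lam)) * (LINT \<tau>:{s<..t}|lborel. slip \<tau> + dissipation \<tau>) \<le> energy s"
proof -
  let ?k = "min 1 (min \<mu> (2 * \<mu> + lam))"
  have s0: "0 \<le> s" using s by simp
  obtain I where I: "((\<lambda>\<tau>. visc \<tau> + slip \<tau>) has_integral I) {s..t}" "energy t + I \<le> energy s"
    using energy_dissipation[OF s0 s(2)] by blast
  have "set_integrable lborel {s<..t} (\<lambda>\<tau>. slip \<tau> + dissipation \<tau>)"
    by (intro set_integral_add slip_time_integrable Ioc_integral continuous_on_dissipation s0 s)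
  then have "((\<lambda>\<tau>. ?k * (slip \<tau> + dissipation \<tau>)) has_integral ?k * (LINT \<tau>:{s<..t}|lborel. slip \<tau> + dissipation \<tau>)) {s..t}"
    by (intro has_integral_mult_right has_integral_Ioc)
  then have "?k * (LINT \<tau>:{s<..t}|lborel. slip \<tau> + dissipation \<tau>) \<le> I"
  proof (rule has_integral_le[OF _ I(1)])
    fix \<tau> assume "\<tau> \<in> {s..t}"
    then have \<tau>: "\<tau> > 0" "\<tau> \<ge> 0" using s by auto
    have "?k * slip \<tau> \<le> 1 * slip \<tau>" using slip_nonneg[OF \<tau>(2)] by (intro mult_right_mono) auto
    moreover have "?k * dissipation \<tau> \<le> min \<mu> (2 * \<mu> + lam) * dissipation \<tau>"
      using dissipation_nonneg[OF \<tau>(1)] by (intro mult_right_mono) auto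
    ultimately show "?k * (slip \<tau> + dissipation \<tau>) \<le> visc \<tau> + slip \<tau>"
      using visc_ge[OF \<tau>(1)] by (simp add: distrib_left)
  qed
  then show ?thesis using I energy_ge(4)[of t] s by simp
qed

text \<open>Both halves of the energy are bounded in time average by the energy at \<open>s\<close>:
  the kinetic part through the dissipation, the potential part through
  \<open>density_dissipation\<close> with the slip as error and boundary terms dominated by the
  energy.\<close>

lemma energy_decay: "\<exists>C1>0. \<exists>C2>0. \<forall>t\<ge>0. energy t \<le> C1 * energy 0 * exp (- C2 * t)"
proof -
  define k where "k = min 1 (min \<mu> (2 * \<mu> + lam))"
  define K where "K = 1 + sob + R * 2 ^ CARD('n)"
  have R: "0 \<le> R" using \<rho>_nonneg[of 0 0] density_le[of 0 0] by simp
  have k: "k > 0" using \<mu> lam by (auto simp: k_def)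
  have K: "K > 0" using sob_nonneg R by (simp add: K_def add_pos_nonneg)
  obtain c C where c: "c > 0" "C > 0" and pe: "\<And>t. t \<ge> 0 \<Longrightarrow> c * var t \<le> potential_energy t"
    "\<And>t. t \<ge> 0 \<Longrightarrow> potential_energy t \<le> C * var t"
    using potential_energy_bounds by blast
  have "\<exists>D>0. \<forall>s t E. 0 < s \<longrightarrow> s \<le> t \<longrightarrow> set_integrable lborel {s..t} E \<longrightarrow> (\<forall>\<tau>. 0 \<le> E \<tau>) \<longrightarrow>
    (AE \<tau> in lborel. \<tau> \<in> {s..t} \<longrightarrow> drag_bound sob (E \<tau>) \<tau>) \<longrightarrow>
    integral {s..t} var \<le> D * (kin mvel s + var s + kin mvel t + var t
      + integral {s..t} (\<lambda>\<tau>. dissipation \<tau> + kin mvel \<tau>) + integral {s..t} E)"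
    by (rule density_dissipation[where R = R and U = U]) (auto intro: density_le u_bound sob_nonneg fluid_mass_pos)
  then obtain D where D: "D > 0" and dd: "\<forall>s t E. 0 < s \<longrightarrow> s \<le> t \<longrightarrow> set_integrable lborel {s..t} E \<longrightarrow> (\<forall>\<tau>. 0 \<le> E \<tau>) \<longrightarrow>
    (AE \<tau> in lborel. \<tau> \<in> {s..t} \<longrightarrow> drag_bound sob (E \<tau>) \<tau>) \<longrightarrow>
    integral {s..t} var \<le> D * (kin mvel s + var s + kin mvel t + var t
      + integral {s..t} (\<lambda>\<tau>. dissipation \<tau> + kin mvel \<tau>) + integral {s..t} E)"
    by (elim exE conjE) (rule that)
  \<comment> \<open>The two boundary values of \<open>kin\<close> give 4, those of
    \<open>var\<close> give \<open>2 / c\<close>, and the time integrals of dissipation,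
    \<open>kin\<close> and slip together give \<open>(2 * K + 1) / k\<close>.\<close>
  define A where "A = D * (4 + 2 / c + (2 * K + 1) / k)"
  have "(t - s) * energy t \<le> (K / k + C * A) * energy s" if s: "0 < s" "s \<le> t" for s t
  proof -
    have s0: "0 \<le> s" "0 \<le> t" using s by auto
    let ?I = "\<lambda>g :: real \<Rightarrow> real. LINT \<tau>:{s<..t}|lborel. g \<tau>"
    have cont: "continuous_on {0<..} var" "continuous_on {0<..} (kin mvel)"
      by (rule continuous_on_subset[OF continuous_on_var] continuous_on_subset[OF fluid_energy_continuous(2)]; auto)+
    have cdk: "continuous_on {0<..} (\<lambda>\<tau>. dissipation \<tau> + kin mvel \<tau>)"
      by (intro continuous_on_add continuous_on_dissipation cont)
    note int = slip_time_integrable[OF s0(1) s(2)] Ioc_integral(1)[OF continuous_on_dissipation s(1)]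
      Ioc_integral(1)[OF cont(1) s(1)] Ioc_integral(1)[OF cont(2) s(1)]
    have sd: "k * (?I slip + ?I dissipation) \<le> energy s"
      using total_dissipation[OF s] set_integral_add(2)[OF int(1,2)] by (simp add: k_def)
    then have sd': "?I slip + ?I dissipation \<le> energy s / k" using k by (simp add: field_simps)
    have ae: "AE \<tau> in lborel. \<tau> \<in> {s<..t} \<longrightarrow> drag_bound sob (slip \<tau>) \<tau> \<and>
        kinetic_energy mvel \<tau> + kin mvel \<tau> / 2 \<le> K * (slip \<tau> + dissipation \<tau>)"
      using density_bounded
    proof eventually_elim
      case (elim \<tau>)
      then show ?case using s drag_bound_slip[of \<tau>] energy_coercive[of \<tau>] by (auto simp: K_def)
    qed
    \<comment> \<open>The slip is cut off outside the interval because the error function must be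
      nonnegative at all real times; the endpoint \<open>s\<close>, where it is set to 0, is
      negligible.\<close>
    define E where "E \<tau> = indicat_real {s<..t} \<tau> * slip \<tau>" for \<tau>
    have E1: "set_integrable lborel {s..t} E"
    proof -
      have "(\<lambda>\<tau>. indicat_real {s..t} \<tau> *\<^sub>R E \<tau>) = (\<lambda>\<tau>. indicat_real {s<..t} \<tau> *\<^sub>R slip \<tau>)"
        by (auto simp: E_def indicator_def)
      then show ?thesis using int(1) by (simp add: set_integrable_def)
    qed
    have E2: "integral {s..t} E = ?I slip"
      by (rule integral_unique, rule has_integral_spike[OF negligible_sing[of s] _ has_integral_Ioc[OF int(1)]])
        (auto simp: E_def)
    have E3: "\<forall>\<tau>. 0 \<le> E \<tau>" using slip_nonneg s by (auto simp: E_def indicator_def)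
    have E4: "AE \<tau> in lborel. \<tau> \<in> {s..t} \<longrightarrow> drag_bound sob (E \<tau>) \<tau>"
      using ae AE_lborel_singleton[of s] by eventually_elim (auto simp: E_def)
    have kin_int: "?I (kin mvel) \<le> 2 * K * (?I slip + ?I dissipation)"
    proof -
      have "?I (kin mvel) \<le> ?I (\<lambda>\<tau>. 2 * K * (slip \<tau> + dissipation \<tau>))"
      proof (rule set_integral_le_AE)
        show "AE \<tau> in lborel. \<tau> \<in> {s<..t} \<longrightarrow> kin mvel \<tau> \<le> 2 * K * (slip \<tau> + dissipation \<tau>)"
          using ae
        proof eventually_elim
          case (elim \<tau>)
          then show ?case using s kinetic_energy_nonneg[of \<tau> mvel] by (auto simp: mult.assoc)
        qed
      qed (intro int set_integrable_mult_right set_integral_add)+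
      then show ?thesis using set_integral_add(2)[OF int(1,2)] by simp
    qed
    have v: "var \<tau> \<le> energy s / c" if "\<tau> \<ge> s" for \<tau>
    proof -
      have "c * var \<tau> \<le> energy s"
        using pe(1)[of \<tau>] energy_ge(3)[of \<tau>] energy_antimono[OF s0(1) that] that s0 by linarith
      then show ?thesis using c by (simp add: field_simps)
    qed
    have kk: "kin mvel \<tau> \<le> 2 * energy s" if "\<tau> \<ge> s" for \<tau>
      using energy_ge(2)[of \<tau>] energy_antimono[OF s0(1) that] that s0 by linarith
    have "?I var \<le> D * (kin mvel s + var s + kin mvel t + var t + (?I dissipation + ?I (kin mvel)) + ?I slip)"
      using dd[rule_format, OF s E1 _ E4] E3 set_integral_add(2)[OF int(2,4)]
      unfolding E2 Ioc_integral(2)[OF cont(1) s(1)] Ioc_integral(2)[OF cdk s(1)] by simp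
    also have "\<dots> \<le> D * (4 * energy s + 2 * (energy s / c) + (2 * K + 1) * (energy s / k))"
    proof (intro mult_left_mono)
      have "(2 * K + 1) * (?I slip + ?I dissipation) \<le> (2 * K + 1) * (energy s / k)"
        using sd' K by (intro mult_left_mono) auto
      then show "kin mvel s + var s + kin mvel t + var t + (?I dissipation + ?I (kin mvel)) + ?I slip
        \<le> 4 * energy s + 2 * (energy s / c) + (2 * K + 1) * (energy s / k)"
        using kin_int v[of s] v[of t] kk[of s] kk[of t] s by (simp add: distrib_right)
    qed (use D in simp)
    also have "\<dots> = A * energy s" by (simp add: A_def algebra_simps)
    finally have var_int: "?I var \<le> A * energy s" .
    \<comment> \<open>Monotonicity of the energy replaces the final value by the value at each
      earlier \<open>\<tau>\<close>, where coercivity can be used.\<close>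
    have "?I (\<lambda>\<tau>. energy t) \<le> ?I (\<lambda>\<tau>. K * (slip \<tau> + dissipation \<tau>) + C * var \<tau>)"
    proof (rule set_integral_le_AE)
      show "AE \<tau> in lborel. \<tau> \<in> {s<..t} \<longrightarrow> energy t \<le> K * (slip \<tau> + dissipation \<tau>) + C * var \<tau>"
        using ae
      proof eventually_elim
        case (elim \<tau>)
        show ?case
        proof
          assume \<tau>: "\<tau> \<in> {s<..t}"
          then have "0 \<le> \<tau>" "\<tau> \<le> t" using s by auto
          from energy_antimono[OF this] pe(2)[OF this(1)] elim \<tau>
          show "energy t \<le> K * (slip \<tau> + dissipation \<tau>) + C * var \<tau>" by (simp add: energy_def)
        qed
      qed
      show "set_integrable lborel {s<..t} (\<lambda>\<tau>. energy t)" by (rule Ioc_integral(1)[OF continuous_on_const s(1)])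
    qed (intro int set_integrable_mult_right set_integral_add)
    also have "\<dots> = K * (?I slip + ?I dissipation) + C * ?I var"
      by (simp add: set_integral_add(2) int set_integrable_mult_right set_integral_add(1))
    also have "\<dots> \<le> K * (energy s / k) + C * (A * energy s)"
      using sd' var_int K c by (intro add_mono mult_left_mono) auto
    finally show ?thesis using s by (simp add: set_lebesgue_integral_def algebra_simps)
  qed
  moreover have "K / k + C * A > 0" using K k c D by (auto simp: A_def intro!: add_pos_pos mult_pos_pos divide_pos_pos)
  ultimately show ?thesis
    using energy_antimono energy_ge(4) by (intro exponential_decay[where K = "K / k + C * A"]) auto
qed

text \<open>The Lyapunov functional in components; the factor 2 undoes the 1 / 2 in
  \<open>kinetic_energy\<close>.\<close>

definition functional where
  "functional t = 2 * kinetic_energy (pvel t) t + kin (fvel t) t + var t + (\<Sum>i\<in>UNIV. (pvel t i - fvel t i)\<^sup>2)"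

text \<open>Expanding both kinetic energies around \<open>mvel\<close> yields the fluctuations and
  the squared distances of the two mean velocities from \<open>mvel\<close>, which bound their
  mutual distance by the triangle inequality.\<close>

lemma functional_le_energy: "\<exists>C>0. \<forall>t\<ge>0. functional t \<le> C * energy t"
proof -
  obtain c where c: "c > 0" and pe: "\<And>t. t \<ge> 0 \<Longrightarrow> c * var t \<le> potential_energy t"
    using potential_energy_bounds by blast
  let ?C = "4 + 1 / c + 4 / pmass + 4 / fmass"
  have "functional t \<le> ?C * energy t" if t: "t \<ge> 0" for t
  proof -
    let ?P = "\<Sum>i\<in>UNIV. (mvel i - pvel t i)\<^sup>2" and ?Q = "\<Sum>i\<in>UNIV. (mvel i - fvel t i)\<^sup>2"
    note ge = energy_ge[OF t]
    have P: "kinetic_energy (pvel t) t + pmass / 2 * ?P \<le> energy t"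
      using ge(1) unfolding kinetic_energy_expand[OF t, of mvel] .
    have Q: "kin (fvel t) t + fmass * ?Q \<le> 2 * energy t"
      using ge(2) unfolding kin_expand[OF t, of mvel] .
    have nn: "0 \<le> ?P" "0 \<le> ?Q" by (auto intro: sum_nonneg)
    have "pmass * ?P \<le> 2 * energy t" "fmass * ?Q \<le> 2 * energy t"
      using P Q kinetic_energy_nonneg[OF t, of "pvel t"] kin_nonneg[OF t, of "fvel t"] by simp_all
    then have PQ: "?P \<le> 2 / pmass * energy t" "?Q \<le> 2 / fmass * energy t"
      using masses by (simp_all add: field_simps)
    have "0 \<le> pmass / 2 * ?P" "0 \<le> fmass * ?Q" using masses nn by (auto intro!: mult_nonneg_nonneg)
    with P Q have 1: "kinetic_energy (pvel t) t \<le> energy t" "kin (fvel t) t \<le> 2 * energy t" by linarith+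
    have "c * var t \<le> energy t" using pe[OF t] ge(3) by linarith
    then have 2: "var t \<le> 1 / c * energy t" using c by (simp add: field_simps)
    have "(\<Sum>i\<in>UNIV. (pvel t i - fvel t i)\<^sup>2) \<le> (\<Sum>i\<in>UNIV. 2 * (mvel i - pvel t i)\<^sup>2 + 2 * (mvel i - fvel t i)\<^sup>2)"
    proof (rule sum_mono)
      fix i
      have "2 * (mvel i - pvel t i)\<^sup>2 + 2 * (mvel i - fvel t i)\<^sup>2 - (pvel t i - fvel t i)\<^sup>2
        = ((mvel i - pvel t i) + (mvel i - fvel t i))\<^sup>2" by (simp add: power2_eq_square algebra_simps)
      then show "(pvel t i - fvel t i)\<^sup>2 \<le> 2 * (mvel i - pvel t i)\<^sup>2 + 2 * (mvel i - fvel t i)\<^sup>2"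
        using zero_le_power2[of "(mvel i - pvel t i) + (mvel i - fvel t i)"] by linarith
    qed
    also have "\<dots> = 2 * ?P + 2 * ?Q" by (simp add: sum.distrib sum_distrib_left)
    finally have "functional t \<le> 2 * energy t + 2 * energy t + 1 / c * energy t
      + (2 * (2 / pmass * energy t) + 2 * (2 / fmass * energy t))"
      using 1 2 PQ unfolding functional_def by linarith
    then show ?thesis by (simp add: distrib_right)
  qed
  moreover have "?C > 0" using c masses by (simp add: add_pos_pos)
  ultimately show ?thesis by blast
qed

text \<open>Since \<open>mvel\<close> is a convex combination of the two mean velocities, its
  distance from each is at most their mutual distance.\<close>

lemma energy_le_functional: "\<exists>C>0. \<forall>t\<ge>0. energy t \<le> C * functional t"
proof -
  obtain C where C: "C > 0" and pe: "\<And>t. t \<ge> 0 \<Longrightarrow> potential_energy t \<le> C * var t"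
    using potential_energy_bounds by blast
  let ?C = "2 + pmass + fmass + C"
  have "energy t \<le> ?C * functional t" if t: "t \<ge> 0" for t
  proof -
    let ?W = "\<Sum>i\<in>UNIV. (pvel t i - fvel t i)\<^sup>2"
    have le: "(mvel i - pvel t i)\<^sup>2 \<le> (pvel t i - fvel t i)\<^sup>2" "(mvel i - fvel t i)\<^sup>2 \<le> (pvel t i - fvel t i)\<^sup>2" for i
    proof -
      let ?T = "pmass + fmass"
      have T: "?T > 0" using masses by simp
      have e: "?T * (mvel i - pvel t i) = fmass * (fvel t i - pvel t i)" "?T * (mvel i - fvel t i) = pmass * (pvel t i - fvel t i)"
        using momentum_conservation[OF t, of i] by (simp_all add: algebra_simps)
      have "\<bar>?T * (mvel i - pvel t i)\<bar> \<le> ?T * \<bar>pvel t i - fvel t i\<bar>" "\<bar>?T * (mvel i - fvel t i)\<bar> \<le> ?T * \<bar>pvel t i - fvel t i\<bar>"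
        unfolding e abs_mult using masses by (auto simp: abs_minus_commute intro!: mult_right_mono)
      then have "\<bar>mvel i - pvel t i\<bar> \<le> \<bar>pvel t i - fvel t i\<bar>" "\<bar>mvel i - fvel t i\<bar> \<le> \<bar>pvel t i - fvel t i\<bar>"
        using T by (simp_all add: abs_mult)
      then show "(mvel i - pvel t i)\<^sup>2 \<le> (pvel t i - fvel t i)\<^sup>2" "(mvel i - fvel t i)\<^sup>2 \<le> (pvel t i - fvel t i)\<^sup>2"
        by (simp_all add: abs_le_square_iff)
    qed
    have "pmass / 2 * (\<Sum>i\<in>UNIV. (mvel i - pvel t i)\<^sup>2) \<le> pmass / 2 * ?W" "fmass * (\<Sum>i\<in>UNIV. (mvel i - fvel t i)\<^sup>2) \<le> fmass * ?W"
      using masses le by (auto intro!: mult_left_mono sum_mono)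
    then have e: "energy t \<le> kinetic_energy (pvel t) t + pmass / 2 * ?W + (kin (fvel t) t + fmass * ?W) / 2 + C * var t"
      unfolding energy_def kinetic_energy_expand[OF t, of mvel] kin_expand[OF t, of mvel] using pe[OF t] by argo
    have nn: "0 \<le> kinetic_energy (pvel t) t" "0 \<le> kin (fvel t) t" "0 \<le> var t" "0 \<le> ?W"
      using kinetic_energy_nonneg[OF t, of "pvel t"] kin_nonneg[OF t, of "fvel t"] var_nonneg[OF t] by (auto intro: sum_nonneg)
    then have f: "?W \<le> functional t" "var t \<le> functional t" "kinetic_energy (pvel t) t + kin (fvel t) t / 2 \<le> functional t" "0 \<le> functional t"
      by (auto simp: functional_def)
    have "pmass * ?W \<le> pmass * functional t" "fmass * ?W \<le> fmass * functional t" "C * var t \<le> C * functional t"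
      using masses C f by (auto intro!: mult_left_mono)
    moreover have "0 \<le> pmass * ?W" "0 \<le> fmass * ?W" using masses nn by auto
    ultimately have "energy t \<le> 2 * functional t + pmass * functional t + fmass * functional t + C * functional t"
      using e f by argo
    then show ?thesis by (simp add: distrib_right)
  qed
  moreover have "?C > 0" using C masses by simp
  ultimately show ?thesis by blast
qed

theorem functional_decay: "\<exists>C1>0. \<exists>C2>0. \<forall>t\<ge>0. functional t \<le> C1 * functional 0 * exp (- C2 * t)"
proof -
  obtain A where A: "A > 0" "\<And>t. t \<ge> 0 \<Longrightarrow> functional t \<le> A * energy t" using functional_le_energy by blast
  obtain B where B: "B > 0" "\<And>t. t \<ge> 0 \<Longrightarrow> energy t \<le> B * functional t" using energy_le_functional by blast
  obtain C1 C2 where C: "C1 > 0" "C2 > 0" "\<And>t. t \<ge> 0 \<Longrightarrow> energy t \<le> C1 * energy 0 * exp (- C2 * t)"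
    using energy_decay by blast
  have "functional t \<le> A * C1 * B * functional 0 * exp (- C2 * t)" if t: "t \<ge> 0" for t
  proof -
    have "functional t \<le> A * (C1 * energy 0 * exp (- C2 * t))"
      by (rule order_trans[OF A(2)[OF t] mult_left_mono[OF C(3)[OF t]]]) (use A(1) in simp)
    also have "\<dots> \<le> A * (C1 * (B * functional 0) * exp (- C2 * t))"
      using A(1) B(2)[of 0] C(1) by (intro mult_left_mono mult_right_mono) auto
    finally show ?thesis by (simp add: mult.assoc)
  qed
  moreover have "A * C1 * B > 0" using A B C by simp
  ultimately show ?thesis using C(2) by blast
qed

end

subsection \<open>Classical solutions\<close>

lemma C1_on_has_derivative:
  assumes "C1_on S g" "open S" "k x \<in> S" "(k has_derivative K) (at x)"
  shows "((\<lambda>y. g (k y)) has_derivative (\<lambda>h. frechet_derivative g (at (k x)) (K h))) (at x)"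
proof -
  have "g differentiable (at (k x))"
    using assms(1-3) unfolding C1_on_def by (metis differentiable_on_eq_differentiable_at)
  then have "(g has_derivative frechet_derivative g (at (k x))) (at (k x))" by (simp add: frechet_derivative_works)
  from has_derivative_compose[OF assms(4) this] show ?thesis .
qed

lemma C1_on_component:
  assumes "C1_on S g" "open S"
  shows "C1_on S (\<lambda>z. g z $ i)"
proof -
  have d: "((\<lambda>z. g z $ i) has_derivative (\<lambda>h. frechet_derivative g (at z) h $ i)) (at z)" if "z \<in> S" for z
    using bounded_linear.has_derivative[OF bounded_linear_vec_nth C1_on_has_derivative[OF assms that has_derivative_ident]] .
  then have "frechet_derivative (\<lambda>z. g z $ i) (at z) = (\<lambda>h. frechet_derivative g (at z) h $ i)" if "z \<in> S" for z
    using that frechet_derivative_at by metis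
  then have "continuous_on S (\<lambda>z. frechet_derivative (\<lambda>z. g z $ i) (at z) h)" for h
    using assms(1) by (subst continuous_on_cong[OF refl, of _ _ "\<lambda>z. frechet_derivative g (at z) h $ i"])
      (auto simp: C1_on_def intro!: continuous_intros)
  moreover have "(\<lambda>z. g z $ i) differentiable_on S"
    using d by (auto simp: differentiable_on_def differentiable_def intro: has_derivative_at_withinI)
  ultimately show ?thesis by (simp add: C1_on_def)
qed

lemma partial_eq_frechet:
  assumes "(g has_derivative D) (at x)"
  shows "partial i g x = D (axis i 1)"
  using frechet_derivative_at[OF assms] by (simp add: partial_def)

lemma has_partial_partial:
  assumes "\<And>x. g differentiable (at x)"
  shows "has_partial i g (partial i g)"
  unfolding has_partial_def
proof
  fix x :: "real ^ 'a"
  have g: "(g has_derivative frechet_derivative g (at x)) (at (x + 0 *\<^sub>R axis i 1))"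
    using assms[of x] by (simp add: frechet_derivative_works)
  have k: "((\<lambda>s. x + s *\<^sub>R axis i 1) has_derivative (\<lambda>s. s *\<^sub>R axis i 1)) (at 0)"
    by (auto intro!: derivative_eq_intros)
  have "((\<lambda>s. g (x + s *\<^sub>R axis i 1)) has_derivative (\<lambda>s. frechet_derivative g (at x) (s *\<^sub>R axis i 1))) (at 0)"
    using has_derivative_compose[OF k g] .
  moreover have "frechet_derivative g (at x) (s *\<^sub>R axis i 1) = partial i g x * s" for s
    using linear_frechet_derivative[OF assms[of x]] by (simp add: partial_def linear_cmul)
  ultimately show "((\<lambda>s. g (x + s *\<^sub>R axis i 1)) has_real_derivative partial i g x) (at 0)"
    by (simp add: has_field_derivative_def)
qed

text \<open>Lets the operators of the system, which are Frechet derivatives, be computed by the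
  rules for \<open>has_partial\<close>; differentiability is what gives the Frechet derivative its
  meaning.\<close>

lemma partial_eqI:
  assumes "\<And>x. g differentiable (at x)" "has_partial i g g'"
  shows "partial i g x = g' x"
  using has_partial_partial[OF assms(1), of i] assms(2) unfolding has_partial_def by (metis DERIV_unique)

lemma C1_on_time_derivative:
  fixes g :: "real \<times> 'a::euclidean_space \<Rightarrow> real"
  assumes g: "C1_on ({0<..} \<times> UNIV) g"
  shows "t > 0 \<Longrightarrow> ((\<lambda>s. g (s, y)) has_real_derivative deriv (\<lambda>s. g (s, y)) t) (at t)"
    and "continuous_on ({0<..} \<times> UNIV) (\<lambda>z. deriv (\<lambda>s. g (s, snd z)) (fst z))"
proof -
  have op: "open ({(0 :: real)<..} \<times> (UNIV :: 'a set))" by (intro open_Times) auto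
  have d: "((\<lambda>s. g (s, y)) has_real_derivative frechet_derivative g (at (t, y)) (1, 0)) (at t)" if "t > 0" for t y
  proof -
    have D: "((\<lambda>s. g (s, y)) has_derivative (\<lambda>h. frechet_derivative g (at (t, y)) (h, 0))) (at t)"
      by (rule C1_on_has_derivative[OF g op, where k = "\<lambda>s. (s, y)"]) (use that in \<open>auto intro!: derivative_eq_intros\<close>)
    interpret bounded_linear "\<lambda>h. frechet_derivative g (at (t, y)) (h, 0)" using D by (rule has_derivative_bounded_linear)
    have "(\<lambda>h. frechet_derivative g (at (t, y)) (h, 0)) = (*) (frechet_derivative g (at (t, y)) (1, 0))"
    proof
      fix h
      show "frechet_derivative g (at (t, y)) (h, 0) = frechet_derivative g (at (t, y)) (1, 0) * h"
        using scaleR[of h 1] by simp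
    qed
    with D show ?thesis unfolding has_field_derivative_def by (rule back_subst)
  qed
  show "((\<lambda>s. g (s, y)) has_real_derivative deriv (\<lambda>s. g (s, y)) t) (at t)" if "t > 0"
    unfolding DERIV_imp_deriv[OF d[OF that]] by (rule d[OF that])
  have "continuous_on ({0<..} \<times> UNIV) (\<lambda>z. frechet_derivative g (at z) (1, 0))" using g by (simp add: C1_on_def)
  then show "continuous_on ({0<..} \<times> UNIV) (\<lambda>z. deriv (\<lambda>s. g (s, snd z)) (fst z))"
    by (rule continuous_on_eq) (auto simp: DERIV_imp_deriv[OF d])
qed

text \<open>The map \<open>k y\<close> embeds the space of the varying coordinates as the slice
  through \<open>y\<close>, and \<open>m\<close> reads off the position of \<open>y\<close> in it.
  Derivatives in position and in velocity are two instances.\<close>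

lemma C1_on_partial:
  fixes g :: "real \<times> 'a::euclidean_space \<Rightarrow> real" and k :: "'a \<Rightarrow> real ^ 'n::finite \<Rightarrow> 'a"
  assumes g: "C1_on ({0<..} \<times> UNIV) g" and k: "\<And>y x. (k y has_derivative K) (at x)" "\<And>y. k y (m y) = y"
  shows "t > 0 \<Longrightarrow> (\<lambda>x. g (t, k y x)) differentiable (at x)"
    and "continuous_on ({0<..} \<times> UNIV) (\<lambda>z. partial i (\<lambda>x. g (fst z, k (snd z) x)) (m (snd z)))"
proof -
  have op: "open ({(0 :: real)<..} \<times> (UNIV :: 'a set))" by (intro open_Times) auto
  have d: "((\<lambda>x. g (t, k y x)) has_derivative (\<lambda>h. frechet_derivative g (at (t, k y x)) (0, K h))) (at x)" if "t > 0" for t y x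
    by (rule C1_on_has_derivative[OF g op, where k = "\<lambda>x. (t, k y x)"]) (use that in \<open>auto intro!: derivative_eq_intros k\<close>)
  then show "t > 0 \<Longrightarrow> (\<lambda>x. g (t, k y x)) differentiable (at x)" by (auto simp: differentiable_def)
  have "continuous_on ({0<..} \<times> UNIV) (\<lambda>z. frechet_derivative g (at z) (0, K (axis i 1)))" using g by (simp add: C1_on_def)
  then show "continuous_on ({0<..} \<times> UNIV) (\<lambda>z. partial i (\<lambda>x. g (fst z, k (snd z) x)) (m (snd z)))"
    by (rule continuous_on_eq) (auto simp: partial_eq_frechet[OF d] k(2))
qed

lemma C1_field:
  assumes g: "C1_on ({0<..} \<times> UNIV) (\<lambda>(t, x). g t x)" and p: "\<forall>t>0. torus_periodic (g t)"
  shows "has_time_deriv g (\<lambda>t x. deriv (\<lambda>s. g s x) t)" "tcont {0<..} (\<lambda>t x. deriv (\<lambda>s. g s x) t)"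
    "t > 0 \<Longrightarrow> g t differentiable (at x)" "tcont {0<..} (\<lambda>t. partial i (g t))"
    "t > 0 \<Longrightarrow> has_partial i (g t) (partial i (g t))"
proof -
  note T = C1_on_time_derivative[OF g]
  note X = C1_on_partial[OF g, where k = "\<lambda>y x. x" and m = "\<lambda>y. y" and K = "\<lambda>h. h", OF has_derivative_ident refl]
  show 1: "has_time_deriv g (\<lambda>t x. deriv (\<lambda>s. g s x) t)" using T(1) by (simp add: has_time_deriv_def)
  show 2: "g t differentiable (at x)" if "t > 0" for t x using X(1)[OF that] by simp
  then show 3: "has_partial i (g t) (partial i (g t))" if "t > 0" for t i using that by (intro has_partial_partial)
  have "torus_periodic (\<lambda>x. deriv (\<lambda>s. g s x) t)" if t: "t > 0" for t
    unfolding torus_periodic_def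
  proof (intro allI)
    fix x and i :: 'a
    have "((\<lambda>s. g s (x + axis i 1)) has_real_derivative deriv (\<lambda>s. g s x) t) (at t)"
      by (rule has_field_derivative_transform_within_open[where S = "{0<..}" and f = "\<lambda>s. g s x"])
        (use 1 t p in \<open>auto simp: has_time_deriv_def torus_periodic_def\<close>)
    then show "deriv (\<lambda>s. g s (x + axis i 1)) t = deriv (\<lambda>s. g s x) t" by (rule DERIV_imp_deriv)
  qed
  then show "tcont {0<..} (\<lambda>t x. deriv (\<lambda>s. g s x) t)"
    using T(2) by (simp add: tcont_def case_prod_beta)
  show "tcont {0<..} (\<lambda>t. partial i (g t))"
    using X(2)[of i] has_partial_periodic[OF p[rule_format] 3] by (simp add: tcont_def case_prod_beta)
qed

section \<open>Vector-valued integrals and essential bounds\<close>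

lemma has_vector_derivative_vec:
  fixes g :: "real \<Rightarrow> real ^ 'n::finite"
  assumes "\<And>i. ((\<lambda>s. g s $ i) has_real_derivative g' $ i) (at t)"
  shows "(g has_vector_derivative g') (at t)"
  unfolding has_vector_derivative_def has_derivative_componentwise_within[of g]
  using assms by (auto simp: Basis_vec_def inner_axis has_field_derivative_def mult_commute_abs)

lemma integral_vec:
  fixes g :: "'a \<Rightarrow> real ^ 'n::finite"
  assumes "\<And>i. integrable M (\<lambda>x. g x $ i)"
  shows "integrable M g" "(LINT x|M. g x) $ i = (LINT x|M. g x $ i)"
proof -
  have "g = (\<lambda>x. \<Sum>i\<in>UNIV. (g x $ i) *\<^sub>R axis i 1)"
    by (simp add: fun_eq_iff vec_eq_iff axis_nth_if if_distrib cong: if_cong)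
  moreover have "integrable M (\<lambda>x. \<Sum>i\<in>UNIV. (g x $ i) *\<^sub>R axis i (1 :: real))"
    by (intro Bochner_Integration.integrable_sum integrable_scaleR_left assms)
  ultimately show I: "integrable M g" by simp
  show "(LINT x|M. g x) $ i = (LINT x|M. g x $ i)"
    by (rule integral_bounded_linear[OF bounded_linear_vec_nth I, symmetric])
qed

lemma set_integral_vec:
  fixes g :: "'a \<Rightarrow> real ^ 'n::finite"
  assumes "\<And>i. set_integrable M A (\<lambda>x. g x $ i)"
  shows "(LINT x:A|M. g x) $ i = (LINT x:A|M. g x $ i)"
  using integral_vec(2)[of M "\<lambda>x. indicator A x *\<^sub>R g x" i] assms
  by (simp add: set_integrable_def set_lebesgue_integral_def)

lemma norm_vec_power2: "(norm (v :: real ^ 'n::finite))\<^sup>2 = (\<Sum>i\<in>UNIV. (v $ i)\<^sup>2)"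
  by (simp add: norm_vec_def L2_set_def sum_nonneg)

text \<open>In the interior the points violating the bound form an open null set, which must be
  empty. Continuity extends the bound to time 0 and to the faces of the cube, and periodicity
  extends it to the whole space.\<close>

lemma Linf_boundedD:
  fixes w :: "real \<Rightarrow> 'n::finite vector_field"
  assumes cont: "continuous_on ({0..} \<times> UNIV) (\<lambda>(t, x). w t x)" and b: "Linf_bounded U w"
    and p: "\<And>t. t \<ge> 0 \<Longrightarrow> torus_periodic (w t)" and t: "t \<ge> 0"
  shows "norm (w t x) \<le> U"
proof -
  let ?O = "{(0 :: real)<..} \<times> box (0 :: real ^ 'n) One" and ?g = "\<lambda>z. norm (case z of (t, x) \<Rightarrow> w t x)"
  have "box (0 :: real ^ 'n) One \<noteq> {}" by (simp add: box_ne_empty)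
  then have cl: "closure ?O = {0..} \<times> torus" by (simp add: closure_Times closure_box torus_def)
  have cont': "continuous_on ({0..} \<times> torus) ?g"
    by (intro continuous_on_norm continuous_on_subset[OF cont]) auto
  have opO: "open ?O" by (intro open_Times open_greaterThan open_box)
  have OC: "?O \<subseteq> {0..} \<times> torus" using closure_subset[of ?O] cl by simp
  let ?S = "?O \<inter> ?g -` {U<..}"
  have opS: "open ?S"
    by (intro continuous_open_preimage continuous_on_subset[OF cont' OC] opO open_greaterThan)
  have "AE z in lborel. z \<notin> ?S"
    using b unfolding Linf_bounded_def by eventually_elim (use OC in auto)
  then have "?S \<in> null_sets lborel" using opS by (subst AE_iff_null_sets) auto
  then have "negligible ?S" by (simp add: negligible_iff_null_sets null_sets_completionI)
  then have "?S = {}" using open_not_negligible[OF opS] by blast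
  then have "?g z \<le> U" if "z \<in> {0..} \<times> torus" for z
    using that by (intro continuous_le_on_closure[of ?O ?g z U]) (use cl cont' in \<open>auto simp: not_less\<close>)
  moreover obtain y where "y \<in> torus" "w t y = w t x" using torus_representative[OF p[OF t]] .
  ultimately show ?thesis using t by fastforce
qed

text \<open>With negative \<open>M\<close> the bound would fail at every time, although it must hold
  somewhere in the time interval \<open>{0..1}\<close>, which is not a null set.\<close>

lemma Linf_Lp_bounded_nonneg:
  assumes "Linf_Lp_bounded p M g"
  shows "0 \<le> M"
proof (rule ccontr)
  assume "\<not> 0 \<le> M"
  then have n: "\<not> Lp_bounded p M (g t)" for t
    unfolding Lp_bounded_def by (meson order_trans powr_ge_zero)
  have "AE t in lborel. t \<notin> {0..1 :: real}"
    using assms unfolding Linf_Lp_bounded_def by eventually_elim (use n in auto)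
  then have "{0..1 :: real} \<in> null_sets lborel" by (subst AE_iff_null_sets) auto
  then show False by (simp add: null_sets_def)
qed

section \<open>From a classical solution to the abstract coupled flow\<close>

locale classical_solution =
  fixes Q :: "('n::finite) distribution \<Rightarrow> 'n distribution \<Rightarrow> 'n distribution"
    and \<gamma> \<mu> lam :: real and f0 \<rho>0 u0 f \<rho> u and R M U :: real
  assumes dim: "CARD('n) \<ge> 3" and \<gamma>: "\<gamma> > 1" and \<mu>: "\<mu> > 0" and lam: "2 * \<mu> + lam > 0"
    and sol: "global_classical_solution \<gamma> \<mu> lam Q f0 \<rho>0 u0 f \<rho> u"
    and interaction: "t > 0 \<Longrightarrow> interaction_conditions (Q (f t) (f t))"
    and particle_mass: "particle_mass f0 > 0"
    and density: "Linf_Lp_bounded (real CARD('n) / 2) M (\<lambda>t. particle_density (f t))"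
    and range: "t \<ge> 0 \<Longrightarrow> \<rho> t x \<in> {0..R}"
    and fluid_mass: "fluid_mass \<rho>0 > 0"
    and velocity: "Linf_bounded U u"
begin

abbreviation uc :: "'n \<Rightarrow> real \<Rightarrow> 'n scalar_field" where "uc i \<equiv> \<lambda>t x. u t x $ i"

lemmas sol_unfolded = sol[unfolded global_classical_solution_def classical_regularity_def finite_moments_def]

lemma periodic:
  "t \<ge> 0 \<Longrightarrow> torus_periodic (f t)" "t \<ge> 0 \<Longrightarrow> torus_periodic (\<rho> t)"
  "t \<ge> 0 \<Longrightarrow> torus_periodic (u t)" "t \<ge> 0 \<Longrightarrow> torus_periodic (uc i t)"
  using sol_unfolded by (auto simp: torus_periodic_def)

lemma velocity_le: "t \<ge> 0 \<Longrightarrow> \<bar>u t x $ i\<bar> \<le> U"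
  using Linf_boundedD[of u U t x] sol_unfolded velocity periodic component_le_norm_cart[of "u t x" i] by fastforce

lemma C1_f: "C1_on ({0<..} \<times> UNIV) (\<lambda>(t, x, v). f t x v)" and C1_\<rho>: "C1_on ({0<..} \<times> UNIV) (\<lambda>(t, x). \<rho> t x)"
  and C1_u: "C1_on ({0<..} \<times> UNIV) (\<lambda>(t, x). uc i t x)"
proof -
  have "C1_on ({0<..} \<times> UNIV) (\<lambda>z. (case z of (t, x) \<Rightarrow> u t x) $ i)"
    using sol_unfolded by (intro C1_on_component open_Times) auto
  then show "C1_on ({0<..} \<times> UNIV) (\<lambda>(t, x). uc i t x)" by (simp add: split_def)
qed (use sol_unfolded in auto)

lemma slices:
  fixes y :: "(real ^ 'n) \<times> (real ^ 'n)"
  shows "((\<lambda>x. (x, snd y)) has_derivative (\<lambda>h. (h, 0))) (at x)" "((\<lambda>v. (fst y, v)) has_derivative (\<lambda>h. (0, h))) (at v)"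
  by (auto intro!: derivative_eq_intros)

lemmas C1_on_partial_position = C1_on_partial[OF C1_f, where k = "\<lambda>y x. (x, snd y)" and m = fst, OF slices(1) prod.collapse]
lemmas C1_on_partial_velocity = C1_on_partial[OF C1_f, where k = "\<lambda>y v. (fst y, v)" and m = snd, OF slices(2) prod.collapse]

lemma partials_f:
  assumes "t > 0"
  shows "has_partial i (\<lambda>x. f t x v) (\<lambda>x. partial i (\<lambda>y. f t y v) x)" "has_partial i (f t x) (partial i (f t x))"
    "f t x differentiable (at v)"
proof -
  have "(\<lambda>x. f t x v) differentiable (at x)" for x v
    using C1_on_partial_position(1)[OF assms, of "(x, v)"] by simp
  then show "has_partial i (\<lambda>x. f t x v) (\<lambda>x. partial i (\<lambda>y. f t y v) x)" by (intro has_partial_partial)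
  show "f t x differentiable (at v)" for x v
    using C1_on_partial_velocity(1)[OF assms, of "(x, v)"] by simp
  then show "has_partial i (f t x) (partial i (f t x))" by (intro has_partial_partial)
qed

lemma kinetic_flow:
  "kinetic_flow f (\<lambda>t x v. deriv (\<lambda>s. f s x v) t) (\<lambda>t. Q (f t) (f t))
    (\<lambda>i t x v. partial i (\<lambda>y. f t y v) x) (\<lambda>i t x v. partial i (f t x) v) uc U"
proof (intro kinetic_flow.intro)
  note T = C1_on_time_derivative[OF C1_f]
  show "xvcont {0..} f" using sol_unfolded by (simp add: xvcont_def)
  show "xvcont {0<..} (\<lambda>t x v. deriv (\<lambda>s. f s x v) t)" using T(2) by (simp add: xvcont_def case_prod_beta)
  show "xvcont {0<..} (\<lambda>t x v. partial i (\<lambda>y. f t y v) x)" for i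
    using C1_on_partial_position(2)[of i] by (simp add: xvcont_def split_def)
  show "xvcont {0<..} (\<lambda>t x v. partial i (f t x) v)" for i
    using C1_on_partial_velocity(2)[of i] by (simp add: xvcont_def split_def)
  have "continuous_on ({0..} \<times> UNIV) (\<lambda>z. (case z of (t, x) \<Rightarrow> u t x) $ i)" for i
    using sol_unfolded by (intro continuous_intros) auto
  then show "tcont {0..} (uc i)" for i using periodic(4) by (auto simp: tcont_def case_prod_beta)
  show "((\<lambda>s. f s x v) has_real_derivative deriv (\<lambda>s. f s x v) t) (at t)" if "t > 0" for t x v
    using T(1)[OF that, of "(x, v)"] by simp
  show "deriv (\<lambda>s. f s x v) t + (\<Sum>i\<in>UNIV. v $ i * partial i (\<lambda>y. f t y v) x)
      + (\<Sum>i\<in>UNIV. partial i (f t x) v * (u t x $ i - v $ i) - f t x v) = Q (f t) (f t) x v" if t: "t > 0" for t x v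
  proof -
    have K0: "has_partial i (\<lambda>w. w $ i) (\<lambda>w. if i = i then 1 else 0)" for i :: 'n
      by (auto simp: has_partial_def axis_nth_if intro!: derivative_eq_intros)
    have "partial i (\<lambda>w. f t x w * (u t x $ i - w $ i)) v = partial i (f t x) v * (u t x $ i - v $ i) - f t x v" for i
    proof (rule trans[OF partial_eqI])
      show "has_partial i (\<lambda>w. f t x w * (u t x $ i - w $ i))
        (\<lambda>w. partial i (f t x) w * (u t x $ i - w $ i) + f t x w * (0 - (if i = i then 1 else 0)))"
        using has_partial_diff[OF has_partial_const K0]
        by (intro has_partial_mult partials_f[OF t]) simp
      show "(\<lambda>w. f t x w * (u t x $ i - w $ i)) differentiable (at w)" for w
        using bounded_linear_imp_differentiable[OF bounded_linear_vec_nth]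
        by (intro differentiable_mult differentiable_diff partials_f[OF t]) auto
    qed simp
    moreover have "deriv (\<lambda>s. f s x v) t + v \<bullet> grad (\<lambda>y. f t y v) x
       + divergence (\<lambda>w. f t x w *\<^sub>R (u t x - w)) v = Q (f t) (f t) x v"
      using sol t by (simp add: global_classical_solution_def vlasov_equation_def)
    ultimately show ?thesis by (simp add: inner_vec_def grad_def divergence_def)
  qed
qed (use sol_unfolded periodic(1) velocity_le interaction partials_f in auto)

sublocale K: kinetic_flow f "\<lambda>t x v. deriv (\<lambda>s. f s x v) t" "\<lambda>t. Q (f t) (f t)"
    "\<lambda>i t x v. partial i (\<lambda>y. f t y v) x" "\<lambda>i t x v. partial i (f t x) v" uc U
  by (rule kinetic_flow)

lemma force_eq: "t \<ge> 0 \<Longrightarrow> (LINT v|lborel. f t x v *\<^sub>R (u t x - v)) $ i = K.force i t x"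
  using K.f_velocity_integrable(2)[of t x] by (subst integral_vec(2)) (auto simp: K.force_def)

lemma periodic_pos: "\<forall>t>0. torus_periodic (\<rho> t)" "\<forall>t>0. torus_periodic (uc i t)"
  by (intro allI impI periodic; simp)+

lemmas \<rho>_field = C1_field[OF C1_\<rho> periodic_pos(1)]
lemmas u_field = C1_field[OF C1_u periodic_pos(2)]

lemma second_partials: "t > 0 \<Longrightarrow> partial j (uc i t) differentiable (at x)"
  using sol_unfolded by (auto simp: differentiable_on_def)

lemma mass_equation:
  assumes t: "t > 0"
  shows "deriv (\<lambda>s. \<rho> s x) t = - (\<Sum>j\<in>UNIV. partial j (\<rho> t) x * u t x $ j + \<rho> t x * partial j (uc j t) x)"
proof -
  have "partial j (\<lambda>y. \<rho> t y * u t y $ j) x = partial j (\<rho> t) x * u t x $ j + \<rho> t x * partial j (uc j t) x" for j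
    by (rule partial_eqI) (intro differentiable_mult has_partial_mult \<rho>_field(3,5) u_field(3,5) t)+
  moreover have "deriv (\<lambda>s. \<rho> s x) t + divergence (\<lambda>y. \<rho> t y *\<^sub>R u t y) x = 0"
    using sol t by (simp add: global_classical_solution_def continuity_equation_def)
  ultimately show ?thesis by (simp add: divergence_def)
qed

text \<open>The continuity equation brings the conservative flux into convective form; the term with
  the time derivative of \<open>\<rho>\<close> cancels the one from differentiating
  \<open>\<rho> * u\<close>.\<close>

lemma momentum_flux:
  assumes t: "t > 0"
  shows "divergence (\<lambda>y. (\<rho> t y * u t y $ i) *\<^sub>R u t y) x
    = - deriv (\<lambda>s. \<rho> s x) t * u t x $ i + \<rho> t x * (\<Sum>j\<in>UNIV. u t x $ j * partial j (uc i t) x)"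
proof -
  have "partial j (\<lambda>y. \<rho> t y * u t y $ i * u t y $ j) x
    = (partial j (\<rho> t) x * u t x $ i + \<rho> t x * partial j (uc i t) x) * u t x $ j
      + \<rho> t x * u t x $ i * partial j (uc j t) x" for j
    by (rule partial_eqI) (intro differentiable_mult has_partial_mult \<rho>_field(3,5) u_field(3,5) t)+
  then have "divergence (\<lambda>y. (\<rho> t y * u t y $ i) *\<^sub>R u t y) x
    = (\<Sum>j\<in>UNIV. u t x $ i * (partial j (\<rho> t) x * u t x $ j + \<rho> t x * partial j (uc j t) x)
      + \<rho> t x * (u t x $ j * partial j (uc i t) x))"
    unfolding divergence_def by (intro sum.cong refl) (simp add: algebra_simps)
  also have "\<dots> = u t x $ i * (\<Sum>j\<in>UNIV. partial j (\<rho> t) x * u t x $ j + \<rho> t x * partial j (uc j t) x)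
      + \<rho> t x * (\<Sum>j\<in>UNIV. u t x $ j * partial j (uc i t) x)"
    unfolding sum.distrib[of "\<lambda>j. u t x $ i * _ j"] sum_distrib_left[symmetric] ..
  finally show ?thesis unfolding mass_equation[OF t] by simp
qed

text \<open>Inserting \<open>max 0\<close> does not change the nonnegative density, but makes the
  outer function differentiable also at vacuum.\<close>

lemma pressure_gradient:
  assumes t: "t > 0"
  shows "partial i (\<lambda>y. \<rho> t y powr \<gamma>) x = \<gamma> * \<rho> t x powr (\<gamma> - 1) * partial i (\<rho> t) x"
proof -
  have eq: "(\<lambda>y. \<rho> t y powr \<gamma>) = (\<lambda>y. max 0 (\<rho> t y) powr \<gamma>)" using range[of t] t by auto
  have "partial i (\<lambda>y. max 0 (\<rho> t y) powr \<gamma>) x = \<gamma> * max 0 (\<rho> t x) powr (\<gamma> - 1) * partial i (\<rho> t) x"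
  proof (rule partial_eqI)
    show "has_partial i (\<lambda>y. max 0 (\<rho> t y) powr \<gamma>) (\<lambda>x. \<gamma> * max 0 (\<rho> t x) powr (\<gamma> - 1) * partial i (\<rho> t) x)"
      by (rule has_partial_chain[OF \<rho>_field(5)[OF t] max_0_powr_derivative[OF \<gamma>]])
    fix x
    have "(\<lambda>s. max 0 s powr \<gamma>) differentiable (at (\<rho> t x))"
      using max_0_powr_derivative[OF \<gamma>] by (auto simp: real_differentiable_def)
    from differentiable_chain_at[OF \<rho>_field(3)[OF t] this]
    show "(\<lambda>y. max 0 (\<rho> t y) powr \<gamma>) differentiable (at x)" by (simp add: o_def)
  qed
  then show ?thesis unfolding eq using range[of t x] t by simp
qed

lemma viscous_component:
  assumes t: "t > 0"
  shows "viscous \<mu> lam (u t) x $ i = - \<mu> * (\<Sum>j\<in>UNIV. partial j (partial j (uc i t)) x)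
    - (\<mu> + lam) * (\<Sum>j\<in>UNIV. partial i (partial j (uc j t)) x)"
proof -
  have "partial i (divergence (u t)) x = (\<Sum>j\<in>UNIV. partial i (partial j (uc j t)) x)"
    unfolding divergence_def[abs_def]
    by (rule partial_eqI) (intro differentiable_sum has_partial_sum has_partial_partial second_partials t ballI finite)+
  then show ?thesis by (simp add: viscous_def laplacian_def grad_def)
qed

lemma momentum_equation:
  assumes t: "t > 0"
  shows "\<rho> t x * deriv (\<lambda>s. uc i s x) t = - \<rho> t x * (\<Sum>j\<in>UNIV. uc j t x * partial j (uc i t) x)
    - \<gamma> * \<rho> t x powr (\<gamma> - 1) * partial i (\<rho> t) x + \<mu> * (\<Sum>j\<in>UNIV. partial j (partial j (uc i t)) x)
    + (\<mu> + lam) * (\<Sum>j\<in>UNIV. partial i (partial j (uc j t)) x) - K.force i t x"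
proof -
  have d: "((\<lambda>s. \<rho> s x) has_real_derivative deriv (\<lambda>s. \<rho> s x) t) (at t)"
    "((\<lambda>s. uc i s x) has_real_derivative deriv (\<lambda>s. uc i s x) t) (at t)" for i
    using \<rho>_field(1) u_field(1) t by (auto simp: has_time_deriv_def)
  have "((\<lambda>s. \<rho> s x *\<^sub>R u s x) has_vector_derivative
    (\<chi> i. deriv (\<lambda>s. \<rho> s x) t * u t x $ i + deriv (\<lambda>s. uc i s x) t * \<rho> t x)) (at t)"
    by (rule has_vector_derivative_vec) (use DERIV_mult[OF d] in simp)
  then have vd: "vector_derivative (\<lambda>s. \<rho> s x *\<^sub>R u s x) (at t)
    = (\<chi> i. deriv (\<lambda>s. \<rho> s x) t * u t x $ i + deriv (\<lambda>s. uc i s x) t * \<rho> t x)" by (rule vector_derivative_at)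
  have "vector_derivative (\<lambda>s. \<rho> s x *\<^sub>R u s x) (at t)
       + (\<chi> i. divergence (\<lambda>y. (\<rho> t y * u t y $ i) *\<^sub>R u t y) x)
       + grad (\<lambda>y. \<rho> t y powr \<gamma>) x + viscous \<mu> lam (u t) x = - (LINT v|lborel. f t x v *\<^sub>R (u t x - v))"
    using sol t by (simp add: global_classical_solution_def momentum_equation_def)
  from arg_cong[OF this, of "\<lambda>w. w $ i"] show ?thesis
    unfolding vd grad_def vector_add_component vector_uminus_component vec_lambda_beta
      momentum_flux[OF t] pressure_gradient[OF t] viscous_component[OF t] force_eq[OF less_imp_le[OF t]]
    by (simp add: mult.commute[of "\<rho> t x"])
qed

lemma fluid_flow:
  "fluid_flow \<gamma> \<mu> lam \<rho> (\<lambda>t x. deriv (\<lambda>s. \<rho> s x) t) (\<lambda>i t x. partial i (\<rho> t) x) uc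
    (\<lambda>i t x. deriv (\<lambda>s. uc i s x) t) K.force (\<lambda>i j t x. partial j (uc i t) x)
    (\<lambda>i j k t x. partial k (partial j (uc i t)) x)"
proof (intro fluid_flow.intro)
  show "tcont {0..} \<rho>" using sol_unfolded periodic(2) by (auto simp: tcont_def)
  show "tcont {0<..} (\<lambda>t x. partial k (partial j (uc i t)) x)" for i j k
    using sol_unfolded has_partial_periodic[OF has_partial_periodic[OF periodic_pos(2)[rule_format] u_field(5)]
        has_partial_partial[OF second_partials]]
    by (auto simp: tcont_def)
qed (use \<gamma> \<mu> lam K.cont_u \<rho>_field u_field range mass_equation momentum_equation
  has_partial_partial[OF second_partials] in auto)

lemma masses: "fluid_mass \<rho>0 = tint (\<rho> 0)" "particle_mass f0 = K.moment (\<lambda>v. 1) 0"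
proof -
  interpret F: fluid_flow \<gamma> \<mu> lam \<rho> "\<lambda>t x. deriv (\<lambda>s. \<rho> s x) t" "\<lambda>i t x. partial i (\<rho> t) x" uc
    "\<lambda>i t x. deriv (\<lambda>s. uc i s x) t" K.force "\<lambda>i j t x. partial j (uc i t) x" "\<lambda>i j k t x. partial k (partial j (uc i t)) x"
    by (rule fluid_flow)
  have "f 0 = f0" "\<rho> 0 = \<rho>0" using sol by (auto simp: global_classical_solution_def)
  then show "fluid_mass \<rho>0 = tint (\<rho> 0)" "particle_mass f0 = K.moment (\<lambda>v. 1) 0"
    using pcont_set_integrable(2)[OF tcont_pcont[OF F.tcont_\<rho>, of 0]]
    by (auto simp: fluid_mass_def particle_mass_def K.moment_def)
qed

lemma coupled_flow:
  "coupled_flow \<gamma> \<mu> lam \<rho> (\<lambda>t x. deriv (\<lambda>s. \<rho> s x) t) (\<lambda>i t x. partial i (\<rho> t) x) uc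
    (\<lambda>i t x. deriv (\<lambda>s. uc i s x) t) K.force (\<lambda>i j t x. partial j (uc i t) x)
    (\<lambda>i j k t x. partial k (partial j (uc i t)) x)
    f (\<lambda>t x v. deriv (\<lambda>s. f s x v) t) (\<lambda>t. Q (f t) (f t))
    (\<lambda>i t x v. partial i (\<lambda>y. f t y v) x) (\<lambda>i t x v. partial i (f t x) v) U R M"
  using dim range density particle_mass fluid_mass Linf_Lp_bounded_nonneg[OF density] masses
  by (intro coupled_flow.intro coupled_flow_axioms.intro fluid_flow kinetic_flow) (auto simp: Linf_Lp_bounded_def)

sublocale C: coupled_flow \<gamma> \<mu> lam \<rho> "\<lambda>t x. deriv (\<lambda>s. \<rho> s x) t" "\<lambda>i t x. partial i (\<rho> t) x" uc
    "\<lambda>i t x. deriv (\<lambda>s. uc i s x) t" K.force "\<lambda>i j t x. partial j (uc i t) x"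
    "\<lambda>i j k t x. partial k (partial j (uc i t)) x"
    f "\<lambda>t x v. deriv (\<lambda>s. f s x v) t" "\<lambda>t. Q (f t) (f t)"
    "\<lambda>i t x v. partial i (\<lambda>y. f t y v) x" "\<lambda>i t x v. partial i (f t x) v" U R M
  by (rule coupled_flow)

text \<open>The conserved masses replace the masses at time \<open>t\<close>, norms become sums over
  components, and Lebesgue integrals over the torus become \<open>tint\<close>.\<close>

lemma lyapunov_eq:
  assumes t: "t \<ge> 0"
  shows "lyapunov (f t) (\<rho> t) (u t) = C.functional t"
proof -
  have pc: "pcont (\<rho> t)" "pcont (uc i t)" for i
    using t by (auto intro: tcont_pcont C.tcont_\<rho> K.cont_u)
  have fm: "fluid_mass (\<rho> t) = C.fmass"
    using pcont_set_integrable(2)[OF pc(1)] C.mass_conservation[OF t] by (simp add: fluid_mass_def C.fmass_def)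
  have pm: "particle_mass (f t) = C.pmass"
    using K.particle_mass_conservation[OF t] by (simp add: particle_mass_def C.pmass_def K.moment_def)
  have pv: "particle_mean_velocity (f t) $ i = C.pvel t i" for i
  proof -
    have "set_integrable lborel phase_space (\<lambda>(x, v). 1 * v $ i * f t x v)" for i
      by (rule K.moment_integrable[OF K.growth_component t]) simp
    then have "(LINT (x, v):phase_space|lborel. f t x v *\<^sub>R v) $ i = K.moment (\<lambda>v. v $ i) t"
      unfolding K.moment_def by (subst set_integral_vec) (simp_all add: split_def mult.commute)
    then show ?thesis by (simp add: particle_mean_velocity_def pm C.pvel_def divide_inverse mult.commute)
  qed
  have fv: "fluid_mean_velocity (\<rho> t) (u t) $ i = C.fvel t i" for i
  proof -
    have p: "pcont (\<lambda>x. \<rho> t x * uc i t x)" for i by (intro pcont_mult pc)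
    have "(LINT x:torus|lborel. \<rho> t x *\<^sub>R u t x) $ i = tint (\<lambda>x. \<rho> t x * uc i t x)"
      using pcont_set_integrable[OF p] by (subst set_integral_vec) simp_all
    then show ?thesis by (simp add: fluid_mean_velocity_def fm C.fvel_def divide_inverse mult.commute)
  qed
  have "(LINT (x, v):phase_space|lborel. (norm (v - particle_mean_velocity (f t)))\<^sup>2 * f t x v)
      = (LINT (x, v):phase_space|lborel. 2 * ((\<Sum>i\<in>UNIV. (v $ i - C.pvel t i)\<^sup>2 / 2) * f t x v))"
    by (simp add: norm_vec_power2 pv sum_divide_distrib[symmetric])
  also have "\<dots> = 2 * K.kinetic_energy (C.pvel t) t"
    unfolding K.kinetic_energy_def K.moment_def case_prod_beta by (rule set_integral_mult_right)
  finally have 1: "(LINT (x, v):phase_space|lborel. (norm (v - particle_mean_velocity (f t)))\<^sup>2 * f t x v)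
      = 2 * K.kinetic_energy (C.pvel t) t" .
  have "pcont (\<lambda>x. \<rho> t x * (\<Sum>i\<in>UNIV. (uc i t x - C.fvel t i)\<^sup>2))" "pcont (\<lambda>x. (\<rho> t x - tint (\<rho> 0))\<^sup>2)"
    by (intro pcont_mult pcont_sum pcont_power pcont_diff pcont_const pc)+
  from this[THEN pcont_set_integrable(2)]
  have "(LINT x:torus|lborel. \<rho> t x * (norm (u t x - fluid_mean_velocity (\<rho> t) (u t)))\<^sup>2) = C.kin (C.fvel t) t"
    "(LINT x:torus|lborel. (\<rho> t x - fluid_mass (\<rho> t))\<^sup>2) = C.var t"
    by (simp_all add: norm_vec_power2 fv fm C.kin_def C.var_def C.fmass_def)
  then show ?thesis
    unfolding lyapunov_def C.functional_def 1 by (simp add: norm_vec_power2 pv fv)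
qed

lemma lyapunov_decay:
  "\<exists>C1>0. \<exists>C2>0. \<forall>t\<ge>0. lyapunov (f t) (\<rho> t) (u t) \<le> C1 * lyapunov f0 \<rho>0 u0 * exp (- C2 * t)"
proof -
  have "f 0 = f0" "\<rho> 0 = \<rho>0" "u 0 = u0" using sol by (auto simp: global_classical_solution_def)
  with lyapunov_eq[of 0] C.functional_decay show ?thesis by (simp add: lyapunov_eq)
qed

end

theorem theorem1p1:
  fixes Q :: "('n::finite) distribution \<Rightarrow> 'n distribution \<Rightarrow> 'n distribution"
    and \<gamma> \<mu> lam rho_bar M U :: real
  assumes "CARD('n) \<ge> 3" and "\<gamma> > 1" and "\<mu> > 0" and "2 * \<mu> + lam > 0"
  shows "\<exists>\<epsilon>>0. \<forall>f0 \<rho>0 u0 f \<rho> u.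
    global_classical_solution \<gamma> \<mu> lam Q f0 \<rho>0 u0 f \<rho> u \<longrightarrow>
    (\<forall>t>0. interaction_conditions (Q (f t) (f t))) \<longrightarrow>
    particle_mass f0 > 0 \<longrightarrow>
    Linf_Lp_bounded (real CARD('n) / 2) M (\<lambda>t. particle_density (f t)) \<longrightarrow>
    (\<forall>t\<ge>0. \<forall>x. \<rho> t x \<in> {0..rho_bar}) \<longrightarrow>
    fluid_mass \<rho>0 > 0 \<longrightarrow>
    Linf_bounded U u \<longrightarrow>
    0 < total_energy \<gamma> f0 \<rho>0 u0 \<longrightarrow>
    total_energy \<gamma> f0 \<rho>0 u0 < \<epsilon> \<longrightarrow>
    (\<exists>C1>0. \<exists>C2>0. \<forall>t\<ge>0.
       lyapunov (f t) (\<rho> t) (u t) \<le> C1 * lyapunov f0 \<rho>0 u0 * exp (- C2 * t))"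
proof (rule exI[of _ 1], intro conjI allI impI)
  fix f0 \<rho>0 u0 f \<rho> u
  assume A: "global_classical_solution \<gamma> \<mu> lam Q f0 \<rho>0 u0 f \<rho> u"
    "\<forall>t>0. interaction_conditions (Q (f t) (f t))" "particle_mass f0 > 0"
    "Linf_Lp_bounded (real CARD('n) / 2) M (\<lambda>t. particle_density (f t))"
    "\<forall>t\<ge>0. \<forall>x. \<rho> t x \<in> {0..rho_bar}" "fluid_mass \<rho>0 > 0" "Linf_bounded U u"
  interpret classical_solution Q \<gamma> \<mu> lam f0 \<rho>0 u0 f \<rho> u rho_bar M U
    by (rule classical_solution.intro) (use A assms in \<open>blast+\<close>)
  show "\<exists>C1>0. \<exists>C2>0. \<forall>t\<ge>0. lyapunov (f t) (\<rho> t) (u t) \<le> C1 * lyapunov f0 \<rho>0 u0 * exp (- C2 * t)"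
    by (rule lyapunov_decay)
qed simp

end
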